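(* Let $E\subset\mathbb{R}^4$ be a (nondegenerate) $2$-dimensional affine plane. If $E$ admits weak local rules, then $E$ is determined by its subperiods.
   Context: Octagonal tilings. Fix pairwise non-colinear vectors $\vec v_1,\dots,\vec v_4\in\mathbb{R}^2$. The proto-tiles are $T_{ij}=\{\lambda\vec v_i+\mu\vec v_j : 0\le\lambda,\mu\le 1\}$, $1\le i<j\le 4$; a tile is a translated proto-tile. An octagonal tiling is a covering of $\mathbb{R}^2$ by tiles that is edge-to-edge: two distinct tiles intersect in the empty set, a common vertex, or a common whole edge. A lift of an octagonal tiling is the surface in $\mathbb{R}^4$ obtained by mapping an arbitrary vertex of the tiling to an arbitrary point of $\mathbb{Z}^4$ and each tile that is a translate of $T_{ij}$ to a unit square face generated by the standard basis vectors $\vec e_i,\vec e_j$, so that tiles adjacent along an edge $\vec v_i$ are mapped to faces adjacent along $\vec e_i$ (the lift is thus defined up to translation by $\mathbb{Z}^4$). Planarity. "Plane" means $2$-dimensional affine plane of $\mathbb{R}^4$. An octagonal tiling is planar with slope $E$ (a plane) and thickness $t\ge 1$ if it has a lift contained in $E+[0,t]^4$. Weak local rules. An $r$-map of a tiling is the pattern (finite set of tiles, considered up to translation) formed by exactly the tiles intersecting some closed ball of diameter $r$ of $\mathbb{R}^2$. A plane $E$ has weak local rules of diameter $r\geq 0$ and thickness $t\geq 1$ if every octagonal tiling, all of whose $r$-maps are also $r$-maps of a planar octagonal tiling with slope $E$ and thickness $1$, is itself planar with slope $E$ and thickness $t$. $E$ admits weak local rules if it does so for some $r\ge 0$ and $t\ge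 1$. Grassmann coordinates. If the direction of $E$ is spanned by $(u_1,\dots,u_4)$ and $(v_1,\dots,v_4)$, its Grassmann coordinates are $G_{ij}=u_iv_j-u_jv_i$, $1\le i<j\le 4$, defined up to a common nonzero factor; they satisfy the Plücker relation $G_{12}G_{34}=G_{13}G_{24}-G_{14}G_{23}$. $E$ is nondegenerate if all $G_{ij}\neq 0$; only nondegenerate planes are considered. Subperiods. For $k\in\{1,2,3,4\}$, a type $k$ subperiod of $E$ is a nontrivial linear homogeneous equation with rational coefficients, satisfied by the Grassmann coordinates of $E$, which involves only the three Grassmann coordinates having no index equal to $k$. $E$ is determined by its subperiods if any other plane having the same subperiods is parallel to $E$, where this is understood up to algebraic conjugacy: up to parallelism, there are only finitely many nondegenerate planes whose Grassmann coordinates satisfy all the subperiods of $E$ (that is, the system of polynomial equations formed by the subperiods of $E$ and the Plücker relation is zero-dimensional).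
   Formalization: It is also assumed that E is the slope of at least one planar octagonal tiling (of some thickness) by the tiles of the fixed vectors v_1,...,v_4; otherwise weak local rules hold vacuously and a generic E, which has no subperiods, is a counterexample. *)

theory Defs
  imports "HOL-Analysis.Analysis"
begin

(* The index set {1,2,3,4} is the numeral type 4, with its library linear order
   0 < 1 < 2 < 3 (the literal 4 denotes 0). *)

definition pairwise_noncolinear :: "(4 \<Rightarrow> real^2) \<Rightarrow> bool" where
  "pairwise_noncolinear v \<longleftrightarrow> (\<forall>i j. i \<noteq> j \<longrightarrow> \<not> collinear {0, v i, v j})"

(* With w = v this is the translate x + T_ij of a proto-tile; with w the standard basis
   of R^4 it is a unit face. *)
definition parallelogram :: "(4 \<Rightarrow> 'a::real_vector) \<Rightarrow> 'a \<Rightarrow> 4 \<Rightarrow> 4 \<Rightarrow> 'a set" where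
  "parallelogram w x i j =
     {x + a *\<^sub>R w i + b *\<^sub>R w j | a b. 0 \<le> a \<and> a \<le> 1 \<and> 0 \<le> b \<and> b \<le> 1}"

definition octagonal_tiling :: "(4 \<Rightarrow> real^2) \<Rightarrow> (real^2) set set \<Rightarrow> bool" where
  "octagonal_tiling v T \<longleftrightarrow>
     (\<forall>s\<in>T. \<exists>x i j. i < j \<and> s = parallelogram v x i j) \<and>
     \<Union>T = UNIV \<and>
     (\<forall>s\<in>T. \<forall>t\<in>T. s \<noteq> t \<longrightarrow>
        s \<inter> t = {} \<or>
        (\<exists>p. p extreme_point_of s \<and> p extreme_point_of t \<and> s \<inter> t = {p}) \<or>
        (\<exists>e. e edge_of s \<and> e edge_of t \<and> s \<inter> t = e))"

definition std_basis :: "4 \<Rightarrow> real^4" where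
  "std_basis i = axis i 1"

(* f gives the images of the vertices (its values elsewhere are irrelevant); adjacent tiles
   go to adjacent faces because f is one map shared by all tiles. The condition for
   (j,i) is part of the statement, as parallelogram v x i j = parallelogram v x j i. *)
definition lifting :: "(4 \<Rightarrow> real^2) \<Rightarrow> (real^2) set set \<Rightarrow> (real^2 \<Rightarrow> real^4) \<Rightarrow> bool" where
  "lifting v T f \<longleftrightarrow>
     (\<forall>x i j. i \<noteq> j \<and> parallelogram v x i j \<in> T \<longrightarrow>
        (\<forall>k. f x $ k \<in> \<int>) \<and>
        f (x + v i) = f x + std_basis i \<and>
        f (x + v i + v j) = f x + std_basis i + std_basis j)"

definition lift_surface ::
  "(4 \<Rightarrow> real^2) \<Rightarrow> (real^2) set set \<Rightarrow> (real^2 \<Rightarrow> real^4) \<Rightarrow> (real^4) set" where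
  "lift_surface v T f =
     \<Union>{parallelogram std_basis (f x) i j | x i j. i < j \<and> parallelogram v x i j \<in> T}"

definition is_plane :: "(real^4) set \<Rightarrow> bool" where
  "is_plane E \<longleftrightarrow> affine E \<and> aff_dim E = 2"

definition planar_tiling ::
  "(4 \<Rightarrow> real^2) \<Rightarrow> (real^2) set set \<Rightarrow> (real^4) set \<Rightarrow> real \<Rightarrow> bool" where
  "planar_tiling v T E t \<longleftrightarrow>
     octagonal_tiling v T \<and> t \<ge> 1 \<and>
     (\<exists>f. lifting v T f \<and>
          lift_surface v T f \<subseteq> {x + y | x y. x \<in> E \<and> (\<forall>k. 0 \<le> y $ k \<and> y $ k \<le> t)})"

(* Patterns are considered up to translation: r_maps r T is closed under translations,
   so two patterns are identified as soon as one is a translate of the other.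
   The ball has diameter r. *)
definition r_maps :: "real \<Rightarrow> (real^2) set set \<Rightarrow> (real^2) set set set" where
  "r_maps r T = {(\<lambda>s. (+) d ` s) ` {s\<in>T. s \<inter> cball c (r / 2) \<noteq> {}} | c d. True}"

definition weak_local_rules ::
  "(4 \<Rightarrow> real^2) \<Rightarrow> (real^4) set \<Rightarrow> real \<Rightarrow> real \<Rightarrow> bool" where
  "weak_local_rules v E r t \<longleftrightarrow>
     (\<forall>T. octagonal_tiling v T \<and>
          (\<forall>P\<in>r_maps r T. \<exists>T'. planar_tiling v T' E 1 \<and> P \<in> r_maps r T') \<longrightarrow>
          planar_tiling v T E t)"

definition admits_weak_local_rules :: "(4 \<Rightarrow> real^2) \<Rightarrow> (real^4) set \<Rightarrow> bool" where
  "admits_weak_local_rules v E \<longleftrightarrow> (\<exists>r t. r \<ge> 0 \<and> t \<ge> 1 \<and> weak_local_rules v E r t)"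

definition direction :: "(real^4) set \<Rightarrow> (real^4) set" where
  "direction E = {x - y | x y. x \<in> E \<and> y \<in> E}"

(* G is one of the (mutually proportional) families of Grassmann coordinates of the plane E;
   only the entries G i j with i < j are used below. *)
definition grassmann_coords :: "(real^4) set \<Rightarrow> (4 \<Rightarrow> 4 \<Rightarrow> real) \<Rightarrow> bool" where
  "grassmann_coords E G \<longleftrightarrow>
     (\<exists>u w. direction E = span {u, w} \<and> G = (\<lambda>i j. u $ i * w $ j - u $ j * w $ i))"

definition nondegenerate :: "(real^4) set \<Rightarrow> bool" where
  "nondegenerate E \<longleftrightarrow> (\<forall>G. grassmann_coords E G \<longrightarrow> (\<forall>i j. i < j \<longrightarrow> G i j \<noteq> 0))"

(* A linear homogeneous equation  sum_{i<j} a_ij G_ij = 0  with rational coefficients is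
   represented by its coefficients a. *)
definition satisfies_equation :: "(real^4) set \<Rightarrow> (4 \<Rightarrow> 4 \<Rightarrow> rat) \<Rightarrow> bool" where
  "satisfies_equation E a \<longleftrightarrow>
     (\<forall>G. grassmann_coords E G \<longrightarrow> (\<Sum>(i, j)\<in>{(i, j). i < j}. of_rat (a i j) * G i j) = 0)"

definition subperiod :: "4 \<Rightarrow> (real^4) set \<Rightarrow> (4 \<Rightarrow> 4 \<Rightarrow> rat) \<Rightarrow> bool" where
  "subperiod k E a \<longleftrightarrow>
     (\<exists>i j. i < j \<and> a i j \<noteq> 0) \<and>
     (\<forall>i j. i < j \<and> (i = k \<or> j = k) \<longrightarrow> a i j = 0) \<and>
     satisfies_equation E a"

(* Two planes are parallel iff they have the same direction, so finiteness up to
   parallelism is finiteness of the set of directions. *)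
definition determined_by_subperiods :: "(real^4) set \<Rightarrow> bool" where
  "determined_by_subperiods E \<longleftrightarrow>
     finite {direction F | F. is_plane F \<and> nondegenerate F \<and>
                              (\<forall>k a. subperiod k E a \<longrightarrow> satisfies_equation F a)}"

end

theory Submission
  imports Defs "HOL-Analysis.Kronecker_Approximation_Theorem"
begin

text \<open>Suppose that infinitely many planes satisfy the subperiods of \<open>E\<close>. By Diophantine approximation
  some of them, \<open>F\<close>, are so close to \<open>E\<close> that they have an integer normal \<open>\<nu>\<close> with
  \<open>\<bar>\<nu>\<bar> \<cdot> dist(F, E)\<close> arbitrarily small. The planar tiling of slope \<open>F\<close> is dual to the four families
  of lines cut out on \<open>F\<close> by the integer hyperplanes. Three lines form a small triangle where \<open>F\<close>
  passes close to an integer point in three of the four coordinates. If \<open>F\<close> is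
  suitably translated, \<open>\<nu>\<close> forbids small triangles of different types to occur close to each other,
  unless the rational relations of \<open>E\<close> itself impose them. A triangle that is degenerate for \<open>E\<close> is
  a subperiod, which \<open>F\<close> shares, and a small triangle of one type appears in the grid of \<open>E\<close> as
  well, by density. Hence every \<open>r\<close>-map of the tiling of slope \<open>F\<close> occurs in a tiling of slope \<open>E\<close>, and
  weak local rules would make that tiling planar with slope \<open>E\<close>. But a tiling determines the
  direction of its slope: along a worm, a chain of tiles sharing parallel edges, every lift moves in
  the same way.\<close>

section \<open>Parallelograms in the plane\<close>

text \<open>Weak local rules compare with tilings lying along the given affine plane E, so its base
  point \<open>a\<close> cannot be moved into general position. Triple points of its grid are
  instead resolved by an infinitesimal shift along a vector \<open>b\<close>, common to E and F. Two
  types of small triangles exclude each other because, at an offset z from F, the number \<nu> . z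
  lies in a fixed coset of the integers and is also, up to finitely many constants, a combination of
  the two triples with coefficients of order |\<nu>|. If both triples are of order s, the distance
  of the planes, the combination is of order |\<nu>| s, and a phase avoiding finitely many short
  intervals contradicts this. Mere closeness of F to E would not suffice. A second obstacle is an
  integer normal k of E. Lattice translates of E are then dense only within the slices where k . n
  is constant, so every F keeps k as a normal and every displacement of a point preserves its
  product with k. The radius up to which patterns are compared is fixed before F is known; hence the
  estimates are uniform near a spanning pair of E.\<close>

definition det2 :: "real^2 \<Rightarrow> real^2 \<Rightarrow> real" where
  "det2 p q = p$1 * q$2 - p$2 * q$1"

lemma det2_simps [simp]:
  "det2 (p + p') q = det2 p q + det2 p' q" "det2 q (p + p') = det2 q p + det2 q p'"
  "det2 (p - p') q = det2 p q - det2 p' q" "det2 q (p - p') = det2 q p - det2 q p'"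
  "det2 (c *\<^sub>R p) q = c * det2 p q" "det2 q (c *\<^sub>R p) = c * det2 q p"
  "det2 (- p) q = - det2 p q" "det2 q (- p) = - det2 q p"
  "det2 p p = 0" "det2 0 p = 0" "det2 p 0 = 0"
  by (simp_all add: det2_def algebra_simps)

lemma det2_commute: "det2 q p = - det2 p q"
  by (simp add: det2_def)

lemma det2_sum: "det2 (sum f A) q = (\<Sum>k\<in>A. det2 (f k) q)" "det2 q (sum f A) = (\<Sum>k\<in>A. det2 q (f k))"
  by (induction A rule: infinite_finite_induct) auto

lemma abs_det2_le: "\<bar>det2 p q\<bar> \<le> 2 * norm p * norm q"
proof -
  have "\<bar>det2 p q\<bar> \<le> \<bar>p$1\<bar> * \<bar>q$2\<bar> + \<bar>p$2\<bar> * \<bar>q$1\<bar>"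
    unfolding det2_def abs_mult[symmetric] by linarith
  also have "\<dots> \<le> norm p * norm q + norm p * norm q"
    by (intro add_mono mult_mono component_le_norm_cart) auto
  finally show ?thesis by simp
qed

lemma det2_cramer:
  "det2 p q *\<^sub>R y = det2 y q *\<^sub>R p + det2 p y *\<^sub>R q"
  by (simp add: det2_def vec_eq_iff forall_2 algebra_simps)

lemma det2_coords:
  assumes "det2 p q \<noteq> 0"
  shows "y = (det2 y q / det2 p q) *\<^sub>R p + (det2 p y / det2 p q) *\<^sub>R q"
proof -
  have "y = (1 / det2 p q) *\<^sub>R (det2 p q *\<^sub>R y)" using assms by simp
  also have "\<dots> = (det2 y q / det2 p q) *\<^sub>R p + (det2 p y / det2 p q) *\<^sub>R q"
    by (subst det2_cramer) (simp add: scaleR_right_distrib)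
  finally show ?thesis .
qed

lemma det2_unique:
  assumes "det2 p q \<noteq> 0" "a *\<^sub>R p + b *\<^sub>R q = a' *\<^sub>R p + b' *\<^sub>R q"
  shows "a = a'" "b = b'"
proof -
  have "det2 (a *\<^sub>R p + b *\<^sub>R q) q = det2 (a' *\<^sub>R p + b' *\<^sub>R q) q"
    "det2 p (a *\<^sub>R p + b *\<^sub>R q) = det2 p (a' *\<^sub>R p + b' *\<^sub>R q)" using assms by simp_all
  then show "a = a'" "b = b'" using assms(1) by simp_all
qed

lemma det2_unique_add:
  assumes "det2 p q \<noteq> 0" "x + a *\<^sub>R p + b *\<^sub>R q = x + a' *\<^sub>R p + b' *\<^sub>R q"
  shows "a = a'" "b = b'"
  using det2_unique[OF assms(1), of a b a' b'] assms(2) by (simp_all add: algebra_simps)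

lemma pairwise_noncolinear_det2:
  assumes "pairwise_noncolinear v" "i \<noteq> j" shows "det2 (v i) (v j) \<noteq> 0"
proof
  assume 0: "det2 (v i) (v j) = 0"
  have nc: "\<not> collinear {0, v i, v j}" using assms by (auto simp: pairwise_noncolinear_def)
  then have "v i \<noteq> 0" by (auto simp: collinear_lemma)
  then obtain k where k: "v i $ k \<noteq> 0" by (auto simp: vec_eq_iff)
  have "v j = (v j $ k / v i $ k) *\<^sub>R v i"
    using 0 k exhaust_2[of k] by (auto simp: det2_def vec_eq_iff forall_2 field_simps)
  then show False using nc by (metis collinear_lemma)
qed

text \<open>The spanning vectors are free here, unlike in \<open>parallelogram\<close>, so that they
  may be negated: \<open>pgram_flip\<close> and \<open>pgram_swap\<close> turn every corner and
  every side into the base ones.\<close>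

definition pgram :: "real^2 \<Rightarrow> real^2 \<Rightarrow> real^2 \<Rightarrow> (real^2) set" where
  "pgram x p q = {x + a *\<^sub>R p + b *\<^sub>R q | a b. 0 \<le> a \<and> a \<le> 1 \<and> 0 \<le> b \<and> b \<le> 1}"

lemma parallelogram_eq_pgram: "parallelogram v x i j = pgram x (v i) (v j)"
  by (simp add: parallelogram_def pgram_def)

lemma pgramI: "0 \<le> a \<Longrightarrow> a \<le> 1 \<Longrightarrow> 0 \<le> b \<Longrightarrow> b \<le> 1 \<Longrightarrow> x + a *\<^sub>R p + b *\<^sub>R q \<in> pgram x p q"
  by (auto simp: pgram_def)

lemma pgramE:
  assumes "y \<in> pgram x p q"
  obtains a b where "y = x + a *\<^sub>R p + b *\<^sub>R q" "0 \<le> a" "a \<le> 1" "0 \<le> b" "b \<le> 1"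
  using assms by (auto simp: pgram_def)

lemma pgram_swap: "pgram x p q = pgram x q p"
proof -
  have "pgram x p q \<subseteq> pgram x q p" for p q
  proof
    fix y assume "y \<in> pgram x p q"
    then obtain a b where "y = x + a *\<^sub>R p + b *\<^sub>R q" "0 \<le> a" "a \<le> 1" "0 \<le> b" "b \<le> 1" by (rule pgramE)
    then show "y \<in> pgram x q p" using pgramI[of b a x q p] by (simp add: algebra_simps)
  qed
  then show ?thesis by blast
qed

lemma parallelogram_swap: "parallelogram v x i j = parallelogram v x j i" for v :: "4 \<Rightarrow> real^2"
  by (simp add: parallelogram_eq_pgram pgram_swap)

lemma pgram_flip: "pgram x p q = pgram (x + p) (- p) q"
proof -
  have *: "pgram x p q \<subseteq> pgram (x + p) (- p) q" for x p q
  proof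
    fix y assume "y \<in> pgram x p q"
    then obtain a b where "y = x + a *\<^sub>R p + b *\<^sub>R q" "0 \<le> a" "a \<le> 1" "0 \<le> b" "b \<le> 1" by (rule pgramE)
    then show "y \<in> pgram (x + p) (- p) q" using pgramI[of "1 - a" b "x + p" "-p" q] by (simp add: algebra_simps)
  qed
  show ?thesis using *[of x p q] *[of "x + p" "-p" q] by auto
qed

lemma pgram_flip2: "pgram x p q = pgram (x + q) p (- q)"
  using pgram_flip[of x q p] by (simp add: pgram_swap)

lemma compact_pgram: "compact (pgram x p q)"
proof -
  have "pgram x p q = (\<lambda>c. x + fst c *\<^sub>R p + snd c *\<^sub>R q) ` (cbox 0 1 \<times> cbox 0 (1::real))"
  proof (intro set_eqI iffI)
    fix y assume "y \<in> pgram x p q"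
    then obtain a b where "y = x + a *\<^sub>R p + b *\<^sub>R q" "0 \<le> a" "a \<le> 1" "0 \<le> b" "b \<le> 1" by (rule pgramE)
    then show "y \<in> (\<lambda>c. x + fst c *\<^sub>R p + snd c *\<^sub>R q) ` (cbox 0 1 \<times> cbox 0 (1::real))"
      by (intro image_eqI[of _ _ "(a, b)"]) auto
  qed (auto intro!: pgramI)
  then show ?thesis
    by (auto intro!: compact_continuous_image continuous_intros compact_Times)
qed

lemma pgram_bounded:
  assumes "y \<in> pgram x p q" shows "norm (y - x) \<le> norm p + norm q"
proof -
  from assms obtain a b where 1: "y = x + a *\<^sub>R p + b *\<^sub>R q" "0 \<le> a" "a \<le> 1" "0 \<le> b" "b \<le> 1" by (rule pgramE)
  have "norm (y - x) \<le> norm (a *\<^sub>R p) + norm (b *\<^sub>R q)" using norm_triangle_ineq[of "a *\<^sub>R p" "b *\<^sub>R q"] by (simp add: 1 algebra_simps)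
  also have "\<dots> \<le> norm p + norm q" using 1 by (intro add_mono) (auto intro: mult_left_le_one_le)
  finally show ?thesis .
qed

lemma open_segment_coords:
  assumes "t \<in> open_segment y z" "y = x + a *\<^sub>R p + b *\<^sub>R q" "z = x + c *\<^sub>R p + d *\<^sub>R q"
  obtains u where "0 < u" "u < 1" "t = x + ((1-u) * a + u * c) *\<^sub>R p + ((1-u) * b + u * d) *\<^sub>R q"
proof -
  from assms(1) obtain u where u: "0 < u" "u < 1" "t = (1-u) *\<^sub>R y + u *\<^sub>R z" by (auto simp: in_segment)
  have "t = x + ((1-u) * a + u * c) *\<^sub>R p + ((1-u) * b + u * d) *\<^sub>R q"
    by (simp add: u(3) assms(2,3) algebra_simps)
  then show ?thesis using u that by blast
qed

lemma pos_combo_zero: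
  fixes u a c :: real
  assumes "0 < u" "u < 1" "0 \<le> a" "0 \<le> c" "(1-u) * a + u * c = 0" shows "a = 0" "c = 0"
proof -
  have "0 \<le> (1-u) * a" "0 \<le> u * c" using assms by auto
  then have "(1-u) * a = 0" "u * c = 0" using assms(5) by linarith+
  then show "a = 0" "c = 0" using assms by auto
qed

lemma pgram_corner:
  assumes "det2 p q \<noteq> 0" shows "x extreme_point_of pgram x p q"
  unfolding extreme_point_of_def
proof (intro conjI ballI notI)
  show "x \<in> pgram x p q" using pgramI[of 0 0 x p q] by simp
  fix y z assume yz: "y \<in> pgram x p q" "z \<in> pgram x p q" and o: "x \<in> open_segment y z"
  from yz(1) obtain a b where 1: "y = x + a *\<^sub>R p + b *\<^sub>R q" "0 \<le> a" "a \<le> 1" "0 \<le> b" "b \<le> 1" by (rule pgramE)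
  from yz(2) obtain c d where 2: "z = x + c *\<^sub>R p + d *\<^sub>R q" "0 \<le> c" "c \<le> 1" "0 \<le> d" "d \<le> 1" by (rule pgramE)
  from open_segment_coords[OF o 1(1) 2(1)] obtain u where u: "0 < u" "u < 1"
    "x = x + ((1-u) * a + u * c) *\<^sub>R p + ((1-u) * b + u * d) *\<^sub>R q" .
  have "0 = (1-u) * a + u * c" "0 = (1-u) * b + u * d"
    using det2_unique_add[OF assms, of x 0 0] u(3) by (metis add.right_neutral scaleR_zero_left)+
  then have "a = 0" "c = 0" "b = 0" "d = 0" using pos_combo_zero[of u] u 1 2 by metis+
  then have "y = z" using 1 2 by simp
  then show False using o by simp
qed

lemma mem_base_edge: "y \<in> closed_segment x (x + p) \<longleftrightarrow> (\<exists>a. 0 \<le> a \<and> a \<le> 1 \<and> y = x + a *\<^sub>R p)"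
  for x p :: "real^2"
  by (auto simp: in_segment algebra_simps)

lemma pgram_edge:
  assumes "det2 p q \<noteq> 0" shows "closed_segment x (x + p) edge_of pgram x p q"
  unfolding edge_of_def
proof
  have p0: "p \<noteq> 0" using assms by auto
  have "aff_dim (closed_segment x (x + p)) = aff_dim {x, x + p}"
    by (simp add: segment_convex_hull aff_dim_convex_hull)
  then show "aff_dim (closed_segment x (x + p)) = 1" using p0 by (simp add: aff_dim_2)
  show "closed_segment x (x + p) face_of pgram x p q"
    unfolding face_of_def
  proof (intro conjI ballI impI)
    show "closed_segment x (x + p) \<subseteq> pgram x p q"
      using pgramI[of _ 0 x p q] by (auto simp: mem_base_edge)
    show "convex (closed_segment x (x + p))" by simp
    fix y z t assume yz: "y \<in> pgram x p q" "z \<in> pgram x p q" and t: "t \<in> closed_segment x (x + p)" and o: "t \<in> open_segment y z"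
    from yz(1) obtain a b where 1: "y = x + a *\<^sub>R p + b *\<^sub>R q" "0 \<le> a" "a \<le> 1" "0 \<le> b" "b \<le> 1" by (rule pgramE)
    from yz(2) obtain c d where 2: "z = x + c *\<^sub>R p + d *\<^sub>R q" "0 \<le> c" "c \<le> 1" "0 \<le> d" "d \<le> 1" by (rule pgramE)
    from open_segment_coords[OF o 1(1) 2(1)] obtain u where u: "0 < u" "u < 1"
      "t = x + ((1-u) * a + u * c) *\<^sub>R p + ((1-u) * b + u * d) *\<^sub>R q" .
    obtain e where "t = x + e *\<^sub>R p + 0 *\<^sub>R q" using t by (auto simp: mem_base_edge)
    then have "0 = (1-u) * b + u * d"
      using det2_unique_add(2)[OF assms] u(3) by metis
    then have "b = 0" "d = 0" using pos_combo_zero[of u] u 1 2 by metis+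
    then show "y \<in> closed_segment x (x + p)" "z \<in> closed_segment x (x + p)"
      using 1 2 by (auto simp: mem_base_edge)
  qed
qed

text \<open>Any \<open>y\<close> of the parallelogram can be joined to a point \<open>z\<close> of
  it beyond the given interior point. That point then lies in the open segment between them, and the
  face property puts \<open>y\<close> into \<open>F\<close>.\<close>

lemma pgram_face_interior:
  assumes F: "F face_of pgram x p q" and m: "x + a *\<^sub>R p + b *\<^sub>R q \<in> F"
    and ab: "0 < a" "a < 1" "0 < b" "b < 1"
  shows "F = pgram x p q"
proof
  show "F \<subseteq> pgram x p q" using F face_of_imp_subset by blast
  show "pgram x p q \<subseteq> F"
  proof
    fix y assume "y \<in> pgram x p q"
    then obtain c d where y: "y = x + c *\<^sub>R p + d *\<^sub>R q" "0 \<le> c" "c \<le> 1" "0 \<le> d" "d \<le> 1" by (rule pgramE)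
    define e where "e = Min {a, 1-a, b, 1-b} / 2"
    have e: "0 < e" "e < a" "e < 1 - a" "e < b" "e < 1 - b" "e < 1"
      using ab by (auto simp: e_def Min_less_iff)
    show "y \<in> F"
    proof (cases "c = a \<and> d = b")
      case True then show ?thesis using m y by simp
    next
      case False
      define z where "z = x + (a + e * (a - c)) *\<^sub>R p + (b + e * (b - d)) *\<^sub>R q"
      have "\<bar>e * (a - c)\<bar> \<le> e * 1" "\<bar>e * (b - d)\<bar> \<le> e * 1"
        unfolding abs_mult using e y ab by (auto intro!: mult_mono)
      then have z: "z \<in> pgram x p q" unfolding z_def using e by (intro pgramI) auto
      \<comment> \<open>The interior point divides the segment from \<open>y\<close> to
        \<open>z\<close> in the ratio 1 to \<open>e\<close>; this is the weight of
        \<open>z\<close>.\<close>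
      define u where "u = 1 / (1 + e)"
      have u: "0 < u" "u < 1" "(1-u) + u * (1 + e) = 1 - u + 1" "u * e = 1 - u" using e by (auto simp: u_def field_simps)
      have c1: "(1-u) * c + u * (a + e * (a - c)) = a" for c a
      proof -
        have "(1-u) * c + u * (a + e * (a - c)) = (1-u)*c + u*a + (u*e) * (a - c)" by (simp add: algebra_simps)
        also have "\<dots> = a" unfolding u(4) by (simp add: algebra_simps)
        finally show ?thesis .
      qed
      have "(1-u) *\<^sub>R y + u *\<^sub>R z = x + ((1-u) * c + u * (a + e * (a - c))) *\<^sub>R p + ((1-u) * d + u * (b + e * (b - d))) *\<^sub>R q"
        by (simp add: y z_def algebra_simps)
      then have eq: "x + a *\<^sub>R p + b *\<^sub>R q = (1-u) *\<^sub>R y + u *\<^sub>R z" unfolding c1 by simp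
      show ?thesis
      proof (cases "y = z")
        case True
        then have "x + a *\<^sub>R p + b *\<^sub>R q = y" using eq by (simp add: algebra_simps flip: scaleR_add_left)
        then show ?thesis using m by simp
      next
        case False
        then have "x + a *\<^sub>R p + b *\<^sub>R q \<in> open_segment y z" using eq u by (auto simp: in_segment)
        then show ?thesis using face_ofD[OF F _ _ z m] \<open>y \<in> _\<close> by blast
      qed
    qed
  qed
qed

text \<open>Faces whose relative interiors meet are equal, so the position of one relative interior
  point \<open>m\<close> of \<open>e\<close> decides. The four open sides give the four listed
  segments; at a corner \<open>e\<close> would be a point, and in the open interior it would be the
  whole parallelogram, both of the wrong dimension.\<close>

lemma pgram_boundary:
  assumes d: "det2 p q \<noteq> 0" and e: "e edge_of pgram x p q"
  shows "e = closed_segment x (x + p) \<or> e = closed_segment x (x + q)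
    \<or> e = closed_segment (x + q) (x + q + p) \<or> e = closed_segment (x + p) (x + p + q)"
proof -
  have eF: "e face_of pgram x p q" and e1: "aff_dim e = 1" using e by (auto simp: edge_of_def)
  have "e \<noteq> {}" using e1 by auto
  moreover have ce: "convex e" using eF face_of_imp_convex by blast
  ultimately obtain m where m: "m \<in> rel_interior e" using rel_interior_eq_empty by blast
  then have me: "m \<in> e" using rel_interior_subset by blast
  then have "m \<in> pgram x p q" using eF face_of_imp_subset by blast
  then obtain a b where 1: "m = x + a *\<^sub>R p + b *\<^sub>R q" "0 \<le> a" "a \<le> 1" "0 \<le> b" "b \<le> 1" by (rule pgramE)
  have d': "det2 q p \<noteq> 0" "det2 (-p) q \<noteq> 0" "det2 p (-q) \<noteq> 0" "det2 (-p) (-q) \<noteq> 0"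
    "det2 q (-p) \<noteq> 0" "det2 (-q) p \<noteq> 0" using d by (auto simp: det2_commute[of q p])
  have E: "closed_segment x (x + p) edge_of pgram x p q"
     "closed_segment x (x + q) edge_of pgram x p q"
     "closed_segment (x + q) (x + q + p) edge_of pgram x p q"
     "closed_segment (x + p) (x + p + q) edge_of pgram x p q"
  proof -
    show "closed_segment x (x + p) edge_of pgram x p q" by (rule pgram_edge[OF d])
    show "closed_segment x (x + q) edge_of pgram x p q"
      unfolding pgram_swap[of x p q] by (rule pgram_edge[OF d'(1)])
    show "closed_segment (x + q) (x + q + p) edge_of pgram x p q"
      unfolding pgram_flip2[of x p q] by (rule pgram_edge[OF d'(3)])
    show "closed_segment (x + p) (x + p + q) edge_of pgram x p q"
      unfolding pgram_flip[of x p q] pgram_swap[of "x+p" "-p" q] by (rule pgram_edge[OF d'(5)])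
  qed
  have seg: "e = closed_segment y z" if "closed_segment y z edge_of pgram x p q" "m \<in> open_segment y z" for y z
  proof (rule face_of_eq[OF eF])
    show "closed_segment y z face_of pgram x p q" using that by (simp add: edge_of_def)
    have "y \<noteq> z" using that by auto
    then show "rel_interior e \<inter> rel_interior (closed_segment y z) \<noteq> {}" using m that by (auto simp: rel_interior_closed_segment)
  qed
  have cor: "False" if "m extreme_point_of pgram x p q"
  proof -
    have "e = {m}" using that m by (intro face_of_eq[OF eF]) (auto simp: face_of_singleton)
    then show False using e1 by simp
  qed
  have inn: False if "0 < a" "a < 1" "0 < b" "b < 1"
  proof -
    have *: "e = pgram x p q" using pgram_face_interior[OF eF _ that] me 1 by simp
    have "closed_segment x (x + p) face_of e" using E(1) * by (simp add: edge_of_def)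
    moreover have "closed_segment x (x + p) \<noteq> e"
    proof
      assume "closed_segment x (x + p) = e"
      moreover have "x + 0 *\<^sub>R p + 1 *\<^sub>R q \<in> e" unfolding * by (rule pgramI) auto
      ultimately have "x + 0 *\<^sub>R p + 1 *\<^sub>R q \<in> closed_segment x (x + p)" by simp
      then have "\<exists>c. x + 0 *\<^sub>R p + 1 *\<^sub>R q = x + c *\<^sub>R p + 0 *\<^sub>R q"
        unfolding mem_base_edge by simp blast
      then obtain c where "x + 0 *\<^sub>R p + 1 *\<^sub>R q = x + c *\<^sub>R p + 0 *\<^sub>R q" by blast
      then show False using det2_unique_add(2)[OF d, of x 0 1 c 0] by simp
    qed
    ultimately have "aff_dim (closed_segment x (x + p)) < aff_dim e" using face_of_aff_dim_lt ce by blast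
    then show False using E(1) e1 by (simp add: edge_of_def)
  qed
  have op: "y + c *\<^sub>R r \<in> open_segment y (y + r)" if "0 < c" "c < 1" "r \<noteq> 0" for y r :: "real^2" and c
    using that by (auto simp: in_segment algebra_simps intro!: exI[of _ c])
  have pq0: "p \<noteq> 0" "q \<noteq> 0" using d by auto
  have "a = 0 \<or> a = 1 \<or> 0 < a \<and> a < 1" "b = 0 \<or> b = 1 \<or> 0 < b \<and> b < 1" using 1 by linarith+
  then consider "0 < a" "a < 1" "0 < b" "b < 1" | "a = 0" "0 < b" "b < 1" | "a = 1" "0 < b" "b < 1"
    | "0 < a" "a < 1" "b = 0" | "0 < a" "a < 1" "b = 1" | "a = 0" "b = 0" | "a = 0" "b = 1" | "a = 1" "b = 0" | "a = 1" "b = 1"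
    by blast
  then show ?thesis
  proof cases
    case 1 then show ?thesis using inn by blast
  next
    case 2 then show ?thesis using seg[OF E(2)] op[of b q x] 1 pq0 by simp
  next
    case 3 then show ?thesis using seg[OF E(4)] op[of b q "x + p"] 1 pq0 by simp
  next
    case 4 then show ?thesis using seg[OF E(1)] op[of a p x] 1 pq0 by simp
  next
    case 5 then show ?thesis using seg[OF E(3)] op[of a p "x + q"] 1 pq0 by (simp add: algebra_simps)
  next
    case 6 then show ?thesis using cor pgram_corner[OF d, of x] 1 by simp
  next
    case 7 then show ?thesis using cor pgram_corner[OF d'(3), of "x + q"] 1 pgram_flip2[of x p q] by simp
  next
    case 8 then show ?thesis using cor pgram_corner[OF d'(2), of "x + p"] 1 pgram_flip[of x p q] by simp
  next
    case 9 then show ?thesis using cor pgram_corner[OF d'(4), of "x + p + q"] 1 pgram_flip[of x p q] pgram_flip2[of "x + p" "-p" q] by simp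
  qed
qed

lemma edge_of_pgram_boundary:
  assumes d: "det2 p q \<noteq> 0" and e: "e edge_of pgram x p q" and m: "x + a *\<^sub>R p + b *\<^sub>R q \<in> e"
  shows "\<not> (0 < a \<and> a < 1 \<and> 0 < b \<and> b < 1)"
proof -
  have *: "x + a *\<^sub>R p + b *\<^sub>R q = x + a' *\<^sub>R p + b' *\<^sub>R q \<Longrightarrow> a = a' \<and> b = b'" for a' b'
    using det2_unique_add[OF d] by metis
  have s: "\<exists>a' b'. x + a *\<^sub>R p + b *\<^sub>R q = x + a' *\<^sub>R p + b' *\<^sub>R q \<and> (a' = 0 \<or> a' = 1 \<or> b' = 0 \<or> b' = 1)"
    using pgram_boundary[OF d e]
  proof (elim disjE)
    assume "e = closed_segment x (x + p)"
    then obtain c where "x + a *\<^sub>R p + b *\<^sub>R q = x + c *\<^sub>R p" using m by (auto simp: mem_base_edge)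
    then show ?thesis by (intro exI[of _ c] exI[of _ 0]) simp
  next
    assume "e = closed_segment x (x + q)"
    then obtain c where "x + a *\<^sub>R p + b *\<^sub>R q = x + c *\<^sub>R q" using m by (auto simp: mem_base_edge)
    then show ?thesis by (intro exI[of _ 0] exI[of _ c]) simp
  next
    assume "e = closed_segment (x + q) (x + q + p)"
    then obtain c where "x + a *\<^sub>R p + b *\<^sub>R q = x + q + c *\<^sub>R p" using m by (auto simp: mem_base_edge)
    then show ?thesis by (intro exI[of _ c] exI[of _ 1]) simp
  next
    assume "e = closed_segment (x + p) (x + p + q)"
    then obtain c where "x + a *\<^sub>R p + b *\<^sub>R q = x + p + c *\<^sub>R q" using m by (auto simp: mem_base_edge)
    then show ?thesis by (intro exI[of _ 1] exI[of _ c]) simp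
  qed
  then show ?thesis using * by fastforce
qed

text \<open>Equal segments have equal end points. Noncolinearity then identifies the index, and a
  reversed traversal would force \<open>2 *\<^sub>R v l = 0\<close>, so the starting point is
  determined as well.\<close>

lemma parallelogram_edge_direction:
  assumes nc: "pairwise_noncolinear v" and ij: "i \<noteq> j" and e: "closed_segment y (y + v k) edge_of parallelogram v x i j"
  shows "k = i \<and> (y = x \<or> y = x + v j) \<or> k = j \<and> (y = x \<or> y = x + v i)"
proof -
  have d: "det2 (v i) (v j) \<noteq> 0" using pairwise_noncolinear_det2[OF nc ij] .
  have par: "k = l \<and> y = z" if "closed_segment y (y + v k) = closed_segment z (z + v l)" for z l
  proof -
    from that have st: "{y, y + v k} = {z, z + v l}" by (simp add: closed_segment_eq)
    then have "v k = v l \<or> v k = - v l"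
      unfolding doubleton_eq_iff by (metis add_diff_cancel_left' minus_diff_eq)
    then have "det2 (v k) (v l) = 0" by auto
    then have kl: "k = l" using pairwise_noncolinear_det2[OF nc] by blast
    obtain l' where "l' \<noteq> l" using ij by metis
    then have "v l \<noteq> 0" using pairwise_noncolinear_det2[OF nc, of l l'] by auto
    have "y = z"
    proof (rule ccontr)
      assume "y \<noteq> z"
      then have "y = z + v l" "z = y + v l" using st kl by (auto simp: doubleton_eq_iff)
      then have "2 *\<^sub>R v l = 0" by (simp add: scaleR_2)
      then show False using \<open>v l \<noteq> 0\<close> by simp
    qed
    with kl show ?thesis by simp
  qed
  show ?thesis using pgram_boundary[OF d e[unfolded parallelogram_eq_pgram]] par by blast
qed

lemma parallelogram_eqD:
  assumes nc: "pairwise_noncolinear v" and ij: "i \<noteq> j" "k \<noteq> l"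
    and eq: "parallelogram v x i j = parallelogram v y k l"
  shows "x = y \<and> {i, j} = {k, l}"
proof -
  have d: "det2 (v i) (v j) \<noteq> 0" "det2 (v j) (v i) \<noteq> 0" "det2 (v k) (v l) \<noteq> 0"
    using pairwise_noncolinear_det2[OF nc] ij by auto
  have "closed_segment x (x + v i) edge_of parallelogram v y k l"
    "closed_segment x (x + v j) edge_of parallelogram v y k l"
    unfolding eq[symmetric] unfolding parallelogram_eq_pgram using pgram_edge[OF d(1), of x] pgram_edge[OF d(2), of x]
    by (simp_all only: pgram_swap[of x "v j" "v i"])
  from this[THEN parallelogram_edge_direction[OF nc ij(2)]]
  have *: "i = k \<and> (x = y \<or> x = y + v l) \<or> i = l \<and> (x = y \<or> x = y + v k)"
    "j = k \<and> (x = y \<or> x = y + v l) \<or> j = l \<and> (x = y \<or> x = y + v k)" .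
  have "v k \<noteq> 0" "v l \<noteq> 0" "v k \<noteq> v l" using d by auto
  then show ?thesis using * ij by auto
qed

section \<open>Worms and the direction of a slope\<close>

text \<open>The segment from \<open>x\<close> to \<open>x + v i\<close> as a side of some tile:
  either the side at the base point of the tile or the side opposite to it.\<close>

definition tile_edge :: "(4 \<Rightarrow> real^2) \<Rightarrow> (real^2) set set \<Rightarrow> real^2 \<Rightarrow> 4 \<Rightarrow> bool" where
  "tile_edge v T x i \<longleftrightarrow> (\<exists>l. l \<noteq> i \<and> (parallelogram v x i l \<in> T \<or> parallelogram v (x - v l) i l \<in> T))"

lemma octagonal_tiling_tile:
  assumes "octagonal_tiling v T" "s \<in> T"
  obtains x i j where "i < j" "s = parallelogram v x i j"
  using assms unfolding octagonal_tiling_def by metis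

lemma octagonal_tiling_meet:
  assumes T: "octagonal_tiling v T" and "s \<in> T" "t \<in> T" "s \<noteq> t" "m \<in> s" "m \<in> t"
  shows "(m extreme_point_of s \<and> m extreme_point_of t) \<or> (\<exists>e. m \<in> e \<and> e edge_of s \<and> e edge_of t)"
proof -
  from T have "\<forall>s\<in>T. \<forall>t\<in>T. s \<noteq> t \<longrightarrow>
        s \<inter> t = {} \<or>
        (\<exists>p. p extreme_point_of s \<and> p extreme_point_of t \<and> s \<inter> t = {p}) \<or>
        (\<exists>e. e edge_of s \<and> e edge_of t \<and> s \<inter> t = e)"
    unfolding octagonal_tiling_def by (elim conjE)
  from this[rule_format, OF assms(2-4)] have "(\<exists>p. p extreme_point_of s \<and> p extreme_point_of t \<and> s \<inter> t = {p}) \<or>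
        (\<exists>e. e edge_of s \<and> e edge_of t \<and> s \<inter> t = e)" using assms(5,6) by auto
  moreover have m: "m \<in> s \<inter> t" using assms by simp
  ultimately show ?thesis
  proof (elim disjE exE conjE)
    fix p assume "p extreme_point_of s" "p extreme_point_of t" "s \<inter> t = {p}"
    with m show ?thesis by auto
  next
    fix e assume "e edge_of s" "e edge_of t" "s \<inter> t = e"
    with m show ?thesis by auto
  qed
qed

lemma octagonal_tiling_disjoint:
  assumes nc: "pairwise_noncolinear v" and T: "octagonal_tiling v T"
    and s: "parallelogram v x i j \<in> T" "t \<in> T" "parallelogram v x i j \<noteq> t" "i \<noteq> j"
    and ab: "0 < a" "a < 1" "0 < b" "b < 1"
  shows "x + a *\<^sub>R v i + b *\<^sub>R v j \<notin> t"
proof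
  let ?s = "parallelogram v x i j" and ?c = "x + a *\<^sub>R v i + b *\<^sub>R v j"
  assume ct: "?c \<in> t"
  have d: "det2 (v i) (v j) \<noteq> 0" using pairwise_noncolinear_det2[OF nc s(4)] .
  have cs: "?c \<in> ?s" unfolding parallelogram_eq_pgram using ab by (intro pgramI) auto
  have F: "F = ?s" if "F face_of ?s" "?c \<in> F" for F
    using pgram_face_interior[of F x "v i" "v j" a b] that ab by (simp add: parallelogram_eq_pgram)
  from octagonal_tiling_meet[OF T s(1,2,3) cs ct] show False
  proof (elim disjE exE conjE)
    assume "?c extreme_point_of ?s"
    then have "?s = {?c}" using F[of "{?c}"] by (simp add: face_of_singleton)
    moreover have "x + 0 *\<^sub>R v i + 0 *\<^sub>R v j \<in> ?s" unfolding parallelogram_eq_pgram by (rule pgramI) auto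
    ultimately have "x + 0 *\<^sub>R v i + 0 *\<^sub>R v j = x + a *\<^sub>R v i + b *\<^sub>R v j" by blast
    then show False using det2_unique_add(1)[OF d, of x 0 0 a b] ab by simp
  next
    fix e assume "?c \<in> e" "e edge_of ?s"
    then show False using edge_of_pgram_boundary[OF d, of e x a b] ab by (simp add: parallelogram_eq_pgram)
  qed
qed

lemma discrete_bounded_imp_finite:
  fixes S :: "(real^2) set"
  assumes "0 < d" "bounded S" "\<forall>y\<in>S. \<forall>z\<in>S. dist z y < d \<longrightarrow> z = y"
  shows "finite S"
proof -
  have "uniform_discrete S" unfolding uniform_discrete_def using assms by (metis dist_commute)
  moreover have "compact S" using discrete_imp_closed[OF assms(1,3)] assms(2) by (simp add: compact_eq_bounded_closed)
  ultimately show ?thesis using uniform_discrete_finite_iff[of S] assms(2) by simp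
qed

text \<open>Tiles of one type have base points at mutual distance at least \<open>\<delta>\<close>,
  because two closer ones would overlap in an interior point. A bounded set of such base points is
  finite, and there are finitely many types.\<close>

lemma octagonal_tiling_locally_finite:
  assumes nc: "pairwise_noncolinear v" and T: "octagonal_tiling v T"
  shows "finite {t\<in>T. t \<inter> cball c r \<noteq> {}}"
proof -
  define Y where "Y i j = {y. parallelogram v y i j \<in> T \<and> parallelogram v y i j \<inter> cball c r \<noteq> {}}" for i j
  have fin: "finite (Y i j)" if ij: "i \<noteq> j" for i j
  proof (rule discrete_bounded_imp_finite)
    have d: "det2 (v i) (v j) \<noteq> 0" using pairwise_noncolinear_det2[OF nc ij] .
    define N where "N = norm (v i) + norm (v j) + 1"
    \<comment> \<open>Chosen through \<open>abs_det2_le\<close> so that a vector shorter than this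
      has coordinates below 1 in absolute value with respect to \<open>v i\<close> and
      \<open>v j\<close>.\<close>
    define \<delta> where "\<delta> = \<bar>det2 (v i) (v j)\<bar> / (2 * N)"
    have pos: "N > 0" unfolding N_def by (smt (verit) norm_ge_zero)
    show "0 < \<delta>" unfolding \<delta>_def using d pos by simp
    show "bounded (Y i j)"
      unfolding bounded_iff
    proof (intro exI ballI)
      fix y assume "y \<in> Y i j"
      then obtain z where z: "z \<in> parallelogram v y i j" "dist c z \<le> r" by (auto simp: Y_def)
      have "norm (z - y) \<le> norm (v i) + norm (v j)" using pgram_bounded z(1) by (simp add: parallelogram_eq_pgram)
      then show "norm y \<le> norm c + r + norm (v i) + norm (v j)"
        using z(2) unfolding dist_norm by norm
    qed
    show "\<forall>y\<in>Y i j. \<forall>z\<in>Y i j. dist z y < \<delta> \<longrightarrow> z = y"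
    proof (intro ballI impI)
      fix y z assume y: "y \<in> Y i j" and z: "z \<in> Y i j" and "dist z y < \<delta>"
      then have nz: "norm (z - y) < \<delta>" by (simp add: dist_norm)
      show "z = y"
      proof (rule ccontr)
        assume ne: "z \<noteq> y"
        define a where "a = det2 (z - y) (v j) / det2 (v i) (v j)"
        define b where "b = det2 (v i) (z - y) / det2 (v i) (v j)"
        have zy: "z - y = a *\<^sub>R v i + b *\<^sub>R v j" unfolding a_def b_def by (rule det2_coords[OF d])
        have small: "2 * norm (z - y) * norm (v k) < \<bar>det2 (v i) (v j)\<bar>" if "k = i \<or> k = j" for k
        proof -
          have "2 * norm (z - y) * norm (v k) \<le> 2 * norm (z - y) * N"
            using that by (intro mult_left_mono) (auto simp: N_def)
          also have "\<dots> < 2 * \<delta> * N" using nz pos by simp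
          also have "\<dots> = \<bar>det2 (v i) (v j)\<bar>" using pos by (simp add: \<delta>_def)
          finally show ?thesis .
        qed
        have a: "\<bar>a\<bar> < 1" using abs_det2_le[of "z - y" "v j"] small[of j] d by (simp add: a_def)
        have b: "\<bar>b\<bar> < 1" using abs_det2_le[of "v i" "z - y"] small[of i] d by (simp add: b_def algebra_simps)
        have pz: "parallelogram v y i j \<in> T" "parallelogram v z i j \<in> T" using y z by (auto simp: Y_def)
        have "parallelogram v y i j \<noteq> parallelogram v z i j" using parallelogram_eqD[OF nc ij ij] ne by blast
        \<comment> \<open>The midpoint between the centres of the two tiles. It is interior to both,
          since \<open>a\<close> and \<open>b\<close> are below 1 in absolute value.\<close>
        from octagonal_tiling_disjoint[OF nc T pz this ij, of "(1+a)/2" "(1+b)/2"]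
        have "y + ((1+a)/2) *\<^sub>R v i + ((1+b)/2) *\<^sub>R v j \<notin> parallelogram v z i j" using a b by auto
        moreover have "y + ((1+a)/2) *\<^sub>R v i + ((1+b)/2) *\<^sub>R v j = z + ((1-a)/2) *\<^sub>R v i + ((1-b)/2) *\<^sub>R v j"
        proof -
          have z: "z = y + a *\<^sub>R v i + b *\<^sub>R v j" using zy by (simp add: algebra_simps)
          have "(1+a)/2 = a + (1-a)/2" "(1+b)/2 = b + (1-b)/2" by (simp_all add: field_simps)
          then show ?thesis unfolding z by (simp only: scaleR_add_left add_ac)
        qed
        moreover have "z + ((1-a)/2) *\<^sub>R v i + ((1-b)/2) *\<^sub>R v j \<in> parallelogram v z i j"
          unfolding parallelogram_eq_pgram using a b by (intro pgramI) auto
        ultimately show False by simp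
      qed
    qed
  qed
  have "{t\<in>T. t \<inter> cball c r \<noteq> {}} \<subseteq> (\<Union>(i, j)\<in>{(i, j). i < j}. (\<lambda>y. parallelogram v y i j) ` Y i j)"
  proof
    fix t assume t: "t \<in> {t\<in>T. t \<inter> cball c r \<noteq> {}}"
    then obtain x i j where "i < j" "t = parallelogram v x i j" using octagonal_tiling_tile[OF T] by blast
    then show "t \<in> (\<Union>(i, j)\<in>{(i, j). i < j}. (\<lambda>y. parallelogram v y i j) ` Y i j)" using t by (auto simp: Y_def)
  qed
  moreover have "finite (\<Union>(i, j)\<in>{(i, j). i < j}. (\<lambda>y. parallelogram v y i j) ` Y i j)"
    using fin by (intro finite_UN_I) auto
  ultimately show ?thesis using finite_subset by blast
qed

text \<open>Points just beyond the midpoint of an edge are covered by a tile which, by local finiteness,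
  contains the midpoint; the edge-to-edge condition makes it share the edge.\<close>

lemma next_tile:
  assumes nc: "pairwise_noncolinear v" and T: "octagonal_tiling v T" and e: "tile_edge v T x i"
  obtains l where "l \<noteq> i" "det2 (v i) (v l) > 0 \<and> parallelogram v x i l \<in> T \<or>
    det2 (v i) (v l) < 0 \<and> parallelogram v (x - v l) i l \<in> T"
proof -
  from e obtain j where j: "j \<noteq> i" "parallelogram v x i j \<in> T \<or> parallelogram v (x - v j) i j \<in> T"
    unfolding tile_edge_def by blast
  define c where "c = (if parallelogram v x i j \<in> T then 0 else 1::real)"
  define s where "s = parallelogram v (x - c *\<^sub>R v j) i j"
  have s: "s \<in> T" using j by (auto simp: s_def c_def)
  have d: "det2 (v i) (v j) \<noteq> 0" using pairwise_noncolinear_det2[OF nc] j by metis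
  \<comment> \<open>\<open>g *\<^sub>R v j\<close> points to the side of the edge that has positive
    determinant with \<open>v i\<close>, the side on which the next tile is sought.\<close>
  define g where "g = sgn (det2 (v i) (v j))"
  have g: "g * det2 (v i) (v j) > 0" "g \<noteq> 0" using d by (auto simp: g_def sgn_real_def)
  define m where "m = x + (1/2) *\<^sub>R v i"
  define w where "w n = m + (g / real (Suc n)) *\<^sub>R v j" for n
  have wm: "w \<longlonglongrightarrow> m"
  proof -
    have "(\<lambda>n. g / real (Suc n)) \<longlonglongrightarrow> 0" using lim_const_over_n[of g, THEN LIMSEQ_Suc] by simp
    then have "(\<lambda>n. m + (g / real (Suc n)) *\<^sub>R v j) \<longlonglongrightarrow> m + 0 *\<^sub>R v j"
      by (intro tendsto_add tendsto_scaleR tendsto_const)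
    then show ?thesis unfolding w_def by simp
  qed
  have dw: "det2 (v i) (w n - x) > 0" for n
  proof -
    have "det2 (v i) (w n - x) = (g * det2 (v i) (v j)) / real (Suc n)" by (simp add: w_def m_def)
    also have "\<dots> > 0" using g(1) by (intro divide_pos_pos) auto
    finally show ?thesis .
  qed
  define tl where "tl n = (SOME t. t \<in> T \<and> w n \<in> t)" for n
  have tl: "tl n \<in> T \<and> w n \<in> tl n" for n
  proof -
    have "w n \<in> \<Union>T" using T by (auto simp: octagonal_tiling_def)
    then show ?thesis unfolding tl_def by (intro someI_ex[of "\<lambda>t. t \<in> T \<and> w n \<in> t"]) auto
  qed
  have "range tl \<subseteq> {t\<in>T. t \<inter> cball m (norm (v j)) \<noteq> {}}"
  proof
    fix t assume "t \<in> range tl"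
    then obtain n where n: "t = tl n" by blast
    have "norm ((g / real (Suc n)) *\<^sub>R v j) \<le> norm (v j)"
      by (auto simp: g_def sgn_real_def field_simps)
    then have "w n \<in> cball m (norm (v j))" by (simp add: w_def dist_norm)
    then show "t \<in> {t\<in>T. t \<inter> cball m (norm (v j)) \<noteq> {}}" using tl[of n] n by auto
  qed
  then have "finite (range tl)" using octagonal_tiling_locally_finite[OF nc T] finite_subset by blast
  \<comment> \<open>One tile contains infinitely many of the points \<open>w n\<close>; being
    closed, it contains their limit, the midpoint \<open>m\<close> of the edge.\<close>
  then obtain n0 where inf: "infinite {n. tl n = tl n0}"
    using pigeonhole_infinite[of UNIV tl] by auto
  define t where "t = tl n0"
  have t: "t \<in> T" using tl by (simp add: t_def)
  have "compact t" using octagonal_tiling_tile[OF T t] compact_pgram parallelogram_eq_pgram by metis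
  then have clt: "closed t" by (rule compact_imp_closed)
  define r where "r = enumerate {n. tl n = tl n0}"
  have "strict_mono r" unfolding r_def using inf by (rule strict_mono_enumerate)
  then have "(w \<circ> r) \<longlonglongrightarrow> m" using wm LIMSEQ_subseq_LIMSEQ by blast
  moreover have wr: "(w \<circ> r) n \<in> t" for n
  proof -
    have "r n \<in> {n. tl n = tl n0}" unfolding r_def using inf by (rule enumerate_in_set)
    then show ?thesis using tl[of "r n"] by (simp add: t_def)
  qed
  ultimately have mt: "m \<in> t" using clt closed_sequentially by metis
  obtain q where q: "q \<in> t" "det2 (v i) (q - x) > 0" using wr[of 0] dw[of "r 0"] by auto
  \<comment> \<open>The test asks whether \<open>s\<close> itself lies on the side of positive
    determinant. If it does not, \<open>t\<close>, which has a point \<open>q\<close> on that side,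
    is a different tile.\<close>
  show ?thesis
  proof (cases "g = 1 \<longleftrightarrow> c = 0")
    case True
    then show ?thesis using that[of j] j g(1) by (auto simp: c_def g_def sgn_real_def split: if_splits)
  next
    case False
    have ms: "m = (x - c *\<^sub>R v j) + (1/2) *\<^sub>R v i + c *\<^sub>R v j" by (simp add: m_def)
    have ms': "m \<in> s" unfolding ms s_def parallelogram_eq_pgram by (intro pgramI) (auto simp: c_def)
    have sneg: "det2 (v i) (y - x) \<le> 0" if ys: "y \<in> s" for y
    proof -
      obtain a b where y: "y = (x - c *\<^sub>R v j) + a *\<^sub>R v i + b *\<^sub>R v j" "0 \<le> b" "b \<le> 1"
        using ys unfolding s_def parallelogram_eq_pgram by (rule pgramE)
      have "det2 (v i) (y - x) = (b - c) * det2 (v i) (v j)" by (simp add: y algebra_simps)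
      also have "\<dots> \<le> 0" using False g(1) y(2,3)
        by (auto simp: c_def g_def sgn_real_def mult_nonneg_nonpos mult_nonpos_nonneg split: if_splits)
      finally show ?thesis .
    qed
    have st: "s \<noteq> t" using sneg q by fastforce
    have im: "m \<in> s \<inter> t" using ms' mt by blast
    have ed: "closed_segment x (x + v i) edge_of s"
    proof (cases "c = 0")
      case True then show ?thesis using pgram_edge[OF d, of x] by (simp add: s_def parallelogram_eq_pgram)
    next
      case False
      then have "c = 1" by (auto simp: c_def)
      moreover have "det2 (v i) (- v j) \<noteq> 0" using d by simp
      ultimately show ?thesis using pgram_edge[of "v i" "- v j" x] pgram_flip2[of "x - v j" "v i" "v j"] by (simp add: s_def parallelogram_eq_pgram)
    qed
    have i0: "v i \<noteq> 0" using d by auto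
    have mo: "m \<in> open_segment x (x + v i)" using i0 by (auto simp: m_def in_segment algebra_simps intro!: exI[of _ "1/2"])
    have et: "closed_segment x (x + v i) edge_of t"
      using octagonal_tiling_meet[OF T s t st ms' mt]
    proof (elim disjE exE conjE)
      assume "m extreme_point_of s"
      moreover have "x \<in> s" "x + v i \<in> s" using edge_of_imp_subset[OF ed] by auto
      ultimately have False using mo by (auto simp: extreme_point_of_def)
      then show ?thesis ..
    next
      fix e assume e: "m \<in> e" "e edge_of s" "e edge_of t"
      have "closed_segment x (x + v i) \<subseteq> e"
      proof (rule subset_of_face_of)
        show "e face_of s" "closed_segment x (x + v i) \<subseteq> s" using e edge_of_imp_subset[OF ed] by (auto simp: edge_of_def)
        have "m \<in> rel_interior (closed_segment x (x + v i))" using mo i0 by (simp add: rel_interior_closed_segment)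
        then show "e \<inter> rel_interior (closed_segment x (x + v i)) \<noteq> {}" using e by blast
      qed
      then have fe: "closed_segment x (x + v i) face_of e"
        using ed edge_of_imp_subset[OF e(2)] face_of_subset unfolding edge_of_def by blast
      have "closed_segment x (x + v i) = e"
        using face_of_aff_dim_lt[OF _ fe] e(2) ed face_of_imp_convex[of e s] by (auto simp: edge_of_def)
      then show ?thesis using e by simp
    qed
    obtain y k l where kl: "k < l" "t = parallelogram v y k l" using octagonal_tiling_tile[OF T t] .
    then have kl': "k \<noteq> l" by auto
    obtain l' where l': "l' \<noteq> i" "parallelogram v y i l' = t" "x = y \<or> x = y + v l'"
      using parallelogram_edge_direction[OF nc kl' et[unfolded kl(2)]] kl kl' parallelogram_swap[of v y k l] by metis
    obtain a b where ab: "q = y + a *\<^sub>R v i + b *\<^sub>R v l'" "0 \<le> b" "b \<le> 1"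
      using q(1) unfolding l'(2)[symmetric] parallelogram_eq_pgram by (rule pgramE)
    show ?thesis
    proof (rule that[OF l'(1)], use l'(3) in \<open>elim disjE\<close>)
      assume "x = y"
      then have "b * det2 (v i) (v l') > 0" using q(2) by (simp add: ab)
      then have "det2 (v i) (v l') > 0" using ab by (auto simp: zero_less_mult_iff)
      then show "0 < det2 (v i) (v l') \<and> parallelogram v x i l' \<in> T \<or> det2 (v i) (v l') < 0 \<and> parallelogram v (x - v l') i l' \<in> T"
        using \<open>x = y\<close> l' t by auto
    next
      assume x: "x = y + v l'"
      then have "(b - 1) * det2 (v i) (v l') > 0" using q(2) by (simp add: ab algebra_simps)
      then have "det2 (v i) (v l') < 0" using ab by (auto simp: zero_less_mult_iff)
      then show "0 < det2 (v i) (v l') \<and> parallelogram v x i l' \<in> T \<or> det2 (v i) (v l') < 0 \<and> parallelogram v (x - v l') i l' \<in> T"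
        using x l' t by auto
    qed
  qed
qed

definition grass :: "real^4 \<Rightarrow> real^4 \<Rightarrow> 4 \<Rightarrow> 4 \<Rightarrow> real" where
  "grass u w i j = u$i * w$j - u$j * w$i"

lemma tile_edge_lift_surface:
  assumes L: "lifting v T f" and e: "tile_edge v T x i"
  shows "f x \<in> lift_surface v T f"
proof -
  from e obtain l where l: "l \<noteq> i" "parallelogram v x i l \<in> T \<or> parallelogram v (x - v l) i l \<in> T"
    unfolding tile_edge_def by blast
  have corner: "p \<in> parallelogram std_basis p i j" "p + std_basis i \<in> parallelogram std_basis p i j"
    "p + std_basis j \<in> parallelogram std_basis p i j" for p i j
  proof -
    have "p + 0 *\<^sub>R std_basis i + 0 *\<^sub>R std_basis j \<in> parallelogram std_basis p i j"
      "p + 1 *\<^sub>R std_basis i + 0 *\<^sub>R std_basis j \<in> parallelogram std_basis p i j"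
      "p + 0 *\<^sub>R std_basis i + 1 *\<^sub>R std_basis j \<in> parallelogram std_basis p i j"
      unfolding parallelogram_def mem_Collect_eq by (rule exI, rule exI, rule conjI[OF refl], simp)+
    then show "p \<in> parallelogram std_basis p i j" "p + std_basis i \<in> parallelogram std_basis p i j"
    "p + std_basis j \<in> parallelogram std_basis p i j" by simp_all
  qed
  have mem: "parallelogram std_basis (f y) a b \<subseteq> lift_surface v T f" if "a < b" "parallelogram v y a b \<in> T" for y a b
    using that unfolding lift_surface_def by blast
  have mem2: "f y \<in> lift_surface v T f \<and> f y + std_basis l \<in> lift_surface v T f" if p: "parallelogram v y i l \<in> T" for y
  proof (cases "i < l")
    case True
    then show ?thesis using mem[OF True p] corner(1)[of "f y" i l] corner(3)[of "f y" l i] by blast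
  next
    case False
    then have "l < i" using l(1) by auto
    moreover have "parallelogram v y l i \<in> T" using p parallelogram_swap[of v y i l] by simp
    ultimately show ?thesis using mem[of l i y] corner(1)[of "f y" l i] corner(2)[of "f y" l i] by blast
  qed
  from l(2) show ?thesis
  proof
    assume "parallelogram v x i l \<in> T"
    then show ?thesis using mem2 by blast
  next
    assume p: "parallelogram v (x - v l) i l \<in> T"
    then have "parallelogram v (x - v l) l i \<in> T" using parallelogram_swap[of v "x - v l" i l] by simp
    then have "f (x - v l + v l) = f (x - v l) + std_basis l"
      using L l(1) unfolding lifting_def by blast
    then have "f x = f (x - v l) + std_basis l" by simp
    then show ?thesis using mem2[OF p] by simp
  qed
qed

text \<open>The step leads to the opposite \<open>v i\<close>-side of the next tile. Its direction
  along \<open>v l\<close> depends on whether that tile is based at \<open>x\<close> or at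
  \<open>x - v l\<close>, which is what the sign of the determinant records.\<close>

lemma worm_step:
  assumes nc: "pairwise_noncolinear v" and T: "octagonal_tiling v T" and e: "tile_edge v T x i"
  obtains l y where "l \<noteq> i" "tile_edge v T y i" "\<exists>z. tile_edge v T z l"
    "\<And>f. lifting v T f \<Longrightarrow> f y = f x + sgn (det2 (v i) (v l)) *\<^sub>R std_basis l"
proof -
  obtain l where l: "l \<noteq> i" "det2 (v i) (v l) > 0 \<and> parallelogram v x i l \<in> T \<or>
    det2 (v i) (v l) < 0 \<and> parallelogram v (x - v l) i l \<in> T" using next_tile[OF nc T e] .
  from l(2) show ?thesis
  proof
    assume a: "det2 (v i) (v l) > 0 \<and> parallelogram v x i l \<in> T"
    then have a': "parallelogram v x l i \<in> T" using parallelogram_swap by metis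
    show ?thesis
    proof (rule that[OF l(1), of "x + v l"])
      show "tile_edge v T (x + v l) i" "\<exists>z. tile_edge v T z l" unfolding tile_edge_def using a a' l(1)
        by (metis add_diff_cancel_right')+
      show "f (x + v l) = f x + sgn (det2 (v i) (v l)) *\<^sub>R std_basis l" if "lifting v T f" for f
        using that a a' l(1) unfolding lifting_def by simp
    qed
  next
    assume a: "det2 (v i) (v l) < 0 \<and> parallelogram v (x - v l) i l \<in> T"
    then have a': "parallelogram v (x - v l) l i \<in> T" using parallelogram_swap by metis
    show ?thesis
    proof (rule that[OF l(1), of "x - v l"])
      show "tile_edge v T (x - v l) i" "\<exists>z. tile_edge v T z l" unfolding tile_edge_def using a a' l(1) by metis+
      show "f (x - v l) = f x + sgn (det2 (v i) (v l)) *\<^sub>R std_basis l" if "lifting v T f" for f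
      proof -
        have "f (x - v l + v l) = f (x - v l) + std_basis l" using that a' l(1) unfolding lifting_def by blast
        then show ?thesis using a by simp
      qed
    qed
  qed
qed

text \<open>The same chain of \<open>N\<close> tiles serves all lifts. Every step crosses an edge \<open>v k\<close> towards the side
  of positive determinant with \<open>v i\<close>, so its sign depends on \<open>i\<close> and \<open>k\<close> only.\<close>

lemma worm:
  assumes nc: "pairwise_noncolinear v" and T: "octagonal_tiling v T" and e: "tile_edge v T x i"
  shows "\<exists>(c :: 4 \<Rightarrow> nat) y. c i = 0 \<and> sum c UNIV = N \<and> tile_edge v T y i \<and> (\<forall>k. c k > 0 \<longrightarrow> (\<exists>z. tile_edge v T z k)) \<and>
    (\<forall>f. lifting v T f \<longrightarrow> f y = f x + (\<chi> k. sgn (det2 (v i) (v k)) * real (c k)))"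
proof (induction N)
  case 0
  have "(\<chi> k. sgn (det2 (v i) (v k)) * real ((\<lambda>_. 0) k)) = 0" by (simp add: vec_eq_iff)
  then show ?case using e by (intro exI[of _ "\<lambda>_. 0"] exI[of _ x]) auto
next
  case (Suc N)
  then obtain c :: "4 \<Rightarrow> nat" and y where c: "c i = 0" "sum c UNIV = N" "tile_edge v T y i" "\<And>k. c k > 0 \<Longrightarrow> \<exists>z. tile_edge v T z k"
    "\<And>f. lifting v T f \<Longrightarrow> f y = f x + (\<chi> k. sgn (det2 (v i) (v k)) * real (c k))" by blast
  obtain l y' where l: "l \<noteq> i" "tile_edge v T y' i" "\<exists>z. tile_edge v T z l"
    "\<And>f. lifting v T f \<Longrightarrow> f y' = f y + sgn (det2 (v i) (v l)) *\<^sub>R std_basis l"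
    using worm_step[OF nc T c(3)] by metis
  have "sum (c(l := Suc (c l))) UNIV = Suc (sum c UNIV)"
    by (simp add: sum.remove[of UNIV l])
  then have sm: "sum (c(l := Suc (c l))) UNIV = Suc N" using c(2) by simp
  have "(\<chi> k. sgn (det2 (v i) (v k)) * real ((c(l := Suc (c l))) k)) =
     (\<chi> k. sgn (det2 (v i) (v k)) * real (c k)) + sgn (det2 (v i) (v l)) *\<^sub>R std_basis l"
    by (simp add: vec_eq_iff std_basis_def axis_def algebra_simps)
  note eq = this
  have C': "f y' = f x + (\<chi> k. sgn (det2 (v i) (v k)) * real ((c(l := Suc (c l))) k))" if "lifting v T f" for f
    unfolding l(4)[OF that] c(5)[OF that] eq by (rule add.assoc)
  have "(c(l := Suc (c l))) i = 0" using l(1) c(1) by simp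
  moreover have "\<exists>z. tile_edge v T z k" if "0 < (c(l := Suc (c l))) k" for k
    using that l(3) c(4)[of k] by (cases "k = l") auto
  ultimately show ?case using sm C' l(2) by blast
qed

section \<open>Asymptotic directions of worms\<close>

lemma direction_subspace:
  assumes "affine E" "E \<noteq> {}" shows "subspace (direction E)"
proof -
  obtain a where a: "a \<in> E" using assms by blast
  have s: "subspace {x - a | x. x \<in> E}" using affine_diffs_subspace_subtract[OF assms(1) a] by (simp add: image_def setcompr_eq_image)
  have "direction E = {x - a | x. x \<in> E}"
  proof
    show "{x - a | x. x \<in> E} \<subseteq> direction E" using a by (auto simp: direction_def)
    show "direction E \<subseteq> {x - a | x. x \<in> E}"
    proof
      fix p assume "p \<in> direction E"
      then obtain x y where xy: "p = x - y" "x \<in> E" "y \<in> E" by (auto simp: direction_def)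
      then have "x - a \<in> {x - a | x. x \<in> E}" "y - a \<in> {x - a | x. x \<in> E}" by blast+
      then have "(x - a) - (y - a) \<in> {x - a | x. x \<in> E}" by (rule subspace_diff[OF s])
      then show "p \<in> {x - a | x. x \<in> E}" using xy by simp
    qed
  qed
  then show ?thesis using s by simp
qed

text \<open>Planarity with the base point of the slope eliminated: only differences of surface
  points are constrained, so the condition involves the direction alone and passes to limits of
  difference quotients.\<close>

definition lift_near :: "(4 \<Rightarrow> real^2) \<Rightarrow> (real^2) set set \<Rightarrow> (real^4) set \<Rightarrow> (real^2 \<Rightarrow> real^4) \<Rightarrow> real \<Rightarrow> bool" where
  "lift_near v T D f t \<longleftrightarrow> lifting v T f \<and>
     (\<forall>p\<in>lift_surface v T f. \<forall>q\<in>lift_surface v T f. \<exists>d\<in>D. \<forall>k. \<bar>(p - q - d) $ k\<bar> \<le> t)"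

lemma planar_lift_near:
  assumes "planar_tiling v T E t"
  obtains f where "lift_near v T (direction E) f t"
proof -
  from assms obtain f where f: "lifting v T f"
    "lift_surface v T f \<subseteq> {x + y | x y. x \<in> E \<and> (\<forall>k. 0 \<le> y $ k \<and> y $ k \<le> t)}"
    unfolding planar_tiling_def by blast
  have "\<exists>d\<in>direction E. \<forall>k. \<bar>(p - q - d) $ k\<bar> \<le> t" if p: "p \<in> lift_surface v T f" and q: "q \<in> lift_surface v T f" for p q
  proof -
    obtain x y where 1: "p = x + y" "x \<in> E" "\<forall>k. 0 \<le> y $ k \<and> y $ k \<le> t" using p f(2) by blast
    obtain x' y' where 2: "q = x' + y'" "x' \<in> E" "\<forall>k. 0 \<le> y' $ k \<and> y' $ k \<le> t" using q f(2) by blast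
    have "x - x' \<in> direction E" using 1 2 by (auto simp: direction_def)
    moreover have "\<bar>(p - q - (x - x')) $ k\<bar> \<le> t" for k
      using 1(3)[rule_format, of k] 2(3)[rule_format, of k] by (simp add: 1(1) 2(1) abs_le_iff)
    ultimately show ?thesis by blast
  qed
  then have "lift_near v T (direction E) f t" using f(1) unfolding lift_near_def by blast
  then show ?thesis by (rule that)
qed

text \<open>The displacement along a worm, divided by its length, has a limit point
  \<open>\<gamma>\<close>. Being within \<open>t / N\<close> of the closed subspace \<open>D\<close>
  it lies in \<open>D\<close> in the limit, and since the step counts are the same for every lift,
  one \<open>\<gamma>\<close> serves all \<open>D\<close>, \<open>f\<close> and \<open>t\<close>. It
  avoids coordinate \<open>i\<close> because the worm never crosses a
  \<open>v i\<close>-direction.\<close>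

lemma worm_direction:
  assumes nc: "pairwise_noncolinear v" and T: "octagonal_tiling v T" and e: "tile_edge v T x i"
  shows "\<exists>\<gamma>::real^4. \<gamma> \<noteq> 0 \<and> \<gamma> $ i = 0 \<and> (\<forall>k. sgn (det2 (v i) (v k)) * \<gamma> $ k \<ge> 0) \<and>
    (\<forall>k. \<gamma> $ k \<noteq> 0 \<longrightarrow> (\<exists>z. tile_edge v T z k)) \<and>
    (\<forall>D f t. subspace D \<longrightarrow> lift_near v T D f t \<longrightarrow> \<gamma> \<in> D)"
proof -
  define \<sigma> where "\<sigma> k = sgn (det2 (v i) (v k))" for k
  have \<sigma>: "\<bar>\<sigma> k\<bar> \<le> 1" for k by (auto simp: \<sigma>_def sgn_real_def)
  obtain C Y where C: "\<And>N. C N i = (0::nat)" "\<And>N. sum (C N) UNIV = N" "\<And>N. tile_edge v T (Y N) i"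
      "\<And>N k. C N k > 0 \<Longrightarrow> \<exists>z. tile_edge v T z k"
      "\<And>N f. lifting v T f \<Longrightarrow> f (Y N) = f x + (\<chi> k. \<sigma> k * real (C N k))"
  proof -
    from worm[OF nc T e] have "\<forall>N. \<exists>(c :: 4 \<Rightarrow> nat) y. c i = 0 \<and> sum c UNIV = N \<and> tile_edge v T y i \<and> (\<forall>k. c k > 0 \<longrightarrow> (\<exists>z. tile_edge v T z k)) \<and>
      (\<forall>f. lifting v T f \<longrightarrow> f y = f x + (\<chi> k. sgn (det2 (v i) (v k)) * real (c k)))" ..
    from this[THEN choice] obtain C where "\<forall>N. \<exists>y. C N i = 0 \<and> sum (C N) UNIV = N \<and> tile_edge v T y i \<and> (\<forall>k. C N k > 0 \<longrightarrow> (\<exists>z. tile_edge v T z k)) \<and>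
      (\<forall>f. lifting v T f \<longrightarrow> f y = f x + (\<chi> k. sgn (det2 (v i) (v k)) * real (C N k)))" ..
    from this[THEN choice] obtain Y where "\<forall>N. C N i = 0 \<and> sum (C N) UNIV = N \<and> tile_edge v T (Y N) i \<and> (\<forall>k. C N k > 0 \<longrightarrow> (\<exists>z. tile_edge v T z k)) \<and>
      (\<forall>f. lifting v T f \<longrightarrow> f (Y N) = f x + (\<chi> k. sgn (det2 (v i) (v k)) * real (C N k)))" ..
    then show ?thesis using that[of C Y] unfolding \<sigma>_def by blast
  qed
  \<comment> \<open>Frequencies of the steps. They sum to 1, which keeps the limit from vanishing;
    the signs are put in afterwards.\<close>
  define g :: "nat \<Rightarrow> real^4" where "g N = (\<chi> k. real (C (Suc N) k) / real (Suc N))" for N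
  have g01: "0 \<le> g N $ k" "g N $ k \<le> 1" for N k
  proof -
    have "C (Suc N) k \<le> sum (C (Suc N)) UNIV" by (rule member_le_sum) auto
    then show "0 \<le> g N $ k" "g N $ k \<le> 1" using C(2)[of "Suc N"] by (auto simp: g_def)
  qed
  have "\<forall>N. g N \<in> cbox 0 1" using g01 by (auto simp: mem_box_cart)
  then obtain l r where l: "l \<in> cbox 0 1" and r: "strict_mono (r :: nat \<Rightarrow> nat)" and lim: "(g \<circ> r) \<longlonglongrightarrow> l"
    using compact_cbox[of 0 "1::real^4", unfolded compact_eq_seq_compact_metric seq_compact_def, rule_format, of g] by auto
  have gs: "(\<Sum>k\<in>UNIV. g N $ k) = 1" for N
  proof -
    have "(\<Sum>k\<in>UNIV. g N $ k) = real (sum (C (Suc N)) UNIV) / real (Suc N)"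
      by (simp add: g_def sum_divide_distrib)
    also have "\<dots> = 1" unfolding C(2) by simp
    finally show ?thesis .
  qed
  have limk: "(\<lambda>N. (g \<circ> r) N $ k) \<longlonglongrightarrow> l $ k" for k using lim by (rule tendsto_vec_nth)
  have "(\<lambda>N. \<Sum>k\<in>UNIV. (g \<circ> r) N $ k) \<longlonglongrightarrow> (\<Sum>k\<in>UNIV. l $ k)" by (intro tendsto_sum limk)
  then have ls: "(\<Sum>k\<in>UNIV. l $ k) = 1" by (simp add: o_def gs LIMSEQ_const_iff)
  have li: "l $ i = 0" using limk[of i] by (simp add: o_def g_def C(1) LIMSEQ_const_iff)
  define \<gamma> :: "real^4" where "\<gamma> = (\<chi> k. \<sigma> k * l $ k)"
  have l0: "l $ k \<ge> 0" for k using l by (auto simp: mem_box_cart)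
  show ?thesis
  proof (intro exI[of _ \<gamma>] conjI allI impI)
    show "\<gamma> \<noteq> 0"
    proof
      assume "\<gamma> = 0"
      have "l $ k = 0" for k
      proof (cases "k = i")
        case False
        then have "\<sigma> k \<noteq> 0" using pairwise_noncolinear_det2[OF nc, of i k] by (auto simp: \<sigma>_def sgn_real_def)
        moreover have "\<sigma> k * l $ k = 0" using \<open>\<gamma> = 0\<close> by (simp add: \<gamma>_def vec_eq_iff)
        ultimately show ?thesis by simp
      qed (use li in simp)
      then show False using ls by simp
    qed
    show "\<gamma> $ i = 0" by (simp add: \<gamma>_def li)
    show "sgn (det2 (v i) (v k)) * \<gamma> $ k \<ge> 0" for k using l0[of k] by (simp add: \<gamma>_def \<sigma>_def flip: mult.assoc)
    show "\<exists>z. tile_edge v T z k" if "\<gamma> $ k \<noteq> 0" for k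
    proof (rule ccontr)
      assume "\<not> ?thesis"
      then have "C N k = 0" for N using C(4) by blast
      then have "(\<lambda>N. (g \<circ> r) N $ k) = (\<lambda>_. 0)" by (simp add: g_def o_def)
      then have "l $ k = 0" using limk[of k] LIMSEQ_unique[OF tendsto_const] by metis
      then show False using that by (simp add: \<gamma>_def)
    qed
    fix D f t assume D: "subspace D" and near: "lift_near v T D f t"
    have L: "lifting v T f" using near by (simp add: lift_near_def)
    have "\<exists>d\<in>D. \<forall>k. \<bar>(f (Y N) - f x - d) $ k\<bar> \<le> t" for N
      using near tile_edge_lift_surface[OF L C(3)] tile_edge_lift_surface[OF L e] by (auto simp: lift_near_def)
    then obtain d where d: "\<And>N. d N \<in> D" "\<And>N k. \<bar>(f (Y N) - f x - d N) $ k\<bar> \<le> t" by metis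
    \<comment> \<open>The rescaled vectors of \<open>D\<close> closest to the displacements; they
      approach the same limit as the signed frequencies.\<close>
    define h where "h N = (1 / real (Suc N)) *\<^sub>R d (Suc N)" for N
    have "(\<lambda>N. (h \<circ> r) N $ k) \<longlonglongrightarrow> \<gamma> $ k" for k
    proof -
      have b: "\<bar>h N $ k - \<sigma> k * g N $ k\<bar> \<le> t / real (Suc N)" for N
      proof -
        have "h N $ k - \<sigma> k * g N $ k = - ((f (Y (Suc N)) - f x - d (Suc N)) $ k) / real (Suc N)"
          unfolding C(5)[OF L] by (simp add: h_def g_def diff_divide_distrib)
        then show ?thesis using d(2)[of "Suc N" k] by (simp add: divide_right_mono)
      qed
      have "(\<lambda>N. t / real (Suc N)) \<longlonglongrightarrow> 0" using lim_const_over_n[of t, THEN LIMSEQ_Suc] by simp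
      then have "(\<lambda>N. h N $ k - \<sigma> k * g N $ k) \<longlonglongrightarrow> 0"
        by (rule Lim_null_comparison[rotated]) (use b in auto)
      then have "(\<lambda>N. (h \<circ> r) N $ k - \<sigma> k * (g \<circ> r) N $ k) \<longlonglongrightarrow> 0"
        using LIMSEQ_subseq_LIMSEQ[OF _ r] by (fastforce simp: o_def)
      moreover have "(\<lambda>N. \<sigma> k * (g \<circ> r) N $ k) \<longlonglongrightarrow> \<sigma> k * l $ k" by (intro tendsto_mult tendsto_const limk)
      ultimately have "(\<lambda>N. ((h \<circ> r) N $ k - \<sigma> k * (g \<circ> r) N $ k) + \<sigma> k * (g \<circ> r) N $ k) \<longlonglongrightarrow> 0 + \<sigma> k * l $ k"
        by (rule tendsto_add)
      then show ?thesis by (simp add: \<gamma>_def)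
    qed
    then have "(h \<circ> r) \<longlonglongrightarrow> \<gamma>" by (rule vec_tendstoI)
    moreover have "(h \<circ> r) N \<in> D" for N using d(1) D by (simp add: h_def subspace_scale)
    ultimately show "\<gamma> \<in> D" using closed_subspace[OF D] closed_sequentially by metis
  qed
qed

lemma span_grass_coords:
  assumes "p \<in> span {u, w}"
  obtains s t where "p = s *\<^sub>R u + t *\<^sub>R w"
proof -
  obtain s where "p - s *\<^sub>R u \<in> span {w}" using assms by (auto simp: span_breakdown_eq)
  then obtain t where "p - s *\<^sub>R u = t *\<^sub>R w" by (auto simp: span_breakdown_eq)
  then show ?thesis using that[of s t] by (simp add: algebra_simps)
qed

lemma grass_span_zero:
  assumes "p \<in> span {u, w}" "p $ i = 0" "p $ j = 0" "grass u w i j \<noteq> 0" shows "p = 0"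
proof -
  obtain s t where st: "p = s *\<^sub>R u + t *\<^sub>R w" using span_grass_coords[OF assms(1)] .
  have "s * grass u w i j = (p $ i) * w $ j - (p $ j) * w $ i" "t * grass u w i j = u $ i * (p $ j) - u $ j * (p $ i)"
    by (simp_all add: st grass_def algebra_simps)
  then have "s = 0" "t = 0" using assms by auto
  then show ?thesis by (simp add: st)
qed

text \<open>The plane meets the hyperplane of vanishing \<open>i\<close>-th coordinate in the line
  through \<open>u $ i *\<^sub>R w - w $ i *\<^sub>R u\<close>, whose coordinates are a row of
  Grassmann coordinates.\<close>

lemma grass_span_prop:
  assumes "p \<in> span {u, w}" "p $ i = 0" "p \<noteq> 0" "\<And>k. k \<noteq> i \<Longrightarrow> grass u w i k \<noteq> 0"
  obtains c where "c \<noteq> 0" "\<And>k. p $ k = c * grass u w i k"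
proof -
  obtain s t where st: "p = s *\<^sub>R u + t *\<^sub>R w" using span_grass_coords[OF assms(1)] .
  have z: "s * u $ i + t * w $ i = 0" using assms(2) by (simp add: st)
  have nz: "\<not> (u $ i = 0 \<and> w $ i = 0)"
  proof
    assume "u $ i = 0 \<and> w $ i = 0"
    then have "grass u w i k = 0" for k by (simp add: grass_def)
    moreover have "\<exists>k::4. k \<noteq> i" by (metis zero_neq_one)
    ultimately show False using assms(4) by metis
  qed
  then obtain c where c: "s = - c * w $ i" "t = c * u $ i"
  proof (cases "u $ i = 0")
    case True
    then have "t = 0" using z nz by auto
    then show ?thesis using that[of "- s / w $ i"] True nz by auto
  next
    case False then show ?thesis using that[of "t / u $ i"] z by (simp add: field_simps)
  qed
  have "p $ k = c * grass u w i k" for k by (simp add: st c grass_def algebra_simps)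
  moreover have "c \<noteq> 0"
  proof
    assume "c = 0" then have "p = 0" by (simp add: st c) then show False using assms by simp
  qed
  ultimately show ?thesis using that by blast
qed

text \<open>Two lifts of the same tiling follow the same worms, hence have the same slope.\<close>

lemma lift_near_unique_direction:
  assumes nc: "pairwise_noncolinear v" and T: "octagonal_tiling v T"
    and "lift_near v T (span {u, w}) f t" "lift_near v T (span {u', w'}) f' t'"
    and nd: "\<And>i j. i \<noteq> j \<Longrightarrow> grass u w i j \<noteq> 0" "\<And>i j. i \<noteq> j \<Longrightarrow> grass u' w' i j \<noteq> 0"
  shows "span {u, w} = span {u', w'}"
proof -
  have "T \<noteq> {}" using T by (auto simp: octagonal_tiling_def)
  then obtain x i j where ij: "i < j" "parallelogram v x i j \<in> T" using octagonal_tiling_tile[OF T] by blast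
  then have "tile_edge v T x i" "tile_edge v T x j" unfolding tile_edge_def using parallelogram_swap[of v x i j] by force+
  then obtain \<gamma> \<delta> :: "real^4" where g: "\<gamma> \<noteq> 0" "\<gamma> $ i = 0" "\<gamma> \<in> span {u, w}" "\<gamma> \<in> span {u', w'}"
    and d: "\<delta> \<noteq> 0" "\<delta> $ j = 0" "\<delta> \<in> span {u, w}" "\<delta> \<in> span {u', w'}"
  proof -
    assume a: "tile_edge v T x i" "tile_edge v T x j"
    obtain \<gamma> :: "real^4" where "\<gamma> \<noteq> 0" "\<gamma> $ i = 0" "\<And>D f t. subspace D \<Longrightarrow> lift_near v T D f t \<Longrightarrow> \<gamma> \<in> D"
      using worm_direction[OF nc T a(1)] by (elim exE conjE) (rule that, auto)
    moreover obtain \<delta> :: "real^4" where "\<delta> \<noteq> 0" "\<delta> $ j = 0" "\<And>D f t. subspace D \<Longrightarrow> lift_near v T D f t \<Longrightarrow> \<delta> \<in> D"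
      using worm_direction[OF nc T a(2)] by (elim exE conjE) (rule that, auto)
    ultimately show ?thesis using that[of \<gamma> \<delta>] assms(3,4) subspace_span by blast
  qed
  \<comment> \<open>A nonzero vector of a nondegenerate plane has at most one zero coordinate, so
    \<open>\<gamma> $ j\<close> and \<open>\<delta> $ i\<close> are nonzero. Subtracting multiples
    of them from \<open>u\<close> or \<open>w\<close> clears the coordinates \<open>i\<close> and
    \<open>j\<close>, and nothing else remains.\<close>
  have dims: "span {\<gamma>, \<delta>} = span {u, w}" if "\<gamma> \<in> span {u, w}" "\<delta> \<in> span {u, w}" "\<And>i j. i \<noteq> j \<Longrightarrow> grass u w i j \<noteq> 0" for u w
  proof -
    have gj: "\<gamma> $ j \<noteq> 0" using grass_span_zero[OF that(1) g(2) _ that(3)] g(1) ij by fastforce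
    have di: "\<delta> $ i \<noteq> 0" using grass_span_zero[OF that(2) _ d(2) that(3)] d(1) ij by fastforce
    have "u \<in> span {\<gamma>, \<delta>}" if "p \<in> span {u, w}" "p = u" for p
    proof -
      define q where "q = u - (u $ j / \<gamma> $ j) *\<^sub>R \<gamma> - (u $ i / \<delta> $ i) *\<^sub>R \<delta>"
      have "q \<in> span {u, w}" unfolding q_def using \<open>\<gamma> \<in> span {u, w}\<close> \<open>\<delta> \<in> span {u, w}\<close> by (intro span_diff span_scale) (auto intro: span_base)
      moreover have "q $ i = 0" "q $ j = 0" using g(2) d(2) gj di by (simp_all add: q_def)
      ultimately have "q = 0" using grass_span_zero that(1) \<open>\<And>i j. i \<noteq> j \<Longrightarrow> grass u w i j \<noteq> 0\<close> ij by (metis less_irrefl)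
      then have "u = (u $ j / \<gamma> $ j) *\<^sub>R \<gamma> + (u $ i / \<delta> $ i) *\<^sub>R \<delta>" by (simp add: q_def algebra_simps)
      also have "\<dots> \<in> span {\<gamma>, \<delta>}" by (intro span_add span_scale span_base) auto
      finally show ?thesis .
    qed note U = this
    have w: "w \<in> span {\<gamma>, \<delta>}"
    proof -
      define q where "q = w - (w $ j / \<gamma> $ j) *\<^sub>R \<gamma> - (w $ i / \<delta> $ i) *\<^sub>R \<delta>"
      have "q \<in> span {u, w}" unfolding q_def using \<open>\<gamma> \<in> span {u, w}\<close> \<open>\<delta> \<in> span {u, w}\<close> by (intro span_diff span_scale) (auto intro: span_base)
      moreover have "q $ i = 0" "q $ j = 0" using g(2) d(2) gj di by (simp_all add: q_def)
      ultimately have "q = 0" using grass_span_zero that ij by (metis less_irrefl)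
      then have "w = (w $ j / \<gamma> $ j) *\<^sub>R \<gamma> + (w $ i / \<delta> $ i) *\<^sub>R \<delta>" by (simp add: q_def algebra_simps)
      also have "\<dots> \<in> span {\<gamma>, \<delta>}" by (intro span_add span_scale span_base) auto
      finally show ?thesis .
    qed
    have u: "u \<in> span {\<gamma>, \<delta>}" by (rule U[of u]) (auto intro: span_base)
    show ?thesis using that(1,2) u w by (intro span_eq[THEN iffD2]) auto
  qed
  show ?thesis using dims[OF g(3) d(3) nd(1)] dims[OF g(4) d(4) nd(2)] by simp
qed

text \<open>A worm along \<open>v i\<close> moves in the direction of row \<open>i\<close> of the
  Grassmann coordinates, with the signs of the determinants against \<open>v i\<close>; so the
  products in one row have a common sign. All coordinates of that direction except the
  \<open>i\<close>-th are nonzero, so worms of every type occur, and symmetry of the products links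
  the rows.\<close>

lemma lift_near_orientation:
  assumes nc: "pairwise_noncolinear v" and T: "octagonal_tiling v T"
    and near: "lift_near v T (span {u, w}) f t"
    and nd: "\<And>i j. i \<noteq> j \<Longrightarrow> grass u w i j \<noteq> 0"
  shows "(\<forall>i j. i \<noteq> j \<longrightarrow> grass u w i j * det2 (v i) (v j) > 0) \<or> (\<forall>i j. i \<noteq> j \<longrightarrow> grass u w i j * det2 (v i) (v j) < 0)"
proof -
  define P where "P i j = grass u w i j * det2 (v i) (v j)" for i j
  have Psym: "P i j = P j i" for i j by (simp add: P_def grass_def det2_def algebra_simps)
  have P0: "P i j \<noteq> 0" if "i \<noteq> j" for i j using nd[OF that] pairwise_noncolinear_det2[OF nc that] by (simp add: P_def)
  have row: "(\<exists>c. \<forall>k. k \<noteq> i \<longrightarrow> c * P i k > 0) \<and> (\<forall>k. \<exists>z. tile_edge v T z k)" if e: "tile_edge v T x i" for x i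
  proof -
    obtain \<gamma> :: "real^4" where g: "\<gamma> \<noteq> 0" "\<gamma> $ i = 0" "\<And>k. sgn (det2 (v i) (v k)) * \<gamma> $ k \<ge> 0"
      "\<And>k. \<gamma> $ k \<noteq> 0 \<Longrightarrow> \<exists>z. tile_edge v T z k" "\<gamma> \<in> span {u, w}"
      using worm_direction[OF nc T e] near subspace_span by (elim exE conjE) (rule that, blast+)
    obtain c where c: "c \<noteq> 0" "\<And>k. \<gamma> $ k = c * grass u w i k"
      using grass_span_prop[OF g(5,2,1)] nd by metis
    have "c * P i k > 0" if "k \<noteq> i" for k
    proof -
      have "det2 (v i) (v k) * \<gamma> $ k \<ge> 0" using g(3)[of k] by (auto simp: sgn_real_def zero_le_mult_iff split: if_splits)
      then have "c * P i k \<ge> 0" by (simp add: c P_def algebra_simps)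
      moreover have "c * P i k \<noteq> 0" using c(1) P0 that by auto
      ultimately show ?thesis by linarith
    qed
    moreover have "\<exists>z. tile_edge v T z k" for k
      using g(4)[of k] c nd[of i k] e by (cases "k = i") auto
    ultimately show ?thesis by blast
  qed
  have "T \<noteq> {}" using T by (auto simp: octagonal_tiling_def)
  then obtain x i j where ij: "i < j" "parallelogram v x i j \<in> T" using octagonal_tiling_tile[OF T] by blast
  then have "tile_edge v T x i" unfolding tile_edge_def by force
  then have "\<forall>k. \<exists>z. tile_edge v T z k" using row by blast
  then have "\<forall>i. \<exists>c. \<forall>k. k \<noteq> i \<longrightarrow> c * P i k > 0" using row by blast
  from choice[OF this] obtain c where c: "\<And>i k. k \<noteq> i \<Longrightarrow> c i * P i k > 0" by (elim exE) (rule that, blast)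
  have cc: "c i * c j > 0" if "i \<noteq> j" for i j
    using c[of j i] c[of i j] that Psym[of i j] by (auto simp: zero_less_mult_iff)
  have pos: "(\<forall>i. c i > 0) \<or> (\<forall>i. c i < 0)"
  proof (cases "c 0 > 0")
    case True
    then have "c i > 0" for i using cc[of i 0] by (cases "i = 0") (auto simp: zero_less_mult_iff)
    then show ?thesis by blast
  next
    case False
    have "c 0 \<noteq> 0" using cc[of 0 1] by auto
    with False have "c i < 0" for i using cc[of i 0] by (cases "i = 0") (auto simp: zero_less_mult_iff)
    then show ?thesis by blast
  qed
  then show ?thesis
  proof
    assume "\<forall>i. c i > 0"
    then have "P i j > 0" if "i \<noteq> j" for i j using c[of j i] that by (metis zero_less_mult_pos)
    then show ?thesis by (auto simp: P_def)
  next
    assume "\<forall>i. c i < 0"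
    then have "P i j < 0" if "i \<noteq> j" for i j using c[of j i] that by (metis mult_less_0_iff not_less_iff_gr_or_eq zero_less_mult_iff)
    then show ?thesis by (auto simp: P_def)
  qed
qed

section \<open>The grid of a plane\<close>

definition proj :: "(4 \<Rightarrow> real^2) \<Rightarrow> real^4 \<Rightarrow> real^2" where
  "proj v p = (\<Sum>k\<in>UNIV. p $ k *\<^sub>R v k)"

definition lattice_point :: "real^4 \<Rightarrow> bool" where
  "lattice_point p \<longleftrightarrow> (\<forall>k. p $ k \<in> \<int>)"

text \<open>The determinant of \<open>u\<close>, \<open>w\<close>, \<open>p\<close> in the
  coordinates \<open>i\<close>, \<open>j\<close>, \<open>k\<close>. For a nondegenerate plane
  through \<open>a\<close> and a lattice point \<open>p\<close>, it vanishes at \<open>p - a\<close>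
  exactly when the three grid lines with levels \<open>p $ i\<close>, \<open>p $ j\<close>,
  \<open>p $ k\<close> are concurrent; its size measures the triangle they form.\<close>

definition triple :: "real^4 \<Rightarrow> real^4 \<Rightarrow> 4 \<Rightarrow> 4 \<Rightarrow> 4 \<Rightarrow> real^4 \<Rightarrow> real" where
  "triple u w i j k p = grass u w j k * p$i - grass u w i k * p$j + grass u w i j * p$k"

text \<open>Every coordinate face keeps its orientation when passing from the plane to
  \<open>real^2\<close> by \<open>proj\<close>. All terms of the Cauchy-Binet sum are then positive,
  so their sum cannot cancel.\<close>

definition oriented :: "(4 \<Rightarrow> real^2) \<Rightarrow> real^4 \<Rightarrow> real^4 \<Rightarrow> bool" where
  "oriented v u w \<longleftrightarrow> (\<forall>i j. i \<noteq> j \<longrightarrow> grass u w i j * det2 (v i) (v j) > 0)"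

lemma proj_simps [simp]:
  "proj v (p + q) = proj v p + proj v q" "proj v (p - q) = proj v p - proj v q"
  "proj v (c *\<^sub>R p) = c *\<^sub>R proj v p" "proj v 0 = 0"
  by (simp_all add: proj_def scaleR_add_left scaleR_diff_left sum.distrib sum_subtractf scaleR_sum_right)

lemma proj_std [simp]: "proj v (std_basis i) = v i"
proof -
  have "proj v (std_basis i) = (\<Sum>k\<in>UNIV. if k = i then v i else 0)"
    unfolding proj_def std_basis_def by (rule sum.cong) (auto simp: axis_def)
  then show ?thesis by simp
qed

lemma std_basis_nth: "std_basis i $ k = (if k = i then 1 else 0)"
  by (auto simp: std_basis_def axis_def)

lemma norm_proj_le: "norm (proj v p) \<le> (\<Sum>k\<in>UNIV. norm (v k)) * norm p"
proof -
  have "norm (proj v p) \<le> (\<Sum>k\<in>UNIV. norm (p $ k *\<^sub>R v k))" unfolding proj_def by (rule norm_sum)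
  also have "\<dots> \<le> (\<Sum>k\<in>UNIV. norm (v k) * norm p)"
    by (intro sum_mono) (simp add: mult.commute[of _ "norm (v _)"] mult_left_mono component_le_norm_cart)
  finally show ?thesis by (simp add: sum_distrib_right)
qed

lemma triple_simps [simp]:
  "triple u w i j k (p + q) = triple u w i j k p + triple u w i j k q"
  "triple u w i j k (p - q) = triple u w i j k p - triple u w i j k q"
  "triple u w i j k (c *\<^sub>R p) = c * triple u w i j k p" "triple u w i j k 0 = 0"
  "triple u w i j k (- p) = - triple u w i j k p"
  by (simp_all add: triple_def algebra_simps)

lemma triple_span:
  assumes "p \<in> span {u, w}" shows "triple u w i j k p = 0"
proof -
  obtain s t where "p = s *\<^sub>R u + t *\<^sub>R w" using span_grass_coords[OF assms] .
  then show ?thesis by (simp add: triple_def grass_def algebra_simps)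
qed

lemma triple_local:
  assumes "p $ i = 0" "p $ j = 0" shows "triple u w i j k p = grass u w i j * p $ k"
  using assms by (simp add: triple_def)

lemma grass_commute: "grass u w j i = - grass u w i j"
  by (simp add: grass_def algebra_simps)

lemma grass_same [simp]: "grass u w i i = 0"
  by (simp add: grass_def)

lemma lattice_point_simps [intro]:
  "lattice_point p \<Longrightarrow> lattice_point q \<Longrightarrow> lattice_point (p + q)"
  "lattice_point p \<Longrightarrow> lattice_point q \<Longrightarrow> lattice_point (p - q)"
  "lattice_point (std_basis i)" "lattice_point 0"
  by (auto simp: lattice_point_def std_basis_nth)

lemma orientedD: "oriented v u w \<Longrightarrow> i \<noteq> j \<Longrightarrow> grass u w i j \<noteq> 0"
  unfolding oriented_def by fastforce

text \<open>Bilinear expansion gives terms \<open>p$i * q$j\<close>; exchanging the indices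
  antisymmetrises them. The sum runs over ordered pairs and counts each pair twice, hence the factor
  2.\<close>

lemma cauchy_binet:
  "2 * det2 (proj v p) (proj v q) = (\<Sum>i\<in>UNIV. \<Sum>j\<in>UNIV. grass p q i j * det2 (v i) (v j))"
proof -
  have 1: "det2 (proj v p) (proj v q) = (\<Sum>i\<in>UNIV. \<Sum>j\<in>UNIV. p$i * q$j * det2 (v i) (v j))"
  proof -
    have "det2 (proj v p) (proj v q) = (\<Sum>i\<in>UNIV. p$i * (\<Sum>j\<in>UNIV. q$j * det2 (v i) (v j)))"
      unfolding proj_def[of v p] unfolding proj_def by (simp only: det2_sum(1) det2_simps(5)) (simp only: det2_sum(2) det2_simps(6))
    then show ?thesis by (simp add: sum_distrib_left mult.assoc)
  qed
  have "(\<Sum>i\<in>UNIV. \<Sum>j\<in>UNIV. p$j * q$i * det2 (v i) (v j)) = (\<Sum>j\<in>UNIV. \<Sum>i\<in>UNIV. p$j * q$i * det2 (v i) (v j))"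
    by (rule sum.swap)
  also have "\<dots> = (\<Sum>j\<in>UNIV. \<Sum>i\<in>UNIV. - (p$j * q$i * det2 (v j) (v i)))"
  proof (intro sum.cong refl)
    fix j i show "p$j * q$i * det2 (v i) (v j) = - (p$j * q$i * det2 (v j) (v i))"
      unfolding det2_commute[of "v i" "v j"] by simp
  qed
  also have "\<dots> = - det2 (proj v p) (proj v q)" unfolding 1 by (simp add: sum_negf)
  finally have 2: "(\<Sum>i\<in>UNIV. \<Sum>j\<in>UNIV. p$j * q$i * det2 (v i) (v j)) = - det2 (proj v p) (proj v q)" .
  have "(\<Sum>i\<in>UNIV. \<Sum>j\<in>UNIV. grass p q i j * det2 (v i) (v j)) =
     (\<Sum>i\<in>UNIV. \<Sum>j\<in>UNIV. p$i * q$j * det2 (v i) (v j)) - (\<Sum>i\<in>UNIV. \<Sum>j\<in>UNIV. p$j * q$i * det2 (v i) (v j))"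
    unfolding sum_subtractf[symmetric] by (intro sum.cong refl) (simp add: grass_def left_diff_distrib)
  then show ?thesis using 1 2 by simp
qed

lemma oriented_det_pos:
  assumes "oriented v u w" shows "det2 (proj v u) (proj v w) > 0"
proof -
  have nn: "grass u w i j * det2 (v i) (v j) \<ge> 0" for i j
    using assms by (cases "i = j") (auto simp: oriented_def less_imp_le)
  have "0 < grass u w 0 1 * det2 (v 0) (v 1)" using assms by (simp add: oriented_def)
  also have "\<dots> \<le> (\<Sum>j\<in>UNIV. grass u w 0 j * det2 (v 0) (v j))"
    by (rule member_le_sum) (use nn in auto)
  also have "\<dots> \<le> (\<Sum>i\<in>UNIV. \<Sum>j\<in>UNIV. grass u w i j * det2 (v i) (v j))"
    by (rule member_le_sum[of 0 UNIV "\<lambda>i. \<Sum>j\<in>UNIV. grass u w i j * det2 (v i) (v j)"]) (use nn in \<open>auto intro: sum_nonneg\<close>)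
  finally show ?thesis using cauchy_binet[of v u w] by simp
qed

text \<open>The points \<open>\<tau>\<close> related to \<open>z\<close> are the values at \<open>z\<close> of the coordinatewise ceiling, made
  multivalued at its jumps; as \<open>z\<close> runs over the plane they fill the surface of the dual tiling.\<close>

definition grid_rel :: "real^4 \<Rightarrow> real^4 \<Rightarrow> real^4 \<Rightarrow> real^4 \<Rightarrow> real^4 \<Rightarrow> bool" where
  "grid_rel u w a z \<tau> \<longleftrightarrow> z - a \<in> span {u, w} \<and>
     (\<forall>k. 0 \<le> \<tau>$k - z$k \<and> \<tau>$k - z$k \<le> 1 \<and> (z$k \<notin> \<int> \<longrightarrow> \<tau>$k = of_int \<lceil>z$k\<rceil>))"

text \<open>Geometrically: no three lines of different families meet in a point of the grid on the
  plane through \<open>a\<close>.\<close>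

definition generic :: "real^4 \<Rightarrow> real^4 \<Rightarrow> real^4 \<Rightarrow> bool" where
  "generic u w a \<longleftrightarrow> (\<forall>p i j k. lattice_point p \<longrightarrow> i \<noteq> j \<longrightarrow> i \<noteq> k \<longrightarrow> j \<noteq> k \<longrightarrow> triple u w i j k (p - a) \<noteq> 0)"

lemma generic_no_triple:
  assumes "generic u w a" "z - a \<in> span {u, w}" "i \<noteq> j" "i \<noteq> k" "j \<noteq> k"
  shows "\<not> (z$i \<in> \<int> \<and> z$j \<in> \<int> \<and> z$k \<in> \<int>)"
proof
  assume Z: "z$i \<in> \<int> \<and> z$j \<in> \<int> \<and> z$k \<in> \<int>"
  define p :: "real^4" where "p = (\<chi> l. if l = i \<or> l = j \<or> l = k then z $ l else 0)"
  have "lattice_point p" using Z by (auto simp: lattice_point_def p_def)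
  moreover have "triple u w i j k (p - a) = triple u w i j k (z - a)" by (simp add: triple_def p_def)
  ultimately show False using assms triple_span[OF assms(2)] by (auto simp: generic_def)
qed

lemma grid_rel_mono:
  assumes "grid_rel u w a z \<tau>" "grid_rel u w a z' \<tau>'" "z$k < z'$k"
  shows "\<tau>$k \<le> \<tau>'$k"
proof -
  have 1: "0 \<le> \<tau>$k - z$k" "\<tau>$k - z$k \<le> 1" "z$k \<notin> \<int> \<longrightarrow> \<tau>$k = of_int \<lceil>z$k\<rceil>"
    and 2: "0 \<le> \<tau>'$k - z'$k" "\<tau>'$k - z'$k \<le> 1" "z'$k \<notin> \<int> \<longrightarrow> \<tau>'$k = of_int \<lceil>z'$k\<rceil>"
    using assms by (auto simp: grid_rel_def)
  show ?thesis
  proof (cases "z$k \<in> \<int>")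
    case True
    then obtain m where m: "z$k = of_int m" by (auto elim: Ints_cases)
    show ?thesis
    proof (cases "z'$k \<in> \<int>")
      case True
      then obtain m' where m': "z'$k = of_int m'" by (auto elim: Ints_cases)
      then have "m + 1 \<le> m'" using assms(3) m by simp
      then have "real_of_int m + 1 \<le> real_of_int m'" by linarith
      then show ?thesis using 1 2 m m' by linarith
    next
      case False
      then have "\<tau>'$k = of_int \<lceil>z'$k\<rceil>" using 2 by blast
      moreover have "m + 1 \<le> \<lceil>z'$k\<rceil>" using assms(3) m by linarith
      ultimately show ?thesis using 1 m by linarith
    qed
  next
    case False
    then have t: "\<tau>$k = of_int \<lceil>z$k\<rceil>" using 1 by blast
    show ?thesis
    proof (cases "z'$k \<in> \<int>")
      case True
      then obtain m' where m': "z'$k = of_int m'" by (auto elim: Ints_cases)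
      then have "\<lceil>z$k\<rceil> \<le> m'" using assms(3) by linarith
      then have "real_of_int \<lceil>z$k\<rceil> \<le> real_of_int m'" by linarith
      then show ?thesis using t 2 m' by linarith
    next
      case False
      then have "\<tau>'$k = of_int \<lceil>z'$k\<rceil>" using 2 by blast
      moreover have "\<lceil>z$k\<rceil> \<le> \<lceil>z'$k\<rceil>" using assms(3) by (intro ceiling_mono) simp
      ultimately show ?thesis using t by linarith
    qed
  qed
qed

text \<open>Monotone difference quotients keep every term of the Cauchy-Binet sum nonnegative.\<close>

lemma grid_rel_unique:
  assumes nc: "pairwise_noncolinear v" and ori: "oriented v u w" and gen: "generic u w a"
    and r: "grid_rel u w a z \<tau>" "grid_rel u w a z' \<tau>'" and eq: "proj v \<tau> = proj v \<tau>'"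
  shows "\<tau> = \<tau>'"
proof -
  define \<kappa> where "\<kappa> = \<tau> - \<tau>'"
  define d where "d = z - z'"
  have pk: "proj v \<kappa> = 0" using eq by (simp add: \<kappa>_def)
  have sp: "z - a \<in> span {u, w}" "z' - a \<in> span {u, w}" using r by (auto simp: grid_rel_def)
  then have "(z - a) - (z' - a) \<in> span {u, w}" by (rule span_diff)
  then have ds: "d \<in> span {u, w}" by (simp add: d_def)
  have kd: "\<kappa>$k * d$k \<ge> 0" for k
    using grid_rel_mono[OF r, of k] grid_rel_mono[OF r(2) r(1), of k]
    by (cases "z$k < z'$k"; cases "z'$k < z$k") (auto simp: \<kappa>_def d_def mult_nonpos_nonpos)
  \<comment> \<open>A difference supported on two coordinates cannot project to zero unless it
    vanishes; the cases below aim at such a small support.\<close>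
  have one: "\<kappa> = 0" if "\<And>k. k \<noteq> i \<Longrightarrow> k \<noteq> j \<Longrightarrow> \<kappa>$k = 0" "i \<noteq> j" for i j
  proof -
    have "proj v \<kappa> = (\<Sum>k\<in>{i,j}. \<kappa>$k *\<^sub>R v k)" unfolding proj_def using that(1) by (intro sum.mono_neutral_right) auto
    also have "\<dots> = \<kappa>$i *\<^sub>R v i + \<kappa>$j *\<^sub>R v j" using that by simp
    finally have "\<kappa>$i *\<^sub>R v i + \<kappa>$j *\<^sub>R v j = 0 *\<^sub>R v i + 0 *\<^sub>R v j" using pk by simp
    then have "\<kappa>$i = 0 \<and> \<kappa>$j = 0" using det2_unique[OF pairwise_noncolinear_det2[OF nc that(2)]] by metis
    then show ?thesis using that by (metis vec_eq_iff zero_index)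
  qed
  have G0: "\<And>i j. i \<noteq> j \<Longrightarrow> grass u w i j \<noteq> 0" using orientedD[OF ori] .
  have "\<kappa> = 0"
  proof (cases "d = 0")
    \<comment> \<open>Over a single point \<open>z\<close> the two values differ only at integer
      coordinates, of which genericity leaves at most two.\<close>
    case True
    then have zz: "z = z'" by (simp add: d_def)
    then have k0: "\<kappa>$k = 0" if "z$k \<notin> \<int>" for k using r that by (simp add: grid_rel_def \<kappa>_def)
    have "\<exists>i j. i \<noteq> j \<and> (\<forall>k. k \<noteq> i \<longrightarrow> k \<noteq> j \<longrightarrow> z$k \<notin> \<int>)"
    proof (rule ccontr)
      assume n: "\<nexists>i j. i \<noteq> j \<and> (\<forall>k. k \<noteq> i \<longrightarrow> k \<noteq> j \<longrightarrow> z$k \<notin> \<int>)"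
      have "(0::4) \<noteq> 1" by simp
      then obtain i where i: "z$i \<in> \<int>" using n by blast
      have "\<exists>i'. i' \<noteq> i" by (metis zero_neq_one)
      then obtain j where j: "j \<noteq> i" "z$j \<in> \<int>" using n by blast
      then obtain k where "k \<noteq> i" "k \<noteq> j" "z$k \<in> \<int>" using n by metis
      then show False using generic_no_triple[OF gen sp(1), of i j k] i j by auto
    qed
    then show ?thesis using one k0 by blast
  next
    case False
    show ?thesis
    proof (cases "\<exists>i. d$i = 0")
      \<comment> \<open>Here \<open>d\<close> is proportional to row \<open>i\<close> of the
        Grassmann coordinates, so testing \<open>proj v \<kappa>\<close> against \<open>v i\<close>
        yields a sum of terms of one sign.\<close>
      case True
      then obtain i where i: "d$i = 0" by blast
      obtain c where c: "c \<noteq> 0" "\<And>k. d$k = c * grass u w i k" using grass_span_prop[OF ds i False] G0 by metis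
      have dk: "c * (d$k * det2 (v i) (v k)) > 0" if "k \<noteq> i" for k
      proof -
        have "c * (d$k * det2 (v i) (v k)) = (c * c) * (grass u w i k * det2 (v i) (v k))" by (simp add: c(2) algebra_simps)
        also have "\<dots> > 0" using ori that c(1) unfolding oriented_def by (intro mult_pos_pos[of "c * c"]) (auto simp: zero_less_mult_iff)
        finally show ?thesis .
      qed
      have nn: "c * (\<kappa>$k * det2 (v i) (v k)) \<ge> 0" for k
      proof (cases "k = i")
        case False
        have "(\<kappa>$k * d$k) * (c * (d$k * det2 (v i) (v k))) \<ge> 0" using kd[of k] dk[OF False] less_imp_le by (intro mult_nonneg_nonneg[of "\<kappa>$k * d$k"]) blast+
        then have "(d$k * d$k) * (c * (\<kappa>$k * det2 (v i) (v k))) \<ge> 0" by (simp add: algebra_simps)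
        moreover have "d$k \<noteq> 0" using dk[OF False] by auto
        then have "d$k * d$k > 0" by (metis not_real_square_gt_zero)
        ultimately show ?thesis by (meson zero_le_mult_iff not_less)
      qed simp
      have "(\<Sum>k\<in>UNIV. c * (\<kappa>$k * det2 (v i) (v k))) = c * det2 (v i) (proj v \<kappa>)"
        by (simp add: proj_def det2_sum sum_distrib_left)
      also have "\<dots> = 0" using pk by simp
      finally have "\<forall>k\<in>UNIV. c * (\<kappa>$k * det2 (v i) (v k)) = 0"
        using nn by (subst (asm) sum_nonneg_eq_0_iff) auto
      then have "\<kappa>$k = 0" if "k \<noteq> i" for k using c(1) pairwise_noncolinear_det2[OF nc that[symmetric]]
        by (metis UNIV_I mult_eq_0_iff)
      moreover have "\<exists>j. i \<noteq> j" by (metis zero_neq_one)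
      ultimately show ?thesis using one by blast
    next
      case nz: False
      \<comment> \<open>\<open>\<kappa>\<close> arises from \<open>d\<close> by scaling coordinates
        with nonnegative factors. Scaling \<open>u\<close> and \<open>w\<close> in the same way
        gives vectors with linearly dependent projections; their Cauchy-Binet sum has nonnegative
        terms and vanishes, so at most one factor is nonzero.\<close>
      define \<rho> where "\<rho> k = \<kappa>$k / d$k" for k
      have \<rho>: "\<rho> k \<ge> 0" "\<kappa>$k = \<rho> k * d$k" for k using kd[of k] nz by (auto simp: \<rho>_def zero_le_mult_iff zero_le_divide_iff)
      obtain s t where st: "d = s *\<^sub>R u + t *\<^sub>R w" using span_grass_coords[OF ds] .
      define U where "U = (\<chi> k. \<rho> k * u$k)"
      define W where "W = (\<chi> k. \<rho> k * w$k)"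
      have "\<kappa> = s *\<^sub>R U + t *\<^sub>R W" by (simp add: vec_eq_iff \<rho>(2) U_def W_def st algebra_simps)
      then have z0: "s *\<^sub>R proj v U + t *\<^sub>R proj v W = 0" using pk by simp
      have "s * det2 (proj v U) (proj v W) = det2 (s *\<^sub>R proj v U + t *\<^sub>R proj v W) (proj v W)"
        "t * det2 (proj v U) (proj v W) = det2 (proj v U) (s *\<^sub>R proj v U + t *\<^sub>R proj v W)" by simp_all
      then have "s * det2 (proj v U) (proj v W) = 0" "t * det2 (proj v U) (proj v W) = 0" unfolding z0 by simp_all
      moreover have "s \<noteq> 0 \<or> t \<noteq> 0" using False st by auto
      ultimately have "det2 (proj v U) (proj v W) = 0" by auto
      then have "(\<Sum>i\<in>UNIV. \<Sum>j\<in>UNIV. grass U W i j * det2 (v i) (v j)) = 0" using cauchy_binet[of v U W] by simp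
      moreover have gUW: "grass U W i j * det2 (v i) (v j) = \<rho> i * \<rho> j * (grass u w i j * det2 (v i) (v j))" for i j
        by (simp add: grass_def U_def W_def algebra_simps)
      moreover have nn: "\<rho> i * \<rho> j * (grass u w i j * det2 (v i) (v j)) \<ge> 0" for i j
        using ori \<rho>(1) by (cases "i = j") (auto simp: oriented_def less_imp_le)
      ultimately have "(\<Sum>i\<in>UNIV. \<Sum>j\<in>UNIV. \<rho> i * \<rho> j * (grass u w i j * det2 (v i) (v j))) = 0" by simp
      then have "\<forall>i\<in>UNIV. (\<Sum>j\<in>UNIV. \<rho> i * \<rho> j * (grass u w i j * det2 (v i) (v j))) = 0"
        using nn by (subst (asm) sum_nonneg_eq_0_iff) (auto intro!: sum_nonneg)
      then have z: "\<rho> i * \<rho> j * (grass u w i j * det2 (v i) (v j)) = 0" for i j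
        using sum_nonneg_eq_0_iff[of UNIV "\<lambda>j. \<rho> i * \<rho> j * (grass u w i j * det2 (v i) (v j))"] nn by auto
      have rr: "\<rho> i = 0 \<or> \<rho> j = 0" if "i \<noteq> j" for i j
        using z[of i j] ori that unfolding oriented_def by (metis less_irrefl mult_eq_0_iff)
      show ?thesis
      proof (cases "\<exists>i. \<rho> i \<noteq> 0")
        case True
        then obtain i where "\<rho> i \<noteq> 0" by blast
        then have "\<kappa>$k = 0" if "k \<noteq> i" for k using rr[OF that] \<rho>(2)[of k] by simp
        moreover have "\<exists>j. i \<noteq> j" by (metis zero_neq_one)
        ultimately show ?thesis using one by blast
      next
        case False then show ?thesis by (simp add: vec_eq_iff \<rho>(2))
      qed
    qed
  qed
  then show ?thesis by (simp add: \<kappa>_def)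
qed

section \<open>Every point of the plane is covered: continuous approximations of the ceiling\<close>

text \<open>A continuous stand-in for the ceiling: from each integer \<open>n\<close> it climbs to
  \<open>n + 1\<close> within length \<open>\<delta>\<close> and then stays there up to the next
  integer.\<close>

definition ramp :: "real \<Rightarrow> real \<Rightarrow> real" where
  "ramp \<delta> x = of_int \<lfloor>x\<rfloor> + min 1 (frac x / \<delta>)"

lemma ramp_bounds:
  assumes "0 < \<delta>" "\<delta> \<le> 1" shows "0 \<le> ramp \<delta> x - x" "ramp \<delta> x - x \<le> 1"
proof -
  have "frac x * \<delta> \<le> frac x * 1" using assms by (intro mult_left_mono) auto
  then have "frac x \<le> frac x / \<delta>" using assms by (simp add: pos_le_divide_eq)
  moreover have "frac x \<le> 1" using frac_lt_1[of x] by linarith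
  moreover have "x = of_int \<lfloor>x\<rfloor> + frac x" by (simp add: frac_def)
  ultimately show "0 \<le> ramp \<delta> x - x" "ramp \<delta> x - x \<le> 1"
    unfolding ramp_def min_def by (simp_all split: if_splits) linarith+
qed

lemma ramp_lipschitz:
  assumes d: "0 < \<delta>" "\<delta> \<le> 1" and "x \<le> y"
  shows "0 \<le> ramp \<delta> y - ramp \<delta> x" "ramp \<delta> y - ramp \<delta> x \<le> (y - x) / \<delta>"
proof -
  have xy: "x = of_int \<lfloor>x\<rfloor> + frac x" "y = of_int \<lfloor>y\<rfloor> + frac y" by (simp_all add: frac_def)
  have le: "\<lfloor>x\<rfloor> \<le> \<lfloor>y\<rfloor>" using assms(3) by (rule floor_mono)
  have f: "0 \<le> frac x / \<delta>" "0 \<le> frac y / \<delta>" using d by auto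
  have "0 \<le> ramp \<delta> y - ramp \<delta> x \<and> ramp \<delta> y - ramp \<delta> x \<le> (y - x) / \<delta>"
  proof (cases "\<lfloor>x\<rfloor> = \<lfloor>y\<rfloor>")
    case True
    then have e: "y - x = frac y - frac x" "frac x \<le> frac y" using xy assms(3) by linarith+
    have "frac x / \<delta> \<le> frac y / \<delta>" using e d by (simp add: divide_right_mono)
    then show ?thesis using True by (auto simp: ramp_def e(1) diff_divide_distrib min_def)
  next
    case False
    then have lt: "\<lfloor>x\<rfloor> + 1 \<le> \<lfloor>y\<rfloor>" using le by linarith
    then have lt': "real_of_int \<lfloor>x\<rfloor> + 1 \<le> real_of_int \<lfloor>y\<rfloor>" by linarith
    define N where "N = real_of_int \<lfloor>y\<rfloor> - real_of_int \<lfloor>x\<rfloor> - 1"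
    have N: "0 \<le> N" "N \<le> N / \<delta>" using lt' d by (auto simp: N_def pos_le_divide_eq intro: mult_left_le)
    have "1 - min 1 (frac x / \<delta>) \<le> (1 - frac x) / \<delta>"
    proof (cases "1 \<le> frac x / \<delta>")
      case True then show ?thesis using d frac_lt_1[of x] by simp
    next
      case False
      have "1 \<le> 1 / \<delta>" using d by simp
      then show ?thesis using False by (simp add: diff_divide_distrib min_def)
    qed
    moreover have "(y - x) / \<delta> = N / \<delta> + (1 - frac x) / \<delta> + frac y / \<delta>"
    proof -
      have "y - x = N + (1 - frac x) + frac y" using xy unfolding N_def by linarith
      then show ?thesis by (simp add: add_divide_distrib)
    qed
    moreover have "ramp \<delta> y - ramp \<delta> x = N + (1 - min 1 (frac x / \<delta>)) + min 1 (frac y / \<delta>)" by (simp add: ramp_def N_def)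
    ultimately show ?thesis using N f by (auto simp: min_def split: if_splits)
  qed
  then show "0 \<le> ramp \<delta> y - ramp \<delta> x" "ramp \<delta> y - ramp \<delta> x \<le> (y - x) / \<delta>" by auto
qed

lemma continuous_ramp:
  assumes d: "0 < \<delta>" "\<delta> \<le> 1" shows "continuous_on UNIV (ramp \<delta>)"
proof -
  have "dist (ramp \<delta> x) (ramp \<delta> y) \<le> (1 / \<delta>) * dist x y" for x y
    using ramp_lipschitz[OF d, of x y] ramp_lipschitz[OF d, of y x] d
    by (cases "x \<le> y") (auto simp: dist_real_def)
  then have "(1 / \<delta>)-lipschitz_on UNIV (ramp \<delta>)" using d by (intro lipschitz_onI) auto
  then show ?thesis by (rule lipschitz_on_continuous_on)
qed

text \<open>Cramer's rule recovers the coefficients of \<open>p\<close> from its projection, so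
  \<open>proj v\<close> is injective on the plane with an explicit bound for the inverse.\<close>

lemma span_norm_bound:
  assumes "det2 (proj v u) (proj v w) > 0" "p \<in> span {u, w}"
  shows "norm p \<le> 4 * norm (proj v p) * (norm (proj v u) + norm (proj v w)) * (norm u + norm w) / det2 (proj v u) (proj v w)"
proof -
  let ?D = "det2 (proj v u) (proj v w)"
  obtain s t where st: "p = s *\<^sub>R u + t *\<^sub>R w" using span_grass_coords[OF assms(2)] .
  have "s * ?D = det2 (proj v p) (proj v w)" "t * ?D = det2 (proj v u) (proj v p)" by (simp_all add: st)
  then have "\<bar>s\<bar> * ?D \<le> 2 * norm (proj v p) * norm (proj v w)" "\<bar>t\<bar> * ?D \<le> 2 * norm (proj v u) * norm (proj v p)"
    using abs_det2_le[of "proj v p" "proj v w"] abs_det2_le[of "proj v u" "proj v p"] assms(1)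
    by (metis abs_mult abs_of_pos)+
  then have *: "(\<bar>s\<bar> + \<bar>t\<bar>) * ?D \<le> 2 * norm (proj v p) * (norm (proj v u) + norm (proj v w))"
    by (simp add: algebra_simps)
  have "norm p \<le> \<bar>s\<bar> * norm u + \<bar>t\<bar> * norm w" unfolding st by (metis norm_triangle_ineq norm_scaleR)
  also have "\<dots> \<le> (\<bar>s\<bar> + \<bar>t\<bar>) * (norm u + norm w)" by (simp add: algebra_simps)
  finally have "norm p * ?D \<le> ((\<bar>s\<bar> + \<bar>t\<bar>) * (norm u + norm w)) * ?D" using assms(1) by simp
  also have "\<dots> = ((\<bar>s\<bar> + \<bar>t\<bar>) * ?D) * (norm u + norm w)" by (simp add: algebra_simps)
  also have "\<dots> \<le> (2 * norm (proj v p) * (norm (proj v u) + norm (proj v w))) * (norm u + norm w)"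
    using * by (intro mult_right_mono) auto
  also have "\<dots> \<le> 4 * norm (proj v p) * (norm (proj v u) + norm (proj v w)) * (norm u + norm w)"
    by (intro mult_right_mono) auto
  finally show ?thesis using assms(1) by (simp add: pos_le_divide_eq)
qed

text \<open>The ramp differs from the identity by a vector of the unit cube, so the equation is a
  bounded perturbation of a linear one. Solving the linear part turns it into a fixed point problem
  on a ball, settled by Brouwer; the radius does not depend on \<open>\<delta>\<close>.\<close>

lemma grid_ramp_solution:
  assumes D: "det2 (proj v u) (proj v w) > 0"
  shows "\<exists>R. \<forall>\<delta>. 0 < \<delta> \<and> \<delta> \<le> 1 \<longrightarrow> (\<exists>q::real^2. norm q \<le> R \<and>
     proj v (\<chi> k. ramp \<delta> ((a + q$1 *\<^sub>R u + q$2 *\<^sub>R w) $ k)) = y)"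
proof -
  let ?D = "det2 (proj v u) (proj v w)"
  define Z where "Z q = a + q$1 *\<^sub>R u + q$2 *\<^sub>R w" for q :: "real^2"
  define B where "B = norm (y - proj v a) + (\<Sum>k\<in>UNIV. norm (v k))"
  define R where "R = 2 * B * norm (proj v w) / ?D + 2 * norm (proj v u) * B / ?D"
  have B0: "B \<ge> 0" by (simp add: B_def sum_nonneg)
  then have R0: "R \<ge> 0" using D by (simp add: R_def)
  show ?thesis
  proof (intro exI[of _ "R + 1"] allI impI)
    fix \<delta> :: real assume d: "0 < \<delta> \<and> \<delta> \<le> 1"
    define e where "e q = (\<chi> k. ramp \<delta> (Z q $ k) - Z q $ k)" for q
    define p where "p q = y - proj v a - proj v (e q)" for q
    \<comment> \<open>The coefficients of \<open>p q\<close> in the basis \<open>proj v u\<close>,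
      \<open>proj v w\<close>: a fixed point of \<open>h\<close> is a solution of the
      equation.\<close>
    define h :: "real^2 \<Rightarrow> real^2" where "h q = (det2 (p q) (proj v w) / ?D) *\<^sub>R axis 1 1 + (det2 (proj v u) (p q) / ?D) *\<^sub>R axis 2 1" for q
    have e01: "0 \<le> e q $ k" "e q $ k \<le> 1" for q k using ramp_bounds[of \<delta> "Z q $ k"] d by (auto simp: e_def)
    have "norm (proj v (e q)) \<le> (\<Sum>k\<in>UNIV. norm (v k))" for q
    proof -
      have "norm (proj v (e q)) \<le> (\<Sum>k\<in>UNIV. norm (e q $ k *\<^sub>R v k))" unfolding proj_def by (rule norm_sum)
      also have "\<dots> \<le> (\<Sum>k\<in>UNIV. norm (v k))" using e01 by (intro sum_mono) (simp add: mult_left_le_one_le)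
      finally show ?thesis .
    qed
    then have pB: "norm (p q) \<le> B" for q
      using norm_triangle_ineq4[of "y - proj v a" "proj v (e q)"] unfolding p_def B_def by (smt (verit))
    have hR: "norm (h q) \<le> R" for q
    proof -
      have "norm (h q) \<le> \<bar>det2 (p q) (proj v w) / ?D\<bar> + \<bar>det2 (proj v u) (p q) / ?D\<bar>"
        unfolding h_def by (rule order_trans[OF norm_triangle_ineq]) simp
      also have "\<dots> \<le> (2 * norm (p q) * norm (proj v w)) / ?D + (2 * norm (proj v u) * norm (p q)) / ?D"
        using D abs_det2_le by (intro add_mono) (simp_all add: abs_divide divide_right_mono)
      also have "\<dots> \<le> R" unfolding R_def using D pB B0
        by (intro add_mono divide_right_mono mult_mono) auto
      finally show ?thesis .
    qed
    have cZ: "continuous_on S Z" for S unfolding Z_def by (intro continuous_intros)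
    have "continuous_on S (\<lambda>q. ramp \<delta> (Z q $ k))" for S k
      using continuous_on_compose2[OF continuous_ramp[of \<delta>], of S "\<lambda>q. Z q $ k"] d cZ by (auto intro: continuous_on_component)
    then have ce: "continuous_on S (\<lambda>q. e q $ k)" for S k unfolding e_def by (auto intro!: continuous_intros continuous_on_component cZ)
    have "continuous_on S p" for S unfolding p_def proj_def by (intro continuous_intros ce)
    then have "continuous_on S h" for S unfolding h_def det2_def by (intro continuous_intros) (use D in \<open>auto simp: det2_def\<close>)
    then obtain q where q: "q \<in> cball 0 (R + 1)" "h q = q"
      using brouwer_ball[of "R + 1" 0 h] R0 hR by (auto simp: Pi_iff) (smt (verit) hR)
    have "h q $ 1 = det2 (p q) (proj v w) / ?D" "h q $ 2 = det2 (proj v u) (p q) / ?D"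
      by (simp_all add: h_def axis_def)
    then have "q$1 = det2 (p q) (proj v w) / ?D" "q$2 = det2 (proj v u) (p q) / ?D"
      unfolding q(2) .
    then have "p q = q$1 *\<^sub>R proj v u + q$2 *\<^sub>R proj v w" using det2_coords[of "proj v u" "proj v w" "p q"] D by simp
    then have "proj v (Z q + e q) = y" by (simp add: Z_def p_def algebra_simps)
    moreover have "Z q + e q = (\<chi> k. ramp \<delta> (Z q $ k))" by (simp add: vec_eq_iff e_def)
    ultimately show "\<exists>q::real^2. norm q \<le> R + 1 \<and> proj v (\<chi> k. ramp \<delta> ((a + q$1 *\<^sub>R u + q$2 *\<^sub>R w) $ k)) = y"
      using q(1) unfolding Z_def by (intro exI[of _ q]) simp
  qed
qed

text \<open>As \<open>\<delta>\<close> tends to 0 the graphs of the ramps close up to the graph of the (multivalued) ceiling.\<close>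

lemma grid_rel_exists:
  assumes D: "det2 (proj v u) (proj v w) > 0"
  obtains z \<tau> where "grid_rel u w a z \<tau>" "proj v \<tau> = y"
proof -
  obtain R where R: "\<And>\<delta>. 0 < \<delta> \<Longrightarrow> \<delta> \<le> 1 \<Longrightarrow> (\<exists>q::real^2. norm q \<le> R \<and>
     proj v (\<chi> k. ramp \<delta> ((a + q$1 *\<^sub>R u + q$2 *\<^sub>R w) $ k)) = y)" using grid_ramp_solution[OF D] by metis
  define \<delta> where "\<delta> n = 1 / real (Suc n)" for n
  have d: "0 < \<delta> n" "\<delta> n \<le> 1" for n by (auto simp: \<delta>_def)
  have "\<forall>n. \<exists>q::real^2. norm q \<le> R \<and> proj v (\<chi> k. ramp (\<delta> n) ((a + q$1 *\<^sub>R u + q$2 *\<^sub>R w) $ k)) = y"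
    using R d by blast
  from choice[OF this] obtain Q :: "nat \<Rightarrow> real^2" where Q: "\<And>n. norm (Q n) \<le> R"
    "\<And>n. proj v (\<chi> k. ramp (\<delta> n) ((a + Q n$1 *\<^sub>R u + Q n$2 *\<^sub>R w) $ k)) = y" by blast
  define Z where "Z q = a + q$1 *\<^sub>R u + q$2 *\<^sub>R w" for q :: "real^2"
  define e where "e n = (\<chi> k. ramp (\<delta> n) (Z (Q n) $ k) - Z (Q n) $ k)" for n
  have e01: "e n \<in> cbox 0 1" for n using ramp_bounds[OF d] by (auto simp: e_def mem_box_cart)
  have "compact (cball (0::real^2) R \<times> cbox (0::real^4) 1)" by (intro compact_Times) auto
  moreover have "\<forall>n. (Q n, e n) \<in> cball 0 R \<times> cbox 0 1" using Q(1) e01 by auto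
  ultimately obtain l r where l: "l \<in> cball 0 R \<times> cbox 0 1" "strict_mono (r :: nat \<Rightarrow> nat)" "((\<lambda>n. (Q n, e n)) \<circ> r) \<longlonglongrightarrow> l"
    unfolding compact_eq_seq_compact_metric seq_compact_def by (elim allE[of _ "\<lambda>n. (Q n, e n)"]) auto
  define q where "q = fst l"
  define h where "h = snd l"
  have lq: "(\<lambda>n. Q (r n)) \<longlonglongrightarrow> q" and lh: "(\<lambda>n. e (r n)) \<longlonglongrightarrow> h"
    using tendsto_fst[OF l(3)] tendsto_snd[OF l(3)] by (auto simp: o_def q_def h_def)
  have lZ: "(\<lambda>n. Z (Q (r n))) \<longlonglongrightarrow> Z q" unfolding Z_def by (intro tendsto_intros tendsto_vec_nth lq)
  have h01: "0 \<le> h$k" "h$k \<le> 1" for k using l(1) by (auto simp: h_def mem_box_cart)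
  have ld: "(\<lambda>n. \<delta> (r n)) \<longlonglongrightarrow> 0"
  proof -
    have "\<delta> \<longlonglongrightarrow> 0" unfolding \<delta>_def using lim_1_over_n[THEN LIMSEQ_Suc] by simp
    then show ?thesis using LIMSEQ_subseq_LIMSEQ[OF _ l(2)] by (simp add: o_def)
  qed
  have "proj v (Z (Q n) + e n) = y" for n
  proof -
    have "Z (Q n) + e n = (\<chi> k. ramp (\<delta> n) (Z (Q n) $ k))" by (simp add: vec_eq_iff e_def)
    then show ?thesis using Q(2)[of n] by (simp add: Z_def)
  qed
  moreover have "(\<lambda>n. proj v (Z (Q (r n)) + e (r n))) \<longlonglongrightarrow> proj v (Z q + h)"
    unfolding proj_def by (intro tendsto_intros tendsto_vec_nth lZ lh)
  ultimately have py: "proj v (Z q + h) = y" by (simp only: LIMSEQ_const_iff)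
  have "(Z q + h)$k = of_int \<lceil>Z q$k\<rceil>" if nz: "Z q$k \<notin> \<int>" for k
  proof -
    let ?x = "Z q $ k"
    have fr: "0 < frac ?x" "frac ?x < 1" using nz by (auto simp: frac_gt_0_iff frac_lt_1)
    have lx: "(\<lambda>n. Z (Q (r n)) $ k) \<longlonglongrightarrow> ?x" using lZ by (rule tendsto_vec_nth)
    have x: "?x = of_int \<lfloor>?x\<rfloor> + frac ?x" by (simp add: frac_def)
    have "eventually (\<lambda>n. Z (Q (r n)) $ k > of_int \<lfloor>?x\<rfloor> + frac ?x / 2) sequentially"
      using fr x by (intro order_tendstoD(1)[OF lx]) linarith
    moreover have "eventually (\<lambda>n. Z (Q (r n)) $ k < of_int \<lfloor>?x\<rfloor> + 1) sequentially"
      using fr x by (intro order_tendstoD(2)[OF lx]) linarith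
    moreover have "eventually (\<lambda>n. \<delta> (r n) < frac ?x / 2) sequentially"
      using fr by (intro order_tendstoD(2)[OF ld]) simp
    \<comment> \<open>As soon as the climbing part is shorter than half the fractional part of the
      limit, the ramp has reached its upper value at the nearby points.\<close>
    ultimately have ev: "eventually (\<lambda>n. Z (Q (r n)) $ k + e (r n) $ k = of_int \<lfloor>?x\<rfloor> + 1) sequentially"
    proof eventually_elim
      case (elim n)
      let ?y = "Z (Q (r n)) $ k"
      have fl: "\<lfloor>?y\<rfloor> = \<lfloor>?x\<rfloor>" using elim fr by (intro floor_unique) linarith+
      then have "frac ?y = ?y - of_int \<lfloor>?x\<rfloor>" by (simp add: frac_def)
      then have "frac ?y > \<delta> (r n)" using elim by linarith
      then have "frac ?y / \<delta> (r n) \<ge> 1" using d(1)[of "r n"] by simp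
      then show ?case by (simp add: e_def ramp_def fl)
    qed
    have "(\<lambda>n. Z (Q (r n)) $ k + e (r n) $ k) \<longlonglongrightarrow> ?x + h$k"
      by (intro tendsto_add lx tendsto_vec_nth lh)
    from LIMSEQ_unique[OF this tendsto_eventually[OF ev]] have "?x + h$k = of_int \<lfloor>?x\<rfloor> + 1" .
    moreover have "\<lceil>?x\<rceil> = \<lfloor>?x\<rfloor> + 1" using nz by (simp add: ceiling_altdef) (metis Ints_of_int)
    ultimately show ?thesis by simp
  qed
  moreover have "Z q - a \<in> span {u, w}"
    unfolding Z_def by (simp add: span_add span_scale span_base)
  ultimately have "grid_rel u w a (Z q) (Z q + h)" using h01 by (simp add: grid_rel_def)
  then show ?thesis using that py by blast
qed

text \<open>Slide \<open>z\<close> in the plane along the line of constant \<open>i\<close>-th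
  coordinate until another coordinate first meets an integer. Before that no ceiling changes, and at
  the integer itself the multivalued ceiling still admits \<open>\<tau>\<close>.\<close>

lemma grid_rel_move:
  assumes ori: "oriented v u w" and r: "grid_rel u w a z \<tau>" and ni: "\<And>k. k \<noteq> i \<Longrightarrow> z$k \<notin> \<int>"
  obtains z' j where "grid_rel u w a z' \<tau>" "z'$i = z$i" "j \<noteq> i" "z'$j \<in> \<int>"
proof -
  define d :: "real^4" where "d = u$i *\<^sub>R w - w$i *\<^sub>R u"
  have dk: "d$k = grass u w i k" for k by (simp add: d_def grass_def algebra_simps)
  have d0: "d$k \<noteq> 0" if "k \<noteq> i" for k using orientedD[OF ori that[symmetric]] by (simp add: dk)
  \<comment> \<open>The time at which coordinate \<open>k\<close>, moving along \<open>d\<close>,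
    arrives at the next integer in the direction of its motion.\<close>
  define c where "c k = ((if d$k > 0 then of_int \<lceil>z$k\<rceil> else of_int \<lfloor>z$k\<rfloor>) - z$k) / d$k" for k
  have nf: "of_int \<lfloor>z$k\<rfloor> < z$k" "z$k < of_int \<lceil>z$k\<rceil>" "\<lceil>z$k\<rceil> = \<lfloor>z$k\<rfloor> + 1" if "k \<noteq> i" for k
  proof -
    have "z$k \<noteq> of_int \<lfloor>z$k\<rfloor>" "z$k \<noteq> of_int \<lceil>z$k\<rceil>" using ni[OF that] by (metis Ints_of_int)+
    then show "of_int \<lfloor>z$k\<rfloor> < z$k" "z$k < of_int \<lceil>z$k\<rceil>" "\<lceil>z$k\<rceil> = \<lfloor>z$k\<rfloor> + 1" by linarith+
  qed
  have c0: "c k > 0" if "k \<noteq> i" for k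
    using nf[OF that] d0[OF that] by (auto simp: c_def zero_less_divide_iff)
  define t where "t = Min (c ` (UNIV - {i}))"
  have ne: "UNIV - {i} \<noteq> ({} :: 4 set)" by (metis Diff_eq_empty_iff UNIV_I singletonD subset_eq zero_neq_one)
  have tle: "t \<le> c k" if "k \<noteq> i" for k unfolding t_def using that by (intro Min_le) auto
  have "t \<in> c ` (UNIV - {i})" unfolding t_def using ne by (intro Min_in) auto
  then obtain j where j: "j \<noteq> i" "t = c j" by auto
  have t0: "t > 0" using c0 j by simp
  define z' where "z' = z + t *\<^sub>R d"
  have rng: "of_int \<lfloor>z$k\<rfloor> \<le> z'$k \<and> z'$k \<le> of_int \<lceil>z$k\<rceil>" if k: "k \<noteq> i" for k
  proof (cases "d$k > 0")
    case True
    have "t * d$k \<le> c k * d$k" using tle[OF k] True by simp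
    also have "\<dots> = of_int \<lceil>z$k\<rceil> - z$k" using True by (simp add: c_def)
    finally have "t * d$k \<le> of_int \<lceil>z$k\<rceil> - z$k" .
    moreover have "t * d$k > 0" using t0 True by simp
    ultimately show ?thesis using nf[OF k] by (simp add: z'_def)
  next
    case False
    then have dneg: "d$k < 0" using d0[OF k] by simp
    have "t * d$k \<ge> c k * d$k" using tle[OF k] dneg by simp
    also have "c k * d$k = of_int \<lfloor>z$k\<rfloor> - z$k" using dneg by (simp add: c_def)
    finally have "t * d$k \<ge> of_int \<lfloor>z$k\<rfloor> - z$k" .
    moreover have "t * d$k < 0" using t0 dneg by (simp add: mult_pos_neg)
    ultimately show ?thesis using nf(1,2)[OF k] by (simp add: z'_def)
  qed
  have zi: "z'$i = z$i" by (simp add: z'_def dk)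
  have zj: "z'$j \<in> \<int>"
  proof -
    have "z'$j = (if d$j > 0 then of_int \<lceil>z$j\<rceil> else of_int \<lfloor>z$j\<rfloor>)" using d0[OF j(1)] by (simp add: z'_def j(2) c_def)
    then show ?thesis by simp
  qed
  have "d \<in> span {u, w}" unfolding d_def by (intro span_diff span_scale span_base) auto
  then have "(z - a) + t *\<^sub>R d \<in> span {u, w}" using r by (intro span_add span_scale) (auto simp: grid_rel_def)
  then have "z' - a \<in> span {u, w}" by (simp add: z'_def algebra_simps)
  moreover have "0 \<le> \<tau>$k - z'$k \<and> \<tau>$k - z'$k \<le> 1 \<and> (z'$k \<notin> \<int> \<longrightarrow> \<tau>$k = of_int \<lceil>z'$k\<rceil>)" for k
  proof (cases "k = i")
    case True then show ?thesis using r zi by (auto simp: grid_rel_def)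
  next
    case False
    have tk: "\<tau>$k = of_int \<lceil>z$k\<rceil>" using r ni[OF False] by (simp add: grid_rel_def)
    have "\<lceil>z'$k\<rceil> = \<lceil>z$k\<rceil>" if "z'$k \<notin> \<int>"
    proof (rule ceiling_unique)
      have "z'$k \<noteq> of_int \<lfloor>z$k\<rfloor>" using that by auto
      then show "of_int \<lceil>z$k\<rceil> - 1 < z'$k" using rng[OF False] nf(3)[OF False] by auto
      show "z'$k \<le> of_int \<lceil>z$k\<rceil>" using rng[OF False] by simp
    qed
    then show ?thesis using rng[OF False] nf(3)[OF False] tk by auto
  qed
  ultimately have "grid_rel u w a z' \<tau>" by (simp add: grid_rel_def)
  then show ?thesis using that zi j(1) zj by blast
qed

text \<open>Two slides suffice, the second one along the line reached by the first. So every value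
  \<open>\<tau>\<close> is already taken at a crossing of two grid lines, that is, on a
  face.\<close>

lemma grid_rel_two_ints:
  assumes ori: "oriented v u w" and r: "grid_rel u w a z \<tau>"
  obtains z' i j where "grid_rel u w a z' \<tau>" "i < j" "z'$i \<in> \<int>" "z'$j \<in> \<int>"
proof -
  have "\<exists>z' j. grid_rel u w a z' \<tau> \<and> z'$j \<in> \<int>"
  proof (cases "\<exists>j. z$j \<in> \<int>")
    case True then show ?thesis using r by blast
  next
    case False
    then have "\<And>k. k \<noteq> 0 \<Longrightarrow> z$k \<notin> \<int>" by blast
    from grid_rel_move[OF ori r this] show ?thesis by blast
  qed
  then obtain z1 j where 1: "grid_rel u w a z1 \<tau>" "z1$j \<in> \<int>" by blast
  have "\<exists>z' i. grid_rel u w a z' \<tau> \<and> z'$j \<in> \<int> \<and> i \<noteq> j \<and> z'$i \<in> \<int>"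
  proof (cases "\<exists>i. i \<noteq> j \<and> z1$i \<in> \<int>")
    case True then show ?thesis using 1 by blast
  next
    case False
    then have "\<And>k. k \<noteq> j \<Longrightarrow> z1$k \<notin> \<int>" by blast
    from grid_rel_move[OF ori 1(1) this] show ?thesis using 1(2) by metis
  qed
  then obtain z' i where 2: "grid_rel u w a z' \<tau>" "z'$j \<in> \<int>" "i \<noteq> j" "z'$i \<in> \<int>" by blast
  then show ?thesis using that[of z' i j] that[of z' j i] by (cases "i < j") auto
qed

text \<open>The unit face as a box, so that two faces can be intersected coordinate by
  coordinate.\<close>

definition face_points :: "real^4 \<Rightarrow> 4 \<Rightarrow> 4 \<Rightarrow> (real^4) set" where
  "face_points n i j = {\<tau>. \<forall>k. n$k \<le> \<tau>$k \<and> \<tau>$k \<le> n$k + (if k = i \<or> k = j then 1 else 0)}"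

lemma face_points_eq:
  assumes "i \<noteq> j" shows "face_points n i j = parallelogram std_basis n i j"
proof
  show "parallelogram std_basis n i j \<subseteq> face_points n i j"
    using assms by (auto simp: parallelogram_def face_points_def std_basis_nth)
  show "face_points n i j \<subseteq> parallelogram std_basis n i j"
  proof
    fix \<tau> assume t: "\<tau> \<in> face_points n i j"
    have *: "n$k \<le> \<tau>$k \<and> \<tau>$k \<le> n$k + (if k = i \<or> k = j then 1 else 0)" for k using t by (simp add: face_points_def)
    have "\<tau> = n + (\<tau>$i - n$i) *\<^sub>R std_basis i + (\<tau>$j - n$j) *\<^sub>R std_basis j"
      unfolding vec_eq_iff using * assms by (auto simp: std_basis_nth) (smt (verit))
    moreover have "0 \<le> \<tau>$i - n$i" "\<tau>$i - n$i \<le> 1" "0 \<le> \<tau>$j - n$j" "\<tau>$j - n$j \<le> 1"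
      using *[of i] *[of j] by auto
    ultimately show "\<tau> \<in> parallelogram std_basis n i j" unfolding parallelogram_def by blast
  qed
qed

lemma proj_face_points:
  assumes "i \<noteq> j" shows "proj v ` face_points n i j = parallelogram v (proj v n) i j"
  unfolding face_points_eq[OF assms]
proof (intro set_eqI iffI)
  fix y assume "y \<in> proj v ` parallelogram std_basis n i j"
  then obtain a b where ab: "y = proj v (n + a *\<^sub>R std_basis i + b *\<^sub>R std_basis j)" "0 \<le> a \<and> a \<le> 1 \<and> 0 \<le> b \<and> b \<le> 1"
    by (auto simp: parallelogram_def simp del: proj_simps)
  then have "y = proj v n + a *\<^sub>R v i + b *\<^sub>R v j" by simp
  then show "y \<in> parallelogram v (proj v n) i j" using ab(2) unfolding parallelogram_def by blast
next
  fix y assume "y \<in> parallelogram v (proj v n) i j"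
  then obtain a b where ab: "y = proj v n + a *\<^sub>R v i + b *\<^sub>R v j" "0 \<le> a \<and> a \<le> 1 \<and> 0 \<le> b \<and> b \<le> 1"
    by (auto simp: parallelogram_def)
  then have "y = proj v (n + a *\<^sub>R std_basis i + b *\<^sub>R std_basis j)" by simp
  moreover have "n + a *\<^sub>R std_basis i + b *\<^sub>R std_basis j \<in> parallelogram std_basis n i j"
    unfolding parallelogram_def using ab(2) by blast
  ultimately show "y \<in> proj v ` parallelogram std_basis n i j" by blast
qed

section \<open>Dual tilings\<close>

text \<open>Signs of the generic grid tiles: the line crossing \<open>(i, j)\<close> lies strictly between the
  lines \<open>n$k - 1\<close> and \<open>n$k\<close> of every other family.\<close>

definition grid_tile :: "(4 \<Rightarrow> real^2) \<Rightarrow> (4 \<Rightarrow> 4 \<Rightarrow> 4 \<Rightarrow> real^4 \<Rightarrow> real) \<Rightarrow> real^4 \<Rightarrow> 4 \<Rightarrow> 4 \<Rightarrow> bool" where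
  "grid_tile v g n i j \<longleftrightarrow> lattice_point n \<and> i < j \<and>
     (\<forall>k. k \<noteq> i \<longrightarrow> k \<noteq> j \<longrightarrow> g i j k n * det2 (v i) (v j) > 0 \<and> g i j k (n - std_basis k) * det2 (v i) (v j) < 0)"

lemma span_two_coords:
  assumes "grass u w i j \<noteq> 0"
  obtains z where "z - a \<in> span {u, w}" "z$i = x" "z$j = y"
proof -
  define s where "s = ((x - a$i) * w$j - (y - a$j) * w$i) / grass u w i j"
  define t where "t = (u$i * (y - a$j) - u$j * (x - a$i)) / grass u w i j"
  have "s *\<^sub>R u + t *\<^sub>R w \<in> span {u, w}" by (intro span_add span_scale span_base) auto
  moreover have "s * u$i + t * w$i = x - a$i" "s * u$j + t * w$j = y - a$j"
  proof -
    have "(s * u$i + t * w$i) * grass u w i j = (x - a$i) * grass u w i j"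
      "(s * u$j + t * w$j) * grass u w i j = (y - a$j) * grass u w i j"
      using assms by (simp_all add: s_def t_def distrib_right) (simp_all add: grass_def algebra_simps)
    then show "s * u$i + t * w$i = x - a$i" "s * u$j + t * w$j = y - a$j" using assms by simp_all
  qed
  ultimately show ?thesis by (intro that[of "a + (s *\<^sub>R u + t *\<^sub>R w)"]) auto
qed

text \<open>With \<open>z\<close> the crossing of the lines of levels \<open>n$i\<close> and
  \<open>n$j\<close>, the triple measures on which side of the line of level \<open>n$k\<close> this
  crossing lies, and how far off.\<close>

lemma triple_crossing:
  assumes "z - a \<in> span {u, w}" "z$i = n$i" "z$j = n$j"
  shows "triple u w i j k (n - a) = grass u w i j * (n$k - z$k)"
proof -
  have "triple u w i j k (n - a) = triple u w i j k (n - z) + triple u w i j k (z - a)" by simp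
  also have "\<dots> = grass u w i j * (n$k - z$k)" using assms by (simp add: triple_span triple_local del: triple_simps(2))
  finally show ?thesis .
qed

lemma triple_std: "k \<noteq> i \<Longrightarrow> k \<noteq> j \<Longrightarrow> triple u w i j k (std_basis k) = grass u w i j"
  by (simp add: triple_def std_basis_nth)

lemma grid_tile_rel:
  assumes ori: "oriented v u w" and t: "grid_tile v (\<lambda>i j k p. triple u w i j k (p - a)) n i j"
    and f: "\<tau> \<in> face_points n i j"
  obtains z where "grid_rel u w a z \<tau>"
proof -
  have ij: "i \<noteq> j" using t by (auto simp: grid_tile_def)
  obtain z where z: "z - a \<in> span {u, w}" "z$i = n$i" "z$j = n$j" using span_two_coords[OF orientedD[OF ori ij]] .
  have n: "n$k \<in> \<int>" for k using t by (simp add: grid_tile_def lattice_point_def)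
  have k: "0 < n$k - z$k" "n$k - z$k < 1" if "k \<noteq> i" "k \<noteq> j" for k
  proof -
    have g: "grass u w i j * det2 (v i) (v j) > 0" using ori ij by (simp add: oriented_def)
    have "triple u w i j k (n - a) * det2 (v i) (v j) > 0" "triple u w i j k (n - std_basis k - a) * det2 (v i) (v j) < 0"
      using t that by (auto simp: grid_tile_def)
    moreover have "triple u w i j k (n - std_basis k - a) = triple u w i j k (n - a) - grass u w i j"
      using triple_std[OF that] by simp
    moreover have 1: "triple u w i j k (n - a) = grass u w i j * (n$k - z$k)" using triple_crossing[OF z] .
    ultimately have "grass u w i j * (n$k - z$k) * det2 (v i) (v j) > 0"
        "(grass u w i j * (n$k - z$k) - grass u w i j) * det2 (v i) (v j) < 0" by metis+
    then have "(grass u w i j * det2 (v i) (v j)) * (n$k - z$k) > 0"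
        "(grass u w i j * det2 (v i) (v j)) * (n$k - z$k - 1) < 0"
      by (simp_all add: algebra_simps)
    then show "0 < n$k - z$k" "n$k - z$k < 1" using g by (auto simp: zero_less_mult_iff mult_less_0_iff)
  qed
  have "0 \<le> \<tau>$k - z$k \<and> \<tau>$k - z$k \<le> 1 \<and> (z$k \<notin> \<int> \<longrightarrow> \<tau>$k = of_int \<lceil>z$k\<rceil>)" for k
  proof (cases "k = i \<or> k = j")
    case True
    then show ?thesis using f z n[of k] by (auto simp: face_points_def dest!: spec[of _ k])
  next
    case False
    then have tk: "\<tau>$k = n$k" using f by (auto simp: face_points_def dest!: spec[of _ k])
    obtain m where m: "n$k = of_int m" using n[of k] by (auto elim: Ints_cases)
    have "\<lceil>z$k\<rceil> = m" using k[of k] False m by (intro ceiling_unique) auto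
    then show ?thesis using k[of k] False tk m by auto
  qed
  then have "grid_rel u w a z \<tau>" using z by (simp add: grid_rel_def)
  then show ?thesis by (rule that)
qed

text \<open>At a crossing genericity keeps the other two coordinates off the integers. Their
  ceilings exceed them by less than 1, which is what the two strict signs of
  \<open>grid_tile\<close> express.\<close>

lemma grid_rel_tile:
  assumes ori: "oriented v u w" and gen: "generic u w a" and r: "grid_rel u w a z \<tau>"
  obtains n i j where "grid_tile v (\<lambda>i j k p. triple u w i j k (p - a)) n i j" "\<tau> \<in> face_points n i j"
proof -
  obtain z' i j where z: "grid_rel u w a z' \<tau>" "i < j" "z'$i \<in> \<int>" "z'$j \<in> \<int>" using grid_rel_two_ints[OF ori r] .
  have sp: "z' - a \<in> span {u, w}" using z by (simp add: grid_rel_def)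
  have ij: "i \<noteq> j" using z by auto
  have nz: "z'$k \<notin> \<int>" if "k \<noteq> i" "k \<noteq> j" for k using generic_no_triple[OF gen sp ij] that z by metis
  define n :: "real^4" where "n = (\<chi> k. of_int \<lceil>z'$k\<rceil>)"
  have n: "n$i = z'$i" "n$j = z'$j" using z by (simp_all add: n_def)
  have "lattice_point n" by (simp add: lattice_point_def n_def)
  moreover have "triple u w i j k (n - a) * det2 (v i) (v j) > 0 \<and> triple u w i j k (n - std_basis k - a) * det2 (v i) (v j) < 0"
    if k: "k \<noteq> i" "k \<noteq> j" for k
  proof -
    have g: "grass u w i j * det2 (v i) (v j) > 0" using ori ij by (simp add: oriented_def)
    have "z'$k \<noteq> of_int \<lceil>z'$k\<rceil>" using nz[OF k] by (metis Ints_of_int)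
    then have nk: "n$k - z'$k > 0" "n$k - z'$k - 1 < 0" unfolding n_def by (simp_all, linarith+)
    have 1: "triple u w i j k (n - a) = grass u w i j * (n$k - z'$k)" using triple_crossing[OF sp] n by simp
    have "triple u w i j k (n - std_basis k - a) = triple u w i j k (n - a) - grass u w i j"
      using triple_std[OF k] by simp
    then have 2: "triple u w i j k (n - std_basis k - a) = grass u w i j * (n$k - z'$k - 1)" unfolding 1 by (simp add: algebra_simps)
    have "(grass u w i j * det2 (v i) (v j)) * (n$k - z'$k) > 0" using g nk by simp
    moreover have "(grass u w i j * det2 (v i) (v j)) * (n$k - z'$k - 1) < 0" using g nk by (simp add: mult_pos_neg)
    ultimately show ?thesis unfolding 1 2 by (simp add: algebra_simps)
  qed
  ultimately have "grid_tile v (\<lambda>i j k p. triple u w i j k (p - a)) n i j" using z by (simp add: grid_tile_def)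
  moreover have "\<tau> \<in> face_points n i j"
    unfolding face_points_def
  proof (intro CollectI allI)
    fix k
    have t: "0 \<le> \<tau>$k - z'$k \<and> \<tau>$k - z'$k \<le> 1 \<and> (z'$k \<notin> \<int> \<longrightarrow> \<tau>$k = of_int \<lceil>z'$k\<rceil>)" using z(1) by (simp add: grid_rel_def)
    show "n$k \<le> \<tau>$k \<and> \<tau>$k \<le> n$k + (if k = i \<or> k = j then 1 else 0)"
    proof (cases "k = i \<or> k = j")
      case True then show ?thesis using t n by auto
    next
      case False then show ?thesis using t nz[of k] by (simp add: n_def)
    qed
  qed
  ultimately show ?thesis by (rule that)
qed

text \<open>Injectivity of \<open>proj v\<close> on the union of the faces. Both the edge-to-edge
  property and the existence of a lift follow from it, and it concerns only two faces at a
  time.\<close>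

definition compatible :: "(4 \<Rightarrow> real^2) \<Rightarrow> (real^4 \<Rightarrow> 4 \<Rightarrow> 4 \<Rightarrow> bool) \<Rightarrow> bool" where
  "compatible v S \<longleftrightarrow> (\<forall>n i j. S n i j \<longrightarrow> lattice_point n \<and> i < j) \<and>
     (\<forall>n i j n' i' j' \<tau> \<tau>'. S n i j \<longrightarrow> S n' i' j' \<longrightarrow> \<tau> \<in> face_points n i j \<longrightarrow> \<tau>' \<in> face_points n' i' j' \<longrightarrow>
        proj v \<tau> = proj v \<tau>' \<longrightarrow> \<tau> = \<tau>')"

definition dual_tiles :: "(4 \<Rightarrow> real^2) \<Rightarrow> (real^4 \<Rightarrow> 4 \<Rightarrow> 4 \<Rightarrow> bool) \<Rightarrow> (real^2) set set" where
  "dual_tiles v S = {parallelogram v (proj v n) i j | n i j. S n i j}"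

lemma pgram_corners:
  assumes d: "det2 p q \<noteq> 0" and "c = 0 \<or> c = 1" "e = 0 \<or> e = 1"
  shows "(x + c *\<^sub>R p + e *\<^sub>R q) extreme_point_of pgram x p q"
proof -
  have d': "det2 (-p) q \<noteq> 0" "det2 p (-q) \<noteq> 0" "det2 (-p) (-q) \<noteq> 0" using d by auto
  consider "c = 0" "e = 0" | "c = 0" "e = 1" | "c = 1" "e = 0" | "c = 1" "e = 1" using assms by blast
  then show ?thesis
  proof cases
    case 1 then show ?thesis using pgram_corner[OF d, of x] by simp
  next
    case 2 then show ?thesis using pgram_corner[OF d'(2), of "x + q"] pgram_flip2[of x p q] by simp
  next
    case 3 then show ?thesis using pgram_corner[OF d'(1), of "x + p"] pgram_flip[of x p q] by simp
  next
    case 4 then show ?thesis using pgram_corner[OF d'(3), of "x + p + q"] pgram_flip[of x p q] pgram_flip2[of "x + p" "-p" q] by simp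
  qed
qed

lemma pgram_edges:
  assumes d: "det2 p q \<noteq> 0" and "e = 0 \<or> e = 1"
  shows "closed_segment (x + e *\<^sub>R q) (x + e *\<^sub>R q + p) edge_of pgram x p q"
proof -
  have d': "det2 p (-q) \<noteq> 0" using d by auto
  show ?thesis using assms(2)
  proof
    assume "e = 0" then show ?thesis using pgram_edge[OF d, of x] by simp
  next
    assume "e = 1" then show ?thesis using pgram_edge[OF d', of "x + q"] pgram_flip2[of x p q] by simp
  qed
qed

lemma Ints_between: "n \<in> \<int> \<Longrightarrow> m \<in> \<int> \<Longrightarrow> n \<le> m \<Longrightarrow> m \<le> n + 1 \<Longrightarrow> m = n \<or> m = n + (1::real)"
  by (auto elim!: Ints_cases)

lemma face_corner:
  assumes nc: "pairwise_noncolinear v" and ij: "i \<noteq> j" "lattice_point n" and m: "m \<in> face_points n i j" "lattice_point m"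
  shows "proj v m extreme_point_of parallelogram v (proj v n) i j"
proof -
  obtain a b where ab: "m = n + a *\<^sub>R std_basis i + b *\<^sub>R std_basis j" "0 \<le> a" "a \<le> 1" "0 \<le> b" "b \<le> 1"
    using m(1) unfolding face_points_eq[OF ij(1)] parallelogram_def by blast
  have "m$i = n$i + a" "m$j = n$j + b" using ij by (auto simp: ab std_basis_nth)
  moreover have "m$k = n$k \<or> m$k = n$k + 1" if "k = i \<or> k = j" for k
  proof (rule Ints_between)
    show "n$k \<in> \<int>" "m$k \<in> \<int>" using ij m by (simp_all add: lattice_point_def)
    have "n$k \<le> m$k \<and> m$k \<le> n$k + (if k = i \<or> k = j then 1 else 0)" using m(1) unfolding face_points_def by blast
    then show "n$k \<le> m$k" "m$k \<le> n$k + 1" using that by auto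
  qed
  from this[of i] this[of j] have "m$i = n$i \<or> m$i = n$i + 1" "m$j = n$j \<or> m$j = n$j + 1" by auto
  ultimately have "a = 0 \<or> a = 1" "b = 0 \<or> b = 1" by auto
  then show ?thesis using pgram_corners[OF pairwise_noncolinear_det2[OF nc ij(1)], of a b "proj v n"]
    by (simp add: ab(1) parallelogram_eq_pgram)
qed

lemma face_edge:
  assumes nc: "pairwise_noncolinear v" and ij: "i \<noteq> j" "lattice_point n" and m: "m \<in> face_points n i j" "lattice_point m" "m$i = n$i"
  shows "closed_segment (proj v m) (proj v m + v i) edge_of parallelogram v (proj v n) i j"
proof -
  obtain a b where ab: "m = n + a *\<^sub>R std_basis i + b *\<^sub>R std_basis j" "0 \<le> a" "a \<le> 1" "0 \<le> b" "b \<le> 1"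
    using m(1) unfolding face_points_eq[OF ij(1)] parallelogram_def by blast
  have "m$i = n$i + a" "m$j = n$j + b" using ij by (auto simp: ab std_basis_nth)
  moreover have "m$j = n$j \<or> m$j = n$j + 1"
  proof (rule Ints_between)
    show "n$j \<in> \<int>" "m$j \<in> \<int>" using ij m by (simp_all add: lattice_point_def)
    have "n$j \<le> m$j \<and> m$j \<le> n$j + (if j = i \<or> j = j then 1 else 0)" using m(1) unfolding face_points_def by blast
    then show "n$j \<le> m$j" "m$j \<le> n$j + 1" by auto
  qed
  ultimately have "a = 0" "b = 0 \<or> b = 1" using m by auto
  then show ?thesis using pgram_edges[OF pairwise_noncolinear_det2[OF nc ij(1)], of b "proj v n"]
    by (simp add: ab(1) parallelogram_eq_pgram)
qed

lemma face_points_swap: "face_points n i j = face_points n j i"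
  by (auto simp: face_points_def)

text \<open>By injectivity the tiles meet in the projection of the intersection of two boxes, which
  is again a box. It has 0, 1 or 2 free coordinates: a common corner, a common side, or two
  identical faces.\<close>

lemma compatible_meet:
  assumes nc: "pairwise_noncolinear v" and C: "compatible v S" and S: "S n i j" "S n' i' j'"
    and ne: "\<not> (n = n' \<and> i = i' \<and> j = j')"
  defines "s \<equiv> parallelogram v (proj v n) i j" and "t \<equiv> parallelogram v (proj v n') i' j'"
  shows "s \<inter> t = {} \<or> (\<exists>p. p extreme_point_of s \<and> p extreme_point_of t \<and> s \<inter> t = {p}) \<or>
        (\<exists>e. e edge_of s \<and> e edge_of t \<and> s \<inter> t = e)"
proof (cases "s \<inter> t = {}")
  case False
  let ?F = "face_points n i j" and ?F' = "face_points n' i' j'"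
  have L: "lattice_point n" "i < j" "lattice_point n'" "i' < j'" using C S by (auto simp: compatible_def)
  have ij: "i \<noteq> j" "i' \<noteq> j'" using L by auto
  have uniq: "\<tau> = \<tau>'" if "\<tau> \<in> ?F" "\<tau>' \<in> ?F'" "proj v \<tau> = proj v \<tau>'" for \<tau> \<tau>'
    using C S that unfolding compatible_def by blast
  have st: "s = proj v ` ?F" "t = proj v ` ?F'" by (simp_all add: s_def t_def proj_face_points ij)
  have int: "s \<inter> t = proj v ` (?F \<inter> ?F')"
    unfolding st using uniq by blast
  obtain \<tau> where \<tau>: "\<tau> \<in> ?F" "\<tau> \<in> ?F'" using False unfolding int by blast
  \<comment> \<open>The coordinates in which both boxes have the same unit interval. In every other
    coordinate they share a single value, that of \<open>m\<close>.\<close>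
  define J where "J = {k. (k = i \<or> k = j) \<and> (k = i' \<or> k = j') \<and> n$k = n'$k}"
  define m :: "real^4" where "m = (\<chi> k. max (n$k) (n'$k))"
  have nZ: "n$k \<in> \<int>" "n'$k \<in> \<int>" for k using L by (auto simp: lattice_point_def)
  have mZ: "lattice_point m" using nZ by (auto simp: lattice_point_def m_def max_def)
  have lt: "n$k + 1 \<le> n'$k" if "n$k < n'$k" for k using nZ[of k] that by (auto elim!: Ints_cases)
  have lt': "n'$k + 1 \<le> n$k" if "n'$k < n$k" for k using nZ[of k] that by (auto elim!: Ints_cases)
  have fm: "\<sigma>$k = m$k" if "\<sigma> \<in> ?F" "\<sigma> \<in> ?F'" "k \<notin> J" for \<sigma> k
  proof -
    have 1: "n$k \<le> \<sigma>$k" "\<sigma>$k \<le> n$k + (if k = i \<or> k = j then 1 else 0)"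
       "n'$k \<le> \<sigma>$k" "\<sigma>$k \<le> n'$k + (if k = i' \<or> k = j' then 1 else 0)" using that by (auto simp: face_points_def)
    consider "n$k < n'$k" | "n'$k < n$k" | "n$k = n'$k" by linarith
    then show ?thesis
    proof cases
      case 1 then show ?thesis using lt[of k] \<open>n'$k \<le> \<sigma>$k\<close> \<open>\<sigma>$k \<le> n$k + _\<close> by (auto simp: m_def split: if_splits)
    next
      case 2 then show ?thesis using lt'[of k] \<open>n$k \<le> \<sigma>$k\<close> \<open>\<sigma>$k \<le> n'$k + _\<close> by (auto simp: m_def split: if_splits)
    next
      case 3
      then have "\<not> ((k = i \<or> k = j) \<and> (k = i' \<or> k = j'))" using that(3) by (auto simp: J_def)
      then show ?thesis using 3 1 by (auto simp: m_def split: if_splits)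
    qed
  qed
  have mJ: "m$k = n$k \<and> m$k = n'$k" if "k \<in> J" for k using that by (auto simp: J_def m_def)
  have inF: "\<sigma> \<in> ?F \<inter> ?F'" if "\<And>k. k \<notin> J \<Longrightarrow> \<sigma>$k = m$k" "\<And>k. k \<in> J \<Longrightarrow> m$k \<le> \<sigma>$k \<and> \<sigma>$k \<le> m$k + 1" for \<sigma>
  proof -
    have "n$k \<le> \<sigma>$k \<and> \<sigma>$k \<le> n$k + (if k = i \<or> k = j then 1 else 0) \<and>
       n'$k \<le> \<sigma>$k \<and> \<sigma>$k \<le> n'$k + (if k = i' \<or> k = j' then 1 else 0)" for k
    proof (cases "k \<in> J")
      case True
      then have "k = i \<or> k = j" "k = i' \<or> k = j'" by (auto simp: J_def)
      then show ?thesis using that(2)[OF True] mJ[OF True] by auto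
    next
      case False
      then have "\<sigma>$k = \<tau>$k" using that(1) fm[OF \<tau>] by simp
      then show ?thesis using \<tau> by (auto simp: face_points_def)
    qed
    then show ?thesis by (auto simp: face_points_def)
  qed
  have mF: "m \<in> ?F" "m \<in> ?F'" using inF[of m] by auto
  show ?thesis
  proof (cases "J = {}")
    case True
    have "\<sigma> = m" if "\<sigma> \<in> ?F" "\<sigma> \<in> ?F'" for \<sigma> using fm[OF that] True by (simp add: vec_eq_iff)
    then have "?F \<inter> ?F' = {m}" using mF by blast
    then have "s \<inter> t = {proj v m}" by (simp add: int)
    moreover have "proj v m extreme_point_of s" "proj v m extreme_point_of t"
      unfolding s_def t_def using face_corner[OF nc] ij L mF mZ by auto
    ultimately show ?thesis by blast
  next
    case False
    then obtain d where d: "d \<in> J" by blast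
    show ?thesis
    proof (cases "J = {d}")
      case True
      have eq: "?F \<inter> ?F' = {m + c *\<^sub>R std_basis d | c. 0 \<le> c \<and> c \<le> 1}"
      proof (intro set_eqI iffI)
        fix \<sigma> assume s: "\<sigma> \<in> ?F \<inter> ?F'"
        have "\<sigma> = m + (\<sigma>$d - m$d) *\<^sub>R std_basis d" using s fm True by (auto simp: vec_eq_iff std_basis_nth)
        moreover have "0 \<le> \<sigma>$d - m$d" "\<sigma>$d - m$d \<le> 1"
          using s mJ[OF d] d by (auto simp: face_points_def J_def dest!: spec[of _ d])
        ultimately show "\<sigma> \<in> {m + c *\<^sub>R std_basis d | c. 0 \<le> c \<and> c \<le> 1}" by blast
      next
        fix \<sigma> assume "\<sigma> \<in> {m + c *\<^sub>R std_basis d | c. 0 \<le> c \<and> c \<le> 1}"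
        then obtain c where c: "\<sigma> = m + c *\<^sub>R std_basis d" "0 \<le> c" "c \<le> 1" by blast
        show "\<sigma> \<in> ?F \<inter> ?F'" using True c by (intro inF) (auto simp: std_basis_nth)
      qed
      have "s \<inter> t = closed_segment (proj v m) (proj v m + v d)"
        unfolding int eq by (force simp: mem_base_edge image_iff)
      moreover have "closed_segment (proj v m) (proj v m + v d) edge_of s"
      proof (cases "d = i")
        case True then show ?thesis unfolding s_def using face_edge[OF nc ij(1) L(1) mF(1) mZ] mJ[OF d] by simp
      next
        case False
        then have "d = j" using d by (auto simp: J_def)
        then show ?thesis unfolding s_def parallelogram_swap[of v "proj v n" i j]
          using face_edge[OF nc ij(1)[symmetric] L(1) _ mZ] mF(1) mJ[OF d] by (simp add: face_points_swap[of n j i])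
      qed
      moreover have "closed_segment (proj v m) (proj v m + v d) edge_of t"
      proof (cases "d = i'")
        case True then show ?thesis unfolding t_def using face_edge[OF nc ij(2) L(3) mF(2) mZ] mJ[OF d] by simp
      next
        case False
        then have "d = j'" using d by (auto simp: J_def)
        then show ?thesis unfolding t_def parallelogram_swap[of v "proj v n'" i' j']
          using face_edge[OF nc ij(2)[symmetric] L(3) _ mZ] mF(2) mJ[OF d] by (simp add: face_points_swap[of n' j' i'])
      qed
      ultimately show ?thesis by blast
    next
      case False
      then obtain d' where d': "d' \<in> J" "d' \<noteq> d" using d by blast
      then have dd: "{d, d'} = {i, j}" "{d, d'} = {i', j'}" using d by (auto simp: J_def)
      then have e: "i = i'" "j = j'" using L by (auto simp: doubleton_eq_iff)
      have "n$k = n'$k" for k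
      proof (cases "k \<in> J")
        case True then show ?thesis by (simp add: J_def)
      next
        case False
        then have "k \<noteq> i" "k \<noteq> j" using dd d d' by auto
        then have "\<tau>$k = n$k" "\<tau>$k = n'$k" using \<tau> e by (auto simp: face_points_def dest!: spec[of _ k])
        then show ?thesis by simp
      qed
      then show ?thesis using ne e by (simp add: vec_eq_iff)
    qed
  qed
qed simp

lemma compatible_octagonal:
  assumes nc: "pairwise_noncolinear v" and C: "compatible v S" and cov: "\<Union>(dual_tiles v S) = UNIV"
  shows "octagonal_tiling v (dual_tiles v S)"
  unfolding octagonal_tiling_def
proof (intro conjI ballI impI)
  fix s assume "s \<in> dual_tiles v S"
  then show "\<exists>x i j. i < j \<and> s = parallelogram v x i j" using C unfolding dual_tiles_def compatible_def by blast
next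
  show "\<Union>(dual_tiles v S) = UNIV" by (rule cov)
next
  fix s t assume "s \<in> dual_tiles v S" "t \<in> dual_tiles v S" and ne: "s \<noteq> t"
  then obtain n i j n' i' j' where "s = parallelogram v (proj v n) i j" "t = parallelogram v (proj v n') i' j'" "S n i j" "S n' i' j'"
    unfolding dual_tiles_def by blast
  then show "s \<inter> t = {} \<or> (\<exists>p. p extreme_point_of s \<and> p extreme_point_of t \<and> s \<inter> t = {p}) \<or>
        (\<exists>e. e edge_of s \<and> e edge_of t \<and> s \<inter> t = e)"
    using compatible_meet[OF nc C, of n i j n' i' j'] ne by blast
qed

text \<open>The lift inverts \<open>proj v\<close> on the faces; injectivity makes the choice
  unique, so the steps along tile sides come out as basis vectors.\<close>

lemma compatible_lifting:
  assumes nc: "pairwise_noncolinear v" and C: "compatible v S"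
  obtains f where "lifting v (dual_tiles v S) f" "\<And>n i j. S n i j \<Longrightarrow> f (proj v n) = n"
proof -
  define f where "f x = (SOME p. \<exists>n i j. S n i j \<and> p \<in> face_points n i j \<and> proj v p = x)" for x
  have L: "lattice_point n" "i < j" if "S n i j" for n i j using C that by (auto simp: compatible_def)
  have f: "f (proj v p) = p" if "S n i j" "p \<in> face_points n i j" for n i j p
  proof -
    have "\<exists>n' i' j'. S n' i' j' \<and> f (proj v p) \<in> face_points n' i' j' \<and> proj v (f (proj v p)) = proj v p"
      unfolding f_def by (rule someI_ex) (use that in blast)
    then show ?thesis using C that unfolding compatible_def by blast
  qed
  have mem: "n \<in> face_points n i j" "n + std_basis i \<in> face_points n i j" "n + std_basis j \<in> face_points n i j"
    "n + std_basis i + std_basis j \<in> face_points n i j" if "i \<noteq> j" for n i j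
    using that by (auto simp: face_points_def std_basis_nth)
  have "lifting v (dual_tiles v S) f"
    unfolding lifting_def
  proof (intro allI impI, elim conjE)
    fix x i j assume ij: "i \<noteq> j" and "parallelogram v x i j \<in> dual_tiles v S"
    then obtain n i' j' where n: "parallelogram v x i j = parallelogram v (proj v n) i' j'" "S n i' j'"
      unfolding dual_tiles_def by blast
    have i'j': "i' \<noteq> j'" using L[OF n(2)] by auto
    from parallelogram_eqD[OF nc ij i'j' n(1)] have e: "x = proj v n" "{i, j} = {i', j'}" by auto
    then have F: "face_points n i j = face_points n i' j'" using face_points_swap[of n i j] unfolding doubleton_eq_iff by metis
    have p: "f (proj v p) = p" if "p \<in> face_points n i j" for p using f[OF n(2)] that F by simp
    have 1: "f x = n" using p[OF mem(1)[OF ij]] e by simp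
    have 2: "f (x + v i) = n + std_basis i" using p[OF mem(2)[OF ij]] e by simp
    have 3: "f (x + v i + v j) = n + std_basis i + std_basis j" using p[OF mem(4)[OF ij]] e by (simp add: add.assoc)
    show "(\<forall>k. f x $ k \<in> \<int>) \<and> f (x + v i) = f x + std_basis i \<and> f (x + v i + v j) = f x + std_basis i + std_basis j"
      using L(1)[OF n(2)] unfolding 1 2 3 by (simp add: lattice_point_def)
  qed
  moreover have "f (proj v n) = n" if "S n i j" for n i j
  proof -
    have "i \<noteq> j" using L[OF that] by auto
    then show ?thesis using f[OF that mem(1)] by simp
  qed
  ultimately show ?thesis using that by blast
qed

text \<open>The grid of the plane through \<open>a\<close> may have triple points; they are resolved as in the
  grid of the plane through \<open>a - \<eta> b\<close> for infinitesimal \<open>\<eta> > 0\<close>.\<close>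

definition lex_triple :: "real^4 \<Rightarrow> real^4 \<Rightarrow> real^4 \<Rightarrow> real^4 \<Rightarrow> 4 \<Rightarrow> 4 \<Rightarrow> 4 \<Rightarrow> real^4 \<Rightarrow> real" where
  "lex_triple u w a b i j k p =
     (if triple u w i j k (p - a) \<noteq> 0 then triple u w i j k (p - a) else triple u w i j k b)"

definition lex_tile :: "(4 \<Rightarrow> real^2) \<Rightarrow> real^4 \<Rightarrow> real^4 \<Rightarrow> real^4 \<Rightarrow> real^4 \<Rightarrow> real^4 \<Rightarrow> 4 \<Rightarrow> 4 \<Rightarrow> bool" where
  "lex_tile v u w a b = grid_tile v (lex_triple u w a b)"

definition shifted_tile :: "(4 \<Rightarrow> real^2) \<Rightarrow> real^4 \<Rightarrow> real^4 \<Rightarrow> real^4 \<Rightarrow> real^4 \<Rightarrow> 4 \<Rightarrow> 4 \<Rightarrow> bool" where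
  "shifted_tile v u w a = grid_tile v (\<lambda>i j k p. triple u w i j k (p - a))"

section \<open>Replacing the infinitesimal shift by small generic ones\<close>

lemma eventually_lex_sign:
  fixes x y :: real
  shows "eventually (\<lambda>\<eta>. ((x + \<eta> * y) * c > 0 \<longleftrightarrow> (if x \<noteq> 0 then x else y) * c > 0) \<and>
     ((x + \<eta> * y) * c < 0 \<longleftrightarrow> (if x \<noteq> 0 then x else y) * c < 0)) (at_right 0)"
proof (cases "x * c = 0")
  case True
  have "eventually (\<lambda>\<eta>. \<eta> > (0::real)) (at_right 0)" by (simp add: eventually_at_right_less)
  then show ?thesis
  proof eventually_elim
    case (elim \<eta>)
    have "(x + \<eta> * y) * c = \<eta> * (y * c)" using True by (simp add: algebra_simps)
    then show ?case using True elim by (auto simp: zero_less_mult_iff mult_less_0_iff)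
  qed
next
  case False
  have lim: "((\<lambda>\<eta>. (x + \<eta> * y) * c) \<longlongrightarrow> (x + 0 * y) * c) (at_right 0)" by (intro tendsto_intros)
  show ?thesis
  proof (cases "x * c > 0")
    case True
    then have "eventually (\<lambda>\<eta>. (x + \<eta> * y) * c > 0) (at_right 0)" using order_tendstoD(1)[OF lim, of 0] by simp
    then show ?thesis by eventually_elim (use True False in auto)
  next
    case nl: False
    then have "x * c < 0" using False by linarith
    then have "eventually (\<lambda>\<eta>. (x + \<eta> * y) * c < 0) (at_right 0)" using order_tendstoD(2)[OF lim, of 0] by simp
    then show ?thesis by eventually_elim (use nl False \<open>x * c < 0\<close> in auto)
  qed
qed

text \<open>The admissible range of \<open>\<eta>\<close> depends on the tile, so properties
  transfer only when finitely many tiles are involved.\<close>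

lemma eventually_shifted_tile:
  "eventually (\<lambda>\<eta>. shifted_tile v u w (a - \<eta> *\<^sub>R b) n i j \<longleftrightarrow> lex_tile v u w a b n i j) (at_right 0)"
proof -
  let ?c = "det2 (v i) (v j)"
  define P where "P \<eta> k p \<longleftrightarrow>
     (triple u w i j k (p - (a - \<eta> *\<^sub>R b)) * ?c > 0 \<longleftrightarrow> lex_triple u w a b i j k p * ?c > 0) \<and>
     (triple u w i j k (p - (a - \<eta> *\<^sub>R b)) * ?c < 0 \<longleftrightarrow> lex_triple u w a b i j k p * ?c < 0)" for \<eta> k p
  have "eventually (\<lambda>\<eta>. P \<eta> k p) (at_right 0)" for k p
    using eventually_lex_sign[of "triple u w i j k (p - a)" "triple u w i j k b" ?c]
    unfolding P_def lex_triple_def by (simp add: algebra_simps)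
  then have "eventually (\<lambda>\<eta>. \<forall>k. P \<eta> k n \<and> P \<eta> k (n - std_basis k)) (at_right 0)"
    by (intro eventually_all_finite eventually_conj)
  then show ?thesis
  proof eventually_elim
    case (elim \<eta>)
    then have "triple u w i j k (n - (a - \<eta> *\<^sub>R b)) * ?c > 0 \<longleftrightarrow> lex_triple u w a b i j k n * ?c > 0"
      "triple u w i j k (n - std_basis k - (a - \<eta> *\<^sub>R b)) * ?c < 0 \<longleftrightarrow> lex_triple u w a b i j k (n - std_basis k) * ?c < 0" for k
      unfolding P_def by blast+
    then show ?case unfolding shifted_tile_def lex_tile_def grid_tile_def by metis
  qed
qed

lemma countable_lattice_points: "countable {p. lattice_point p}"
proof -
  have "{p. lattice_point p} \<subseteq> range (\<lambda>f :: 4 \<Rightarrow> int. \<chi> k. of_int (f k))"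
  proof
    fix p assume "p \<in> {p. lattice_point p}"
    then have "p = (\<chi> k. of_int \<lfloor>p$k\<rfloor>)" by (simp add: vec_eq_iff lattice_point_def)
    then show "p \<in> range (\<lambda>f :: 4 \<Rightarrow> int. \<chi> k. of_int (f k))"
      by (rule image_eqI[where x = "\<lambda>k. \<lfloor>p$k\<rfloor>"]) simp
  qed
  then show ?thesis by (meson countable_subset countable_image countableI_type)
qed

lemma finite_lattice_points: "finite {p. lattice_point p \<and> norm p \<le> R}"
proof -
  define F where "F = {f :: 4 \<Rightarrow> int. \<forall>k. f k \<in> {- \<lceil>R\<rceil>..\<lceil>R\<rceil>}}"
  have "finite (PiE (UNIV::4 set) (\<lambda>_. {- \<lceil>R\<rceil>..\<lceil>R\<rceil>}))" by (intro finite_PiE) auto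
  moreover have "F = PiE (UNIV::4 set) (\<lambda>_. {- \<lceil>R\<rceil>..\<lceil>R\<rceil>})" by (auto simp: F_def PiE_def)
  ultimately have "finite F" by simp
  moreover have "{p. lattice_point p \<and> norm p \<le> R} \<subseteq> (\<lambda>f. \<chi> k. of_int (f k)) ` F"
  proof
    fix p assume "p \<in> {p. lattice_point p \<and> norm p \<le> R}"
    then have p: "lattice_point p" "norm p \<le> R" by auto
    then have e: "p = (\<chi> k. of_int \<lfloor>p$k\<rfloor>)" by (simp add: vec_eq_iff lattice_point_def)
    have "\<lfloor>p$k\<rfloor> \<in> {- \<lceil>R\<rceil>..\<lceil>R\<rceil>}" for k
    proof -
      have "\<bar>p$k\<bar> \<le> R" using component_le_norm_cart[of p k] p(2) by linarith
      moreover have "p$k = of_int \<lfloor>p$k\<rfloor>" using e by (metis vec_lambda_beta)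
      ultimately have "\<bar>real_of_int \<lfloor>p$k\<rfloor>\<bar> \<le> of_int \<lceil>R\<rceil>" using le_of_int_ceiling[of R] by linarith
      then have "\<bar>\<lfloor>p$k\<rfloor>\<bar> \<le> \<lceil>R\<rceil>" by linarith
      then show ?thesis by auto
    qed
    then have "(\<lambda>k. \<lfloor>p$k\<rfloor>) \<in> F" by (simp add: F_def)
    with e show "p \<in> (\<lambda>f. \<chi> k. of_int (f k)) ` F" by (rule image_eqI)
  qed
  ultimately show ?thesis using finite_subset by blast
qed

definition nondeg_shift :: "real^4 \<Rightarrow> real^4 \<Rightarrow> real^4 \<Rightarrow> bool" where
  "nondeg_shift u w b \<longleftrightarrow> (\<forall>i j k. i \<noteq> j \<longrightarrow> i \<noteq> k \<longrightarrow> j \<noteq> k \<longrightarrow> triple u w i j k b \<noteq> 0)"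

text \<open>For each lattice point and each triple exactly one \<open>\<eta>\<close> is bad, because
  the triple of \<open>b\<close> is nonzero; countably many bad values do not exhaust an
  interval.\<close>

lemma generic_shift:
  assumes b: "nondeg_shift u w b" and "e > 0"
  obtains \<eta> where "0 < \<eta>" "\<eta> < e" "generic u w (a - \<eta> *\<^sub>R b)"
proof -
  define B where "B = (\<Union>p\<in>{p. lattice_point p}. \<Union>i. \<Union>j. \<Union>k. {\<eta>. i \<noteq> j \<and> i \<noteq> k \<and> j \<noteq> k \<and> triple u w i j k (p - a) + \<eta> * triple u w i j k b = 0})"
  have "countable {\<eta>. i \<noteq> j \<and> i \<noteq> k \<and> j \<noteq> k \<and> triple u w i j k (p - a) + \<eta> * triple u w i j k b = 0}" for p and i j k :: 4
  proof (rule countable_subset)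
    show "{\<eta>. i \<noteq> j \<and> i \<noteq> k \<and> j \<noteq> k \<and> triple u w i j k (p - a) + \<eta> * triple u w i j k b = 0} \<subseteq> {- triple u w i j k (p - a) / triple u w i j k b}"
      using b unfolding nondeg_shift_def by (auto simp: field_simps eq_neg_iff_add_eq_0 simp del: triple_simps)
  qed auto
  then have "countable B" unfolding B_def using countable_lattice_points by (intro countable_UN) auto
  moreover have "uncountable {0<..<e}" using assms by (simp add: uncountable_open_interval)
  ultimately have "uncountable ({0<..<e} - B)" by (rule uncountable_minus_countable[rotated])
  then obtain \<eta> where \<eta>: "\<eta> \<in> {0<..<e} - B" by (metis all_not_in_conv countable_empty)
  have "generic u w (a - \<eta> *\<^sub>R b)"
    unfolding generic_def
  proof (intro allI impI)
    fix p :: "real^4" and i j k :: 4 assume p: "lattice_point p" and d: "i \<noteq> j" "i \<noteq> k" "j \<noteq> k"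
    have "triple u w i j k (p - (a - \<eta> *\<^sub>R b)) = triple u w i j k (p - a) + \<eta> * triple u w i j k b" by (simp add: algebra_simps)
    moreover have "triple u w i j k (p - a) + \<eta> * triple u w i j k b \<noteq> 0" using \<eta> p d unfolding B_def by blast
    ultimately show "triple u w i j k (p - (a - \<eta> *\<^sub>R b)) \<noteq> 0" by simp
  qed
  then show ?thesis using that \<eta> by auto
qed

text \<open>Injectivity involves two tiles only. One small generic \<open>\<eta>\<close> makes both
  of them tiles of an ordinary generic grid, where \<open>grid_rel_unique\<close> applies.\<close>

lemma lex_tile_compatible:
  assumes nc: "pairwise_noncolinear v" and ori: "oriented v u w" and b: "nondeg_shift u w b"
  shows "compatible v (lex_tile v u w a b)"
  unfolding compatible_def
proof (intro conjI allI impI)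
  fix n i j assume "lex_tile v u w a b n i j"
  then show "lattice_point n" "i < j" by (auto simp: lex_tile_def grid_tile_def)
next
  fix n i j n' i' j' \<tau> \<tau>'
  assume S: "lex_tile v u w a b n i j" "lex_tile v u w a b n' i' j'"
    and t: "\<tau> \<in> face_points n i j" "\<tau>' \<in> face_points n' i' j'" and eq: "proj v \<tau> = proj v \<tau>'"
  have "eventually (\<lambda>\<eta>. shifted_tile v u w (a - \<eta> *\<^sub>R b) n i j \<and> shifted_tile v u w (a - \<eta> *\<^sub>R b) n' i' j') (at_right 0)"
    using eventually_shifted_tile[of v u w a b n i j] eventually_shifted_tile[of v u w a b n' i' j']
    by eventually_elim (use S in simp)
  then obtain e where e: "e > 0" "\<And>\<eta>. 0 < \<eta> \<Longrightarrow> \<eta> < e \<Longrightarrow> shifted_tile v u w (a - \<eta> *\<^sub>R b) n i j \<and> shifted_tile v u w (a - \<eta> *\<^sub>R b) n' i' j'"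
    unfolding eventually_at_right_field by auto
  obtain \<eta> where \<eta>: "0 < \<eta>" "\<eta> < e" "generic u w (a - \<eta> *\<^sub>R b)" using generic_shift[OF b e(1)] .
  have s: "grid_tile v (\<lambda>i j k p. triple u w i j k (p - (a - \<eta> *\<^sub>R b))) n i j"
      "grid_tile v (\<lambda>i j k p. triple u w i j k (p - (a - \<eta> *\<^sub>R b))) n' i' j'"
    using e(2)[OF \<eta>(1,2)] by (simp_all add: shifted_tile_def)
  obtain z where "grid_rel u w (a - \<eta> *\<^sub>R b) z \<tau>" using grid_tile_rel[OF ori s(1) t(1)] .
  moreover obtain z' where "grid_rel u w (a - \<eta> *\<^sub>R b) z' \<tau>'" using grid_tile_rel[OF ori s(2) t(2)] .
  ultimately show "\<tau> = \<tau>'" using grid_rel_unique[OF nc ori \<eta>(3)] eq by blast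
qed

lemma norm_le_4:
  fixes p :: "real^4"
  assumes "\<And>k. \<bar>p$k\<bar> \<le> c" shows "norm p \<le> 4 * c"
proof -
  have "norm p \<le> (\<Sum>k\<in>UNIV. \<bar>p$k\<bar>)" by (rule norm_le_l1_cart)
  also have "\<dots> \<le> (\<Sum>k\<in>(UNIV::4 set). c)" by (intro sum_mono assms)
  finally show ?thesis by simp
qed

text \<open>The shift \<open>\<eta>\<close> has to be fixed before the tile covering
  \<open>y\<close> is known. So a bound for all candidates, uniform in \<open>\<eta> < 1\<close>,
  comes first; on the finitely many candidates the shifted and the infinitesimal conditions agree
  for small \<open>\<eta>\<close>.\<close>

lemma lex_tile_covers:
  assumes nc: "pairwise_noncolinear v" and ori: "oriented v u w" and b: "nondeg_shift u w b"
  obtains n i j where "lex_tile v u w a b n i j" "y \<in> parallelogram v (proj v n) i j"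
proof -
  have D: "det2 (proj v u) (proj v w) > 0" by (rule oriented_det_pos[OF ori])
  define C where "C = 4 * (norm (proj v u) + norm (proj v w)) * (norm u + norm w) / det2 (proj v u) (proj v w)"
  have C: "norm p \<le> C * norm (proj v p)" if "p \<in> span {u, w}" for p
    using span_norm_bound[OF D that] by (simp add: C_def algebra_simps)
  have C0: "C \<ge> 0" using D by (simp add: C_def)
  define M where "M = (\<Sum>k\<in>UNIV. norm (v k))"
  have M0: "M \<ge> 0" by (simp add: M_def sum_nonneg)
  have M: "norm (proj v p) \<le> M * norm p" for p unfolding M_def by (rule norm_proj_le)
  \<comment> \<open>\<open>B\<close> bounds the projection of \<open>z - a'\<close>; the 4 bounds
    the norm of a vector of the unit cube. \<open>R\<close> then adds up the parts of
    \<open>n\<close>.\<close>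
  define B where "B = norm y + M * 4 + M * (norm a + norm b)"
  define R where "R = 4 + (norm a + norm b) + C * B"
  define N where "N = {n. lattice_point n \<and> norm n \<le> R}"
  have "finite N" unfolding N_def by (rule finite_lattice_points)
  then have "eventually (\<lambda>\<eta>. \<forall>n\<in>N. \<forall>i. \<forall>j. shifted_tile v u w (a - \<eta> *\<^sub>R b) n i j \<longleftrightarrow> lex_tile v u w a b n i j) (at_right 0)"
    by (intro eventually_ball_finite ballI eventually_all_finite eventually_shifted_tile)
  then obtain e where e: "e > 0" "\<And>\<eta> n i j. 0 < \<eta> \<Longrightarrow> \<eta> < e \<Longrightarrow> n \<in> N \<Longrightarrow> shifted_tile v u w (a - \<eta> *\<^sub>R b) n i j \<longleftrightarrow> lex_tile v u w a b n i j"
    unfolding eventually_at_right_field by blast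
  obtain \<eta> where \<eta>: "0 < \<eta>" "\<eta> < min e 1" "generic u w (a - \<eta> *\<^sub>R b)" using generic_shift[OF b, of "min e 1"] e(1) by auto
  define a' where "a' = a - \<eta> *\<^sub>R b"
  have na': "norm a' \<le> norm a + norm b"
  proof -
    have "norm a' \<le> norm a + norm (\<eta> *\<^sub>R b)" unfolding a'_def by (rule norm_triangle_ineq4)
    also have "norm (\<eta> *\<^sub>R b) \<le> norm b" using \<eta> by (simp add: mult_left_le_one_le)
    finally show ?thesis by simp
  qed
  obtain z \<tau> where z: "grid_rel u w a' z \<tau>" "proj v \<tau> = y" using grid_rel_exists[OF D] .
  obtain n i j where n: "grid_tile v (\<lambda>i j k p. triple u w i j k (p - a')) n i j" "\<tau> \<in> face_points n i j"
    using grid_rel_tile[OF ori _ z(1)] \<eta>(3) unfolding a'_def by blast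
  have L: "lattice_point n" "i < j" using n by (auto simp: grid_tile_def)
  have tz: "0 \<le> \<tau>$k - z$k" "\<tau>$k - z$k \<le> 1" for k using z by (auto simp: grid_rel_def)
  have tn: "0 \<le> \<tau>$k - n$k" "\<tau>$k - n$k \<le> 1" for k using n(2) by (auto simp: face_points_def dest!: spec[of _ k] split: if_splits)
  have "\<bar>(\<tau> - z)$k\<bar> \<le> 1" for k using tz[of k] by auto
  then have ntz: "norm (\<tau> - z) \<le> 4" using norm_le_4[of "\<tau> - z" 1] by simp
  have "\<bar>(n - z)$k\<bar> \<le> 1" for k using tz[of k] tn[of k] by auto
  then have nnz: "norm (n - z) \<le> 4" using norm_le_4[of "n - z" 1] by simp
  have sp: "z - a' \<in> span {u, w}" using z by (simp add: grid_rel_def)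
  have "proj v (z - a') = y - proj v (\<tau> - z) - proj v a'" using z(2) by simp
  then have "norm (proj v (z - a')) \<le> norm y + norm (proj v (\<tau> - z)) + norm (proj v a')"
    using norm_triangle_ineq4[of "y - proj v (\<tau> - z)" "proj v a'"] norm_triangle_ineq4[of y "proj v (\<tau> - z)"] by (simp only:)
  also have "\<dots> \<le> B" unfolding B_def using M[of "\<tau> - z"] M[of a'] mult_left_mono[OF ntz M0] mult_left_mono[OF na' M0] by linarith
  finally have "norm (z - a') \<le> C * B" using C[OF sp] mult_left_mono[OF _ C0] by (meson order_trans)
  moreover have "norm n \<le> norm (n - z) + norm (z - a') + norm a'"
    using norm_triangle_ineq[of "n - z" "z - a'"] norm_triangle_ineq[of "(n - z) + (z - a')" a'] by simp
  ultimately have "norm n \<le> R" unfolding R_def using nnz na' by linarith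
  then have "n \<in> N" using L by (simp add: N_def)
  moreover have "shifted_tile v u w (a - \<eta> *\<^sub>R b) n i j" using n(1) by (simp add: shifted_tile_def a'_def)
  ultimately have "lex_tile v u w a b n i j" using e(2)[OF \<eta>(1)] \<eta>(2) by auto
  moreover have "y \<in> parallelogram v (proj v n) i j"
  proof -
    have "i \<noteq> j" using L by auto
    from proj_face_points[OF this, of v n] z(2) n(2) show ?thesis by blast
  qed
  ultimately show ?thesis by (rule that)
qed

text \<open>The tie-breaking by \<open>b\<close> weakens the strict inequalities of
  \<open>grid_tile\<close> to weak ones for the plane through \<open>a\<close> itself. The closed
  unit cube absorbs this, so the thickness remains 1 and the plane is not moved.\<close>

lemma lex_tile_near_plane:
  assumes ori: "oriented v u w" and t: "lex_tile v u w a b n i j"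
  obtains z where "z - a \<in> span {u, w}" "\<And>\<tau> k. \<tau> \<in> face_points n i j \<Longrightarrow> 0 \<le> \<tau>$k - z$k \<and> \<tau>$k - z$k \<le> 1"
proof -
  have ij: "i \<noteq> j" using t by (auto simp: lex_tile_def grid_tile_def)
  obtain z where z: "z - a \<in> span {u, w}" "z$i = n$i" "z$j = n$j" using span_two_coords[OF orientedD[OF ori ij]] .
  have "0 \<le> n$k - z$k \<and> n$k - z$k \<le> 1" if k: "k \<noteq> i" "k \<noteq> j" for k
  proof -
    let ?c = "det2 (v i) (v j)" and ?g = "grass u w i j"
    have g: "?g * ?c > 0" using ori ij by (simp add: oriented_def)
    have "lex_triple u w a b i j k n * ?c > 0" "lex_triple u w a b i j k (n - std_basis k) * ?c < 0"
      using t k by (auto simp: lex_tile_def grid_tile_def)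
    then have "triple u w i j k (n - a) * ?c \<ge> 0" "triple u w i j k (n - std_basis k - a) * ?c \<le> 0"
      unfolding lex_triple_def by (auto split: if_splits simp del: triple_simps)
    moreover have 1: "triple u w i j k (n - a) = ?g * (n$k - z$k)" using triple_crossing[OF z] .
    moreover have "triple u w i j k (n - std_basis k - a) = triple u w i j k (n - a) - ?g"
      using triple_std[OF k] by simp
    ultimately have "?g * (n$k - z$k) * ?c \<ge> 0" "(?g * (n$k - z$k) - ?g) * ?c \<le> 0" by metis+
    then have "(?g * ?c) * (n$k - z$k) \<ge> 0" "(?g * ?c) * (n$k - z$k - 1) \<le> 0" by (simp_all add: algebra_simps)
    then have "n$k - z$k \<ge> 0" "n$k - z$k - 1 \<le> 0" using g by (meson zero_le_mult_iff mult_le_0_iff not_le less_imp_le order.asym)+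
    then show ?thesis by simp
  qed note K = this
  have "0 \<le> \<tau>$k - z$k \<and> \<tau>$k - z$k \<le> 1" if "\<tau> \<in> face_points n i j" for \<tau> k
  proof -
    have "n$k \<le> \<tau>$k \<and> \<tau>$k \<le> n$k + (if k = i \<or> k = j then 1 else 0)" using that unfolding face_points_def by blast
    then show ?thesis using K[of k] z by (cases "k = i \<or> k = j") auto
  qed
  then show ?thesis using that z(1) by blast
qed

definition lex_tiling :: "(4 \<Rightarrow> real^2) \<Rightarrow> real^4 \<Rightarrow> real^4 \<Rightarrow> real^4 \<Rightarrow> real^4 \<Rightarrow> (real^2) set set" where
  "lex_tiling v u w a b = dual_tiles v (lex_tile v u w a b)"

lemma lex_tiling_planar:
  assumes nc: "pairwise_noncolinear v" and ori: "oriented v u w" and b: "nondeg_shift u w b"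
  shows "planar_tiling v (lex_tiling v u w a b) {a + e | e. e \<in> span {u, w}} 1"
proof -
  let ?S = "lex_tile v u w a b" and ?T = "lex_tiling v u w a b"
  have C: "compatible v ?S" by (rule lex_tile_compatible[OF nc ori b])
  have cov: "\<Union>(dual_tiles v ?S) = UNIV"
  proof (intro set_eqI iffI UNIV_I)
    fix y
    obtain n i j where "?S n i j" "y \<in> parallelogram v (proj v n) i j" using lex_tile_covers[OF nc ori b] .
    then show "y \<in> \<Union>(dual_tiles v ?S)" unfolding dual_tiles_def by blast
  qed
  have T: "octagonal_tiling v ?T" unfolding lex_tiling_def by (rule compatible_octagonal[OF nc C cov])
  obtain f where "lifting v (dual_tiles v ?S) f" and f2: "\<And>n i j. ?S n i j \<Longrightarrow> f (proj v n) = n"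
    using compatible_lifting[OF nc C] by blast
  then have f: "lifting v ?T f" by (simp add: lex_tiling_def)
  have "lift_surface v ?T f \<subseteq> {x + y | x y. x \<in> {a + e | e. e \<in> span {u, w}} \<and> (\<forall>k. 0 \<le> y $ k \<and> y $ k \<le> 1)}"
  proof
    fix p assume "p \<in> lift_surface v ?T f"
    then obtain x i j where x: "p \<in> parallelogram std_basis (f x) i j" "i < j" "parallelogram v x i j \<in> ?T"
      unfolding lift_surface_def by blast
    then obtain n i' j' where n: "parallelogram v x i j = parallelogram v (proj v n) i' j'" "?S n i' j'"
      unfolding lex_tiling_def dual_tiles_def by blast
    have i'j': "i' < j'" using n(2) by (simp add: lex_tile_def grid_tile_def)
    have "i \<noteq> j" "i' \<noteq> j'" using x(2) i'j' by auto
    from parallelogram_eqD[OF nc this n(1)] have e: "x = proj v n" "i = i'" "j = j'"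
      using x(2) i'j' by (auto simp: doubleton_eq_iff)
    have p: "p \<in> face_points n i j" using x(1) f2[OF n(2)] e(1) face_points_eq[OF \<open>i \<noteq> j\<close>] by simp
    obtain z where z: "z - a \<in> span {u, w}" "\<And>k. 0 \<le> p$k - z$k \<and> p$k - z$k \<le> 1"
      using lex_tile_near_plane[OF ori n(2)] p e by metis
    have "p = (a + (z - a)) + (p - z)" "a + (z - a) \<in> {a + e | e. e \<in> span {u, w}}" using z(1) by (simp, blast)
    moreover have "\<forall>k. 0 \<le> (p - z)$k \<and> (p - z)$k \<le> 1" using z(2) by auto
    ultimately show "p \<in> {x + y | x y. x \<in> {a + e | e. e \<in> span {u, w}} \<and> (\<forall>k. 0 \<le> y $ k \<and> y $ k \<le> 1)}"
      by blast
  qed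
  then show ?thesis unfolding planar_tiling_def using T f by auto
qed

section \<open>Nearby planes with the same subperiods\<close>

lemma UNIV_four:
  fixes i j k l :: 4
  assumes "distinct [i, j, k, l]" shows "UNIV = {i, j, k, l}"
proof -
  have "card {i, j, k, l} = card (UNIV :: 4 set)" using assms by simp
  then show ?thesis using card_subset_eq[of "UNIV :: 4 set" "{i, j, k, l}"] by simp
qed

lemma four_extend1:
  fixes l :: 4 obtains i j k where "distinct [i, j, k, l]"
proof -
  have c: "card (UNIV - {l}) = 3" by (simp add: card_Diff_singleton)
  from c[unfolded card_3_iff] obtain i j k where "UNIV - {l} = {i, j, k}" "i \<noteq> j" "i \<noteq> k" "j \<noteq> k" by blast
  then show ?thesis using that[of i j k] by auto
qed

lemma four_extend2:
  fixes a b :: 4 assumes "a \<noteq> b" obtains c d where "distinct [c, d, a, b]"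
proof -
  have "card (UNIV - {a, b}) = 2" using assms by (simp add: card_Diff_subset)
  then obtain c d where "UNIV - {a, b} = {c, d}" "c \<noteq> d" by (auto simp: card_Suc_eq numeral_2_eq_2)
  then show ?thesis using that[of c d] assms by auto
qed

lemma four_extend3:
  fixes i j k :: 4 assumes "i \<noteq> j" "i \<noteq> k" "j \<noteq> k" obtains l where "distinct [i, j, k, l]"
proof -
  have "card (UNIV - {i, j, k}) = 1" using assms by (simp add: card_Diff_subset)
  then obtain l where "UNIV - {i, j, k} = {l}" by (auto simp: card_Suc_eq)
  then show ?thesis using that[of l] assms by auto
qed

lemma inner_four:
  fixes p q :: "real^4"
  assumes "distinct [i, j, k, l]" shows "p \<bullet> q = p$i * q$i + p$j * q$j + p$k * q$k + p$l * q$l"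
  using assms by (simp add: inner_vec_def UNIV_four[OF assms])

lemma vec_eq_four:
  fixes p q :: "real^4"
  assumes "distinct [i, j, k, l]" "p$i = q$i" "p$j = q$j" "p$k = q$k" "p$l = q$l" shows "p = q"
proof -
  have "p$x = q$x" for x
  proof -
    have "x \<in> {i, j, k, l}" using UNIV_four[OF assms(1)] by blast
    then show ?thesis using assms(2-) by auto
  qed
  then show ?thesis by (simp add: vec_eq_iff)
qed

definition nondeg :: "real^4 \<Rightarrow> real^4 \<Rightarrow> bool" where
  "nondeg u w \<longleftrightarrow> (\<forall>i j. i \<noteq> j \<longrightarrow> grass u w i j \<noteq> 0)"

text \<open>An integer zero \<open>m\<close> of \<open>triple u w i j k\<close> is a subperiod of the span of \<open>u\<close> and \<open>w\<close> whose type
  is the fourth index.\<close>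

definition inherits_subperiods :: "real^4 \<Rightarrow> real^4 \<Rightarrow> real^4 \<Rightarrow> real^4 \<Rightarrow> bool" where
  "inherits_subperiods u w u' w' \<longleftrightarrow> (\<forall>i j k m. i \<noteq> j \<longrightarrow> i \<noteq> k \<longrightarrow> j \<noteq> k \<longrightarrow> lattice_point m \<longrightarrow>
      triple u w i j k m = 0 \<longrightarrow> triple u' w' i j k m = 0)"

definition normal :: "4 \<Rightarrow> 4 \<Rightarrow> 4 \<Rightarrow> real^4 \<Rightarrow> real^4 \<Rightarrow> real^4" where
  "normal i j k u w = grass u w j k *\<^sub>R std_basis i - grass u w i k *\<^sub>R std_basis j + grass u w i j *\<^sub>R std_basis k"

lemma inner_std [simp]: "p \<bullet> std_basis i = p $ i" "std_basis i \<bullet> p = p $ i"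
  by (simp_all add: std_basis_def inner_axis inner_axis')

lemma inner_normal: "p \<bullet> normal i j k u w = triple u w i j k p"
  by (simp add: normal_def triple_def inner_add_right inner_diff_right)

lemma normal_inner: "normal i j k u w \<bullet> p = triple u w i j k p"
  using inner_normal by (simp add: inner_commute)

lemma normal_nth:
  assumes "distinct [i, j, k, l]"
  shows "normal i j k u w $ i = grass u w j k" "normal i j k u w $ j = - grass u w i k"
    "normal i j k u w $ k = grass u w i j" "normal i j k u w $ l = 0"
  using assms by (auto simp: normal_def std_basis_nth)

lemma lattice_grass: "lattice_point u \<Longrightarrow> lattice_point w \<Longrightarrow> grass u w i j \<in> \<int>"
  by (auto simp: lattice_point_def grass_def intro!: Ints_diff Ints_mult)

lemma lattice_scale: "c \<in> \<int> \<Longrightarrow> lattice_point p \<Longrightarrow> lattice_point (c *\<^sub>R p)"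
  by (auto simp: lattice_point_def intro!: Ints_mult)

lemma lattice_normal: "lattice_point u \<Longrightarrow> lattice_point w \<Longrightarrow> lattice_point (normal i j k u w)"
  unfolding normal_def by (intro lattice_point_simps lattice_scale lattice_grass)

lemma lattice_inner: "lattice_point p \<Longrightarrow> lattice_point q \<Longrightarrow> p \<bullet> q \<in> \<int>"
  unfolding inner_vec_def lattice_point_def by (auto intro!: Ints_sum Ints_mult)

lemma lattice_triple: "lattice_point u \<Longrightarrow> lattice_point w \<Longrightarrow> lattice_point p \<Longrightarrow> triple u w i j k p \<in> \<int>"
  unfolding inner_normal[symmetric] by (intro lattice_inner lattice_normal)

lemma span_member: "s *\<^sub>R u + t *\<^sub>R w \<in> span {u, w}"
  by (intro span_add span_scale span_base) auto

lemma inner_span_zero: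
  assumes "k \<bullet> u = 0" "k \<bullet> w = 0" "p \<in> span {u, w}" shows "k \<bullet> p = 0"
proof -
  obtain s t where "p = s *\<^sub>R u + t *\<^sub>R w" using span_grass_coords[OF assms(3)] .
  then show ?thesis using assms by (simp add: inner_add_right)
qed

lemma span_eq_of_grass:
  assumes p: "p \<in> span {u, w}" and q: "q \<in> span {u, w}" and g: "grass p q i j \<noteq> 0"
  shows "span {p, q} = span {u, w}"
proof -
  obtain s t where p': "p = s *\<^sub>R u + t *\<^sub>R w" using span_grass_coords[OF p] .
  obtain s' t' where q': "q = s' *\<^sub>R u + t' *\<^sub>R w" using span_grass_coords[OF q] .
  define D where "D = s * t' - t * s'"
  have "grass p q i j = D * grass u w i j" by (simp add: grass_def p' q' D_def algebra_simps)
  then have D: "D \<noteq> 0" using g by auto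
  have "D *\<^sub>R u = t' *\<^sub>R p + (- t) *\<^sub>R q" "D *\<^sub>R w = (- s') *\<^sub>R p + s *\<^sub>R q"
    by (simp_all add: p' q' D_def vec_eq_iff algebra_simps)
  then have Du: "D *\<^sub>R u \<in> span {p, q}" "D *\<^sub>R w \<in> span {p, q}" using span_member by metis+
  have e: "(1/D) *\<^sub>R (D *\<^sub>R u) = u" "(1/D) *\<^sub>R (D *\<^sub>R w) = w" using D by simp_all
  have "u \<in> span {p, q}" "w \<in> span {p, q}"
    using span_scale[OF Du(1), of "1/D", unfolded e] span_scale[OF Du(2), of "1/D", unfolded e] .
  then show ?thesis using p q by (intro span_eq[THEN iffD2]) auto
qed

text \<open>A zero of the triple agrees with some vector of the plane in the three coordinates
  concerned, so only the remaining coordinate has to be corrected.\<close>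

lemma triple_zero_lift:
  assumes d: "distinct [i, j, k, l]" and g: "grass u w i j \<noteq> 0" and t: "triple u w i j k m = 0"
  obtains x where "m + x *\<^sub>R std_basis l \<in> span {u, w}"
proof -
  obtain z where z: "z - 0 \<in> span {u, w}" "z$i = m$i" "z$j = m$j" using span_two_coords[OF g] .
  have "triple u w i j k (m - z) = 0" using t z(1) by (simp add: triple_span)
  then have "z$k = m$k" using g triple_local[of "m - z" i j u w k] z by simp
  then have "m + (z$l - m$l) *\<^sub>R std_basis l = z" using d z by (intro vec_eq_four[OF d]) (auto simp: std_basis_nth)
  then show ?thesis using that z(1) by (metis diff_zero)
qed

lemma triple_cong: "m$i = n$i \<Longrightarrow> m$j = n$j \<Longrightarrow> m$k = n$k \<Longrightarrow> triple u w i j k m = triple u w i j k n"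
  by (simp add: triple_def)

text \<open>In the three coordinates \<open>i\<close>, \<open>j\<close>, \<open>k\<close> the vector
  \<open>normal i j k u w\<close> is the cross product of the truncations of \<open>u\<close> and
  \<open>w\<close>. A nonzero vector orthogonal to both truncations has every such cross product
  among its multiples.\<close>

lemma normal_parallel:
  assumes d: "distinct [i, j, k, l]" and n: "n \<bullet> u = 0" "n \<bullet> w = 0" "n $ l = 0" "n \<noteq> 0"
  obtains c where "normal i j k u w = c *\<^sub>R n"
proof -
  have e: "n$i * u$i + n$j * u$j + n$k * u$k = 0" "n$i * w$i + n$j * w$j + n$k * w$k = 0"
    using n inner_four[OF d, of n u] inner_four[OF d, of n w] by simp_all
  have c1: "n$i * normal i j k u w $ j = n$j * normal i j k u w $ i"
  proof -
    have a: "n$i * u$i = - (n$j * u$j) - n$k * u$k" "n$i * w$i = - (n$j * w$j) - n$k * w$k" using e by linarith+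
    have "n$i * normal i j k u w $ j = u$k * (n$i * w$i) - (n$i * u$i) * w$k" by (simp add: normal_nth[OF d] grass_def algebra_simps)
    then show ?thesis unfolding a by (simp add: normal_nth[OF d] grass_def algebra_simps)
  qed
  have c2: "n$i * normal i j k u w $ k = n$k * normal i j k u w $ i"
  proof -
    have a: "n$i * u$i = - (n$j * u$j) - n$k * u$k" "n$i * w$i = - (n$j * w$j) - n$k * w$k" using e by linarith+
    have "n$i * normal i j k u w $ k = (n$i * u$i) * w$j - u$j * (n$i * w$i)" by (simp add: normal_nth[OF d] grass_def algebra_simps)
    then show ?thesis unfolding a by (simp add: normal_nth[OF d] grass_def algebra_simps)
  qed
  have c3: "n$j * normal i j k u w $ k = n$k * normal i j k u w $ j"
  proof -
    have a: "n$j * u$j = - (n$i * u$i) - n$k * u$k" "n$j * w$j = - (n$i * w$i) - n$k * w$k" using e by linarith+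
    have "n$j * normal i j k u w $ k = u$i * (n$j * w$j) - (n$j * u$j) * w$i" by (simp add: normal_nth[OF d] grass_def algebra_simps)
    then show ?thesis unfolding a by (simp add: normal_nth[OF d] grass_def algebra_simps)
  qed
  have nl: "normal i j k u w $ l = 0" by (simp add: normal_nth[OF d])
  have "n$i \<noteq> 0 \<or> n$j \<noteq> 0 \<or> n$k \<noteq> 0" using n(3,4) vec_eq_four[OF d, of n 0] by auto
  then show ?thesis
  proof (elim disjE)
    assume 0: "n$i \<noteq> 0"
    show ?thesis using c1 c2 n(3) nl 0
      by (intro that[of "normal i j k u w $ i / n$i"] vec_eq_four[OF d]) (auto simp: field_simps)
  next
    assume 0: "n$j \<noteq> 0"
    show ?thesis using c1 c3 n(3) nl 0
      by (intro that[of "normal i j k u w $ j / n$j"] vec_eq_four[OF d]) (auto simp: field_simps)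
  next
    assume 0: "n$k \<noteq> 0"
    show ?thesis using c2 c3 n(3) nl 0
      by (intro that[of "normal i j k u w $ k / n$k"] vec_eq_four[OF d]) (auto simp: field_simps)
  qed
qed

lemma abs_grass_diff_le:
  assumes "norm (u' - u) \<le> s" "norm (w' - w) \<le> s"
  shows "\<bar>grass u' w' i j - grass u w i j\<bar> \<le> 2 * s * (norm u + norm w + s)"
proof -
  have s0: "s \<ge> 0" using assms(1) norm_ge_zero order_trans by blast
  have c: "\<bar>u'$k - u$k\<bar> \<le> s" "\<bar>w'$k - w$k\<bar> \<le> s" "\<bar>u$k\<bar> \<le> norm u" "\<bar>w$k\<bar> \<le> norm w" for k
    using component_le_norm_cart[of "u' - u" k] component_le_norm_cart[of "w' - w" k] assms
      component_le_norm_cart[of u k] component_le_norm_cart[of w k] by auto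
  have w': "\<bar>w'$k\<bar> \<le> norm w + s" for k using c(2)[of k] c(4)[of k] by linarith
  have "grass u' w' i j - grass u w i j = ((u'$i - u$i) * w'$j + u$i * (w'$j - w$j)) - ((u'$j - u$j) * w'$i + u$j * (w'$i - w$i))"
    by (simp add: grass_def algebra_simps)
  then have "\<bar>grass u' w' i j - grass u w i j\<bar> \<le> (\<bar>u'$i - u$i\<bar> * \<bar>w'$j\<bar> + \<bar>u$i\<bar> * \<bar>w'$j - w$j\<bar>) + (\<bar>u'$j - u$j\<bar> * \<bar>w'$i\<bar> + \<bar>u$j\<bar> * \<bar>w'$i - w$i\<bar>)"
    unfolding abs_mult[symmetric] by linarith
  also have "\<dots> \<le> (s * (norm w + s) + norm u * s) + (s * (norm w + s) + norm u * s)"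
    using c w' s0 by (intro add_mono mult_mono) auto
  also have "\<dots> = 2 * s * (norm u + norm w + s)" by (simp add: algebra_simps)
  finally show ?thesis .
qed

lemma nondeg_open:
  assumes "nondeg u w"
  obtains e where "e > 0" "\<And>u' w'. norm (u' - u) \<le> e \<Longrightarrow> norm (w' - w) \<le> e \<Longrightarrow> nondeg u' w' \<and>
      (\<forall>i j. \<bar>grass u w i j\<bar> / 2 \<le> \<bar>grass u' w' i j\<bar> \<and> grass u w i j * grass u' w' i j \<ge> 0)"
proof -
  define g where "g = Min ((\<lambda>(i, j). \<bar>grass u w i j\<bar>) ` {(i, j). i \<noteq> j})"
  have ne: "{(i, j). i \<noteq> j} \<noteq> ({} :: (4 \<times> 4) set)"
  proof -
    have "(0, 1) \<in> {(i :: 4, j :: 4). i \<noteq> j}" by simp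
    then show ?thesis by blast
  qed
  have g0: "g > 0" unfolding g_def using assms ne by (subst Min_gr_iff) (auto simp: nondeg_def)
  have gle: "g \<le> \<bar>grass u w i j\<bar>" if "i \<noteq> j" for i j unfolding g_def using that by (intro Min_le) auto
  define e where "e = min 1 (g / (4 * (norm u + norm w + 1)))"
  have K: "norm u + norm w + 1 > 0" by (smt (verit) norm_ge_zero)
  have e0: "e > 0" using g0 K by (simp add: e_def)
  have "nondeg u' w' \<and> (\<forall>i j. \<bar>grass u w i j\<bar> / 2 \<le> \<bar>grass u' w' i j\<bar> \<and> grass u w i j * grass u' w' i j \<ge> 0)"
    if "norm (u' - u) \<le> e" "norm (w' - w) \<le> e" for u' w'
  proof -
    have d: "\<bar>grass u' w' i j - grass u w i j\<bar> \<le> g / 2" for i j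
    proof -
      have "\<bar>grass u' w' i j - grass u w i j\<bar> \<le> 2 * e * (norm u + norm w + e)" using abs_grass_diff_le that by blast
      also have "\<dots> \<le> 2 * e * (norm u + norm w + 1)" using e0 by (intro mult_left_mono) (auto simp: e_def)
      also have "\<dots> \<le> 2 * (g / (4 * (norm u + norm w + 1))) * (norm u + norm w + 1)"
        using K by (intro mult_right_mono mult_left_mono) (auto simp: e_def)
      also have "\<dots> = g / 2" using K by (simp add: field_simps)
      finally show ?thesis .
    qed
    have "\<bar>grass u w i j\<bar> / 2 \<le> \<bar>grass u' w' i j\<bar> \<and> grass u w i j * grass u' w' i j \<ge> 0 \<and> (i \<noteq> j \<longrightarrow> grass u' w' i j \<noteq> 0)" for i j
    proof (cases "i = j")
      case False
      have "\<bar>grass u' w' i j - grass u w i j\<bar> \<le> \<bar>grass u w i j\<bar> / 2" "\<bar>grass u w i j\<bar> > 0" using d[of i j] gle[OF False] g0 by linarith+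
      then show ?thesis by (cases "grass u w i j > 0") (auto simp: zero_le_mult_iff abs_if split: if_splits)
    qed simp
    then show ?thesis by (auto simp: nondeg_def)
  qed
  then show ?thesis using that e0 by blast
qed

section \<open>Diophantine approximation by planes with a further integer normal\<close>

text \<open>\<open>s\<close> measures the distance of the new plane and \<open>\<nu>\<close> is its
  additional integer normal. The decisive demand is that the product \<open>norm \<nu> * s\<close>
  be small. The old normal \<open>k\<close> is kept; for \<open>k = 0\<close> the condition on
  multiples just says that \<open>\<nu>\<close> is nonzero.\<close>

definition approximable :: "real^4 \<Rightarrow> real^4 \<Rightarrow> real^4 \<Rightarrow> bool" where
  "approximable u w k \<longleftrightarrow> (\<forall>\<epsilon>>0. \<exists>u' w' \<nu> s. 0 \<le> s \<and> s < \<epsilon> \<and> norm (u' - u) \<le> s \<and> norm (w' - w) \<le> s \<and>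
     lattice_point \<nu> \<and> \<nu> \<bullet> u' = 0 \<and> \<nu> \<bullet> w' = 0 \<and> norm \<nu> * s < \<epsilon> \<and> (\<nexists>c. \<nu> = c *\<^sub>R k) \<and>
     k \<bullet> u' = 0 \<and> k \<bullet> w' = 0 \<and> inherits_subperiods u w u' w' \<and> span {u', w'} \<noteq> span {u, w})"

definition int_normal :: "real^4 \<Rightarrow> real^4 \<Rightarrow> real^4 \<Rightarrow> bool" where
  "int_normal u w k \<longleftrightarrow> lattice_point k \<and> k \<bullet> u = 0 \<and> k \<bullet> w = 0"

lemma Dirichlet_lattice:
  fixes x :: "real^4"
  assumes "\<epsilon> > 0"
  obtains q :: int and \<nu> where "q \<ge> 1" "lattice_point \<nu>" "norm (\<nu> - of_int q *\<^sub>R x) \<le> \<epsilon>"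
proof -
  obtain N :: nat where N: "N > 0" "4 / \<epsilon> < real N" using reals_Archimedean2[of "4 / \<epsilon>"] assms
    by (metis divide_pos_pos gr0I less_asym of_nat_0 zero_less_numeral)
  have "\<exists>n::nat. n < 4 \<and> of_nat n = k" for k :: 4
  proof -
    have "of_nat 0 = (4::4)" "of_nat 1 = (1::4)" "of_nat 2 = (2::4)" "of_nat 3 = (3::4)" by simp_all
    then show ?thesis using exhaust_4[of k] by (metis less_numeral_extra(1) numeral_less_iff one_less_numeral_iff semiring_norm(76,78,81) zero_less_numeral)
  qed
  then obtain ix :: "4 \<Rightarrow> nat" where ix: "\<And>k. ix k < 4 \<and> of_nat (ix k) = k" by metis
  obtain q p where q: "0 < q" "\<And>n. n < 4 \<Longrightarrow> \<bar>of_int q * x $ (of_nat n) - of_int (p n)\<bar> < 1 / real N"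
    using Dirichlet_approx_simult[OF N(1), of 4 "\<lambda>n. x $ of_nat n"] by metis
  define \<nu> :: "real^4" where "\<nu> = (\<chi> k. of_int (p (ix k)))"
  have "\<bar>(\<nu> - of_int q *\<^sub>R x) $ k\<bar> \<le> 1 / real N" for k
    using q(2)[of "ix k"] ix[of k] by (simp add: \<nu>_def abs_minus_commute)
  then have "norm (\<nu> - of_int q *\<^sub>R x) \<le> 4 * (1 / real N)" by (rule norm_le_4)
  also have "\<dots> \<le> \<epsilon>" using N assms by (simp add: field_simps)
  finally have small: "norm (\<nu> - of_int q *\<^sub>R x) \<le> \<epsilon>" .
  moreover have "lattice_point \<nu>" by (simp add: \<nu>_def lattice_point_def)
  moreover have "1 \<le> q" using q(1) by simp
  ultimately show ?thesis by (intro that[of q \<nu>])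
qed

lemma Ints_small_zero: "x \<in> \<int> \<Longrightarrow> \<bar>x\<bar> < 1 \<Longrightarrow> x = (0::real)"
  by (auto elim!: Ints_cases)

lemma frac_half_less:
  assumes "0 \<le> x" shows "1 / (2 * (x + 1)) * x < (1/2 :: real)"
proof -
  have "x / (2 * (x + 1)) < 1/2" using assms by (simp add: divide_less_eq)
  then show ?thesis by simp
qed

text \<open>The integer normal is a Dirichlet approximation of a large multiple of the normal \<open>\<nu>\<^sub>0\<close> of type \<open>l\<close>.
  Being close to that multiple and integral, it annihilates every bounded integer vector orthogonal
  to \<open>\<nu>\<^sub>0\<close>, in particular \<open>m\<close>.\<close>

lemma approximable_rational_normal:
  assumes nz: "\<nu>\<^sub>0 $ l = 0" "\<nu>\<^sub>0 \<bullet> u = 0" "\<nu>\<^sub>0 \<bullet> w = 0" "\<nu>\<^sub>0 \<noteq> 0" and nd: "nondeg u w"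
    and k: "int_normal u w k" "k = 0 \<or> k $ l \<noteq> 0" "\<And>k'. int_normal u w k' \<Longrightarrow> \<exists>c. k' = c *\<^sub>R k"
    and \<rho>: "\<rho> \<in> span {u, w}" "lattice_point m" "\<And>i. i \<noteq> l \<Longrightarrow> m $ i = \<rho> $ i"
    and H: "\<And>a b c d n. distinct [a, b, c, d] \<Longrightarrow> lattice_point n \<Longrightarrow> triple u w a b c n = 0 \<Longrightarrow>
       (\<exists>t. n$a = t * \<rho>$a \<and> n$b = t * \<rho>$b \<and> n$c = t * \<rho>$c) \<or> (k \<noteq> 0 \<and> k$d = 0 \<and> k$a * n$a + k$b * n$b + k$c * n$c = 0)"
  shows "approximable u w k"
  unfolding approximable_def
proof (intro allI impI)
  fix \<epsilon> :: real assume e: "\<epsilon> > 0"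
  \<comment> \<open>The component of \<open>\<nu>\<^sub>0\<close> orthogonal to \<open>k\<close>:
    moving along it changes the product with \<open>\<nu>\<^sub>0\<close> but not the one with
    \<open>k\<close>.\<close>
  define y where "y = \<nu>\<^sub>0 - ((\<nu>\<^sub>0 \<bullet> k) / (k \<bullet> k)) *\<^sub>R k"
  have y0: "y \<noteq> 0"
  proof
    assume "y = 0"
    then obtain c where c: "\<nu>\<^sub>0 = c *\<^sub>R k" by (auto simp: y_def)
    then have "c * k $ l = 0" using nz(1) by simp
    then have "\<nu>\<^sub>0 = 0" using c k(2) by auto
    then show False using nz by simp
  qed
  have ky: "k \<bullet> y = 0" by (simp add: y_def inner_diff_right inner_commute)
  have "y \<bullet> y = \<nu>\<^sub>0 \<bullet> y" using ky by (simp add: y_def inner_diff_left)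
  then have ny: "\<nu>\<^sub>0 \<bullet> y > 0" using y0 by (metis inner_gt_zero_iff)
  define y1 where "y1 = (1 / (\<nu>\<^sub>0 \<bullet> y)) *\<^sub>R y"
  have y1: "\<nu>\<^sub>0 \<bullet> y1 = 1" "k \<bullet> y1 = 0" using ny ky by (simp_all add: y1_def)
  define K where "K = 2 * (norm u + norm w + 1) * (norm y1 + 1) * (norm \<nu>\<^sub>0 + 1)"
  have K0: "K > 0" unfolding K_def by (intro mult_pos_pos) (smt (verit) norm_ge_zero)+
  \<comment> \<open>In order, the entries force: \<open>\<nu> $ l = 0\<close>;
    \<open>\<nu> \<noteq> 0\<close>; a product of \<open>\<nu>\<close> with \<open>y1\<close> of at
    least \<open>Q / 2\<close>; orthogonality of \<open>\<nu>\<close> to \<open>m\<close>; and the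
    two final estimates by \<open>\<epsilon>\<close>.\<close>
  define \<delta> where "\<delta> = Min {1/2, norm \<nu>\<^sub>0 / 2, 1 / (2 * (norm y1 + 1)), 1 / (2 * (norm m + 1)), \<epsilon> / (2 * K)}"
  have dpos: "\<delta> > 0" unfolding \<delta>_def using nz e K0 by (simp add: add_nonneg_pos)
  have d: "\<delta> \<le> 1/2" "\<delta> \<le> norm \<nu>\<^sub>0 / 2" "\<delta> \<le> 1 / (2 * (norm y1 + 1))" "\<delta> \<le> 1 / (2 * (norm m + 1))" "\<delta> \<le> \<epsilon> / (2 * K)"
    unfolding \<delta>_def by (auto intro!: Min_le)
  obtain q :: int and \<nu> where q: "q \<ge> 1" "lattice_point \<nu>" "norm (\<nu> - of_int q *\<^sub>R \<nu>\<^sub>0) \<le> \<delta>" using Dirichlet_lattice[OF dpos] .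
  define Q where "Q = real_of_int q"
  have Q: "Q \<ge> 1" using q(1) by (simp add: Q_def)
  define \<xi> where "\<xi> = \<nu> - Q *\<^sub>R \<nu>\<^sub>0"
  have xi: "norm \<xi> \<le> \<delta>" "\<nu> = Q *\<^sub>R \<nu>\<^sub>0 + \<xi>" using q(3) by (simp_all add: \<xi>_def Q_def)
  have xip: "\<bar>\<xi> \<bullet> p\<bar> \<le> \<delta> * norm p" for p
    using Cauchy_Schwarz_ineq2[of \<xi> p] xi(1) by (meson mult_right_mono norm_ge_zero order_trans)
  \<comment> \<open>The pattern used again for \<open>m\<close> below: an integer quantity that
    vanishes for \<open>\<nu>\<^sub>0\<close> and is less than 1 for the error \<open>\<xi>\<close>
    must be 0.\<close>
  have \<nu>l: "\<nu> $ l = 0"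
  proof (rule Ints_small_zero)
    show "\<nu> $ l \<in> \<int>" using q(2) by (simp add: lattice_point_def)
    have "\<nu> $ l = \<xi> $ l" using xi(2) nz(1) by simp
    then show "\<bar>\<nu> $ l\<bar> < 1" using component_le_norm_cart[of \<xi> l] xi(1) d(1) by linarith
  qed
  have \<nu>m: "\<nu> \<bullet> \<rho> = 0"
  proof -
    obtain a b c where abc: "distinct [a, b, c, l]" using four_extend1 .
    have "\<nu>' \<bullet> \<rho> = \<nu>' \<bullet> m" if "\<nu>' $ l = 0" for \<nu>' :: "real^4"
      using that \<rho>(3)[of a] \<rho>(3)[of b] \<rho>(3)[of c] abc unfolding inner_four[OF abc] by simp
    then have 1: "\<nu> \<bullet> \<rho> = \<nu> \<bullet> m" "\<nu>\<^sub>0 \<bullet> m = 0" using \<nu>l nz inner_span_zero[OF nz(2,3) \<rho>(1)] by auto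
    have "\<nu> \<bullet> m = 0"
    proof (rule Ints_small_zero)
      show "\<nu> \<bullet> m \<in> \<int>" using q(2) \<rho>(2) by (rule lattice_inner)
      have "\<nu> \<bullet> m = \<xi> \<bullet> m" using 1 xi(2) by (simp add: inner_add_left)
      then have "\<bar>\<nu> \<bullet> m\<bar> \<le> \<delta> * norm m" using xip by simp
      also have "\<dots> \<le> 1 / (2 * (norm m + 1)) * norm m" using d(4) by (intro mult_right_mono) auto
      also have "\<dots> < 1" using frac_half_less[OF norm_ge_zero[of m]] by linarith
      finally show "\<bar>\<nu> \<bullet> m\<bar> < 1" .
    qed
    then show ?thesis using 1 by simp
  qed
  have \<nu>0: "\<nu> \<noteq> 0"
  proof
    assume "\<nu> = 0"
    then have "Q *\<^sub>R \<nu>\<^sub>0 = - \<xi>" using xi(2) by (simp add: eq_neg_iff_add_eq_0)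
    then have "Q * norm \<nu>\<^sub>0 = norm \<xi>" using Q by (metis abs_of_nonneg norm_minus_cancel norm_scaleR order_trans zero_le_one)
    moreover have "1 * norm \<nu>\<^sub>0 \<le> Q * norm \<nu>\<^sub>0" using Q by (intro mult_right_mono) auto
    moreover have "norm \<nu>\<^sub>0 > 0" using nz by simp
    ultimately show False using xi(1) d(2) by linarith
  qed
  have \<nu>k: "\<nexists>c. \<nu> = c *\<^sub>R k"
  proof
    assume "\<exists>c. \<nu> = c *\<^sub>R k"
    then obtain c where c: "\<nu> = c *\<^sub>R k" by blast
    then have "c * k $ l = 0" using \<nu>l by simp
    then show False using c k(2) \<nu>0 by auto
  qed
  have \<nu>y: "\<nu> \<bullet> y1 \<ge> Q / 2"
  proof -
    have "\<nu> \<bullet> y1 = Q + \<xi> \<bullet> y1" using y1 xi(2) by (simp add: inner_add_left)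
    moreover have "\<bar>\<xi> \<bullet> y1\<bar> \<le> 1/2"
    proof -
      have "\<delta> * norm y1 \<le> 1 / (2 * (norm y1 + 1)) * norm y1" using d(3) by (intro mult_right_mono) auto
      also have "\<dots> \<le> 1/2" using frac_half_less[of "norm y1"] by simp
      finally show ?thesis using xip[of y1] by linarith
    qed
    ultimately show ?thesis using Q by linarith
  qed
  then have \<nu>y0: "\<nu> \<bullet> y1 > 0" using Q by linarith
  \<comment> \<open>The projection along \<open>y1\<close> onto the hyperplane orthogonal to
    \<open>\<nu>\<close>. The plane spanned by \<open>f u\<close> and \<open>f w\<close> has the
    normal \<open>\<nu>\<close> and retains \<open>k\<close>.\<close>
  define f where "f p = p - ((\<nu> \<bullet> p) / (\<nu> \<bullet> y1)) *\<^sub>R y1" for p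
  have fn: "\<nu> \<bullet> f p = 0" for p using \<nu>y0 by (simp add: f_def inner_diff_right)
  have fk: "k \<bullet> f p = k \<bullet> p" for p using y1 by (simp add: f_def inner_diff_right)
  have fspan: "f p \<in> span {f u, f w}" if pq: "p \<in> span {u, w}" for p
  proof -
    obtain s t where st: "p = s *\<^sub>R u + t *\<^sub>R w" using span_grass_coords[OF pq] .
    have "f p = s *\<^sub>R f u + t *\<^sub>R f w" by (simp add: f_def st inner_add_right add_divide_distrib algebra_simps)
    then show ?thesis using span_member by metis
  qed
  \<comment> \<open>For \<open>p\<close> orthogonal to \<open>\<nu>\<^sub>0\<close> the product with
    \<open>\<nu>\<close> is of order \<open>\<delta>\<close>, and it is divided by a number of order
    \<open>Q\<close>. As \<open>norm \<nu>\<close> is of order \<open>Q\<close> too,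
    \<open>norm \<nu> * s\<close> is of order \<open>\<delta>\<close>, whatever \<open>Q\<close>
    is.\<close>
  define s where "s = 2 * \<delta> * (norm u + norm w + 1) * (norm y1 + 1) / Q"
  have fs: "norm (f p - p) \<le> s" if p: "\<nu>\<^sub>0 \<bullet> p = 0" "norm p \<le> norm u + norm w + 1" for p
  proof -
    have "\<bar>\<nu> \<bullet> p\<bar> = \<bar>\<xi> \<bullet> p\<bar>" using p xi(2) by (simp add: inner_add_left)
    also have "\<dots> \<le> \<delta> * (norm u + norm w + 1)" using xip[of p] p(2) dpos by (meson mult_left_mono less_imp_le order_trans)
    finally have 1: "\<bar>\<nu> \<bullet> p\<bar> \<le> \<delta> * (norm u + norm w + 1)" .
    have "norm (f p - p) = \<bar>\<nu> \<bullet> p\<bar> / (\<nu> \<bullet> y1) * norm y1" using \<nu>y0 by (simp add: f_def abs_divide)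
    also have "\<dots> \<le> (\<delta> * (norm u + norm w + 1)) / (Q / 2) * (norm y1 + 1)"
      using 1 \<nu>y Q dpos by (intro mult_mono frac_le) auto
    also have "\<dots> = s" by (simp add: s_def)
    finally show ?thesis .
  qed
  have sK: "s \<le> \<delta> * K / Q"
  proof -
    have "2 * \<delta> * (norm u + norm w + 1) * (norm y1 + 1) * 1 \<le> 2 * \<delta> * (norm u + norm w + 1) * (norm y1 + 1) * (norm \<nu>\<^sub>0 + 1)"
      using dpos by (intro mult_left_mono mult_nonneg_nonneg) auto
    also have "\<dots> = \<delta> * K" by (simp add: K_def algebra_simps)
    finally show ?thesis unfolding s_def using Q by (simp add: divide_right_mono)
  qed
  have dK: "\<delta> * K \<le> \<epsilon> / 2" using d(5) K0 by (simp add: field_simps)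
  have s0: "s \<ge> 0" unfolding s_def using dpos Q by simp
  have dK0: "\<delta> * K \<ge> 0" using dpos K0 by simp
  have se: "s < \<epsilon>"
  proof -
    have "\<delta> * K / Q \<le> \<delta> * K / 1" using Q dK0 by (intro divide_left_mono) auto
    then show ?thesis using sK dK e by linarith
  qed
  have nse: "norm \<nu> * s < \<epsilon>"
  proof -
    have "norm \<nu> \<le> Q * norm \<nu>\<^sub>0 + \<delta>" unfolding xi(2) using norm_triangle_ineq[of "Q *\<^sub>R \<nu>\<^sub>0" \<xi>] xi(1) Q by simp
    also have "\<dots> \<le> Q * (norm \<nu>\<^sub>0 + 1)" using d(1) Q by (simp add: algebra_simps)
    finally have "norm \<nu> * s \<le> (Q * (norm \<nu>\<^sub>0 + 1)) * s" using s0 by (intro mult_right_mono)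
    also have "\<dots> = \<delta> * K" using Q by (simp add: s_def K_def)
    finally show ?thesis using dK e by linarith
  qed
  have inh: "inherits_subperiods u w (f u) (f w)"
    unfolding inherits_subperiods_def
  proof (intro allI impI)
    fix a b c n assume abc: "a \<noteq> b" "a \<noteq> c" "b \<noteq> c" and n: "lattice_point n" "triple u w a b c n = 0"
    obtain d where d: "distinct [a, b, c, d]" using four_extend3[OF abc] .
    from H[OF d n] show "triple (f u) (f w) a b c n = 0"
    proof
      assume "\<exists>t. n$a = t * \<rho>$a \<and> n$b = t * \<rho>$b \<and> n$c = t * \<rho>$c"
      then obtain t where t: "n$a = (t *\<^sub>R \<rho>)$a" "n$b = (t *\<^sub>R \<rho>)$b" "n$c = (t *\<^sub>R \<rho>)$c" by auto
      have "f \<rho> = \<rho>" by (simp add: f_def \<nu>m)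
      then have "triple (f u) (f w) a b c \<rho> = 0" using fspan[OF \<rho>(1)] triple_span by metis
      then show ?thesis unfolding triple_cong[OF t] by simp
    next
      assume A: "k \<noteq> 0 \<and> k$d = 0 \<and> k$a * n$a + k$b * n$b + k$c * n$c = 0"
      have "k \<bullet> f u = 0" "k \<bullet> f w = 0" using k(1) fk by (simp_all add: int_normal_def)
      then obtain c' where c': "normal a b c (f u) (f w) = c' *\<^sub>R k" using normal_parallel[OF d] A by metis
      have "triple (f u) (f w) a b c n = c' * (k \<bullet> n)" by (simp add: normal_inner[symmetric] c')
      also have "k \<bullet> n = 0" using A unfolding inner_four[OF d] by simp
      finally show ?thesis by simp
    qed
  qed
  \<comment> \<open>An unchanged span would make \<open>\<nu>\<close> an integer normal of the
    original plane, hence a multiple of \<open>k\<close>.\<close>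
  have ne: "span {f u, f w} \<noteq> span {u, w}"
  proof
    assume eq: "span {f u, f w} = span {u, w}"
    have "u \<in> span {f u, f w}" "w \<in> span {f u, f w}" unfolding eq by (auto intro: span_base)
    then have "\<nu> \<bullet> u = 0" "\<nu> \<bullet> w = 0" using inner_span_zero[OF fn fn] by auto
    then have "int_normal u w \<nu>" using q(2) by (simp add: int_normal_def)
    then show False using k(3) \<nu>k by blast
  qed
  have "norm u \<le> norm u + norm w + 1" "norm w \<le> norm u + norm w + 1" by (simp_all add: add_increasing add_increasing2)
  then have "norm (f u - u) \<le> s" "norm (f w - w) \<le> s" using fs nz by auto
  then show "\<exists>u' w' \<nu> s. 0 \<le> s \<and> s < \<epsilon> \<and> norm (u' - u) \<le> s \<and> norm (w' - w) \<le> s \<and>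
     lattice_point \<nu> \<and> \<nu> \<bullet> u' = 0 \<and> \<nu> \<bullet> w' = 0 \<and> norm \<nu> * s < \<epsilon> \<and> (\<nexists>c. \<nu> = c *\<^sub>R k) \<and>
     k \<bullet> u' = 0 \<and> k \<bullet> w' = 0 \<and> inherits_subperiods u w u' w' \<and> span {u', w'} \<noteq> span {u, w}"
    using s0 se q(2) fn nse \<nu>k fk k(1) inh ne unfolding int_normal_def by (intro exI[of _ "f u"] exI[of _ "f w"] exI[of _ \<nu>] exI[of _ s]) auto
qed

lemma irrational_affine:
  assumes "a \<in> \<int>" "b \<in> \<int>" "a + b * \<mu> = 0" "(\<mu>::real) \<notin> \<rat>"
  shows "a = 0 \<and> b = 0"
proof (cases "b = 0")
  case False
  then have "\<mu> = - a / b" using assms(3) by (simp add: field_simps eq_neg_iff_add_eq_0)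
  moreover have "a \<in> \<rat>" "b \<in> \<rat>" using assms Ints_subset_Rats by auto
  ultimately have "\<mu> \<in> \<rat>" by simp
  then show ?thesis using assms by simp
qed (use assms in simp)

lemma quadratic_infinite_roots:
  assumes "infinite Y" "\<And>y. y \<in> Y \<Longrightarrow> a + b * y + c * y^2 = (0::real)"
  shows "a + b * y + c * y^2 = 0"
proof -
  have e: "poly [:a, b, c:] y = a + b * y + c * y^2" for y by (simp add: power2_eq_square algebra_simps)
  have "[:a, b, c:] = 0"
  proof (rule ccontr)
    assume "[:a, b, c:] \<noteq> 0"
    then have "finite {y. poly [:a, b, c:] y = 0}" by (rule poly_roots_finite)
    moreover have "Y \<subseteq> {y. poly [:a, b, c:] y = 0}" using assms(2) unfolding e by blast
    ultimately show False using assms(1) finite_subset by blast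
  qed
  then show ?thesis using e[of y] by simp
qed

text \<open>Infinitely many common zeros force the integral bilinear equations to share the curve through
  \<open>(\<mu>, \<kappa>)\<close>, which is a graph over the second coordinate because both coordinates are irrational.\<close>

lemma bilinear_zero_curve:
  fixes \<P> :: "(real \<times> real \<times> real \<times> real) set"
  defines "Z \<equiv> {(x, y). \<forall>(A, B, C, D)\<in>\<P>. A + B * x + C * y + D * (x * y) = 0}"
  assumes int: "\<And>A B C D. (A, B, C, D) \<in> \<P> \<Longrightarrow> A \<in> \<int> \<and> B \<in> \<int> \<and> C \<in> \<int> \<and> D \<in> \<int>"
    and inf: "infinite Z" and mem: "(\<mu>, \<kappa>) \<in> Z" and irr: "\<mu> \<notin> \<rat>" "\<kappa> \<notin> \<rat>"
  obtains K \<delta> where "K \<ge> 0" "\<delta> > 0" "\<And>y. \<bar>y - \<kappa>\<bar> < \<delta> \<Longrightarrow> \<exists>x. (x, y) \<in> Z \<and> \<bar>x - \<mu>\<bar> \<le> K * \<bar>y - \<kappa>\<bar>"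
proof (cases "\<forall>P\<in>\<P>. P = (0, 0, 0, 0)")
  case True
  then have "(\<mu>, y) \<in> Z" for y by (auto simp: Z_def)
  then show ?thesis by (intro that[of 0 1]) auto
next
  case False
  then obtain A B C D where P: "(A, B, C, D) \<in> \<P>" "(A, B, C, D) \<noteq> (0, 0, 0, 0)" by (metis surj_pair)
  have iP: "A \<in> \<int>" "B \<in> \<int>" "C \<in> \<int>" "D \<in> \<int>" using int P by auto
  have z: "A + B * \<mu> + C * \<kappa> + D * (\<mu> * \<kappa>) = 0" using mem P(1) by (auto simp: Z_def)
  \<comment> \<open>The coefficient of \<open>x\<close> in the chosen equation at
    \<open>y = \<kappa>\<close>. Irrationality of \<open>\<kappa>\<close> makes it nonzero, so the
    equation can be solved for \<open>x\<close> nearby.\<close>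
  define E where "E = B + D * \<kappa>"
  have E0: "E \<noteq> 0"
  proof
    assume "E = 0"
    then have "B = 0 \<and> D = 0" unfolding E_def by (rule irrational_affine[OF iP(2,4) _ irr(2)])
    moreover from this have "A = 0 \<and> C = 0" using z by (intro irrational_affine[OF iP(1,3) _ irr(2)]) simp
    ultimately show False using P by simp
  qed
  \<comment> \<open>Two zeros over the same \<open>y\<close> would make \<open>y\<close> the
    rational number \<open>- B / D\<close> and the equation a product; at the zero
    \<open>(\<mu>, \<kappa>)\<close> this contradicts irrationality. So infinitely many zeros have
    infinitely many second coordinates.\<close>
  have fib: "x = x'" if xx: "(x, y) \<in> Z" "(x', y) \<in> Z" for x x' y
  proof (rule ccontr)
    assume ne: "x \<noteq> x'"
    have e: "A + B * x + C * y + D * (x * y) = 0" "A + B * x' + C * y + D * (x' * y) = 0" using xx P(1) by (auto simp: Z_def)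
    then have "(x - x') * (B + D * y) = 0" by (simp add: algebra_simps)
    then have 1: "B + D * y = 0" using ne by simp
    moreover have "A + C * y + x * (B + D * y) = 0" using e(1) by (simp add: algebra_simps)
    ultimately have 2: "A + C * y = 0" by simp
    have D0: "D \<noteq> 0"
    proof
      assume "D = 0"
      then have "E = 0" using 1 by (simp add: E_def)
      then show False using E0 by simp
    qed
    have "y = - B / D" using 1 D0 by (simp add: field_simps eq_neg_iff_add_eq_0)
    moreover have "B \<in> \<rat>" "D \<in> \<rat>" using iP Ints_subset_Rats by auto
    ultimately have "y \<in> \<rat>" by simp
    then have yk: "\<kappa> - y \<noteq> 0" using irr by auto
    have AB: "A = - (C * y)" "B = - (D * y)" using 1 2 by simp_all
    have "(\<kappa> - y) * (C + D * \<mu>) = 0" using z unfolding AB by (simp add: algebra_simps)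
    then have "C + D * \<mu> = 0" using yk by simp
    then have "D = 0" using irrational_affine[OF iP(3,4) _ irr(1)] by blast
    then show False using D0 by simp
  qed
  have "inj_on snd Z"
  proof (rule inj_onI)
    fix p q assume "p \<in> Z" "q \<in> Z" "snd p = snd q"
    then show "p = q" using fib by (cases p; cases q) auto
  qed
  then have infY: "infinite (snd ` Z)" using inf by (simp add: finite_image_iff)
  \<comment> \<open>Eliminating \<open>x\<close> from two equations leaves a quadratic in
    \<open>y\<close>. It has infinitely many roots, so it is identically zero, and solving one
    equation solves all of them.\<close>
  have R0: "(A' + C' * y) * (B + D * y) = (A + C * y) * (B' + D' * y)" if P': "(A', B', C', D') \<in> \<P>" for A' B' C' D' y
  proof -
    have c: "(A' + C' * y) * (B + D * y) - (A + C * y) * (B' + D' * y) =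
       (A' * B - A * B') + (A' * D + C' * B - A * D' - C * B') * y + (C' * D - C * D') * y^2" for y
      by (simp add: power2_eq_square algebra_simps)
    have "(A' * B - A * B') + (A' * D + C' * B - A * D' - C * B') * y + (C' * D - C * D') * y^2 = 0" if y: "y \<in> snd ` Z" for y
    proof -
      obtain x where x: "(x, y) \<in> Z" using y by auto
      have "A + B * x + C * y + D * (x * y) = 0" "A' + B' * x + C' * y + D' * (x * y) = 0" using x P(1) P' by (auto simp: Z_def)
      then have "A + C * y = - x * (B + D * y)" "A' + C' * y = - x * (B' + D' * y)" by (simp_all add: algebra_simps)
      then have "(A' + C' * y) * (B + D * y) - (A + C * y) * (B' + D' * y) = 0" by simp
      then show ?thesis unfolding c .
    qed
    from quadratic_infinite_roots[OF infY this] show ?thesis using c[of y] by simp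
  qed
  \<comment> \<open>Keeps the denominator \<open>B + D * y\<close> at least half as large as
    \<open>E\<close>, which also yields the Lipschitz constant \<open>K\<close>.\<close>
  define \<delta> where "\<delta> = \<bar>E\<bar> / (2 * (\<bar>D\<bar> + 1))"
  have d0: "\<delta> > 0" using E0 by (simp add: \<delta>_def add_nonneg_pos)
  define K where "K = 2 * \<bar>C + D * \<mu>\<bar> / \<bar>E\<bar>"
  show ?thesis
  proof (rule that[of K \<delta>])
    show "K \<ge> 0" by (simp add: K_def)
    show "\<delta> > 0" by (rule d0)
    fix y assume y: "\<bar>y - \<kappa>\<bar> < \<delta>"
    have "\<bar>D * (y - \<kappa>)\<bar> \<le> \<bar>E\<bar> / 2"
    proof -
      have "\<bar>D * (y - \<kappa>)\<bar> \<le> (\<bar>D\<bar> + 1) * \<delta>" unfolding abs_mult using y by (intro mult_mono) auto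
      also have "\<dots> = \<bar>E\<bar> / 2" unfolding \<delta>_def by (simp add: field_simps)
      finally show ?thesis .
    qed
    moreover have BD: "B + D * y = E + D * (y - \<kappa>)" by (simp add: E_def algebra_simps)
    ultimately have BE: "\<bar>B + D * y\<bar> \<ge> \<bar>E\<bar> / 2" by linarith
    then have BD0: "B + D * y \<noteq> 0" using E0 by auto
    define x where "x = - (A + C * y) / (B + D * y)"
    have x: "x * (B + D * y) = - (A + C * y)" using BD0 by (simp add: x_def)
    have "(x, y) \<in> Z"
      unfolding Z_def
    proof (clarify)
      fix A' B' C' D' assume P': "(A', B', C', D') \<in> \<P>"
      have "(A' + C' * y + x * (B' + D' * y)) * (B + D * y) = (A' + C' * y) * (B + D * y) + (x * (B + D * y)) * (B' + D' * y)"
        by (simp add: algebra_simps)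
      also have "\<dots> = 0" unfolding x R0[OF P'] by (simp add: algebra_simps)
      finally have "A' + C' * y + x * (B' + D' * y) = 0" using BD0 by simp
      then show "A' + B' * x + C' * y + D' * (x * y) = 0" by (simp add: algebra_simps)
    qed
    moreover have "\<bar>x - \<mu>\<bar> \<le> K * \<bar>y - \<kappa>\<bar>"
    proof -
      have "(x - \<mu>) * (B + D * y) = - (A + C * y + \<mu> * (B + D * y))" using x by (simp add: algebra_simps)
      also have "\<dots> = - ((C + D * \<mu>) * (y - \<kappa>))" using z by (simp add: algebra_simps)
      finally have "\<bar>x - \<mu>\<bar> * \<bar>B + D * y\<bar> = \<bar>C + D * \<mu>\<bar> * \<bar>y - \<kappa>\<bar>" by (metis abs_minus_cancel abs_mult)
      moreover have "\<bar>x - \<mu>\<bar> * (\<bar>E\<bar> / 2) \<le> \<bar>x - \<mu>\<bar> * \<bar>B + D * y\<bar>" using BE by (intro mult_left_mono) auto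
      ultimately have "\<bar>x - \<mu>\<bar> * (\<bar>E\<bar> / 2) \<le> \<bar>C + D * \<mu>\<bar> * \<bar>y - \<kappa>\<bar>" by simp
      then show ?thesis using E0 by (simp add: K_def field_simps)
    qed
    ultimately show "\<exists>x. (x, y) \<in> Z \<and> \<bar>x - \<mu>\<bar> \<le> K * \<bar>y - \<kappa>\<bar>" by blast
  qed
qed

lemma grass_span_scale:
  assumes p: "p \<in> span {u, w}" and q: "q \<in> span {u, w}"
  obtains D where "\<And>i j. grass p q i j = D * grass u w i j"
proof -
  obtain s t where p': "p = s *\<^sub>R u + t *\<^sub>R w" using span_grass_coords[OF p] .
  obtain s' t' where q': "q = s' *\<^sub>R u + t' *\<^sub>R w" using span_grass_coords[OF q] .
  have "grass p q i j = (s * t' - t * s') * grass u w i j" for i j by (simp add: grass_def p' q' algebra_simps)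
  then show ?thesis by (rule that)
qed

lemma basis_change:
  assumes nd: "nondeg u w" and p: "p \<in> span {u, w}" "p \<noteq> 0" and q: "q \<in> span {u, w}" "\<nexists>t. q = t *\<^sub>R p"
  shows "nondeg p q" "span {p, q} = span {u, w}" "inherits_subperiods p q = inherits_subperiods u w"
proof -
  obtain D where D: "\<And>i j. grass p q i j = D * grass u w i j" using grass_span_scale[OF p(1) q(1)] by blast
  have D0: "D \<noteq> 0"
  proof
    assume "D = 0"
    then have g: "grass p q i j = 0" for i j using D by simp
    obtain i where i: "p $ i \<noteq> 0" using p(2) by (auto simp: vec_eq_iff)
    have "q = (q $ i / p $ i) *\<^sub>R p"
      using g[of i] i by (auto simp: vec_eq_iff grass_def field_simps)
    then show False using q(2) by blast
  qed
  show n: "nondeg p q" using nd D D0 by (simp add: nondeg_def)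
  have "(0::4) \<noteq> 1" by simp
  then show "span {p, q} = span {u, w}" using n span_eq_of_grass[OF p(1) q(1)] unfolding nondeg_def by blast
  have "triple p q i j k m = D * triple u w i j k m" for i j k m by (simp add: triple_def D algebra_simps)
  then show "inherits_subperiods p q = inherits_subperiods u w"
    using D0 by (auto simp: inherits_subperiods_def fun_eq_iff)
qed

text \<open>The planes inheriting the subperiods form a curve of pairs \<open>(x, y)\<close> through
  \<open>(\<mu>, \<kappa>)\<close>. A Dirichlet fraction \<open>y\<close> of \<open>\<kappa>\<close>
  with denominator \<open>Q\<close> makes \<open>Q *\<^sub>R W y\<close> integral, which produces an
  integer normal of size about \<open>Q\<close>; the distance of the planes is of order
  \<open>\<bar>y - \<kappa>\<bar>\<close>, much smaller than \<open>1 / Q\<close>.\<close>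

lemma approximable_conic:
  assumes nd: "nondeg w1 w2" and ab: "a \<noteq> b" and m: "lattice_point m1" "lattice_point m2"
    and w: "w1 = m1 + \<mu> *\<^sub>R std_basis a" "w2 = m2 + \<kappa> *\<^sub>R std_basis b"
    and nk: "\<And>k. int_normal w1 w2 k \<Longrightarrow> k = 0"
    and inf: "infinite {span {u', w'} | u' w'. nondeg u' w' \<and> inherits_subperiods w1 w2 u' w'}"
  shows "approximable w1 w2 0"
proof -
  obtain c d where cd: "distinct [c, d, a, b]" using four_extend2[OF ab] .
  then have perm: "distinct [c, d, b, a]" by auto
  define U where "U x = m1 + x *\<^sub>R std_basis a" for x
  define W where "W y = m2 + y *\<^sub>R std_basis b" for y
  have g: "grass (U x) (W y) c d = grass w1 w2 c d" for x y using cd by (simp add: grass_def U_def W_def w std_basis_nth)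
  have g0: "grass w1 w2 c d \<noteq> 0" using nd cd by (simp add: nondeg_def)
  \<comment> \<open>The triples are bilinear in the two spanning vectors, so inheriting one
    subperiod is one equation in \<open>x\<close>, \<open>y\<close> and \<open>x * y\<close> with
    integer coefficients.\<close>
  define \<P> where "\<P> = {(triple m1 m2 i j k n, triple (std_basis a) m2 i j k n, triple m1 (std_basis b) i j k n, triple (std_basis a) (std_basis b) i j k n)
     | i j k n. i \<noteq> j \<and> i \<noteq> k \<and> j \<noteq> k \<and> lattice_point n \<and> triple w1 w2 i j k n = 0}"
  define Z where "Z = {(x, y). \<forall>(A, B, C, D)\<in>\<P>. A + B * x + C * y + D * (x * y) = 0}"
  have tr: "triple (U x) (W y) i j k n = triple m1 m2 i j k n + triple (std_basis a) m2 i j k n * x + triple m1 (std_basis b) i j k n * y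
     + triple (std_basis a) (std_basis b) i j k n * (x * y)" for x y i j k n
    by (simp add: triple_def grass_def U_def W_def algebra_simps)
  have Z: "(x, y) \<in> Z \<longleftrightarrow> inherits_subperiods w1 w2 (U x) (W y)" for x y
  proof
    assume z: "(x, y) \<in> Z"
    show "inherits_subperiods w1 w2 (U x) (W y)"
      unfolding inherits_subperiods_def
    proof (intro allI impI)
      fix i j k n assume "i \<noteq> j" "i \<noteq> k" "j \<noteq> k" "lattice_point n" "triple w1 w2 i j k n = 0"
      then have "(triple m1 m2 i j k n, triple (std_basis a) m2 i j k n, triple m1 (std_basis b) i j k n, triple (std_basis a) (std_basis b) i j k n) \<in> \<P>"
        unfolding \<P>_def by blast
      from bspec[OF z[unfolded Z_def, simplified] this] show "triple (U x) (W y) i j k n = 0" unfolding tr by simp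
    qed
  next
    assume h: "inherits_subperiods w1 w2 (U x) (W y)"
    show "(x, y) \<in> Z"
      unfolding Z_def
    proof clarify
      fix A B C D assume "(A, B, C, D) \<in> \<P>"
      then obtain i j k n where n: "A = triple m1 m2 i j k n" "B = triple (std_basis a) m2 i j k n" "C = triple m1 (std_basis b) i j k n"
        "D = triple (std_basis a) (std_basis b) i j k n" "i \<noteq> j" "i \<noteq> k" "j \<noteq> k" "lattice_point n" "triple w1 w2 i j k n = 0"
        unfolding \<P>_def by blast
      then have "triple (U x) (W y) i j k n = 0" using h unfolding inherits_subperiods_def by blast
      then show "A + B * x + C * y + D * (x * y) = 0" unfolding tr n(1-4) .
    qed
  qed
  have int: "A \<in> \<int> \<and> B \<in> \<int> \<and> C \<in> \<int> \<and> D \<in> \<int>" if "(A, B, C, D) \<in> \<P>" for A B C D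
    using that m unfolding \<P>_def by (auto intro!: lattice_triple)
  have UW: "w1 = U \<mu>" "w2 = W \<kappa>" by (simp_all add: U_def W_def w)
  have mem: "(\<mu>, \<kappa>) \<in> Z" unfolding Z UW by (simp add: inherits_subperiods_def)
  have "{span {u', w'} | u' w'. nondeg u' w' \<and> inherits_subperiods w1 w2 u' w'} \<subseteq> (\<lambda>(x, y). span {U x, W y}) ` Z"
  proof
    fix F assume "F \<in> {span {u', w'} | u' w'. nondeg u' w' \<and> inherits_subperiods w1 w2 u' w'}"
    then obtain u' w' where F: "F = span {u', w'}" "nondeg u' w'" "inherits_subperiods w1 w2 u' w'" by blast
    have sw: "w1 \<in> span {w1, w2}" "w2 \<in> span {w1, w2}" by (auto intro: span_base)
    \<comment> \<open>\<open>m1\<close> and \<open>m2\<close> are themselves subperiods, of types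
      \<open>a\<close> and \<open>b\<close>. Every inheriting plane therefore contains some
      \<open>U x\<close> and some \<open>W y\<close>, and is spanned by them.\<close>
    have "triple w1 w2 c d b m1 = triple w1 w2 c d b w1" by (rule triple_cong) (use cd in \<open>auto simp: w std_basis_nth\<close>)
    then have "triple w1 w2 c d b m1 = 0" using triple_span[OF sw(1)] by simp
    then have t1: "triple u' w' c d b m1 = 0" using F(3) m(1) cd unfolding inherits_subperiods_def by auto
    have "triple w1 w2 c d a m2 = triple w1 w2 c d a w2" by (rule triple_cong) (use cd in \<open>auto simp: w std_basis_nth\<close>)
    then have "triple w1 w2 c d a m2 = 0" using triple_span[OF sw(2)] by simp
    then have t2: "triple u' w' c d a m2 = 0" using F(3) m(2) cd unfolding inherits_subperiods_def by auto
    have g': "grass u' w' c d \<noteq> 0" using F(2) cd by (simp add: nondeg_def)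
    obtain x where x: "U x \<in> span {u', w'}" using triple_zero_lift[OF perm g' t1] unfolding U_def by blast
    obtain y where y: "W y \<in> span {u', w'}" using triple_zero_lift[OF cd g' t2] unfolding W_def by blast
    have sp: "span {U x, W y} = span {u', w'}" using span_eq_of_grass[OF x y] g g0 by metis
    obtain D where D: "\<And>i j. grass (U x) (W y) i j = D * grass u' w' i j" using grass_span_scale[OF x y] by blast
    have "triple (U x) (W y) i j k n = D * triple u' w' i j k n" for i j k n by (simp add: triple_def D algebra_simps)
    then have "inherits_subperiods w1 w2 (U x) (W y)" using F(3) by (simp add: inherits_subperiods_def)
    then show "F \<in> (\<lambda>(x, y). span {U x, W y}) ` Z" using sp F(1) Z by force
  qed
  then have infZ: "infinite Z" using inf finite_surj by blast
  \<comment> \<open>A rational \<open>\<mu>\<close> would make a multiple of \<open>w1\<close>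
    integral, and with \<open>m2\<close> it would give a nonzero integer normal, which is excluded.
    The same holds for \<open>\<kappa>\<close> and \<open>w2\<close>.\<close>
  have irr1: "\<mu> \<notin> \<rat>"
  proof
    assume "\<mu> \<in> \<rat>"
    then obtain r t :: int where rt: "t \<noteq> 0" "\<mu> = of_int r / of_int t" by (metis Rats_cases' less_irrefl)
    define m' where "m' = of_int t *\<^sub>R m1 + of_int r *\<^sub>R std_basis a"
    have m': "m' = of_int t *\<^sub>R w1" using rt by (simp add: m'_def w scaleR_add_right)
    define k where "k = normal c d a m' m2"
    have "lattice_point m'" unfolding m'_def using m by (intro lattice_point_simps lattice_scale) auto
    then have "lattice_point k" unfolding k_def using m by (intro lattice_normal)
    moreover have "of_int t * (k \<bullet> w1) = 0"
    proof -
      have "of_int t * (k \<bullet> w1) = triple m' m2 c d a m'" by (simp add: k_def normal_inner m')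
      also have "\<dots> = 0" by (rule triple_span) (auto intro: span_base)
      finally show ?thesis .
    qed
    moreover have "k \<bullet> w2 = 0"
    proof -
      have "k \<bullet> w2 = triple m' m2 c d a m2" unfolding k_def normal_inner by (rule triple_cong) (use cd in \<open>auto simp: w std_basis_nth\<close>)
      also have "\<dots> = 0" by (rule triple_span) (auto intro: span_base)
      finally show ?thesis .
    qed
    ultimately have "k = 0" using nk rt by (simp add: int_normal_def)
    moreover have "k $ a = of_int t * grass w1 w2 c d" using cd unfolding k_def normal_nth(3)[OF cd]
      by (simp add: grass_def m' w std_basis_nth algebra_simps)
    ultimately show False using g0 rt by simp
  qed
  have irr2: "\<kappa> \<notin> \<rat>"
  proof
    assume "\<kappa> \<in> \<rat>"
    then obtain r t :: int where rt: "t \<noteq> 0" "\<kappa> = of_int r / of_int t" by (metis Rats_cases' less_irrefl)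
    define m' where "m' = of_int t *\<^sub>R m2 + of_int r *\<^sub>R std_basis b"
    have m': "m' = of_int t *\<^sub>R w2" using rt by (simp add: m'_def w scaleR_add_right)
    define k where "k = normal c d b m1 m'"
    have "lattice_point m'" unfolding m'_def using m by (intro lattice_point_simps lattice_scale) auto
    then have "lattice_point k" unfolding k_def using m by (intro lattice_normal)
    moreover have "of_int t * (k \<bullet> w2) = 0"
    proof -
      have "of_int t * (k \<bullet> w2) = triple m1 m' c d b m'" by (simp add: k_def normal_inner m')
      also have "\<dots> = 0" by (rule triple_span) (auto intro: span_base)
      finally show ?thesis .
    qed
    moreover have "k \<bullet> w1 = 0"
    proof -
      have "k \<bullet> w1 = triple m1 m' c d b m1" unfolding k_def normal_inner by (rule triple_cong) (use cd in \<open>auto simp: w std_basis_nth\<close>)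
      also have "\<dots> = 0" by (rule triple_span) (auto intro: span_base)
      finally show ?thesis .
    qed
    ultimately have "k = 0" using nk rt by (simp add: int_normal_def)
    moreover have "k $ b = of_int t * grass w1 w2 c d" using cd unfolding k_def normal_nth(3)[OF perm]
      by (simp add: grass_def m' w std_basis_nth algebra_simps)
    ultimately show False using g0 rt by simp
  qed
  obtain K \<delta> where K: "K \<ge> 0" "\<delta> > 0" "\<And>y. \<bar>y - \<kappa>\<bar> < \<delta> \<Longrightarrow> \<exists>x. (x, y) \<in> Z \<and> \<bar>x - \<mu>\<bar> \<le> K * \<bar>y - \<kappa>\<bar>"
    using bilinear_zero_curve[of \<P> \<mu> \<kappa>] int infZ mem irr1 irr2 unfolding Z_def by blast
  define N0 where "N0 = normal c d b m1 m2"
  define N1 where "N1 = normal c d b m1 (std_basis b)"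
  have N: "normal c d b m1 (W y) = N0 + y *\<^sub>R N1" for y
    by (simp add: N0_def N1_def normal_def W_def grass_def vec_eq_iff algebra_simps)
  define L where "L = norm N0 + (\<bar>\<kappa>\<bar> + \<delta>) * norm N1"
  have L0: "L \<ge> 0" using K(2) by (simp add: L_def)
  show ?thesis
    unfolding approximable_def
  proof (intro allI impI)
    fix \<epsilon> :: real assume e: "\<epsilon> > 0"
    \<comment> \<open>Taking \<open>n\<close> above this bound puts \<open>1 / n\<close> below
      \<open>\<delta>\<close>, where the curve is available, and
      \<open>(K + 1) * (L + 1) / n\<close> below \<open>\<epsilon>\<close>.\<close>
    define M where "M = (K + 1) * (L + 1) / \<epsilon> + 1 / \<delta>"
    obtain n :: nat where n: "real n > M" using reals_Archimedean2 by blast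
    have "M > 0" unfolding M_def using K L0 e by (intro add_pos_pos) (auto intro!: divide_pos_pos mult_pos_pos)
    then have n0: "real n > 0" using n by linarith
    then have "n > 0" by simp
    then obtain p q :: int where q: "0 < q" "\<bar>of_int q * \<kappa> - of_int p\<bar> < 1 / real n"
      using Dirichlet_approx[of n \<kappa>] by metis
    define Q where "Q = real_of_int q"
    have Q: "Q \<ge> 1" using q(1) unfolding Q_def by linarith
    define y where "y = of_int p / Q"
    have Qy: "Q * y = of_int p" using Q by (simp add: y_def)
    have "Q * \<bar>y - \<kappa>\<bar> = \<bar>Q * y - Q * \<kappa>\<bar>" using Q by (metis abs_mult abs_of_nonneg order_trans right_diff_distrib zero_le_one)
    then have yk: "Q * \<bar>y - \<kappa>\<bar> < 1 / real n" using q(2) unfolding Qy by (simp add: Q_def abs_minus_commute)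
    have "\<bar>y - \<kappa>\<bar> \<le> Q * \<bar>y - \<kappa>\<bar>" using mult_right_mono[OF Q, of "\<bar>y - \<kappa>\<bar>"] by simp
    from le_less_trans[OF this yk] have yk1: "\<bar>y - \<kappa>\<bar> < 1 / real n" .
    have nd: "1 / real n < \<delta>"
    proof -
      have "1 / \<delta> < real n" using n K e L0 unfolding M_def by (smt (verit) divide_nonneg_pos mult_nonneg_nonneg)
      then show ?thesis using n0 K(2) by (simp add: field_simps)
    qed
    then obtain x where x: "(x, y) \<in> Z" "\<bar>x - \<mu>\<bar> \<le> K * \<bar>y - \<kappa>\<bar>" using K(3)[of y] yk1 by auto
    define s where "s = (K + 1) * \<bar>y - \<kappa>\<bar>"
    have s0: "s \<ge> 0" using K by (simp add: s_def)
    have KLn: "(K + 1) * (L + 1) / real n < \<epsilon>"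
    proof -
      have "(K + 1) * (L + 1) / \<epsilon> < real n" using n K(2) unfolding M_def by (smt (verit) divide_pos_pos)
      then show ?thesis using n0 e by (simp add: field_simps)
    qed
    have sQ: "Q * s \<le> (K + 1) / real n"
    proof -
      have "Q * s = (K + 1) * (Q * \<bar>y - \<kappa>\<bar>)" by (simp add: s_def)
      also have "\<dots> \<le> (K + 1) * (1 / real n)" using K yk by (intro mult_left_mono) auto
      finally show ?thesis by simp
    qed
    \<comment> \<open>Its \<open>a\<close>-th coordinate is zero, so replacing \<open>m1\<close> by
      \<open>U x\<close> does not affect orthogonality.\<close>
    define \<nu> where "\<nu> = normal c d b m1 (Q *\<^sub>R W y)"
    have nu: "\<nu> = Q *\<^sub>R normal c d b m1 (W y)"
      by (simp add: \<nu>_def normal_def grass_def vec_eq_iff algebra_simps)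
    have "Q *\<^sub>R W y = Q *\<^sub>R m2 + of_int p *\<^sub>R std_basis b" using Qy by (simp add: W_def scaleR_add_right)
    then have "lattice_point (Q *\<^sub>R W y)" unfolding Q_def using m by (auto intro!: lattice_point_simps lattice_scale)
    then have nuL: "lattice_point \<nu>" unfolding \<nu>_def using m by (intro lattice_normal)
    have nuU: "\<nu> \<bullet> U x = 0"
    proof -
      have "\<nu> \<bullet> U x = triple m1 (Q *\<^sub>R W y) c d b m1" unfolding \<nu>_def normal_inner
        by (rule triple_cong) (use cd in \<open>auto simp: U_def std_basis_nth\<close>)
      also have "\<dots> = 0" by (rule triple_span) (auto intro: span_base)
      finally show ?thesis .
    qed
    have nuW: "\<nu> \<bullet> W y = 0"
    proof -
      have "\<nu> \<bullet> W y = Q * triple m1 (W y) c d b (W y)" unfolding nu by (simp add: normal_inner)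
      also have "triple m1 (W y) c d b (W y) = 0" by (rule triple_span) (auto intro: span_base)
      finally show ?thesis by simp
    qed
    have nu0: "\<nu> \<noteq> 0"
    proof
      assume "\<nu> = 0"
      moreover have "\<nu> $ b = Q * grass m1 (W y) c d" unfolding nu by (simp add: normal_nth(3)[OF perm])
      ultimately have "Q * grass m1 (W y) c d = 0" by simp
      moreover have "grass m1 (W y) c d = grass w1 w2 c d" using cd by (simp add: grass_def W_def w std_basis_nth)
      ultimately show False using g0 Q by auto
    qed
    have "\<bar>y\<bar> \<le> \<bar>\<kappa>\<bar> + \<delta>" using yk1 nd by linarith
    then have "norm (normal c d b m1 (W y)) \<le> L"
      unfolding N L_def using norm_triangle_ineq[of N0 "y *\<^sub>R N1"] by (smt (verit) mult_right_mono norm_ge_zero norm_scaleR)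
    then have nuN: "norm \<nu> \<le> Q * L" unfolding nu using Q by simp
    have nus: "norm \<nu> * s < \<epsilon>"
    proof -
      have "norm \<nu> * s \<le> (Q * L) * s" using nuN s0 by (rule mult_right_mono)
      also have "\<dots> = L * (Q * s)" by simp
      also have "\<dots> \<le> (L + 1) * ((K + 1) / real n)" using sQ L0 Q s0 by (intro mult_mono) auto
      also have "\<dots> < \<epsilon>" using KLn by (simp add: mult.commute)
      finally show ?thesis .
    qed
    have se: "s < \<epsilon>"
    proof -
      have "s \<le> Q * s" using Q s0 by (simp add: mult_le_cancel_right1)
      also have "\<dots> \<le> (K + 1) / real n" by (rule sQ)
      also have "\<dots> \<le> (K + 1) * (L + 1) / real n" using K L0 n0 by (intro divide_right_mono) auto
      finally show ?thesis using KLn by linarith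
    qed
    have nb: "norm (std_basis i) = 1" for i by (simp add: std_basis_def)
    have d1: "norm (U x - w1) \<le> s"
    proof -
      have "U x - w1 = (x - \<mu>) *\<^sub>R std_basis a" by (simp add: U_def w scaleR_diff_left)
      then have "norm (U x - w1) = \<bar>x - \<mu>\<bar>" by (simp add: nb)
      also have "\<dots> \<le> s" using x(2) by (simp add: s_def distrib_right)
      finally show ?thesis .
    qed
    have d2: "norm (W y - w2) \<le> s"
    proof -
      have "W y - w2 = (y - \<kappa>) *\<^sub>R std_basis b" by (simp add: W_def w scaleR_diff_left)
      then have "norm (W y - w2) = \<bar>y - \<kappa>\<bar>" by (simp add: nb)
      also have "\<dots> \<le> s" using K by (simp add: s_def distrib_right)
      finally show ?thesis .
    qed
    have ne: "span {U x, W y} \<noteq> span {w1, w2}"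
    proof
      assume "span {U x, W y} = span {w1, w2}"
      then have "W y \<in> span {w1, w2}" "w2 \<in> span {w1, w2}" by (auto intro: span_base)
      then have "W y - w2 \<in> span {w1, w2}" by (rule span_diff)
      moreover have "W y - w2 = (y - \<kappa>) *\<^sub>R std_basis b" by (simp add: W_def w scaleR_diff_left)
      ultimately have "(y - \<kappa>) *\<^sub>R std_basis b = 0"
        using grass_span_zero[of "(y - \<kappa>) *\<^sub>R std_basis b" w1 w2 c d] g0 cd by (auto simp: std_basis_nth)
      then have "y = \<kappa>" using nb[of b] by auto
      moreover have "y \<in> \<rat>" by (simp add: y_def Q_def)
      ultimately show False using irr2 by simp
    qed
    have inh: "inherits_subperiods w1 w2 (U x) (W y)" using x(1) Z by blast
    have nuk: "\<nexists>c. \<nu> = c *\<^sub>R 0" using nu0 by simp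
    show "\<exists>u' w' \<nu> s. 0 \<le> s \<and> s < \<epsilon> \<and> norm (u' - w1) \<le> s \<and> norm (w' - w2) \<le> s \<and>
     lattice_point \<nu> \<and> \<nu> \<bullet> u' = 0 \<and> \<nu> \<bullet> w' = 0 \<and> norm \<nu> * s < \<epsilon> \<and> (\<nexists>c. \<nu> = c *\<^sub>R 0) \<and>
     0 \<bullet> u' = 0 \<and> 0 \<bullet> w' = 0 \<and> inherits_subperiods w1 w2 u' w' \<and> span {u', w'} \<noteq> span {w1, w2}"
      by (intro exI[of _ "U x"] exI[of _ "W y"] exI[of _ \<nu>] exI[of _ s] conjI s0 se d1 d2 nuL nuU nuW nus nuk inh ne inner_zero_left)
  qed
qed

text \<open>Two independent integer normals have, for every \<open>l\<close>, a nonzero integer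
  combination with vanishing \<open>l\<close>-th coordinate. Its integer zeros are subperiods of
  type \<open>l\<close>, so the type \<open>l\<close> normal of an inheriting plane is parallel to
  it, and two types determine a plane.\<close>

lemma two_int_normals_rigid:
  assumes nd: "nondeg u w" and k: "int_normal u w k" "int_normal u w k'" "k \<noteq> 0" "\<nexists>c. k' = c *\<^sub>R k"
    and F: "nondeg u' w'" "inherits_subperiods u w u' w'"
  shows "span {u', w'} = span {u, w}"
proof -
  define n where "n l = k' $ l *\<^sub>R k - k $ l *\<^sub>R k'" for l
  have nl: "n l $ l = 0" for l by (simp add: n_def)
  have nL: "lattice_point (n l)" for l unfolding n_def using k(1,2)
    by (intro lattice_point_simps lattice_scale) (auto simp: int_normal_def lattice_point_def)
  have nE: "n l \<bullet> u = 0" "n l \<bullet> w = 0" for l using k by (simp_all add: n_def int_normal_def inner_diff_left)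
  have nn: "n l \<noteq> 0" for l
  proof
    assume z: "n l = 0"
    then have e: "k' $ l *\<^sub>R k = k $ l *\<^sub>R k'" by (simp add: n_def)
    show False
    proof (cases "k $ l = 0")
      case False
      then have "k' = (k' $ l / k $ l) *\<^sub>R k" using e by (simp add: vec_eq_iff field_simps)
      then show False using k by blast
    next
      case True
      obtain a b c where abc: "distinct [a, b, c, l]" using four_extend1 .
      then have "k' $ l *\<^sub>R k = 0" using e True by simp
      then have k'l: "k' $ l = 0" using k(3) by simp
      obtain r where r: "normal a b c u w = r *\<^sub>R k" using normal_parallel[OF abc _ _ True k(3)] k(1) unfolding int_normal_def by metis
      have "k' \<noteq> 0" using k(4) by (metis scaleR_zero_left)
      then obtain r' where r': "normal a b c u w = r' *\<^sub>R k'" using normal_parallel[OF abc _ _ k'l] k(2) unfolding int_normal_def by metis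
      have "normal a b c u w $ c \<noteq> 0" using nd abc by (simp add: normal_nth[OF abc] nondeg_def)
      then have "r' \<noteq> 0" using r' by auto
      then have "k' = (r / r') *\<^sub>R k" using r r' by (metis divide_inverse_commute scaleR_left_imp_eq scaleR_scaleR real_vector.scale_left_imp_eq nonzero_mult_div_cancel_left times_divide_eq_right)
      then show False using k by blast
    qed
  qed
  have par: "normal a b c u' w' \<bullet> p = 0 \<Longrightarrow> n l \<bullet> p = 0" "n l $ a \<noteq> 0 \<and> n l $ b \<noteq> 0 \<and> n l $ c \<noteq> 0"
    if abc: "distinct [a, b, c, l]" for a b c l p
  proof -
    obtain r where r: "normal a b c u w = r *\<^sub>R n l" using normal_parallel[OF abc nE nl nn] .
    have N0: "normal a b c u w $ a \<noteq> 0" "normal a b c u w $ b \<noteq> 0" "normal a b c u w $ c \<noteq> 0"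
      using nd abc by (simp_all add: normal_nth[OF abc] nondeg_def)
    then show nz: "n l $ a \<noteq> 0 \<and> n l $ b \<noteq> 0 \<and> n l $ c \<noteq> 0" unfolding r by auto
    have z: "triple u' w' a b c m = 0" if "lattice_point m" "n l \<bullet> m = 0" for m
    proof -
      have "triple u w a b c m = 0" using that(2) by (simp add: normal_inner[symmetric] r)
      then show ?thesis using F(2) that(1) abc unfolding inherits_subperiods_def by auto
    qed
    have ints: "n l $ i \<in> \<int>" for i using nL by (simp add: lattice_point_def)
    \<comment> \<open>Two integer vectors orthogonal to \<open>n l\<close>; together they fix the
      ratios of the three coordinates of a normal.\<close>
    define x where "x = n l $ b *\<^sub>R std_basis a - n l $ a *\<^sub>R std_basis b"
    define y where "y = n l $ c *\<^sub>R std_basis a - n l $ a *\<^sub>R std_basis c"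
    have "lattice_point x" "lattice_point y" unfolding x_def y_def using ints by (auto intro!: lattice_point_simps lattice_scale)
    moreover have "n l \<bullet> x = 0" "n l \<bullet> y = 0" by (simp_all add: x_def y_def inner_diff_right)
    ultimately have "triple u' w' a b c x = 0" "triple u' w' a b c y = 0" using z by auto
    then have e: "normal a b c u' w' \<bullet> x = 0" "normal a b c u' w' \<bullet> y = 0" by (simp_all add: normal_inner)
    let ?N = "normal a b c u' w'"
    have e': "n l $ b * ?N $ a = n l $ a * ?N $ b" "n l $ c * ?N $ a = n l $ a * ?N $ c"
      using e by (simp_all add: x_def y_def inner_diff_right)
    have Na: "?N $ a \<noteq> 0" using F(1) abc by (simp add: normal_nth[OF abc] nondeg_def)
    have "?N $ a *\<^sub>R n l = n l $ a *\<^sub>R ?N"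
      using e' nl[of l] by (intro vec_eq_four[OF abc]) (auto simp: normal_nth(4)[OF abc] mult.commute)
    then have "?N $ a * (n l \<bullet> p) = n l $ a * (?N \<bullet> p)" by (metis inner_scaleR_left)
    then show "?N \<bullet> p = 0 \<Longrightarrow> n l \<bullet> p = 0" using Na by simp
  qed
  have ab: "(0::4) \<noteq> 1" by simp
  obtain c d :: 4 where cd: "distinct [c, d, 0, 1]" using four_extend2[OF ab] .
  then have d1: "distinct [c, d, 1, 0]" by auto
  have sub: "p \<in> span {u, w}" if p: "p \<in> span {u', w'}" for p
  proof -
    have n0: "n 0 \<bullet> p = 0" using par(1)[OF d1] triple_span[OF p] by (simp add: normal_inner)
    have n1: "n 1 \<bullet> p = 0" using par(1)[OF cd] triple_span[OF p] by (simp add: normal_inner)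
    have g: "grass u w c d \<noteq> 0" using nd cd by (simp add: nondeg_def)
    obtain z where z: "z - 0 \<in> span {u, w}" "z$c = p$c" "z$d = p$d" using span_two_coords[OF g] .
    have zs: "z \<in> span {u, w}" using z(1) by simp
    have "n 0 \<bullet> (p - z) = 0" "n 1 \<bullet> (p - z) = 0" using n0 n1 inner_span_zero[OF nE zs] by (simp_all add: inner_diff_right)
    then have "n 0 $ 1 * (p - z) $ 1 = 0" "n 1 $ 0 * (p - z) $ 0 = 0"
      using z nl[of 0] nl[of 1] unfolding inner_four[OF cd] by simp_all
    then have "(p - z) $ 1 = 0" "(p - z) $ 0 = 0" using par(2)[OF d1] par(2)[OF cd] by auto
    then have "p = z" using z by (intro vec_eq_four[OF cd]) auto
    then show ?thesis using zs by simp
  qed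
  have "u' \<in> span {u, w}" "w' \<in> span {u, w}" using sub by (auto intro: span_base)
  then show ?thesis using span_eq_of_grass F(1) ab unfolding nondeg_def by blast
qed

text \<open>In the three coordinates other than \<open>l\<close> both vectors are integral, so their
  cross product is an integer normal.\<close>

lemma two_int_points_normal:
  assumes nd: "nondeg u w" and p: "p \<in> span {u, w}" "p \<noteq> 0" and q: "q \<in> span {u, w}" "\<nexists>t. q = t *\<^sub>R p"
    and int: "\<And>i. i \<noteq> l \<Longrightarrow> p $ i \<in> \<int> \<and> q $ i \<in> \<int>"
  obtains k where "int_normal u w k" "k \<noteq> 0" "k $ l = 0"
proof -
  obtain a b c where abc: "distinct [a, b, c, l]" using four_extend1 .
  have g: "grass p q i j \<in> \<int>" if "i \<noteq> l" "j \<noteq> l" for i j using int that by (auto simp: grass_def intro!: Ints_diff Ints_mult)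
  define k where "k = normal a b c p q"
  have "lattice_point k" unfolding k_def normal_def using abc g by (auto intro!: lattice_point_simps lattice_scale)
  moreover note kL = this
  have eq: "span {p, q} = span {u, w}" using basis_change[OF nd p q] by blast
  have "u \<in> span {p, q}" "w \<in> span {p, q}" unfolding eq by (auto intro: span_base)
  then have "k \<bullet> u = 0" "k \<bullet> w = 0" unfolding k_def normal_inner by (simp_all only: triple_span)
  moreover have "k $ c \<noteq> 0" using basis_change(1)[OF nd p q] abc by (simp add: k_def normal_nth[OF abc] nondeg_def)
  then have "k \<noteq> 0" by auto
  moreover have "k $ l = 0" by (simp add: k_def normal_nth[OF abc])
  ultimately show ?thesis using that kL by (auto simp: int_normal_def)
qed

text \<open>An integer zero of a triple of type \<open>l\<close> lifts to a point of \<open>V l\<close>. Either these points and the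
  integer normal are generated by one \<open>\<rho>\<close> and one \<open>k\<close>, or two points of different types span the plane
  and the planes inheriting the subperiods form the curve of a bilinear equation.\<close>

lemma approximation_exists:
  assumes nd: "nondeg u w"
    and inf: "infinite {span {u', w'} | u' w'. nondeg u' w' \<and> inherits_subperiods u w u' w'}"
  obtains u\<^sub>0 w\<^sub>0 k where "span {u\<^sub>0, w\<^sub>0} = span {u, w}" "nondeg u\<^sub>0 w\<^sub>0" "int_normal u\<^sub>0 w\<^sub>0 k"
    "\<And>k'. int_normal u\<^sub>0 w\<^sub>0 k' \<Longrightarrow> \<exists>c. k' = c *\<^sub>R k" "approximable u\<^sub>0 w\<^sub>0 k"
proof -
  \<comment> \<open>Points of the plane that are integral in all coordinates but possibly the
    \<open>l\<close>-th: the lifts of the subperiods of type \<open>l\<close>.\<close>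
  define V where "V l = {p \<in> span {u, w}. \<forall>i. i \<noteq> l \<longrightarrow> p $ i \<in> \<int>}" for l
  have V0: "0 \<in> V l" for l by (simp add: V_def span_0)
  have trunc: "lattice_point (p - p $ l *\<^sub>R std_basis l)" if "p \<in> V l" for p l
    using that by (auto simp: V_def lattice_point_def std_basis_nth)
  have run: "approximable u w k" if k: "int_normal u w k" "k = 0 \<or> k $ l \<noteq> 0" "\<And>k'. int_normal u w k' \<Longrightarrow> \<exists>c. k' = c *\<^sub>R k" and \<rho>: "\<rho> \<in> V l"
    and H: "\<And>a b c d n. distinct [a, b, c, d] \<Longrightarrow> lattice_point n \<Longrightarrow> triple u w a b c n = 0 \<Longrightarrow>
       (\<exists>t. n$a = t * \<rho>$a \<and> n$b = t * \<rho>$b \<and> n$c = t * \<rho>$c) \<or> (k \<noteq> 0 \<and> k$d = 0 \<and> k$a * n$a + k$b * n$b + k$c * n$c = 0)" for k l \<rho>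
  proof -
    obtain a b c where abc: "distinct [a, b, c, l]" using four_extend1 .
    have "normal a b c u w $ c \<noteq> 0" using nd abc by (simp add: normal_nth[OF abc] nondeg_def)
    then have "normal a b c u w \<noteq> 0" by auto
    moreover have "normal a b c u w \<bullet> u = 0" "normal a b c u w \<bullet> w = 0"
      unfolding normal_inner by (rule triple_span, simp add: span_base)+
    moreover have "normal a b c u w $ l = 0" by (simp add: normal_nth[OF abc])
    moreover have "\<rho> \<in> span {u, w}" using \<rho> by (simp add: V_def)
    moreover have "(\<rho> - \<rho> $ l *\<^sub>R std_basis l) $ i = \<rho> $ i" if "i \<noteq> l" for i using that by (simp add: std_basis_nth)
    ultimately show ?thesis
      using approximable_rational_normal[OF _ _ _ _ nd k, of "normal a b c u w" \<rho> "\<rho> - \<rho> $ l *\<^sub>R std_basis l"] trunc[OF \<rho>] H by blast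
  qed
  have lift: "\<exists>x. n + x *\<^sub>R std_basis d \<in> V d" if d: "distinct [a, b, c, d]" and n: "lattice_point n" "triple u w a b c n = 0" for a b c d n
  proof -
    have "grass u w a b \<noteq> 0" using nd d by (simp add: nondeg_def)
    from triple_zero_lift[OF d this n(2)] obtain x where "n + x *\<^sub>R std_basis d \<in> span {u, w}" .
    then show ?thesis using n(1) by (intro exI[of _ x]) (auto simp: V_def std_basis_nth lattice_point_def)
  qed
  show ?thesis
  proof (cases "\<exists>k. int_normal u w k \<and> k \<noteq> 0")
    case True
    then obtain k where k: "int_normal u w k" "k \<noteq> 0" by blast
    have uniq: "\<exists>c. k' = c *\<^sub>R k" if k': "int_normal u w k'" for k'
    proof (rule ccontr)
      assume "\<nexists>c. k' = c *\<^sub>R k"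
      then have "{span {u', w'} | u' w'. nondeg u' w' \<and> inherits_subperiods u w u' w'} \<subseteq> {span {u, w}}"
        using two_int_normals_rigid[OF nd k(1) k' k(2)] by blast
      then show False using inf finite_subset by blast
    qed
    \<comment> \<open>With \<open>k $ l\<close> nonzero, no integer normal other than 0 has a
      vanishing \<open>l\<close>-th coordinate, so \<open>V l\<close> cannot contain two independent
      points.\<close>
    obtain l where l: "k $ l \<noteq> 0" using k(2) by (auto simp: vec_eq_iff)
    define \<rho> where "\<rho> = (if V l = {0} then 0 else SOME p. p \<in> V l \<and> p \<noteq> 0)"
    have \<rho>: "\<rho> \<in> V l" "V l \<noteq> {0} \<Longrightarrow> \<rho> \<noteq> 0"
    proof -
      have "\<rho> \<in> V l \<and> (V l \<noteq> {0} \<longrightarrow> \<rho> \<noteq> 0)"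
      proof (cases "V l = {0}")
        case False
        then have "\<exists>p. p \<in> V l \<and> p \<noteq> 0" using V0 by blast
        from someI_ex[OF this] show ?thesis using False by (simp add: \<rho>_def)
      qed (simp add: \<rho>_def)
      then show "\<rho> \<in> V l" "V l \<noteq> {0} \<Longrightarrow> \<rho> \<noteq> 0" by auto
    qed
    have mult: "\<exists>t. p = t *\<^sub>R \<rho>" if p: "p \<in> V l" for p
    proof (rule ccontr)
      assume np: "\<nexists>t. p = t *\<^sub>R \<rho>"
      have "\<rho> \<noteq> 0"
      proof (rule \<rho>(2))
        have "p \<noteq> 0" using np by (metis scaleR_zero_left)
        then show "V l \<noteq> {0}" using p by blast
      qed
      moreover have "\<rho> \<in> span {u, w}" "p \<in> span {u, w}" "\<And>i. i \<noteq> l \<Longrightarrow> \<rho> $ i \<in> \<int> \<and> p $ i \<in> \<int>" using p \<rho>(1) by (auto simp: V_def)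
      ultimately obtain k' where k': "int_normal u w k'" "k' \<noteq> 0" "k' $ l = 0" using two_int_points_normal[OF nd _ _ _ np] by metis
      obtain c where c: "k' = c *\<^sub>R k" using uniq[OF k'(1)] by blast
      then have "c * k $ l = 0" using k'(3) by simp
      then show False using l c k'(2) by simp
    qed
    have "approximable u w k"
    proof (rule run[OF k(1) _ uniq \<rho>(1)])
      show "k = 0 \<or> k $ l \<noteq> 0" using l by simp
      fix a b c d n assume d: "distinct [a, b, c, d]" and n: "lattice_point n" "triple u w a b c n = 0"
      show "(\<exists>t. n$a = t * \<rho>$a \<and> n$b = t * \<rho>$b \<and> n$c = t * \<rho>$c) \<or> (k \<noteq> 0 \<and> k$d = 0 \<and> k$a * n$a + k$b * n$b + k$c * n$c = 0)"
      proof (cases "k $ d = 0")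
        case True
        obtain r where r: "normal a b c u w = r *\<^sub>R k" using normal_parallel[OF d _ _ True k(2)] k(1) unfolding int_normal_def by metis
        have "normal a b c u w $ c \<noteq> 0" using nd d by (simp add: normal_nth[OF d] nondeg_def)
        then have "r \<noteq> 0" using r by auto
        moreover have "r * (k \<bullet> n) = 0" using n(2) by (simp add: normal_inner[symmetric] r)
        ultimately have "k \<bullet> n = 0" by simp
        then show ?thesis using True k(2) unfolding inner_four[OF d] by simp
      next
        case False
        obtain x where x: "n + x *\<^sub>R std_basis d \<in> V d" using lift[OF d n] by blast
        \<comment> \<open>Scaling by \<open>k $ d\<close> makes the last coordinate integral too,
          since orthogonality to \<open>k\<close> expresses \<open>k $ d * p $ d\<close> through the
          others. So lifts of every type whose \<open>k\<close>-coordinate is nonzero end up in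
          \<open>V l\<close>.\<close>
        define p where "p = k $ d *\<^sub>R (n + x *\<^sub>R std_basis d)"
        have ps: "p \<in> span {u, w}" unfolding p_def using x by (intro span_scale) (simp add: V_def)
        have kZ: "k $ i \<in> \<int>" "n $ i \<in> \<int>" for i using k(1) n(1) by (auto simp: int_normal_def lattice_point_def)
        have pabc: "p $ a = k $ d * n $ a" "p $ b = k $ d * n $ b" "p $ c = k $ d * n $ c" using d by (auto simp: p_def std_basis_nth)
        have "k \<bullet> p = 0" using inner_span_zero[OF _ _ ps] k(1) by (simp add: int_normal_def)
        then have "k $ d * p $ d = - (k $ a * p $ a + k $ b * p $ b + k $ c * p $ c)" unfolding inner_four[OF d] by linarith
        also have "\<dots> = k $ d * - (k $ a * n $ a + k $ b * n $ b + k $ c * n $ c)" unfolding pabc by (simp add: algebra_simps)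
        finally have pd: "p $ d = - (k $ a * n $ a + k $ b * n $ b + k $ c * n $ c)" using False by simp
        have "p $ i \<in> \<int>" for i
        proof -
          have "i \<in> {a, b, c, d}" using UNIV_four[OF d] by blast
          then show ?thesis using pabc pd kZ by (auto intro!: Ints_mult Ints_add Ints_minus)
        qed
        then have "p \<in> V l" using ps by (simp add: V_def)
        then obtain t where t: "p = t *\<^sub>R \<rho>" using mult by blast
        have "n $ i = (t / k $ d) * \<rho> $ i" if "p $ i = k $ d * n $ i" for i
        proof -
          have "k $ d * n $ i = t * \<rho> $ i" using that t by simp
          then show ?thesis using False by (simp add: field_simps)
        qed
        then show ?thesis using pabc by blast
      qed
    qed
    then show ?thesis using that[OF refl nd k(1) uniq] by blast
  next
    case False
    then have k0: "k = 0" if "int_normal u w k" for k using that by blast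
    have n0: "int_normal u w 0" by (simp add: int_normal_def lattice_point_def)
    have u0: "\<exists>c. k' = c *\<^sub>R 0" if "int_normal u w k'" for k' using k0[OF that] by simp
    show ?thesis
    proof (cases "\<exists>l. \<exists>\<rho>\<in>V l. \<forall>d. \<forall>p\<in>V d. \<exists>t. p = t *\<^sub>R \<rho>")
      case True
      then obtain l \<rho> where \<rho>: "\<rho> \<in> V l" "\<And>d p. p \<in> V d \<Longrightarrow> \<exists>t. p = t *\<^sub>R \<rho>" by blast
      have "approximable u w 0"
      proof (rule run[OF n0 _ u0 \<rho>(1)])
        fix a b c d n assume d: "distinct [a, b, c, d]" and n: "lattice_point n" "triple u w a b c n = 0"
        obtain x where x: "n + x *\<^sub>R std_basis d \<in> V d" using lift[OF d n] by blast
        then obtain t where t: "n + x *\<^sub>R std_basis d = t *\<^sub>R \<rho>" using \<rho>(2) by blast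
        have "n $ i = t * \<rho> $ i" if "i \<noteq> d" for i
        proof -
          have "n $ i = (n + x *\<^sub>R std_basis d) $ i" using that by (simp add: std_basis_nth)
          then show ?thesis unfolding t by simp
        qed
        then show "(\<exists>t. n$a = t * \<rho>$a \<and> n$b = t * \<rho>$b \<and> n$c = t * \<rho>$c) \<or> ((0::real^4) \<noteq> 0 \<and> (0::real^4)$d = 0 \<and> (0::real^4)$a * n$a + (0::real^4)$b * n$b + (0::real^4)$c * n$c = 0)"
          using d by auto
      qed simp
      then show ?thesis using that[OF refl nd n0 u0] by blast
    next
      case no: False
      \<comment> \<open>Failure of the single generator, used for 0 and then for \<open>p\<close>,
        gives two independent lifts. They cannot have the same type, as this would create an integer
        normal.\<close>
      obtain a p where p: "p \<in> V a" "\<nexists>t. p = t *\<^sub>R 0" using no V0 by blast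
      then have p0: "p \<noteq> 0" by auto
      obtain b q where q: "q \<in> V b" "\<nexists>t. q = t *\<^sub>R p" using no p(1) by blast
      have ps: "p \<in> span {u, w}" "q \<in> span {u, w}" using p q by (auto simp: V_def)
      have ab: "a \<noteq> b"
      proof
        assume "a = b"
        then have "\<And>i. i \<noteq> a \<Longrightarrow> p $ i \<in> \<int> \<and> q $ i \<in> \<int>" using p q by (auto simp: V_def)
        then show False using two_int_points_normal[OF nd ps(1) p0 ps(2) q(2)] k0 by metis
      qed
      note bc = basis_change[OF nd ps(1) p0 ps(2) q(2)]
      have "u \<in> span {p, q}" "w \<in> span {p, q}" unfolding bc(2) by (auto intro: span_base)
      then have k0': "int_normal u w k" if "int_normal p q k" for k
        using that inner_span_zero[of k p q] by (auto simp: int_normal_def)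
      have "approximable p q 0"
      proof (rule approximable_conic[OF bc(1) ab trunc[OF p(1)] trunc[OF q(1)]])
        show "p = p - p $ a *\<^sub>R std_basis a + p $ a *\<^sub>R std_basis a" "q = q - q $ b *\<^sub>R std_basis b + q $ b *\<^sub>R std_basis b" by simp_all
        show "k = 0" if "int_normal p q k" for k using k0[OF k0'[OF that]] .
        show "infinite {span {u', w'} |u' w'. nondeg u' w' \<and> inherits_subperiods p q u' w'}" unfolding bc(3) by (rule inf)
      qed
      moreover have "int_normal p q 0" by (simp add: int_normal_def lattice_point_def)
      moreover have "\<exists>c. k' = c *\<^sub>R 0" if "int_normal p q k'" for k' using k0[OF k0'[OF that]] by simp
      ultimately show ?thesis using that[OF bc(2,1)] by blast
    qed
  qed
qed

section \<open>Local patterns of the grid\<close>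

text \<open>Kronecker's theorem for selected coordinates of a vector. Independence is demanded on
  \<open>S\<close> alone, because an integer normal makes all four coordinates dependent.\<close>

lemma Kronecker_coordinates:
  fixes \<theta> \<alpha> :: "real^4"
  assumes ind: "\<And>c :: 4 \<Rightarrow> int. (\<And>i. i \<notin> S \<Longrightarrow> c i = 0) \<Longrightarrow> (\<Sum>i\<in>UNIV. of_int (c i) * \<theta> $ i) = 0 \<Longrightarrow> \<forall>i. c i = 0"
    and e: "\<epsilon> > 0"
  obtains t and h :: "4 \<Rightarrow> int" where "\<And>i. i \<in> S \<Longrightarrow> \<bar>t * \<theta> $ i - of_int (h i) - \<alpha> $ i\<bar> < \<epsilon>"
proof -
  interpret M: Modules.module "(\<lambda>r. (*) (real_of_int r))"
    by (simp add: Modules.module.intro distrib_left mult.commute)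
  obtain g where g: "bij_betw g {..<card S} S" using ex_bij_betw_nat_finite[of S] by (auto simp: atLeast0LessThan)
  then have gS: "g ` {..<card S} = S" and ginj: "inj_on g {..<card S}" by (auto simp: bij_betw_def)
  define f where "f = inv_into {..<card S} g"
  have fg: "g (f i) = i" "f i < card S" if "i \<in> S" for i
    using that gS unfolding f_def by (auto simp: f_inv_into_f intro: inv_into_into[of _ g "{..<card S}", simplified])
  have gf: "f (g n) = n" if "n < card S" for n using ginj that by (simp add: f_def)
  have inj\<theta>: "inj_on (\<lambda>i. \<theta> $ i) S"
  proof (rule inj_onI, rule ccontr)
    fix i j assume ij: "i \<in> S" "j \<in> S" "\<theta> $ i = \<theta> $ j" "i \<noteq> j"
    define c where "c k = (if k = i then 1 else if k = j then -1 else (0::int))" for k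
    have "(\<Sum>k\<in>UNIV. of_int (c k) * \<theta> $ k) = (\<Sum>k\<in>{i, j}. of_int (c k) * \<theta> $ k)"
      by (rule sum.mono_neutral_right) (auto simp: c_def)
    also have "\<dots> = 0" using ij by (simp add: c_def)
    finally have "\<forall>k. c k = 0" using ij by (intro ind) (auto simp: c_def)
    then show False by (auto simp: c_def split: if_splits)
  qed
  have inj: "inj_on (\<lambda>n. \<theta> $ g n) {..<card S}"
    using comp_inj_on[OF ginj, of "\<lambda>i. \<theta> $ i"] inj\<theta> gS by (simp add: o_def)
  have "M.independent ((\<lambda>n. \<theta> $ g n) ` {..<card S})"
  proof
    have "finite ((\<lambda>n. \<theta> $ g n) ` {..<card S})" by simp
    moreover assume "M.dependent ((\<lambda>n. \<theta> $ g n) ` {..<card S})"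
    ultimately obtain F :: "real \<Rightarrow> int" and x where
      z: "(\<Sum>x\<in>(\<lambda>n. \<theta> $ g n) ` {..<card S}. real_of_int (F x) * x) = 0" and x: "x \<in> (\<lambda>n. \<theta> $ g n) ` {..<card S}" "F x \<noteq> 0"
      using M.dependent_finite by blast
    define c where "c i = (if i \<in> S then F (\<theta> $ i) else 0)" for i
    have "(\<Sum>i\<in>UNIV. of_int (c i) * \<theta> $ i) = (\<Sum>i\<in>S. of_int (F (\<theta> $ i)) * \<theta> $ i)"
      by (rule sum.mono_neutral_cong_right) (auto simp: c_def)
    also have "\<dots> = (\<Sum>x\<in>(\<lambda>i. \<theta> $ i) ` S. of_int (F x) * x)" by (simp add: sum.reindex[OF inj\<theta>])
    also have "(\<lambda>i. \<theta> $ i) ` S = (\<lambda>n. \<theta> $ g n) ` {..<card S}" using arg_cong[OF gS, of "image (\<lambda>i. \<theta> $ i)"] by (simp add: image_image)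
    finally have "\<forall>i. c i = 0" using z by (intro ind) (auto simp: c_def)
    moreover obtain n where "n < card S" "x = \<theta> $ g n" using x(1) by auto
    moreover from this have "g n \<in> S" using gS by blast
    ultimately show False using x(2) by (auto simp: c_def dest!: spec[of _ "g n"])
  qed
  from Kronecker_thm_1[OF this inj e, of "\<lambda>n. \<alpha> $ g n"] obtain t h where
    th: "\<And>n. n < card S \<Longrightarrow> \<bar>t * \<theta> $ g n - of_int (h n) - \<alpha> $ g n\<bar> < \<epsilon>" by metis
  show ?thesis
  proof (rule that[of t "\<lambda>i. h (f i)"])
    fix i assume "i \<in> S"
    then show "\<bar>t * \<theta> $ i - of_int (h (f i)) - \<alpha> $ i\<bar> < \<epsilon>" using th[of "f i"] fg[of i] by simp
  qed
qed

text \<open>Each lattice vector not orthogonal to the plane excludes at most one slope; a slope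
  outside this countable set gives a line satisfying only those integer relations that hold on the
  whole plane.\<close>

lemma generic_direction:
  obtains \<theta> where "\<theta> \<in> span {u, w}" "\<And>k. lattice_point k \<Longrightarrow> k \<bullet> \<theta> = 0 \<Longrightarrow> k \<bullet> u = 0 \<and> k \<bullet> w = 0"
proof -
  have "countable ((\<lambda>k. - (k \<bullet> u) / (k \<bullet> w)) ` {k. lattice_point k})" using countable_lattice_points by simp
  then obtain \<tau> :: real where \<tau>: "\<tau> \<notin> (\<lambda>k. - (k \<bullet> u) / (k \<bullet> w)) ` {k. lattice_point k}"
    using uncountable_UNIV_real by (metis UNIV_eq_I)
  have "k \<bullet> u = 0 \<and> k \<bullet> w = 0" if k: "lattice_point k" "k \<bullet> (1 *\<^sub>R u + \<tau> *\<^sub>R w) = 0" for k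
  proof -
    have e: "k \<bullet> u + \<tau> * (k \<bullet> w) = 0" using k(2) by (simp add: inner_add_right)
    have "k \<bullet> w = 0"
    proof (rule ccontr)
      assume "k \<bullet> w \<noteq> 0"
      then have "\<tau> = - (k \<bullet> u) / (k \<bullet> w)" using e by (simp add: field_simps eq_neg_iff_add_eq_0)
      then show False using \<tau> k(1) by blast
    qed
    then show ?thesis using e by simp
  qed
  then show ?thesis using that span_member by blast
qed

text \<open>Modulo the lattice, one generic line of the plane is dense in the hyperplane orthogonal
  to \<open>k\<close>. The integer points used lie in that hyperplane themselves, so density holds
  inside the slice and not only near it.\<close>

lemma lattice_plane_dense:
  assumes k: "int_normal u w k" "\<And>k'. int_normal u w k' \<Longrightarrow> \<exists>c. k' = c *\<^sub>R k"
    and p: "k \<bullet> p = 0" and d: "\<delta> > 0"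
  obtains n e where "lattice_point n" "e \<in> span {u, w}" "norm (n - p - e) < \<delta>" "k \<bullet> n = 0"
proof -
  obtain \<theta> where \<theta>: "\<theta> \<in> span {u, w}" "\<And>k. lattice_point k \<Longrightarrow> k \<bullet> \<theta> = 0 \<Longrightarrow> k \<bullet> u = 0 \<and> k \<bullet> w = 0" using generic_direction[of u w] by blast
  have nrm: "\<exists>r. (\<chi> i. of_int (c i)) = r *\<^sub>R k" if "(\<Sum>i\<in>UNIV. of_int (c i) * \<theta> $ i) = 0" for c :: "4 \<Rightarrow> int"
  proof -
    have "lattice_point (\<chi> i. of_int (c i))" by (simp add: lattice_point_def)
    moreover have "(\<chi> i. of_int (c i)) \<bullet> \<theta> = 0" using that by (simp add: inner_vec_def)
    ultimately show ?thesis using \<theta>(2) k(2) by (auto simp: int_normal_def)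
  qed
  show ?thesis
  proof (cases "k = 0")
    case True
    have ind: "\<forall>i. c i = 0" if "(\<Sum>i\<in>UNIV. of_int (c i) * \<theta> $ i) = 0" for c :: "4 \<Rightarrow> int"
      using nrm[OF that] True by (auto simp: vec_eq_iff)
    obtain t h where th: "\<And>i. i \<in> UNIV \<Longrightarrow> \<bar>t * \<theta> $ i - of_int (h i) - (- p) $ i\<bar> < \<delta> / 8"
      using Kronecker_coordinates[of UNIV \<theta> "\<delta> / 8" "- p"] ind d by auto
    define n :: "real^4" where "n = (\<chi> i. of_int (h i))"
    have "\<bar>(n - p - t *\<^sub>R \<theta>) $ i\<bar> \<le> \<delta> / 8" for i
    proof -
      have "(n - p - t *\<^sub>R \<theta>) $ i = - (t * \<theta> $ i - of_int (h i) - (- p) $ i)" by (simp add: n_def)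
      then show ?thesis using th[of i] by (simp only: abs_minus_cancel UNIV_I less_imp_le)
    qed
    then have "norm (n - p - t *\<^sub>R \<theta>) \<le> 4 * (\<delta> / 8)" by (rule norm_le_4)
    then have "norm (n - p - t *\<^sub>R \<theta>) < \<delta>" using d by simp
    moreover have "lattice_point n" by (simp add: n_def lattice_point_def)
    ultimately show ?thesis using that[of n "t *\<^sub>R \<theta>"] \<theta>(1) True by (simp add: span_scale)
  next
    case False
    then obtain l where l: "k $ l \<noteq> 0" by (auto simp: vec_eq_iff)
    obtain a b c where abc: "distinct [a, b, c, l]" using four_extend1 .
    have kZ: "k $ i \<in> \<int>" for i using k(1) by (simp add: int_normal_def lattice_point_def)
    have ind: "\<forall>i. c i = 0" if cl: "\<And>i. i \<notin> - {l} \<Longrightarrow> c i = 0" and cs: "(\<Sum>i\<in>UNIV. of_int (c i) * \<theta> $ i) = 0" for c :: "4 \<Rightarrow> int"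
    proof -
      obtain r where r: "(\<chi> i. of_int (c i)) = r *\<^sub>R k" using nrm[OF cs] by blast
      have "of_int (c l) = r * k $ l" using arg_cong[OF r, of "\<lambda>x. x $ l"] by simp
      then have "r = 0" using cl[of l] l by simp
      then show ?thesis using r by (auto simp: vec_eq_iff)
    qed
    \<comment> \<open>Kronecker is applied to the other three coordinates and to \<open>p\<close>
      divided by \<open>k $ l\<close>; multiplying back by \<open>\<kappa>\<close> lets the
      coordinate \<open>l\<close> be solved from orthogonality to \<open>k\<close> in
      integers.\<close>
    define \<kappa> where "\<kappa> = k $ l"
    define S where "S = \<bar>\<kappa>\<bar> + \<bar>k $ a\<bar> + \<bar>k $ b\<bar> + \<bar>k $ c\<bar>"
    have S: "S > 0" using l by (simp add: S_def \<kappa>_def add_pos_nonneg)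
    define \<epsilon> where "\<epsilon> = \<delta> / (8 * S)"
    have e0: "\<epsilon> > 0" using d S by (simp add: \<epsilon>_def)
    obtain t h where th: "\<And>i. i \<in> - {l} \<Longrightarrow> \<bar>t * \<theta> $ i - of_int (h i) - ((- 1 / \<kappa>) *\<^sub>R p) $ i\<bar> < \<epsilon>"
      using Kronecker_coordinates[of "- {l}" \<theta> \<epsilon> "(- 1 / \<kappa>) *\<^sub>R p"] ind e0 by auto
    define n :: "real^4" where "n = (\<chi> i. if i = l then - (k $ a * of_int (h a) + k $ b * of_int (h b) + k $ c * of_int (h c)) else \<kappa> * of_int (h i))"
    have nL: "lattice_point n" using kZ by (auto simp: n_def \<kappa>_def lattice_point_def intro!: Ints_mult Ints_add Ints_minus)
    have kn: "k \<bullet> n = 0" using abc unfolding inner_four[OF abc] by (simp add: n_def \<kappa>_def algebra_simps)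
    define e where "e = (\<kappa> * t) *\<^sub>R \<theta>"
    define x where "x = n - p - e"
    have eS: "e \<in> span {u, w}" unfolding e_def using \<theta>(1) by (rule span_scale)
    have "k \<bullet> e = 0" using inner_span_zero[OF _ _ eS] k(1) by (simp add: int_normal_def)
    then have kx: "k \<bullet> x = 0" using kn p by (simp add: x_def inner_diff_right)
    have xi: "\<bar>x $ i\<bar> \<le> \<bar>\<kappa>\<bar> * \<epsilon>" if "i \<noteq> l" for i
    proof -
      have "x $ i = - (\<kappa> * (t * \<theta> $ i - of_int (h i) - ((- 1 / \<kappa>) *\<^sub>R p) $ i))"
        using that l by (simp add: x_def n_def e_def \<kappa>_def field_simps)
      then have "\<bar>x $ i\<bar> = \<bar>\<kappa>\<bar> * \<bar>t * \<theta> $ i - of_int (h i) - ((- 1 / \<kappa>) *\<^sub>R p) $ i\<bar>" by (simp only: abs_minus_cancel abs_mult)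
      also have "\<dots> \<le> \<bar>\<kappa>\<bar> * \<epsilon>" using th[of i] that by (intro mult_left_mono) auto
      finally show ?thesis .
    qed
    have xl: "\<bar>x $ l\<bar> \<le> (\<bar>k $ a\<bar> + \<bar>k $ b\<bar> + \<bar>k $ c\<bar>) * \<epsilon>"
    proof -
      have "\<kappa> * x $ l = - (k $ a * x $ a + k $ b * x $ b + k $ c * x $ c)" using kx unfolding inner_four[OF abc] \<kappa>_def by linarith
      then have "\<bar>\<kappa>\<bar> * \<bar>x $ l\<bar> = \<bar>k $ a * x $ a + k $ b * x $ b + k $ c * x $ c\<bar>" by (metis abs_minus_cancel abs_mult)
      also have "\<dots> \<le> \<bar>k $ a\<bar> * \<bar>x $ a\<bar> + \<bar>k $ b\<bar> * \<bar>x $ b\<bar> + \<bar>k $ c\<bar> * \<bar>x $ c\<bar>"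
        unfolding abs_mult[symmetric] by linarith
      also have "\<dots> \<le> \<bar>k $ a\<bar> * (\<bar>\<kappa>\<bar> * \<epsilon>) + \<bar>k $ b\<bar> * (\<bar>\<kappa>\<bar> * \<epsilon>) + \<bar>k $ c\<bar> * (\<bar>\<kappa>\<bar> * \<epsilon>)"
        using abc xi by (intro add_mono mult_left_mono) auto
      also have "\<dots> = \<bar>\<kappa>\<bar> * ((\<bar>k $ a\<bar> + \<bar>k $ b\<bar> + \<bar>k $ c\<bar>) * \<epsilon>)" by (simp add: algebra_simps)
      finally show ?thesis using l by (simp add: \<kappa>_def)
    qed
    have "\<bar>x $ i\<bar> \<le> S * \<epsilon>" for i
    proof (cases "i = l")
      case True
      have "(\<bar>k $ a\<bar> + \<bar>k $ b\<bar> + \<bar>k $ c\<bar>) * \<epsilon> \<le> S * \<epsilon>" using e0 by (intro mult_right_mono) (auto simp: S_def)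
      with xl have "\<bar>x $ l\<bar> \<le> S * \<epsilon>" by (rule order_trans)
      then show ?thesis using True by simp
    next
      case False
      have "\<bar>\<kappa>\<bar> * \<epsilon> \<le> S * \<epsilon>" using e0 by (intro mult_right_mono) (auto simp: S_def)
      then show ?thesis using xi[OF False] by linarith
    qed
    then have "norm x \<le> 4 * (S * \<epsilon>)" by (rule norm_le_4)
    also have "\<dots> = \<delta> / 2" using S by (simp add: \<epsilon>_def)
    finally have "norm x < \<delta>" using d by simp
    then show ?thesis using that[OF nL eS _ kn] by (simp add: x_def)
  qed
qed

text \<open>Pigeonhole: each \<open>\<theta>\<close> spoils at most one of the equidistant phases.\<close>

lemma phase_avoiding:
  fixes \<Theta> :: "real set"
  assumes fin: "finite \<Theta>" and small: "2 * \<kappa> * (real (card \<Theta>) + 1) < 1"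
  obtains t where "\<And>\<theta> n. \<theta> \<in> \<Theta> \<Longrightarrow> n \<in> \<int> \<Longrightarrow> \<bar>n - t - \<theta>\<bar> > \<kappa>"
proof (rule ccontr)
  assume "\<not> thesis"
  then have no: "\<And>t. \<exists>\<theta>\<in>\<Theta>. \<exists>n\<in>\<int>. \<bar>n - t - \<theta>\<bar> \<le> \<kappa>" using that by (meson not_le)
  define N where "N = card \<Theta> + 1"
  have N0: "real N > 0" by (simp add: N_def)
  have "\<forall>j. \<exists>\<theta>. \<theta> \<in> \<Theta> \<and> (\<exists>n\<in>\<int>. \<bar>n - real j / real N - \<theta>\<bar> \<le> \<kappa>)" using no by blast
  from choice[OF this] obtain f where f: "\<And>j. f j \<in> \<Theta>" "\<And>j. \<exists>n\<in>\<int>. \<bar>n - real j / real N - f j\<bar> \<le> \<kappa>" by blast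
  have "card (f ` {..<N}) \<le> card \<Theta>" using f(1) fin by (intro card_mono) auto
  then have "card (f ` {..<N}) < card {..<N}" by (simp add: N_def)
  from pigeonhole[OF this] obtain i j where ij: "i < N" "j < N" "i \<noteq> j" "f i = f j" by (auto simp: inj_on_def)
  obtain n m where n: "n \<in> \<int>" "\<bar>n - real i / real N - f i\<bar> \<le> \<kappa>" and m: "m \<in> \<int>" "\<bar>m - real j / real N - f j\<bar> \<le> \<kappa>" using f(2) by blast
  have "\<bar>(n - m) - (real i - real j) / real N\<bar> \<le> 2 * \<kappa>" using n(2) m(2) ij(4) unfolding diff_divide_distrib by linarith
  then have "\<bar>(n - m) - (real i - real j) / real N\<bar> * real N \<le> 2 * \<kappa> * real N" by (intro mult_right_mono) auto
  also have "\<dots> < 1" using small by (simp add: N_def add.commute)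
  also have "\<bar>(n - m) - (real i - real j) / real N\<bar> * real N = \<bar>((n - m) - (real i - real j) / real N) * real N\<bar>" by (simp add: abs_mult)
  also have "((n - m) - (real i - real j) / real N) * real N = (n - m) * real N - (real i - real j)"
    unfolding left_diff_distrib[of "n - m"] using N0 by simp
  finally have "\<bar>(n - m) * real N - (real i - real j)\<bar> < 1" .
  moreover have "(n - m) * real N - (real i - real j) \<in> \<int>" using n(1) m(1) by (auto intro!: Ints_diff Ints_mult)
  ultimately have e: "(n - m) * real N = real i - real j" using Ints_small_zero[of "(n - m) * real N - (real i - real j)"] by simp
  have "\<bar>real i - real j\<bar> < real N" using ij by linarith
  then have "\<bar>n - m\<bar> * real N < 1 * real N" using e by (metis abs_mult abs_of_nat mult_1)
  then have "\<bar>n - m\<bar> < 1" using N0 by simp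
  then have "n - m = 0" using n m by (intro Ints_small_zero Ints_diff)
  then show False using e ij by simp
qed

text \<open>The component of \<open>\<nu>\<close> orthogonal to \<open>k\<close>, normalised. It
  allows moving the value of one normal while the other stays fixed.\<close>

lemma dual_vector:
  fixes k \<nu> :: "real^4"
  assumes "\<nexists>c. \<nu> = c *\<^sub>R k"
  obtains y where "k \<bullet> y = 0" "\<nu> \<bullet> y = 1"
proof -
  define y where "y = \<nu> - ((\<nu> \<bullet> k) / (k \<bullet> k)) *\<^sub>R k"
  have y0: "y \<noteq> 0" using assms by (auto simp: y_def)
  have ky: "k \<bullet> y = 0" by (simp add: y_def inner_diff_right inner_commute)
  have "y \<bullet> y = \<nu> \<bullet> y" using ky by (simp add: y_def inner_diff_left)
  then have "\<nu> \<bullet> y > 0" using y0 by (metis inner_gt_zero_iff)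
  then show ?thesis using ky by (intro that[of "(1 / (\<nu> \<bullet> y)) *\<^sub>R y"]) auto
qed

section \<open>Triples sorted by type\<close>

lemma triple_permute:
  assumes "distinct [i, j, k, l]" "distinct [a, b, c, l]"
  obtains \<sigma> :: real where "\<sigma> = 1 \<or> \<sigma> = -1" "\<And>u w p. triple u w i j k p = \<sigma> * triple u w a b c p"
proof -
  have i: "i \<in> {a, b, c, l}" "j \<in> {a, b, c, l}" "k \<in> {a, b, c, l}" using UNIV_four[OF assms(2)] by blast+
  then consider "i = a" "j = b" "k = c" | "i = a" "j = c" "k = b" | "i = b" "j = a" "k = c" | "i = b" "j = c" "k = a"
    | "i = c" "j = a" "k = b" | "i = c" "j = b" "k = a" using assms by auto
  then show ?thesis
  proof cases
    case 1 then show ?thesis by (intro that[of 1]) auto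
  next
    case 2 then show ?thesis by (intro that[of "-1"]) (auto simp: triple_def grass_def algebra_simps)
  next
    case 3 then show ?thesis by (intro that[of "-1"]) (auto simp: triple_def grass_def algebra_simps)
  next
    case 4 then show ?thesis by (intro that[of 1]) (auto simp: triple_def grass_def algebra_simps)
  next
    case 5 then show ?thesis by (intro that[of 1]) (auto simp: triple_def grass_def algebra_simps)
  next
    case 6 then show ?thesis by (intro that[of "-1"]) (auto simp: triple_def grass_def algebra_simps)
  qed
qed

text \<open>The order chosen here affects a triple of type \<open>l\<close> only by its sign.\<close>

definition others :: "4 \<Rightarrow> 4 \<times> 4 \<times> 4" where
  "others l = (SOME (i, j, k). distinct [i, j, k, l])"

definition typed :: "4 \<Rightarrow> real^4 \<Rightarrow> real^4 \<Rightarrow> real^4 \<Rightarrow> real" where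
  "typed l u w = (case others l of (i, j, k) \<Rightarrow> triple u w i j k)"

definition tnormal :: "4 \<Rightarrow> real^4 \<Rightarrow> real^4 \<Rightarrow> real^4" where
  "tnormal l u w = (case others l of (i, j, k) \<Rightarrow> normal i j k u w)"

lemma others: obtains i j k where "others l = (i, j, k)" "distinct [i, j, k, l]"
proof -
  obtain a b c where "distinct [a, b, c, l]" using four_extend1 .
  then have "\<exists>t. case t of (i, j, k) \<Rightarrow> distinct [i, j, k, l]" by (intro exI[of _ "(a, b, c)"]) auto
  from someI_ex[OF this] have "case others l of (i, j, k) \<Rightarrow> distinct [i, j, k, l]" by (simp add: others_def)
  then show ?thesis using that by (cases "others l") auto
qed

lemma typed_inner: "typed l u w p = tnormal l u w \<bullet> p"
  by (rule others[of l]) (simp add: typed_def tnormal_def normal_inner)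

lemma typed_linear [simp]:
  "typed l u w (p + q) = typed l u w p + typed l u w q" "typed l u w (p - q) = typed l u w p - typed l u w q"
  "typed l u w (c *\<^sub>R p) = c * typed l u w p"
  by (simp_all add: typed_inner inner_add_right inner_diff_right)

lemma typed_span: "p \<in> span {u, w} \<Longrightarrow> typed l u w p = 0"
  by (rule others[of l]) (simp add: typed_def triple_span)

lemma triple_typed:
  assumes "distinct [i, j, k, l]"
  obtains \<sigma> :: real where "\<sigma> = 1 \<or> \<sigma> = -1" "\<And>u w p. triple u w i j k p = \<sigma> * typed l u w p"
proof -
  obtain a b c where o: "others l = (a, b, c)" "distinct [a, b, c, l]" using others .
  show ?thesis using triple_permute[OF assms o(2)] that by (auto simp: typed_def o(1))
qed

lemma tnormal_self: "tnormal l u w $ l = 0"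
proof -
  obtain a b c where o: "others l = (a, b, c)" "distinct [a, b, c, l]" using others .
  then show ?thesis by (simp add: tnormal_def normal_nth)
qed

lemma tnormal_other:
  assumes "l' \<noteq> l" obtains i j where "i \<noteq> j" "\<And>u w. \<bar>tnormal l u w $ l'\<bar> = \<bar>grass u w i j\<bar>"
proof -
  obtain a b c where o: "others l = (a, b, c)" "distinct [a, b, c, l]" using others .
  have "l' \<in> {a, b, c, l}" using UNIV_four[OF o(2)] by blast
  then consider "l' = a" | "l' = b" | "l' = c" using assms by blast
  then show ?thesis
  proof cases
    case 1 then show ?thesis using o(2) by (intro that[of b c]) (auto simp: tnormal_def o(1) normal_nth[OF o(2)])
  next
    case 2 then show ?thesis using o(2) by (intro that[of a c]) (auto simp: tnormal_def o(1) normal_nth[OF o(2)])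
  next
    case 3 then show ?thesis using o(2) by (intro that[of a b]) (auto simp: tnormal_def o(1) normal_nth[OF o(2)])
  qed
qed

lemma tnormal_parallel:
  assumes "n \<bullet> u = 0" "n \<bullet> w = 0" "n $ l = 0" "n \<noteq> 0"
  obtains c where "tnormal l u w = c *\<^sub>R n"
proof -
  obtain a b c where o: "others l = (a, b, c)" "distinct [a, b, c, l]" using others .
  show ?thesis using normal_parallel[OF o(2) assms] that by (auto simp: tnormal_def o(1))
qed

lemma typed_inherits:
  assumes "inherits_subperiods u w u' w'" "lattice_point m" "typed l u w m = 0" shows "typed l u' w' m = 0"
proof -
  obtain a b c where o: "others l = (a, b, c)" "distinct [a, b, c, l]" using others .
  then show ?thesis using assms unfolding inherits_subperiods_def by (auto simp: typed_def)
qed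

lemma typed_diff_le:
  assumes "norm (u' - u) \<le> s" "norm (w' - w) \<le> s" "s \<le> 1"
  shows "\<bar>typed l u' w' p - typed l u w p\<bar> \<le> 6 * (norm u + norm w + 1) * s * norm p"
proof -
  obtain a b c where o: "others l = (a, b, c)" "distinct [a, b, c, l]" using others .
  have s0: "s \<ge> 0" using assms(1) norm_ge_zero order_trans by blast
  define K where "K = 2 * s * (norm u + norm w + 1)"
  have K: "\<bar>grass u' w' i j - grass u w i j\<bar> \<le> K" for i j
  proof -
    have "\<bar>grass u' w' i j - grass u w i j\<bar> \<le> 2 * s * (norm u + norm w + s)" using assms abs_grass_diff_le by blast
    also have "\<dots> \<le> K" unfolding K_def using s0 assms by (intro mult_left_mono) auto
    finally show ?thesis .
  qed
  have "typed l u' w' p - typed l u w p = (grass u' w' b c - grass u w b c) * p $ a - (grass u' w' a c - grass u w a c) * p $ b + (grass u' w' a b - grass u w a b) * p $ c"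
    by (simp add: typed_def o(1) triple_def algebra_simps)
  then have "\<bar>typed l u' w' p - typed l u w p\<bar> \<le> \<bar>grass u' w' b c - grass u w b c\<bar> * \<bar>p $ a\<bar> + \<bar>grass u' w' a c - grass u w a c\<bar> * \<bar>p $ b\<bar> + \<bar>grass u' w' a b - grass u w a b\<bar> * \<bar>p $ c\<bar>"
    unfolding abs_mult[symmetric] by linarith
  also have "\<dots> \<le> K * norm p + K * norm p + K * norm p"
    using K s0 by (intro add_mono mult_mono component_le_norm_cart) (auto simp: K_def)
  also have "\<dots> = 6 * (norm u + norm w + 1) * s * norm p" by (simp add: K_def algebra_simps)
  finally show ?thesis .
qed

lemma tnormal_nonzero:
  assumes "nondeg u w" "l' \<noteq> l" shows "tnormal l u w $ l' \<noteq> 0"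
  using tnormal_other[OF assms(2)] assms(1) unfolding nondeg_def by (metis abs_eq_0_iff)

text \<open>Two normals of different types span the annihilator of the plane.\<close>

lemma normal_combination:
  assumes nd: "nondeg u w" and l: "l \<noteq> l'" and n: "\<nu> \<bullet> u = 0" "\<nu> \<bullet> w = 0"
  shows "\<nu> \<bullet> p = \<nu> $ l' / tnormal l u w $ l' * typed l u w p + \<nu> $ l / tnormal l' u w $ l * typed l' u w p"
proof -
  define A where "A = \<nu> $ l' / tnormal l u w $ l'"
  define B where "B = \<nu> $ l / tnormal l' u w $ l"
  obtain i j where ij: "distinct [i, j, l, l']" using four_extend2[OF l] .
  have AB: "A * tnormal l u w $ l' = \<nu> $ l'" "B * tnormal l' u w $ l = \<nu> $ l"
    using tnormal_nonzero[OF nd] l by (simp_all add: A_def B_def)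
  define x where "x = \<nu> - A *\<^sub>R tnormal l u w - B *\<^sub>R tnormal l' u w"
  have x0: "x $ l = 0" "x $ l' = 0" using AB by (simp_all add: x_def tnormal_self)
  have "u \<in> span {u, w}" "w \<in> span {u, w}" by (auto intro: span_base)
  then have "x \<bullet> u = 0" "x \<bullet> w = 0" using n by (simp_all add: x_def inner_diff_left typed_inner[symmetric] typed_span)
  then have e: "x $ i * u $ i + x $ j * u $ j = 0" "x $ i * w $ i + x $ j * w $ j = 0" using x0 unfolding inner_four[OF ij] by simp_all
  have g: "grass u w i j \<noteq> 0" using nd ij by (simp add: nondeg_def)
  have "x $ i * grass u w i j = (x $ i * u $ i + x $ j * u $ j) * w $ j - (x $ i * w $ i + x $ j * w $ j) * u $ j"
    "x $ j * grass u w i j = (x $ i * w $ i + x $ j * w $ j) * u $ i - (x $ i * u $ i + x $ j * u $ j) * w $ i"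
    by (simp_all add: grass_def algebra_simps)
  then have "x $ i = 0" "x $ j = 0" unfolding e using g by simp_all
  then have "x = 0" using x0 by (intro vec_eq_four[OF ij]) auto
  then have "\<nu> = A *\<^sub>R tnormal l u w + B *\<^sub>R tnormal l' u w" by (simp add: x_def algebra_simps)
  then have "\<nu> \<bullet> p = A * typed l u w p + B * typed l' u w p" by (metis inner_add_left inner_scaleR_left typed_inner)
  then show ?thesis by (simp add: A_def B_def)
qed

lemma pos_lower_bound:
  fixes S :: "real set" assumes "finite S"
  obtains \<mu> where "\<mu> > 0" "\<And>x. x \<in> S \<Longrightarrow> x \<noteq> 0 \<Longrightarrow> \<mu> \<le> \<bar>x\<bar>"
proof -
  define A where "A = insert 1 (abs ` (S - {0}))"
  have "finite A" "A \<noteq> {}" using assms by (auto simp: A_def)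
  then have "Min A > 0" by (subst Min_gr_iff) (auto simp: A_def)
  moreover have "Min A \<le> \<bar>x\<bar>" if "x \<in> S" "x \<noteq> 0" for x using \<open>finite A\<close> that by (intro Min_le) (auto simp: A_def)
  ultimately show ?thesis using that by blast
qed

lemma sgn_stable:
  fixes x y :: real assumes "\<bar>y - x\<bar> \<le> d" "d < \<bar>x\<bar>" shows "sgn y = sgn x" "y \<noteq> 0" "x \<noteq> 0"
  using assms by (auto simp: sgn_real_def abs_if split: if_splits)

text \<open>Applied to products of \<open>k\<close> with lattice points relative to
  \<open>a\<close>: they cannot be small without vanishing.\<close>

lemma discrete_coset:
  fixes x :: real
  obtains \<zeta> where "\<zeta> > 0" "\<And>n. n \<in> \<int> \<Longrightarrow> n - x \<noteq> 0 \<Longrightarrow> \<zeta> \<le> \<bar>n - x\<bar>"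
proof -
  obtain \<mu> where \<mu>: "\<mu> > 0" "\<And>y. y \<in> {of_int \<lfloor>x\<rfloor> - x, of_int \<lfloor>x\<rfloor> + 1 - x} \<Longrightarrow> y \<noteq> 0 \<Longrightarrow> \<mu> \<le> \<bar>y\<bar>"
    using pos_lower_bound[of "{of_int \<lfloor>x\<rfloor> - x, of_int \<lfloor>x\<rfloor> + 1 - x}"] by auto
  show ?thesis
  proof (rule that[of "min 1 \<mu>"])
    show "min 1 \<mu> > 0" using \<mu> by simp
    fix n :: real assume n: "n \<in> \<int>" "n - x \<noteq> 0"
    obtain i where i: "n = of_int i" using n by (auto elim: Ints_cases)
    show "min 1 \<mu> \<le> \<bar>n - x\<bar>"
    proof (cases "i \<le> \<lfloor>x\<rfloor>")
      case True
      show ?thesis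
      proof (cases "i = \<lfloor>x\<rfloor>")
        case True then show ?thesis using \<mu>(2)[of "of_int \<lfloor>x\<rfloor> - x"] n i by auto
      next
        case False
        then have "i + 1 \<le> \<lfloor>x\<rfloor>" using \<open>i \<le> _\<close> by simp
        then have "n + 1 \<le> x" using i by linarith
        then show ?thesis by (simp add: min_def)
      qed
    next
      case False
      show ?thesis
      proof (cases "i = \<lfloor>x\<rfloor> + 1")
        case True then show ?thesis using \<mu>(2)[of "of_int \<lfloor>x\<rfloor> + 1 - x"] n i by auto
      next
        case False
        then have "\<lfloor>x\<rfloor> + 2 \<le> i" using \<open>\<not> i \<le> _\<close> by simp
        then have "n \<ge> x + 1" using i by linarith
        then show ?thesis by (simp add: min_def)
      qed
    qed
  qed
qed

definition lex_typed :: "real^4 \<Rightarrow> real^4 \<Rightarrow> real^4 \<Rightarrow> real^4 \<Rightarrow> 4 \<Rightarrow> real^4 \<Rightarrow> real" where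
  "lex_typed u w a b l p = (if typed l u w (p - a) \<noteq> 0 then typed l u w (p - a) else typed l u w b)"

text \<open>Heart of the argument. The phase \<open>a'\<close> keeps the grid of the approximating plane away from
  all points where triangles of two different types degenerate in the given plane; next to a
  degeneration of a single type, moving the point slightly restores every sign.\<close>

lemma window:
  assumes nd: "nondeg u w" and k: "int_normal u w k" "\<And>k'. int_normal u w k' \<Longrightarrow> \<exists>c. k' = c *\<^sub>R k"
    and app: "approximable u w k" and b: "\<And>l. typed l u w b \<noteq> 0" and e0: "\<epsilon>\<^sub>0 > 0" and R0: "R \<ge> 0"
  obtains u' w' a' where "norm (u' - u) < \<epsilon>\<^sub>0" "norm (w' - w) < \<epsilon>\<^sub>0" "span {u', w'} \<noteq> span {u, w}"
    "nondeg u' w'" "\<And>l. typed l u' w' b \<noteq> 0"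
    "\<And>n0 f. lattice_point n0 \<Longrightarrow> f \<in> span {u', w'} \<Longrightarrow> (\<And>i. 0 \<le> (n0 - a' - f) $ i \<and> (n0 - a' - f) $ i \<le> 1) \<Longrightarrow>
       \<exists>n1. lattice_point n1 \<and> (\<forall>l m. lattice_point m \<longrightarrow> norm m \<le> R \<longrightarrow>
         sgn (lex_typed u w a b l (n1 + m)) = sgn (lex_typed u' w' a' b l (n0 + m)))"
proof -
  define M where "M = {m. lattice_point m \<and> norm m \<le> R}"
  define M2 where "M2 = {m. lattice_point m \<and> norm m \<le> 2 * R}"
  have finM: "finite M" "finite M2" unfolding M_def M2_def by (rule finite_lattice_points)+
  have U1: "norm u + norm w + 1 > 0" by (smt (verit) norm_ge_zero)
  \<comment> \<open>Replacing the plane changes the typed forms by at most \<open>c1 * s\<close> on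
    vectors of norm up to \<open>R + 4\<close>: a lattice vector up to \<open>R\<close> plus an
    offset in the unit cube.\<close>
  define c1 where "c1 = 6 * (norm u + norm w + 1) * (R + 4)"
  define cb where "cb = 6 * (norm u + norm w + 1) * norm b"
  have c1: "c1 > 0" unfolding c1_def using U1 R0 by simp
  have cb: "cb \<ge> 0" unfolding cb_def using U1 by simp
  have "\<forall>l. \<exists>d. (\<nexists>c. tnormal l u w = c *\<^sub>R k) \<longrightarrow> k \<bullet> d = 0 \<and> tnormal l u w \<bullet> d = 1" using dual_vector by metis
  \<comment> \<open>A direction that raises the form of type \<open>l\<close> at unit rate within
    the slice of \<open>k\<close>; it exists unless the normal of type \<open>l\<close> is a
    multiple of \<open>k\<close>.\<close>
  from choice[OF this] obtain dd where dd: "\<And>l. (\<nexists>c. tnormal l u w = c *\<^sub>R k) \<Longrightarrow> k \<bullet> dd l = 0 \<and> typed l u w (dd l) = 1"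
    unfolding typed_inner by blast
  define D where "D = (\<Sum>l\<in>UNIV. \<Sum>l'\<in>UNIV. \<bar>typed l' u w (dd l)\<bar>)"
  have D: "\<bar>typed l' u w (dd l)\<bar> \<le> D" for l l'
  proof -
    have "\<bar>typed l' u w (dd l)\<bar> \<le> (\<Sum>l'\<in>UNIV. \<bar>typed l' u w (dd l)\<bar>)" by (rule member_le_sum) auto
    also have "\<dots> \<le> D" unfolding D_def by (rule member_le_sum[of l UNIV "\<lambda>l. \<Sum>l'\<in>UNIV. \<bar>typed l' u w (dd l)\<bar>"]) (auto intro: sum_nonneg)
    finally show ?thesis .
  qed
  have D0: "D \<ge> 0" unfolding D_def by (intro sum_nonneg) auto
  \<comment> \<open>The threshold for being nearly degenerate. It exceeds the plane error
    \<open>c1\<close> and also the effect \<open>3 * c1 * D\<close> that the correcting move has on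
    the other forms.\<close>
  define c2 where "c2 = c1 * (2 + 3 * D)"
  have "c1 * 1 \<le> c1 * (2 + 3 * D)" using c1 D0 by (intro mult_left_mono) auto
  then have c12: "c1 \<le> c2" by (simp add: c2_def)
  have c2: "c2 > 0" "3 * c1 * D < c2" "c1 < c2" using c1 D0 by (auto simp: c2_def algebra_simps add_pos_nonneg)
  have "finite ((\<lambda>(l, m). typed l u w m) ` (UNIV \<times> M2))" using finM by simp
  \<comment> \<open>The radius is doubled because differences of two vectors of \<open>M\<close> are
    considered: two nearly degenerate values of one type must then differ by exactly zero.\<close>
  from pos_lower_bound[OF this] obtain \<mu>1 where \<mu>1: "\<mu>1 > 0" "\<And>l m. m \<in> M2 \<Longrightarrow> typed l u w m \<noteq> 0 \<Longrightarrow> \<mu>1 \<le> \<bar>typed l u w m\<bar>"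
    by (metis (no_types, lifting) SigmaI UNIV_I case_prod_conv image_eqI)
  have "finite ((\<lambda>l. typed l u w b) ` UNIV)" by simp
  from pos_lower_bound[OF this] obtain \<mu>2 where \<mu>2: "\<mu>2 > 0" "\<And>l. \<mu>2 \<le> \<bar>typed l u w b\<bar>" using b by (metis rangeI)
  have "finite ((\<lambda>(i, j). grass u w i j) ` UNIV)" by simp
  from pos_lower_bound[OF this] obtain g where g: "g > 0" "\<And>i j. i \<noteq> j \<Longrightarrow> g \<le> \<bar>grass u w i j\<bar>"
    using nd unfolding nondeg_def by (metis (mono_tags, lifting) UNIV_I case_prod_conv image_eqI)
  obtain \<zeta> where \<zeta>: "\<zeta> > 0" "\<And>n. n \<in> \<int> \<Longrightarrow> n - k \<bullet> a \<noteq> 0 \<Longrightarrow> \<zeta> \<le> \<bar>n - k \<bullet> a\<bar>" using discrete_coset[of "k \<bullet> a"] by blast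
  have "\<forall>l. \<exists>c. (\<exists>c. tnormal l u w = c *\<^sub>R k) \<longrightarrow> tnormal l u w = c *\<^sub>R k" by blast
  from choice[OF this] obtain rr where rr: "\<And>l. (\<exists>c. tnormal l u w = c *\<^sub>R k) \<Longrightarrow> tnormal l u w = rr l *\<^sub>R k" by blast
  have "finite (rr ` UNIV)" by simp
  from pos_lower_bound[OF this] obtain \<mu>3 where \<mu>3: "\<mu>3 > 0" "\<And>l. rr l \<noteq> 0 \<Longrightarrow> \<mu>3 \<le> \<bar>rr l\<bar>" by (metis rangeI)
  have tn0: "tnormal l u w \<noteq> 0" for l
  proof -
    obtain l' where "l' \<noteq> l" by (metis zero_neq_one)
    from tnormal_nonzero[OF nd this] show ?thesis by auto
  qed
  obtain e1 where e1: "e1 > 0" "\<And>u' w'. norm (u' - u) \<le> e1 \<Longrightarrow> norm (w' - w) \<le> e1 \<Longrightarrow> nondeg u' w' \<and>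
      (\<forall>i j. \<bar>grass u w i j\<bar> / 2 \<le> \<bar>grass u' w' i j\<bar> \<and> grass u w i j * grass u' w' i j \<ge> 0)" using nondeg_open[OF nd] by blast
  define N where "N = card ((UNIV :: 4 set) \<times> M \<times> (UNIV :: 4 set) \<times> M)"
  \<comment> \<open>After the first three entries, each gap serves one argument: equality of nearly
    degenerate values of one type, signs at \<open>b\<close>, types whose normal is a multiple of
    \<open>k\<close>, and the length of the forbidden phase intervals.\<close>
  define \<epsilon> where "\<epsilon> = Min {\<epsilon>\<^sub>0, 1, e1, \<mu>1 / (2 * c2), \<mu>2 / (cb + 1), \<mu>3 * \<zeta> / c1, g / (16 * (c1 + c2) * (real N + 1))}"
  have "0 < \<mu>1 / (2 * c2)" "0 < \<mu>2 / (cb + 1)" "0 < \<mu>3 * \<zeta> / c1" "0 < g / (16 * (c1 + c2) * (real N + 1))"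
    using \<mu>1(1) \<mu>2(1) \<mu>3(1) \<zeta>(1) g(1) c1 c2(1) cb by (auto intro!: divide_pos_pos mult_pos_pos add_pos_pos)
  then have epos: "\<epsilon> > 0" unfolding \<epsilon>_def using e0 e1(1) by (subst Min_gr_iff) auto
  have eps: "\<epsilon> \<le> \<epsilon>\<^sub>0" "\<epsilon> \<le> 1" "\<epsilon> \<le> e1" "\<epsilon> \<le> \<mu>1 / (2 * c2)" "\<epsilon> \<le> \<mu>2 / (cb + 1)" "\<epsilon> \<le> \<mu>3 * \<zeta> / c1" "\<epsilon> \<le> g / (16 * (c1 + c2) * (real N + 1))"
    unfolding \<epsilon>_def by (rule Min_le, simp, blast)+
  from app[unfolded approximable_def, rule_format, OF epos] obtain u' w' \<nu> s where
    s: "0 \<le> s" "s < \<epsilon>" and us: "norm (u' - u) \<le> s" and ws: "norm (w' - w) \<le> s" and \<nu>: "lattice_point \<nu>" "\<nu> \<bullet> u' = 0" "\<nu> \<bullet> w' = 0"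
    "norm \<nu> * s < \<epsilon>" "\<nexists>c. \<nu> = c *\<^sub>R k" and k': "k \<bullet> u' = 0" "k \<bullet> w' = 0" and inh: "inherits_subperiods u w u' w'"
    and ne: "span {u', w'} \<noteq> span {u, w}" by blast
  have s0: "s > 0"
  proof (rule ccontr)
    assume "\<not> s > 0"
    then have "s = 0" using s by simp
    then have "u' = u" "w' = w" using us ws by auto
    then show False using ne by simp
  qed
  have nd': "nondeg u' w'" and gr': "\<And>i j. i \<noteq> j \<Longrightarrow> g / 2 \<le> \<bar>grass u' w' i j\<bar>"
  proof -
    have "norm (u' - u) \<le> e1" "norm (w' - w) \<le> e1" using us ws s eps(3) by linarith+
    from e1(2)[OF this] show "nondeg u' w'" "\<And>i j. i \<noteq> j \<Longrightarrow> g / 2 \<le> \<bar>grass u' w' i j\<bar>" using g(2) by (auto, smt (verit) divide_right_mono)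
  qed
  have s1: "s \<le> 1" using s eps(2) by linarith
  define X where "X l p = typed l u w p" for l p
  define X' where "X' l p = typed l u' w' p" for l p
  have Xlin [simp]: "X l (p + q) = X l p + X l q" "X l (p - q) = X l p - X l q" "X l (c *\<^sub>R p) = c * X l p"
    "X' l (p + q) = X' l p + X' l q" "X' l (p - q) = X' l p - X' l q" "X' l (c *\<^sub>R p) = c * X' l p" for l p q c by (simp_all add: X_def X'_def)
  have close: "\<bar>X' l p - X l p\<bar> \<le> c1 * s" if "norm p \<le> R + 4" for l p
  proof -
    have "\<bar>X' l p - X l p\<bar> \<le> 6 * (norm u + norm w + 1) * s * norm p" unfolding X_def X'_def by (rule typed_diff_le[OF us ws s1])
    also have "\<dots> \<le> 6 * (norm u + norm w + 1) * s * (R + 4)" using that U1 s by (intro mult_left_mono) auto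
    finally show ?thesis by (simp add: c1_def algebra_simps)
  qed
  have bsgn: "sgn (X' l b) = sgn (X l b)" "X' l b \<noteq> 0" for l
  proof -
    have 1: "\<bar>X' l b - X l b\<bar> \<le> cb * s" using typed_diff_le[OF us ws s1, of l b] by (simp add: X_def X'_def cb_def algebra_simps)
    have "cb * s \<le> (cb + 1) * s" using s by (simp add: mult_right_mono)
    also have "\<dots> < (cb + 1) * \<epsilon>" using s cb by (intro mult_strict_left_mono) auto
    also have "\<dots> \<le> \<mu>2" using eps(5) cb by (simp add: field_simps)
    also have "\<dots> \<le> \<bar>X l b\<bar>" using \<mu>2 by (simp add: X_def)
    finally have 2: "cb * s < \<bar>X l b\<bar>" .
    show "sgn (X' l b) = sgn (X l b)" "X' l b \<noteq> 0" using sgn_stable[OF 1 2] by auto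
  qed
  define A where "A l l' = \<nu> $ l' / tnormal l u' w' $ l'" for l l'
  have A: "\<bar>A l l'\<bar> \<le> 2 / g * norm \<nu>" if ll: "l' \<noteq> l" for l l'
  proof -
    obtain i j where ij: "i \<noteq> j" "\<And>u w. \<bar>tnormal l u w $ l'\<bar> = \<bar>grass u w i j\<bar>" using tnormal_other[OF ll] by blast
    have "\<bar>A l l'\<bar> = \<bar>\<nu> $ l'\<bar> / \<bar>grass u' w' i j\<bar>" by (simp add: A_def abs_divide ij(2))
    also have "\<dots> \<le> norm \<nu> / (g / 2)" using gr'[OF ij(1)] g(1) component_le_norm_cart[of \<nu> l'] by (intro frac_le) auto
    finally show ?thesis by (simp add: mult.commute)
  qed
  \<comment> \<open>The size of the combination of two typed forms that are both at most
    \<open>(c1 + c2) * s\<close>; it is small because \<open>norm \<nu> * s\<close> is.\<close>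
  define \<kappa> where "\<kappa> = 4 / g * (c1 + c2) * (norm \<nu> * s)"
  \<comment> \<open>The phases at which forms of the types \<open>l\<close> and \<open>l'\<close>
    could be small at once, at the neighbours \<open>m\<close> and \<open>m'\<close>. Their number
    is bounded independently of the approximating plane.\<close>
  define \<Theta> where "\<Theta> = (\<lambda>(l, m, l', m'). \<nu> \<bullet> a - (A l l' * X' l m + A l' l * X' l' m')) ` (UNIV \<times> M \<times> UNIV \<times> M)"
  have fin\<Theta>: "finite \<Theta>" unfolding \<Theta>_def using finM by simp
  have card\<Theta>: "card \<Theta> \<le> N" unfolding \<Theta>_def N_def using finM by (intro card_image_le) simp
  have \<kappa>: "2 * \<kappa> * (real (card \<Theta>) + 1) < 1"
  proof -
    have P: "c1 + c2 > 0" "real N + 1 > 0" using c1 c2 by auto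
    have \<kappa>0: "\<kappa> \<ge> 0" unfolding \<kappa>_def using g(1) P s by simp
    have "\<kappa> \<le> 4 / g * (c1 + c2) * \<epsilon>" unfolding \<kappa>_def using \<nu>(4) g(1) P by (intro mult_left_mono) auto
    also have "\<dots> \<le> 4 / g * (c1 + c2) * (g / (16 * (c1 + c2) * (real N + 1)))" using eps(7) g(1) P by (intro mult_left_mono) auto
    also have "\<dots> = 1 / (4 * (real N + 1))"
    proof -
      have "4 / g * C * (g / (16 * C * n)) = 1 / (4 * n)" if "C > 0" "n > 0" for C n using that g(1) by (simp add: field_simps)
      then show ?thesis using P by blast
    qed
    finally have "\<kappa> * (real N + 1) \<le> 1 / 4" using P by (simp add: field_simps)
    moreover have "\<kappa> * (real (card \<Theta>) + 1) \<le> \<kappa> * (real N + 1)" using card\<Theta> \<kappa>0 by (intro mult_left_mono) auto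
    ultimately show ?thesis by linarith
  qed
  obtain t where t: "\<And>\<theta> n. \<theta> \<in> \<Theta> \<Longrightarrow> n \<in> \<int> \<Longrightarrow> \<bar>n - t - \<theta>\<bar> > \<kappa>" using phase_avoiding[OF fin\<Theta> \<kappa>] by blast
  obtain b1 where b1: "k \<bullet> b1 = 0" "\<nu> \<bullet> b1 = 1" using dual_vector[OF \<nu>(5)] .
  \<comment> \<open>Moving along \<open>b1\<close> sets the phase of \<open>\<nu>\<close> while
    leaving the product with \<open>k\<close> equal to that of \<open>a\<close>.\<close>
  define a' where "a' = a + t *\<^sub>R b1"
  have main: "\<exists>n1. lattice_point n1 \<and> (\<forall>l m. lattice_point m \<longrightarrow> norm m \<le> R \<longrightarrow>
         sgn (lex_typed u w a b l (n1 + m)) = sgn (lex_typed u' w' a' b l (n0 + m)))"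
    if n0: "lattice_point n0" and f: "f \<in> span {u', w'}" and cube: "\<And>i. 0 \<le> (n0 - a' - f) $ i \<and> (n0 - a' - f) $ i \<le> 1" for n0 f
  proof -
    \<comment> \<open>The offset of \<open>n0\<close> from the approximating plane. Modulo the
      plane, \<open>z + m\<close> is the position of the neighbour \<open>n0 + m\<close>.\<close>
    define z where "z = n0 - a' - f"
    have "\<bar>z $ i\<bar> \<le> 1" for i using cube[of i] by (simp add: z_def)
    then have nz: "norm z \<le> 4" using norm_le_4[of z 1] by simp
    have zm: "norm (z + m) \<le> R + 4" if "m \<in> M" for m using norm_triangle_ineq[of z m] nz that by (simp add: M_def)
    have cl: "\<bar>X' l (z + m) - X l (z + m)\<bar> \<le> c1 * s" if "m \<in> M" for l m using close[OF zm[OF that]] .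
    have "\<nu> \<bullet> f = 0" "k \<bullet> f = 0" using inner_span_zero[OF _ _ f] \<nu>(2,3) k' by auto
    then have \<nu>z: "\<nu> \<bullet> z = \<nu> \<bullet> n0 - t - \<nu> \<bullet> a" and kz: "k \<bullet> z = k \<bullet> n0 - k \<bullet> a"
      by (simp_all add: z_def a'_def inner_diff_right inner_add_right b1)
    \<comment> \<open>Evaluating \<open>\<nu>\<close> at \<open>z\<close> through the two forms
      would put its phase into a forbidden interval.\<close>
    have one_type: "l = l'" if m: "m \<in> M" "\<bar>X l (z + m)\<bar> \<le> c2 * s" and m': "m' \<in> M" "\<bar>X l' (z + m')\<bar> \<le> c2 * s" for l m l' m'
    proof (rule ccontr)
      assume ll: "l \<noteq> l'"
      have "\<nu> \<bullet> z = A l l' * X' l z + A l' l * X' l' z" unfolding A_def X'_def by (rule normal_combination[OF nd' ll \<nu>(2,3)])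
      then have "\<nu> \<bullet> n0 - t - (\<nu> \<bullet> a - (A l l' * X' l m + A l' l * X' l' m')) = A l l' * X' l (z + m) + A l' l * X' l' (z + m')"
        unfolding \<nu>z by (simp add: algebra_simps)
      also have "\<bar>\<dots>\<bar> \<le> \<bar>A l l'\<bar> * \<bar>X' l (z + m)\<bar> + \<bar>A l' l\<bar> * \<bar>X' l' (z + m')\<bar>" by (metis abs_mult abs_triangle_ineq)
      also have "\<dots> \<le> (2 / g * norm \<nu>) * ((c1 + c2) * s) + (2 / g * norm \<nu>) * ((c1 + c2) * s)"
      proof (intro add_mono mult_mono)
        show "\<bar>A l l'\<bar> \<le> 2 / g * norm \<nu>" "\<bar>A l' l\<bar> \<le> 2 / g * norm \<nu>" using A ll by auto
        show "\<bar>X' l (z + m)\<bar> \<le> (c1 + c2) * s" using cl[OF m(1), of l] m(2) unfolding distrib_right by linarith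
        show "\<bar>X' l' (z + m')\<bar> \<le> (c1 + c2) * s" using cl[OF m'(1), of l'] m'(2) unfolding distrib_right by linarith
      qed (use g(1) in auto)
      also have "\<dots> = \<kappa>" by (simp add: \<kappa>_def algebra_simps)
      finally have "\<bar>\<nu> \<bullet> n0 - t - (\<nu> \<bullet> a - (A l l' * X' l m + A l' l * X' l' m'))\<bar> \<le> \<kappa>" .
      moreover have "\<nu> \<bullet> a - (A l l' * X' l m + A l' l * X' l' m') \<in> \<Theta>"
        unfolding \<Theta>_def using m(1) m'(1) by (intro image_eqI[of _ _ "(l, m, l', m')"]) auto
      ultimately show False using t[OF _ lattice_inner[OF \<nu>(1) n0]] by fastforce
    qed
    define lv where "lv l m = (if X' l (z + m) \<noteq> 0 then X' l (z + m) else X' l b)" for l m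
    have lv0: "lv l m \<noteq> 0" for l m using bsgn by (simp add: lv_def)
    \<comment> \<open>The difference of the two vectors is a bounded lattice vector with a form too
      small to be nonzero. It is thus a subperiod, inherited by the approximating plane, so the
      values agree for both planes.\<close>
    have same: "X l (z + m) = X l (z + m0) \<and> X' l (z + m) = X' l (z + m0)"
      if m: "m \<in> M" "\<bar>X l (z + m)\<bar> \<le> c2 * s" and m0: "m0 \<in> M" "\<bar>X l (z + m0)\<bar> \<le> c2 * s" for l m m0
    proof -
      have L: "lattice_point (m - m0)" using m(1) m0(1) by (auto simp: M_def)
      have "norm (m - m0) \<le> 2 * R" using m(1) m0(1) norm_triangle_ineq4[of m m0] by (simp add: M_def)
      then have M2: "m - m0 \<in> M2" using L by (simp add: M2_def)
      have "X l (m - m0) = X l (z + m) - X l (z + m0)" by simp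
      then have "\<bar>X l (m - m0)\<bar> \<le> 2 * c2 * s" using m(2) m0(2) by linarith
      also have "\<dots> < 2 * c2 * \<epsilon>" using s c2 by simp
      also have "\<dots> \<le> \<mu>1" using eps(4) c2 by (simp add: field_simps)
      finally have "X l (m - m0) = 0" using \<mu>1(2)[OF M2, of l] unfolding X_def by linarith
      moreover from this have "X' l (m - m0) = 0" unfolding X_def X'_def by (rule typed_inherits[OF inh L])
      ultimately show ?thesis by simp
    qed
    have far: "sgn (lv l m) = sgn (X l (z + m))" if "m \<in> M" "c1 * s < \<bar>X l (z + m)\<bar>" for l m
      using sgn_stable[OF cl[OF that(1)] that(2)] by (simp add: lv_def)
    \<comment> \<open>A position \<open>y\<close> relative to the given plane is sought at which all
      signs are as required and stable. The second alternative is for types whose normal is a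
      multiple of \<open>k\<close>: they cannot be moved within the slice, but then both planes are
      exactly degenerate and \<open>b\<close> breaks the tie.\<close>
    have "\<exists>y. k \<bullet> y = k \<bullet> z \<and> (\<forall>l. \<forall>m\<in>M. (X l (y + m) \<noteq> 0 \<and> sgn (X l (y + m)) = sgn (lv l m)) \<or>
       ((\<exists>c. tnormal l u w = c *\<^sub>R k) \<and> X l (y + m) = 0 \<and> X' l (z + m) = 0))"
    proof (cases "\<exists>l. \<exists>m\<in>M. \<bar>X l (z + m)\<bar> \<le> c1 * s")
      case False
      then have "c1 * s < \<bar>X l (z + m)\<bar>" if "m \<in> M" for l m using that by (meson not_le)
      then have "X l (z + m) \<noteq> 0 \<and> sgn (X l (z + m)) = sgn (lv l m)" if "m \<in> M" for l m
        using far that sgn_stable(3)[OF cl] by metis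
      then show ?thesis by blast
    next
      case True
      then obtain l0 m0 where 0: "m0 \<in> M" "\<bar>X l0 (z + m0)\<bar> \<le> c1 * s" by blast
      have "c1 * s \<le> c2 * s" using c12 s by (simp add: mult_right_mono)
      then have 00: "\<bar>X l0 (z + m0)\<bar> \<le> c2 * s" using 0(2) by linarith
      show ?thesis
      proof (cases "\<exists>c. tnormal l0 u w = c *\<^sub>R k")
        case True
        define r where "r = rr l0"
        have r: "tnormal l0 u w = r *\<^sub>R k" unfolding r_def using rr True by blast
        then have r0: "r \<noteq> 0" and kn0: "k \<noteq> 0" using tn0[of l0] by auto
        have km: "k \<bullet> (z + m0) = (k \<bullet> n0 + k \<bullet> m0) - k \<bullet> a" by (simp add: inner_add_right kz)
        \<comment> \<open>The product lies in a discrete set determined by \<open>k\<close> and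
          \<open>a\<close>, and it is below the gap of that set.\<close>
        have "k \<bullet> (z + m0) = 0"
        proof (rule ccontr)
          assume nz: "k \<bullet> (z + m0) \<noteq> 0"
          have "k \<bullet> n0 + k \<bullet> m0 \<in> \<int>" using k(1) n0 0(1) by (auto simp: int_normal_def M_def intro!: Ints_add lattice_inner)
          then have "\<zeta> \<le> \<bar>k \<bullet> (z + m0)\<bar>" using \<zeta>(2) nz unfolding km by blast
          then have "\<mu>3 * \<zeta> \<le> \<bar>r\<bar> * \<bar>k \<bullet> (z + m0)\<bar>" using \<mu>3 r0 \<zeta>(1) by (intro mult_mono) (auto simp: r_def)
          also have "\<dots> = \<bar>X l0 (z + m0)\<bar>" unfolding X_def typed_inner r by (simp add: abs_mult)
          also have "\<dots> \<le> c1 * s" by (rule 0(2))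
          also have "\<dots> < c1 * \<epsilon>" using s c1 by simp
          also have "\<dots> \<le> \<mu>3 * \<zeta>" using eps(6) c1 by (simp add: field_simps)
          finally show False by simp
        qed
        moreover have "k $ l0 = 0"
        proof -
          have "r * k $ l0 = 0" using tnormal_self[of l0 u w] unfolding r by simp
          then show ?thesis using r0 by simp
        qed
        then obtain r' where "tnormal l0 u' w' = r' *\<^sub>R k" using tnormal_parallel[OF k' _ kn0] by blast
        ultimately have Z: "X l0 (z + m0) = 0" "X' l0 (z + m0) = 0" unfolding X_def X'_def typed_inner r by simp_all
        have "(X l (z + m) \<noteq> 0 \<and> sgn (X l (z + m)) = sgn (lv l m)) \<or>
          ((\<exists>c. tnormal l u w = c *\<^sub>R k) \<and> X l (z + m) = 0 \<and> X' l (z + m) = 0)" if m: "m \<in> M" for l m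
        proof (cases "\<bar>X l (z + m)\<bar> \<le> c2 * s")
          case n: True
          have "l = l0" using one_type[OF m n 0(1) 00] .
          then show ?thesis using same[of m l m0] m n 0(1) 00 Z True by simp
        next
          case False
          then have "c1 * s < \<bar>X l (z + m)\<bar>" using \<open>c1 * s \<le> c2 * s\<close> by linarith
          then show ?thesis using far[OF m] sgn_stable(3)[OF cl[OF m]] by metis
        qed
        then show ?thesis by blast
      next
        case False
        define d where "d = dd l0"
        have d: "k \<bullet> d = 0" "X l0 d = 1" using dd[OF False] by (auto simp: d_def X_def)
        define \<sigma> where "\<sigma> = sgn (lv l0 m0)"
        have \<sigma>: "\<bar>\<sigma>\<bar> = 1" "sgn \<sigma> = \<sigma>" using lv0[of l0 m0] by (auto simp: \<sigma>_def)
        \<comment> \<open>Moves the common value of all nearly degenerate forms of type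
          \<open>l0\<close> to \<open>2 * c1 * s * \<sigma>\<close>, of the required sign. The
          displacement is at most \<open>3 * c1 * s\<close>, too little to flip any other
          form.\<close>
        define \<tau> where "\<tau> = 2 * c1 * s * \<sigma> - X l0 (z + m0)"
        have "\<bar>2 * c1 * s * \<sigma>\<bar> = 2 * c1 * s" using \<sigma> s0 c1 by (simp add: abs_mult)
        then have \<tau>: "\<bar>\<tau>\<bar> \<le> 3 * c1 * s" using 0(2) unfolding \<tau>_def by linarith
        define y where "y = z + \<tau> *\<^sub>R d"
        have Xy: "X l (y + m) = X l (z + m) + \<tau> * X l d" for l m by (simp add: y_def)
        have "X l (y + m) \<noteq> 0 \<and> sgn (X l (y + m)) = sgn (lv l m)" if m: "m \<in> M" for l m
        proof (cases "\<bar>X l (z + m)\<bar> \<le> c2 * s")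
          case n: True
          have l: "l = l0" using one_type[OF m n 0(1) 00] .
          have sm: "X l0 (z + m) = X l0 (z + m0)" "X' l0 (z + m) = X' l0 (z + m0)" using same[of m l0 m0] m n 0(1) 00 l by auto
          then have "lv l0 m = lv l0 m0" unfolding lv_def by simp
          then have "sgn (lv l0 m) = \<sigma>" by (simp add: \<sigma>_def)
          moreover have "X l0 (y + m) = 2 * c1 * s * \<sigma>" unfolding Xy sm(1) d(2) by (simp add: \<tau>_def)
          moreover have "sgn (2 * c1 * s * \<sigma>) = \<sigma>" using \<sigma> c1 s0 by (simp add: sgn_mult)
          moreover have "2 * c1 * s * \<sigma> \<noteq> 0" using \<sigma> c1 s0 by auto
          ultimately show ?thesis using l by simp
        next
          case nn: False
          then have c: "c1 * s < \<bar>X l (z + m)\<bar>" using \<open>c1 * s \<le> c2 * s\<close> by linarith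
          have "\<bar>X l (y + m) - X l (z + m)\<bar> = \<bar>\<tau>\<bar> * \<bar>X l d\<bar>" unfolding Xy by (simp add: abs_mult)
          also have "\<dots> \<le> (3 * c1 * s) * D" using \<tau> D[of l l0] c1 s0 by (intro mult_mono) (auto simp: X_def d_def)
          also have "\<dots> = (3 * c1 * D) * s" by simp
          finally have 1: "\<bar>X l (y + m) - X l (z + m)\<bar> \<le> (3 * c1 * D) * s" .
          have "(3 * c1 * D) * s < c2 * s" using c2(2) s0 by simp
          then have 2: "(3 * c1 * D) * s < \<bar>X l (z + m)\<bar>" using nn by linarith
          show ?thesis using sgn_stable[OF 1 2] far[OF m c] by simp
        qed
        moreover have "k \<bullet> y = k \<bullet> z" by (simp add: y_def inner_add_right d(1))
        ultimately show ?thesis by blast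
      qed
    qed
    then obtain y where ky: "k \<bullet> y = k \<bullet> z" and y: "\<And>l m. m \<in> M \<Longrightarrow> (X l (y + m) \<noteq> 0 \<and> sgn (X l (y + m)) = sgn (lv l m)) \<or>
       ((\<exists>c. tnormal l u w = c *\<^sub>R k) \<and> X l (y + m) = 0 \<and> X' l (z + m) = 0)" by blast
    have "finite ((\<lambda>(l, m). X l (y + m)) ` (UNIV \<times> M))" using finM by simp
    from pos_lower_bound[OF this] obtain \<eta> where \<eta>: "\<eta> > 0" "\<And>l m. m \<in> M \<Longrightarrow> X l (y + m) \<noteq> 0 \<Longrightarrow> \<eta> \<le> \<bar>X l (y + m)\<bar>"
      by (metis (no_types, lifting) SigmaI UNIV_I case_prod_conv image_eqI)
    define Tn where "Tn = (\<Sum>l\<in>UNIV. norm (tnormal l u w)) + 1"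
    have Tn: "norm (tnormal l u w) \<le> Tn" for l
      unfolding Tn_def using member_le_sum[of l UNIV "\<lambda>l. norm (tnormal l u w)"] by simp
    have Tn0: "Tn > 0" unfolding Tn_def by (intro add_nonneg_pos sum_nonneg) auto
    \<comment> \<open>The translation that would put \<open>n0\<close> exactly at position
      \<open>y\<close> relative to the plane through \<open>a\<close>. It is orthogonal to
      \<open>k\<close>, so density supplies a lattice translation close to it modulo the
      plane.\<close>
    define p where "p = a + y - n0"
    have "k \<bullet> p = 0" by (simp add: p_def inner_add_right inner_diff_right ky kz)
    then obtain n e where n: "lattice_point n" "e \<in> span {u, w}" "norm (n - p - e) < \<eta> / Tn" "k \<bullet> n = 0"
      using lattice_plane_dense[OF k, of p "\<eta> / Tn"] \<eta>(1) Tn0 by auto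
    define h where "h = n - p - e"
    have "k \<bullet> e = 0" using inner_span_zero[OF _ _ n(2)] k(1) by (simp add: int_normal_def)
    then have kh: "k \<bullet> h = 0" using n(4) \<open>k \<bullet> p = 0\<close> by (simp add: h_def inner_diff_right)
    have Xh: "\<bar>X l h\<bar> < \<eta>" for l
    proof -
      have "\<bar>X l h\<bar> \<le> norm (tnormal l u w) * norm h" unfolding X_def typed_inner by (rule Cauchy_Schwarz_ineq2)
      also have "\<dots> \<le> Tn * norm h" using Tn by (intro mult_right_mono) auto
      also have "\<dots> < Tn * (\<eta> / Tn)" using n(3) Tn0 unfolding h_def by (intro mult_strict_left_mono)
      finally show ?thesis using Tn0 by simp
    qed
    have "sgn (lex_typed u w a b l (n0 + n + m)) = sgn (lex_typed u' w' a' b l (n0 + m))" if m: "lattice_point m" "norm m \<le> R" for l m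
    proof -
      have mM: "m \<in> M" using m by (simp add: M_def)
      have "n0 + n + m - a = (y + m) + e + h" by (simp add: h_def p_def)
      then have "typed l u w (n0 + n + m - a) = typed l u w ((y + m) + e + h)" by (rule arg_cong)
      also have "\<dots> = X l (y + m) + X l h" using typed_span[OF n(2)] by (simp add: X_def)
      finally have Xn: "typed l u w (n0 + n + m - a) = X l (y + m) + X l h" .
      have "n0 + m - a' = (z + m) + f" by (simp add: z_def)
      then have "typed l u' w' (n0 + m - a') = typed l u' w' ((z + m) + f)" by (rule arg_cong)
      also have "\<dots> = X' l (z + m)" using typed_span[OF f] by (simp add: X'_def)
      finally have Xf: "typed l u' w' (n0 + m - a') = X' l (z + m)" .
      have F: "lex_typed u' w' a' b l (n0 + m) = lv l m" unfolding lex_typed_def Xf lv_def by (simp only: X'_def)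
      from y[OF mM, of l] show ?thesis
      proof
        assume Y: "X l (y + m) \<noteq> 0 \<and> sgn (X l (y + m)) = sgn (lv l m)"
        have 1: "\<bar>(X l (y + m) + X l h) - X l (y + m)\<bar> \<le> \<bar>X l h\<bar>" by simp
        have 2: "\<bar>X l h\<bar> < \<bar>X l (y + m)\<bar>" using \<eta>(2)[OF mM, of l] Xh[of l] Y by linarith
        have "lex_typed u w a b l (n0 + n + m) = X l (y + m) + X l h"
          unfolding lex_typed_def Xn using sgn_stable(2)[OF 1 2] by (rule if_P)
        then show ?thesis unfolding F using sgn_stable(1)[OF 1 2] Y by metis
      next
        assume Y: "(\<exists>c. tnormal l u w = c *\<^sub>R k) \<and> X l (y + m) = 0 \<and> X' l (z + m) = 0"
        \<comment> \<open>Here approximation alone would not preserve the zero; the error vanishes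
          because \<open>h\<close> is orthogonal to \<open>k\<close>.\<close>
        then have "X l h = 0" unfolding X_def typed_inner using kh by auto
        then have "X l (y + m) + X l h = 0" using Y by (simp only: add_0)
        then have "lex_typed u w a b l (n0 + n + m) = X l b" unfolding lex_typed_def Xn by (simp add: X_def)
        moreover have "lv l m = X' l b" unfolding lv_def using Y by (simp only: if_False not_True_eq_False simp_thms)
        ultimately show ?thesis unfolding F using bsgn(1)[of l] by metis
      qed
    qed
    moreover have "lattice_point (n0 + n)" using n0 n(1) by blast
    ultimately show ?thesis by blast
  qed
  show ?thesis
  proof (rule that[of u' w' a'])
    show "norm (u' - u) < \<epsilon>\<^sub>0" "norm (w' - w) < \<epsilon>\<^sub>0" using us ws s eps(1) by linarith+
    show "span {u', w'} \<noteq> span {u, w}" by (rule ne)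
    show "nondeg u' w'" by (rule nd')
    show "typed l u' w' b \<noteq> 0" for l using bsgn(2)[of l] by (simp add: X'_def)
    show "\<exists>n1. lattice_point n1 \<and> (\<forall>l m. lattice_point m \<longrightarrow> norm m \<le> R \<longrightarrow>
         sgn (lex_typed u w a b l (n1 + m)) = sgn (lex_typed u' w' a' b l (n0 + m)))"
      if "lattice_point n0" "f \<in> span {u', w'}" "\<And>i. 0 \<le> (n0 - a' - f) $ i \<and> (n0 - a' - f) $ i \<le> 1" for n0 f
      using main[OF that] .
  qed
qed

section \<open>Comparing the two tilings\<close>

lemma parallelogram_translate:
  fixes v :: "4 \<Rightarrow> real^2"
  shows "parallelogram v (t + x) i j = (+) t ` parallelogram v x i j"
proof -
  have "(+) t ` parallelogram v x i j = {t + (x + a *\<^sub>R v i + b *\<^sub>R v j) | a b. 0 \<le> a \<and> a \<le> 1 \<and> 0 \<le> b \<and> b \<le> 1}"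
    unfolding parallelogram_def by auto
  then show ?thesis unfolding parallelogram_def by (simp add: add.assoc)
qed

lemma lex_triple_typed:
  assumes "distinct [i, j, k, l]"
  obtains \<sigma> where "\<sigma> = 1 \<or> \<sigma> = -1" "\<And>u w a b p. lex_triple u w a b i j k p = \<sigma> * lex_typed u w a b l p"
proof -
  obtain \<sigma> :: real where s: "\<sigma> = 1 \<or> \<sigma> = -1" "\<And>u w p. triple u w i j k p = \<sigma> * typed l u w p" using triple_typed[OF assms] by metis
  have "lex_triple u w a b i j k p = \<sigma> * lex_typed u w a b l p" for u w a b p
    unfolding lex_triple_def lex_typed_def s(2) using s(1) by auto
  then show ?thesis using that s(1) by blast
qed

lemma oriented_nondeg: "oriented v u w \<Longrightarrow> nondeg u w"
  using orientedD by (simp add: nondeg_def)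

lemma nondeg_shift_typed:
  assumes "\<And>l. typed l u w b \<noteq> 0" shows "nondeg_shift u w b"
  unfolding nondeg_shift_def
proof (intro allI impI)
  fix i j k :: 4 assume d: "i \<noteq> j" "i \<noteq> k" "j \<noteq> k"
  obtain l where "distinct [i, j, k, l]" using four_extend3[OF d] .
  from triple_typed[OF this] show "triple u w i j k b \<noteq> 0" using assms by (metis mult_eq_0_iff zero_neq_neg_one zero_neq_one)
qed

text \<open>Whether a face is a tile depends only on the signs at its base point \<open>n\<close>
  and at the four points \<open>n - std_basis k\<close>.\<close>

lemma lex_tile_transfer:
  assumes t: "lex_tile v u' w' a' b n i j" and L: "lattice_point (n + d)"
    and eq: "\<And>l m. m = n \<or> (\<exists>k. m = n - std_basis k) \<Longrightarrow> sgn (lex_typed u w a b l (m + d)) = sgn (lex_typed u' w' a' b l m)"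
  shows "lex_tile v u w a b (n + d) i j"
proof -
  have s: "sgn (lex_triple u w a b i j k (m + d)) = sgn (lex_triple u' w' a' b i j k m)"
    if k: "i \<noteq> j" "i \<noteq> k" "j \<noteq> k" and m: "m = n \<or> (\<exists>k. m = n - std_basis k)" for k m
  proof -
    obtain l where l: "distinct [i, j, k, l]" by (rule four_extend3[OF k])
    obtain \<sigma> where \<sigma>: "\<And>u w a b p. lex_triple u w a b i j k p = \<sigma> * lex_typed u w a b l p" by (rule lex_triple_typed[OF l]) blast
    show ?thesis unfolding \<sigma> sgn_mult using eq[OF m] by simp
  qed
  have c: "x * c > 0 \<longleftrightarrow> y * c > 0" "x * c < 0 \<longleftrightarrow> y * c < 0" if "sgn x = sgn y" for x y c :: real
    using that by (auto simp: sgn_real_def zero_less_mult_iff mult_less_0_iff split: if_splits)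
  have ij: "i < j" "i \<noteq> j" using t by (auto simp: lex_tile_def grid_tile_def)
  have "lex_triple u w a b i j k (n + d) * det2 (v i) (v j) > 0 \<and> lex_triple u w a b i j k (n + d - std_basis k) * det2 (v i) (v j) < 0"
    if k: "k \<noteq> i" "k \<noteq> j" for k
  proof -
    have "lex_triple u' w' a' b i j k n * det2 (v i) (v j) > 0" "lex_triple u' w' a' b i j k (n - std_basis k) * det2 (v i) (v j) < 0"
      using t k by (auto simp: lex_tile_def grid_tile_def)
    moreover have "sgn (lex_triple u w a b i j k (n + d)) = sgn (lex_triple u' w' a' b i j k n)"
      by (rule s[OF ij(2) k[symmetric]]) blast
    moreover have "sgn (lex_triple u w a b i j k (n - std_basis k + d)) = sgn (lex_triple u' w' a' b i j k (n - std_basis k))"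
      by (rule s[OF ij(2) k[symmetric]]) blast
    moreover have "n + d - std_basis k = n - std_basis k + d" by simp
    ultimately show ?thesis using c by metis
  qed
  then show ?thesis using ij L by (auto simp: lex_tile_def grid_tile_def)
qed

text \<open>Tiles with nearby points have nearby base points, hence nearby points of the plane
  underneath. The 4 bounds the difference of two cube offsets; \<open>8 * V\<close> collects the
  extent of two tiles and the projection of that difference.\<close>

lemma lex_tile_distance:
  assumes ori: "oriented v u w" and C: "C \<ge> 0" "\<And>p. p \<in> span {u, w} \<Longrightarrow> norm p \<le> C * norm (proj v p)"
    and V: "V = (\<Sum>k\<in>UNIV. norm (v k))"
    and t: "lex_tile v u w a b n i j" "y \<in> parallelogram v (proj v n) i j"
    and t': "lex_tile v u w a b n' i' j'" "y' \<in> parallelogram v (proj v n') i' j'" and d: "dist y y' \<le> \<rho>"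
  shows "norm (n - n') \<le> 4 + C * (\<rho> + 8 * V)"
proof -
  have Vk: "norm (v k) \<le> V" for k unfolding V by (rule member_le_sum) auto
  have face: "norm (y - proj v n) \<le> 2 * V" if "y \<in> parallelogram v (proj v n) i j" for y n i j
    using pgram_bounded[of y "proj v n" "v i" "v j"] that Vk[of i] Vk[of j] by (simp add: parallelogram_eq_pgram)
  have mem: "n \<in> face_points n i j" for n i j by (simp add: face_points_def)
  obtain z where z: "z - a \<in> span {u, w}" "\<And>k. 0 \<le> n$k - z$k \<and> n$k - z$k \<le> 1" using lex_tile_near_plane[OF ori t(1)] mem by metis
  obtain z' where z': "z' - a \<in> span {u, w}" "\<And>k. 0 \<le> n'$k - z'$k \<and> n'$k - z'$k \<le> 1" using lex_tile_near_plane[OF ori t'(1)] mem by metis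
  have "(z - a) - (z' - a) \<in> span {u, w}" using z(1) z'(1) by (rule span_diff)
  then have sp: "z - z' \<in> span {u, w}" by simp
  define h where "h = (n - n') - (z - z')"
  have "\<bar>h $ k\<bar> \<le> 1" for k using z(2)[of k] z'(2)[of k] by (simp add: h_def abs_le_iff)
  then have h4: "norm h \<le> 4" using norm_le_4[of h 1] by simp
  have "proj v (n - n') = (y - y') - (y - proj v n) + (y' - proj v n')" by simp
  then have "norm (proj v (n - n')) \<le> norm (y - y') + norm (y - proj v n) + norm (y' - proj v n')"
    using norm_triangle_ineq4[of "y - y'" "y - proj v n"] norm_triangle_ineq[of "(y - y') - (y - proj v n)" "y' - proj v n'"] by (simp only:)
  also have "\<dots> \<le> \<rho> + 4 * V" using face[OF t(2)] face[OF t'(2)] d by (simp add: dist_norm)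
  finally have 1: "norm (proj v (n - n')) \<le> \<rho> + 4 * V" .
  have "V \<ge> 0" unfolding V by (simp add: sum_nonneg)
  then have 2: "norm (proj v h) \<le> 4 * V" using norm_proj_le[of v h] mult_left_mono[OF h4, of V] unfolding V[symmetric] by linarith
  have "proj v (z - z') = proj v (n - n') - proj v h" by (simp add: h_def)
  then have "norm (proj v (z - z')) \<le> norm (proj v (n - n')) + norm (proj v h)" by (metis norm_triangle_ineq4)
  also have "\<dots> \<le> (\<rho> + 4 * V) + 4 * V" by (rule add_mono[OF 1 2])
  finally have "norm (proj v (z - z')) \<le> \<rho> + 8 * V" by simp
  then have "norm (z - z') \<le> C * (\<rho> + 8 * V)" using C(2)[OF sp] mult_left_mono[OF _ C(1)] by (meson order_trans)
  moreover have "norm (n - n') \<le> norm (z - z') + norm h" using norm_triangle_ineq[of "z - z'" h] by (simp add: h_def)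
  ultimately show ?thesis using h4 by linarith
qed

text \<open>The tiles meeting a ball are governed by signs at lattice points within \<open>R\<close>
  of one base point \<open>n0\<close>; where the signs around \<open>n1\<close> agree, the pattern
  is repeated, translated by the projection of \<open>n1 - n0\<close>. The 5 in \<open>R\<close> is
  the 4 of \<open>lex_tile_distance\<close> plus one unit step to
  \<open>n - std_basis k\<close>.\<close>

lemma r_map_transfer:
  assumes nc: "pairwise_noncolinear v" and ori: "oriented v u w" "oriented v u' w'" and b': "nondeg_shift u' w' b"
    and C: "C \<ge> 0" "\<And>p. p \<in> span {u, w} \<Longrightarrow> norm p \<le> C * norm (proj v p)" "\<And>p. p \<in> span {u', w'} \<Longrightarrow> norm p \<le> C * norm (proj v p)"
    and R: "R = 5 + C * (r / 2 + 8 * (\<Sum>k\<in>UNIV. norm (v k)))" and r0: "r \<ge> 0"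
    and win: "\<And>n0 f. lattice_point n0 \<Longrightarrow> f \<in> span {u', w'} \<Longrightarrow> (\<And>i. 0 \<le> (n0 - a' - f) $ i \<and> (n0 - a' - f) $ i \<le> 1) \<Longrightarrow>
       \<exists>n1. lattice_point n1 \<and> (\<forall>l m. lattice_point m \<longrightarrow> norm m \<le> R \<longrightarrow>
         sgn (lex_typed u w a b l (n1 + m)) = sgn (lex_typed u' w' a' b l (n0 + m)))"
    and P: "P \<in> r_maps r (lex_tiling v u' w' a' b)"
  shows "P \<in> r_maps r (lex_tiling v u w a b)"
proof -
  define V where "V = (\<Sum>k\<in>UNIV. norm (v k))"
  have V0: "V \<ge> 0" by (simp add: V_def sum_nonneg)
  from P obtain c d where P: "P = (\<lambda>s. (+) d ` s) ` {s\<in>lex_tiling v u' w' a' b. s \<inter> cball c (r / 2) \<noteq> {}}"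
    unfolding r_maps_def by blast
  obtain n0 i0 j0 where n0: "lex_tile v u' w' a' b n0 i0 j0" "c \<in> parallelogram v (proj v n0) i0 j0" using lex_tile_covers[OF nc ori(2) b'] .
  have L0: "lattice_point n0" using n0(1) by (simp add: lex_tile_def grid_tile_def)
  have mem: "n0 \<in> face_points n0 i0 j0" by (simp add: face_points_def)
  obtain z where z: "z - a' \<in> span {u', w'}" "\<And>k. 0 \<le> n0$k - z$k \<and> n0$k - z$k \<le> 1" using lex_tile_near_plane[OF ori(2) n0(1)] mem by metis
  have "\<And>i. 0 \<le> (n0 - a' - (z - a')) $ i \<and> (n0 - a' - (z - a')) $ i \<le> 1" using z(2) by simp
  from win[OF L0 z(1) this] obtain n1 where n1: "lattice_point n1" "\<And>l m. lattice_point m \<Longrightarrow> norm m \<le> R \<Longrightarrow>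
         sgn (lex_typed u w a b l (n1 + m)) = sgn (lex_typed u' w' a' b l (n0 + m))" by blast
  define \<delta> where "\<delta> = n1 - n0"
  have L\<delta>: "lattice_point \<delta>" unfolding \<delta>_def using n1(1) L0 by blast
  have nb: "norm (std_basis k) = 1" for k by (simp add: std_basis_def)
  have sg: "sgn (lex_typed u w a b l (m + \<delta>)) = sgn (lex_typed u' w' a' b l m)"
    if n: "lattice_point n" "norm (n - n0) \<le> R - 1" and m: "m = n \<or> (\<exists>k. m = n - std_basis k)" for l m n
  proof -
    have "lattice_point (m - n0)" using n(1) m L0 by blast
    moreover have "norm (m - n0) \<le> R"
    proof (cases "m = n")
      case True then show ?thesis using n(2) by simp
    next
      case False
      then obtain k where "m = n - std_basis k" using m by blast
      then have e: "m - n0 = (n - n0) - std_basis k" by simp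
      show ?thesis unfolding e using norm_triangle_ineq4[of "n - n0" "std_basis k"] nb[of k] n(2) by linarith
    qed
    ultimately have "sgn (lex_typed u w a b l (n1 + (m - n0))) = sgn (lex_typed u' w' a' b l (n0 + (m - n0)))" by (rule n1(2))
    moreover have "n1 + (m - n0) = m + \<delta>" "n0 + (m - n0) = m" by (simp_all add: \<delta>_def)
    ultimately show ?thesis by simp
  qed
  have fwd: "lex_tile v u w a b (n + \<delta>) i j" if t: "lex_tile v u' w' a' b n i j" "norm (n - n0) \<le> R - 1" for n i j
  proof -
    have L: "lattice_point n" using t(1) by (simp add: lex_tile_def grid_tile_def)
    show ?thesis by (rule lex_tile_transfer[OF t(1)]) (use L L\<delta> sg[OF L t(2)] in blast)+
  qed
  have bwd: "lex_tile v u' w' a' b n i j" if t: "lex_tile v u w a b (n + \<delta>) i j" "norm (n - n0) \<le> R - 1" for n i j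
  proof -
    have "lattice_point (n + \<delta>)" using t(1) by (simp add: lex_tile_def grid_tile_def)
    then have "lattice_point (n + \<delta> - \<delta>)" using L\<delta> by (rule lattice_point_simps)
    then have L: "lattice_point n" by simp
    have "lex_tile v u' w' a' b (n + \<delta> + (- \<delta>)) i j"
    proof (rule lex_tile_transfer[OF t(1)])
      show "lattice_point (n + \<delta> + - \<delta>)" using L by simp
      fix l m assume m: "m = n + \<delta> \<or> (\<exists>k. m = n + \<delta> - std_basis k)"
      then have "m - \<delta> = n \<or> (\<exists>k. m - \<delta> = n - std_basis k)" by auto
      from sg[OF L t(2) this, of l] show "sgn (lex_typed u' w' a' b l (m + - \<delta>)) = sgn (lex_typed u w a b l m)" by simp
    qed
    then show ?thesis by simp
  qed
  have R1: "R - 1 = 4 + C * (r / 2 + 8 * V)" by (simp add: R V_def)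
  have R10: "0 \<le> R - 1" unfolding R1 using C(1) r0 V0 by simp
  define c' where "c' = proj v \<delta> + c"
  define T where "T = {s\<in>lex_tiling v u' w' a' b. s \<inter> cball c (r / 2) \<noteq> {}}"
  define T' where "T' = {s\<in>lex_tiling v u w a b. s \<inter> cball c' (r / 2) \<noteq> {}}"
  have shift: "parallelogram v (proj v (n + \<delta>)) i j = (+) (proj v \<delta>) ` parallelogram v (proj v n) i j" for n i j
    using parallelogram_translate[of v "proj v \<delta>" "proj v n" i j] by (simp add: add.commute)
  have base: "lex_tile v u w a b (n0 + \<delta>) i0 j0" using fwd[OF n0(1)] R10 by simp
  have c': "c' \<in> parallelogram v (proj v (n0 + \<delta>)) i0 j0" unfolding shift c'_def using n0(2) by blast
  \<comment> \<open>Both inclusions are needed, as an r-map consists of exactly the tiles meeting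
    the ball; hence signs are transferred forth and back.\<close>
  have eq: "T' = (\<lambda>s. (+) (proj v \<delta>) ` s) ` T"
  proof (intro set_eqI iffI)
    fix s' assume "s' \<in> T'"
    then obtain n' i j where n': "lex_tile v u w a b n' i j" "s' = parallelogram v (proj v n') i j" "s' \<inter> cball c' (r / 2) \<noteq> {}"
      unfolding T'_def lex_tiling_def dual_tiles_def by blast
    from n'(3) obtain y where "y \<in> s'" "dist c' y \<le> r / 2" by (auto simp: disjoint_iff)
    with n'(1,2) have n': "lex_tile v u w a b n' i j" "s' = parallelogram v (proj v n') i j" "y \<in> s'" "dist c' y \<le> r / 2" by blast+
    have d': "dist y c' \<le> r / 2" using n'(4) by (simp add: dist_commute)
    have "norm (n' - (n0 + \<delta>)) \<le> R - 1" unfolding R1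
      by (rule lex_tile_distance[OF ori(1) C(1,2) V_def n'(1) _ base c' d']) (use n' in simp_all)
    then have "norm ((n' - \<delta>) - n0) \<le> R - 1" by (simp add: algebra_simps)
    then have t: "lex_tile v u' w' a' b (n' - \<delta>) i j" using bwd[of "n' - \<delta>" i j] n'(1) by simp
    define s where "s = parallelogram v (proj v (n' - \<delta>)) i j"
    have s': "s' = (+) (proj v \<delta>) ` s" using shift[of "n' - \<delta>" i j] by (simp add: n'(2) s_def)
    then obtain x where x: "x \<in> s" "y = proj v \<delta> + x" using n'(3) by blast
    then have "dist c x \<le> r / 2" using n'(4) by (simp add: c'_def dist_norm)
    then have "s \<inter> cball c (r / 2) \<noteq> {}" using x(1) by (auto simp: disjoint_iff)
    then have "s \<in> T" unfolding T_def lex_tiling_def dual_tiles_def using t s_def by blast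
    then show "s' \<in> (\<lambda>s. (+) (proj v \<delta>) ` s) ` T" using s' by blast
  next
    fix s' assume "s' \<in> (\<lambda>s. (+) (proj v \<delta>) ` s) ` T"
    then obtain s where s: "s \<in> T" "s' = (+) (proj v \<delta>) ` s" by blast
    then obtain n i j where n: "lex_tile v u' w' a' b n i j" "s = parallelogram v (proj v n) i j" "s \<inter> cball c (r / 2) \<noteq> {}"
      unfolding T_def lex_tiling_def dual_tiles_def by blast
    from n(3) obtain y where "y \<in> s" "dist c y \<le> r / 2" by (auto simp: disjoint_iff)
    with n(1,2) have n: "lex_tile v u' w' a' b n i j" "s = parallelogram v (proj v n) i j" "y \<in> s" "dist c y \<le> r / 2" by blast+
    have d': "dist y c \<le> r / 2" using n(4) by (simp add: dist_commute)
    have "norm (n - n0) \<le> R - 1" unfolding R1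
      by (rule lex_tile_distance[OF ori(2) C(1,3) V_def n(1) _ n0 d']) (use n in simp_all)
    then have t: "lex_tile v u w a b (n + \<delta>) i j" using fwd n(1) by blast
    have s': "s' = parallelogram v (proj v (n + \<delta>)) i j" unfolding shift using s n by simp
    have "proj v \<delta> + y \<in> s'" using s n(3) by blast
    moreover have "dist c' (proj v \<delta> + y) \<le> r / 2" using n(4) by (simp add: c'_def dist_norm)
    ultimately have "s' \<inter> cball c' (r / 2) \<noteq> {}" by (auto simp: disjoint_iff)
    then show "s' \<in> T'" unfolding T'_def lex_tiling_def dual_tiles_def using t s' by blast
  qed
  have "P = (\<lambda>s. (+) (d - proj v \<delta>) ` s) ` T'"
    unfolding eq P T_def[symmetric] image_image by (intro image_cong refl) (simp add: image_image)
  then show ?thesis unfolding r_maps_def T'_def by blast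
qed

section \<open>Subperiods as rational equations; bases and neighbourhoods of planes\<close>

lemma sum_four_less:
  fixes h :: "4 \<Rightarrow> 4 \<Rightarrow> real"
  assumes d: "distinct [i, j, k, l]" and sym: "\<And>p q. h p q = h q p" and z: "\<And>p. h p p = 0"
  shows "(\<Sum>(p, q)\<in>{(p, q). p < q}. h p q) = h i j + h i k + h i l + h j k + h j l + h k l"
proof -
  let ?L = "{(p, q). p < q} :: (4 \<times> 4) set" and ?G = "{(p, q). q < p} :: (4 \<times> 4) set"
  let ?f = "\<lambda>(p, q). h p q"
  have "sum ?f UNIV = sum ?f (?L \<union> ?G)"
    by (rule sum.mono_neutral_right) (auto simp: z not_less_iff_gr_or_eq)
  also have "\<dots> = sum ?f ?L + sum ?f ?G" by (rule sum.union_disjoint) (auto intro: finite_subset[OF subset_UNIV])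
  also have "sum ?f ?G = sum ?f ?L"
    by (rule sum.reindex_bij_witness[of _ prod.swap prod.swap]) (auto simp: sym)
  finally have "2 * sum ?f ?L = sum ?f (UNIV \<times> UNIV)" by simp
  also have "\<dots> = (\<Sum>p\<in>UNIV. \<Sum>q\<in>UNIV. h p q)" by (rule sum.cartesian_product[symmetric])
  also have "\<dots> = 2 * (h i j + h i k + h i l + h j k + h j l + h k l)"
    using d sym[of j i] sym[of k i] sym[of l i] sym[of k j] sym[of l j] sym[of l k] unfolding UNIV_four[OF d] by (simp add: z)
  finally show ?thesis by simp
qed

text \<open>Extended antisymmetrically, because only index pairs \<open>p < q\<close> count in an
  equation while \<open>i\<close>, \<open>j\<close>, \<open>k\<close> come in no particular
  order.\<close>

definition triple_equation :: "4 \<Rightarrow> 4 \<Rightarrow> 4 \<Rightarrow> rat \<Rightarrow> rat \<Rightarrow> rat \<Rightarrow> 4 \<Rightarrow> 4 \<Rightarrow> rat" where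
  "triple_equation i j k x y z p q =
     (if p = j \<and> q = k then x else if p = k \<and> q = j then - x
      else if p = i \<and> q = k then - y else if p = k \<and> q = i then y
      else if p = i \<and> q = j then z else if p = j \<and> q = i then - z else 0)"

lemma sum_triple_equation:
  assumes d: "distinct [i, j, k, l]"
  shows "(\<Sum>(p, q)\<in>{(p, q). p < q}. of_rat (triple_equation i j k x y z p q) * grass u w p q)
    = grass u w j k * of_rat x - grass u w i k * of_rat y + grass u w i j * of_rat z"
proof -
  let ?a = "triple_equation i j k x y z"
  have anti: "?a q p = - ?a p q" for p q
    using d unfolding triple_equation_def
    by (cases "p = i"; cases "p = j"; cases "p = k"; cases "q = i"; cases "q = j"; cases "q = k"; simp)
  have sym: "of_rat (?a p q) * grass u w p q = of_rat (?a q p) * grass u w q p" for p q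
    using anti[of p q] grass_commute[of u w p q] by (simp add: of_rat_minus)
  have z: "of_rat (?a p p) * grass u w p p = 0" for p by (simp add: grass_def)
  have "?a i j = z" "?a i k = - y" "?a i l = 0" "?a j k = x" "?a j l = 0" "?a k l = 0"
    using d by (auto simp: triple_equation_def)
  then show ?thesis unfolding sum_four_less[of i j k l "\<lambda>p q. of_rat (?a p q) * grass u w p q", OF d sym z] by (simp add: of_rat_minus)
qed

text \<open>Read as a function of the Grassmann coordinates, a triple with integer argument is a
  rational linear form free of the fourth index, so the hypothesis on equations applies to
  it.\<close>

lemma inherits_of_subperiods:
  assumes E: "direction E = span {u, w}" and F: "direction F = span {u', w'}"
    and sub: "\<And>k a. subperiod k E a \<Longrightarrow> satisfies_equation F a"
  shows "inherits_subperiods u w u' w'"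
  unfolding inherits_subperiods_def
proof (intro allI impI)
  fix i j k m assume d: "i \<noteq> j" "i \<noteq> k" "j \<noteq> k" and m: "lattice_point m" and t: "triple u w i j k m = 0"
  obtain l where l: "distinct [i, j, k, l]" using four_extend3[OF d] .
  have r: "\<exists>x. m $ n = of_rat x" for n
  proof -
    have "m $ n \<in> \<int>" using m by (simp add: lattice_point_def)
    then obtain c where "m $ n = of_int c" by (elim Ints_cases)
    then show ?thesis by (intro exI[of _ "of_int c"]) simp
  qed
  obtain x where x: "m $ i = of_rat x" using r by blast
  obtain y where y: "m $ j = of_rat y" using r by blast
  obtain z where z: "m $ k = of_rat z" using r by blast
  note xyz = x y z
  define a where "a = triple_equation i j k x y z"
  have S: "(\<Sum>(p, q)\<in>{(p, q). p < q}. of_rat (a p q) * grass u w p q) = triple u w i j k m" for u w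
    unfolding a_def sum_triple_equation[OF l] triple_def xyz ..
  have GE: "G = grass u0 w0" if "G = (\<lambda>i j. u0 $ i * w0 $ j - u0 $ j * w0 $ i)" for G u0 w0
    using that by (simp add: grass_def fun_eq_iff)
  show "triple u' w' i j k m = 0"
  proof (cases "x = 0 \<and> y = 0 \<and> z = 0")
    \<comment> \<open>A subperiod has to be a nontrivial equation, so vectors vanishing in the three
      coordinates are treated apart.\<close>
    case True then show ?thesis by (simp add: triple_def xyz)
  next
    case False
    have "subperiod l E a"
      unfolding subperiod_def
    proof (intro conjI)
      have jk: "j < k \<or> k < j" "i < k \<or> k < i" "i < j \<or> j < i" using d by auto
      have nz: "a j k = x" "a k j = - x" "a i k = - y" "a k i = y" "a i j = z" "a j i = - z"
        using d by (auto simp: a_def triple_equation_def)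
      show "\<exists>p q. p < q \<and> a p q \<noteq> 0" using False jk nz by (metis neg_equal_0_iff_equal)
      show "\<forall>p q. p < q \<and> (p = l \<or> q = l) \<longrightarrow> a p q = 0" using l by (auto simp: a_def triple_equation_def)
      show "satisfies_equation E a"
        unfolding satisfies_equation_def
      proof (intro allI impI)
        fix G assume "grassmann_coords E G"
        then obtain u0 w0 where u0: "direction E = span {u0, w0}" "G = grass u0 w0" unfolding grassmann_coords_def using GE by blast
        have "u0 \<in> span {u, w}" "w0 \<in> span {u, w}" using E u0(1) by (auto intro: span_base)
        then obtain D where D: "\<And>i j. grass u0 w0 i j = D * grass u w i j" using grass_span_scale by blast
        have "triple u0 w0 i j k m = D * triple u w i j k m" by (simp add: triple_def D algebra_simps)
        then show "(\<Sum>(p, q)\<in>{(p, q). p < q}. of_rat (a p q) * G p q) = 0" unfolding u0(2) S using t by simp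
      qed
    qed
    then have "satisfies_equation F a" by (rule sub)
    moreover have "grassmann_coords F (grass u' w')" unfolding grassmann_coords_def using F by (auto simp: grass_def fun_eq_iff)
    ultimately have "(\<Sum>(p, q)\<in>{(p, q). p < q}. of_rat (a p q) * grass u' w' p q) = 0" unfolding satisfies_equation_def by blast
    then show ?thesis unfolding S .
  qed
qed

lemma plane_basis:
  assumes "is_plane E"
  obtains u w where "direction E = span {u, w}"
proof -
  have aff: "affine E" "aff_dim E = 2" using assms by (auto simp: is_plane_def)
  then have "E \<noteq> {}" by auto
  then obtain a where a: "a \<in> E" by blast
  have S: "subspace (direction E)" by (rule direction_subspace[OF aff(1) \<open>E \<noteq> {}\<close>])
  have "E = (+) a ` direction E"
  proof
    show "E \<subseteq> (+) a ` direction E" using a by (force simp: direction_def image_iff)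
    show "(+) a ` direction E \<subseteq> E"
    proof
      fix p assume "p \<in> (+) a ` direction E"
      then obtain x y where "p = a + (x - y)" "x \<in> E" "y \<in> E" by (auto simp: direction_def)
      then show "p \<in> E" using mem_affine_3_minus[OF aff(1) a, of x y 1] by simp
    qed
  qed
  then have "aff_dim (direction E) = 2" using aff(2) by (metis aff_dim_translation_eq)
  then have "dim (direction E) = 2" using aff_dim_subspace[OF S] by simp
  then obtain B where B: "B \<subseteq> direction E" "independent B" "direction E \<subseteq> span B" "card B = 2" using basis_exists by metis
  then obtain u w where "B = {u, w}" by (auto simp: card_2_iff)
  moreover have "span B \<subseteq> direction E" using B(1) S by (simp add: span_minimal)
  ultimately show ?thesis using that B(3) by blast
qed

lemma plane_points:
  assumes "is_plane E" "direction E = span {u, w}"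
  obtains a where "E = {a + e | e. e \<in> span {u, w}}"
proof -
  have aff: "affine E" "E \<noteq> {}" using assms(1) by (auto simp: is_plane_def)
  then obtain a where a: "a \<in> E" by blast
  have "E = {a + e | e. e \<in> span {u, w}}"
  proof
    show "E \<subseteq> {a + e | e. e \<in> span {u, w}}"
    proof
      fix p assume "p \<in> E"
      then have "p - a \<in> span {u, w}" unfolding assms(2)[symmetric] using a by (auto simp: direction_def)
      then show "p \<in> {a + e | e. e \<in> span {u, w}}" by (intro CollectI exI[of _ "p - a"]) simp
    qed
    show "{a + e | e. e \<in> span {u, w}} \<subseteq> E"
    proof
      fix p assume "p \<in> {a + e | e. e \<in> span {u, w}}"
      then obtain x y where "p = a + (x - y)" "x \<in> E" "y \<in> E" unfolding assms(2)[symmetric] by (auto simp: direction_def)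
      then show "p \<in> E" using mem_affine_3_minus[OF aff(1) a, of x y 1] by simp
    qed
  qed
  then show ?thesis by (rule that)
qed

lemma direction_translate:
  assumes "subspace S" shows "direction {a + e | e. e \<in> S} = S"
proof
  show "direction {a + e | e. e \<in> S} \<subseteq> S" using assms by (auto simp: direction_def subspace_diff)
  show "S \<subseteq> direction {a + e | e. e \<in> S}"
  proof
    fix e assume "e \<in> S"
    then have "e = (a + e) - (a + 0)" "0 \<in> S" using assms by (auto simp: subspace_0)
    then show "e \<in> direction {a + e | e. e \<in> S}" unfolding direction_def using \<open>e \<in> S\<close> by blast
  qed
qed

lemma nondegenerate_nondeg:
  assumes "nondegenerate E" "direction E = span {u, w}" shows "nondeg u w"
proof -
  have "grassmann_coords E (grass u w)" unfolding grassmann_coords_def using assms(2) by (auto simp: grass_def fun_eq_iff)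
  then have lt: "grass u w i j \<noteq> 0" if "i < j" for i j using assms(1) that unfolding nondegenerate_def by blast
  have "grass u w i j \<noteq> 0" if ij: "i \<noteq> j" for i j
  proof (cases "i < j")
    case False
    then have "j < i" using ij by simp
    then show ?thesis using lt[of j i] grass_commute[of u w i j] by simp
  qed (rule lt)
  then show ?thesis by (simp add: nondeg_def)
qed

lemma inherits_swap: "inherits_subperiods w u w' u' = inherits_subperiods u w u' w'"
proof -
  have s: "triple w u i j k m = - triple u w i j k m" for u w i j k m by (simp add: triple_def grass_def algebra_simps)
  show ?thesis unfolding inherits_subperiods_def s[of w u] s[of w' u'] neg_equal_0_iff_equal ..
qed

lemma approximable_swap:
  assumes "approximable u w k" shows "approximable w u k"
  unfolding approximable_def
proof (intro allI impI)
  fix \<epsilon> :: real assume "\<epsilon> > 0"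
  from assms[unfolded approximable_def, rule_format, OF this] obtain u' w' \<nu> s where
    h: "0 \<le> s" "s < \<epsilon>" "norm (u' - u) \<le> s" "norm (w' - w) \<le> s" "lattice_point \<nu>" "\<nu> \<bullet> u' = 0" "\<nu> \<bullet> w' = 0"
    "norm \<nu> * s < \<epsilon>" "\<nexists>c. \<nu> = c *\<^sub>R k" "k \<bullet> u' = 0" "k \<bullet> w' = 0" "inherits_subperiods u w u' w'"
    "span {u', w'} \<noteq> span {u, w}" by blast
  have "inherits_subperiods w u w' u'" "span {w', u'} \<noteq> span {w, u}" using h(12,13) by (simp_all add: inherits_swap insert_commute)
  then show "\<exists>u' w' \<nu> s. 0 \<le> s \<and> s < \<epsilon> \<and> norm (u' - w) \<le> s \<and> norm (w' - u) \<le> s \<and>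
     lattice_point \<nu> \<and> \<nu> \<bullet> u' = 0 \<and> \<nu> \<bullet> w' = 0 \<and> norm \<nu> * s < \<epsilon> \<and> (\<nexists>c. \<nu> = c *\<^sub>R k) \<and>
     k \<bullet> u' = 0 \<and> k \<bullet> w' = 0 \<and> inherits_subperiods w u u' w' \<and> span {u', w'} \<noteq> span {w, u}"
    by (intro exI[of _ w'] exI[of _ u'] exI[of _ \<nu>] exI[of _ s] conjI h)
qed

text \<open>Four hyperplanes are a null set and do not fill the space.\<close>

lemma typed_nonzero_point:
  assumes "nondeg u w" obtains b where "\<And>l. typed l u w b \<noteq> 0"
proof -
  have "tnormal l u w \<noteq> 0" for l
  proof -
    obtain l' where "l' \<noteq> l" by (metis zero_neq_one)
    from tnormal_nonzero[OF assms this] show ?thesis by auto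
  qed
  then have "negligible {b. tnormal l u w \<bullet> b = 0}" for l by (intro negligible_hyperplane) simp
  then have "negligible (\<Union>(range (\<lambda>l. {b. tnormal l u w \<bullet> b = 0})))" by (intro negligible_Union) auto
  then have "(\<Union>l. {b. tnormal l u w \<bullet> b = 0}) \<noteq> UNIV" using non_negligible_UNIV by auto
  then obtain b where b: "\<And>l. tnormal l u w \<bullet> b \<noteq> 0" by blast
  show ?thesis by (rule that[of b]) (use b in \<open>simp add: typed_inner\<close>)
qed

text \<open>One constant \<open>C\<close> is valid for all nearby planes. This allows the comparison
  radius to be fixed before the approximating plane is chosen.\<close>

lemma oriented_open:
  assumes nc: "pairwise_noncolinear v" and ori: "oriented v u w"
  obtains e C where "e > 0" "C \<ge> 0" "\<And>p. p \<in> span {u, w} \<Longrightarrow> norm p \<le> C * norm (proj v p)"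
    "\<And>u' w'. norm (u' - u) < e \<Longrightarrow> norm (w' - w) < e \<Longrightarrow> oriented v u' w' \<and> (\<forall>p\<in>span {u', w'}. norm p \<le> C * norm (proj v p))"
proof -
  define V where "V = (\<Sum>k\<in>UNIV. norm (v k))"
  have V0: "V \<ge> 0" by (simp add: V_def sum_nonneg)
  define D where "D = det2 (proj v u) (proj v w)"
  have D: "D > 0" unfolding D_def by (rule oriented_det_pos[OF ori])
  define C where "C = 4 * (V * (norm u + 1) + V * (norm w + 1)) * ((norm u + 1) + (norm w + 1)) / (D / 2)"
  have C0: "C \<ge> 0" unfolding C_def using V0 D by simp
  have bound: "norm p \<le> C * norm (proj v p)" if D': "det2 (proj v u') (proj v w') \<ge> D / 2" and p: "p \<in> span {u', w'}"
    and n: "norm u' \<le> norm u + 1" "norm w' \<le> norm w + 1" for u' w' p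
  proof -
    have D0: "det2 (proj v u') (proj v w') > 0" using D' D by linarith
    have pn: "norm (proj v u') \<le> V * (norm u + 1)" "norm (proj v w') \<le> V * (norm w + 1)"
      using norm_proj_le[of v u'] norm_proj_le[of v w'] mult_left_mono[OF n(1) V0] mult_left_mono[OF n(2) V0] unfolding V_def[symmetric] by linarith+
    have "norm p \<le> 4 * norm (proj v p) * (norm (proj v u') + norm (proj v w')) * (norm u' + norm w') / det2 (proj v u') (proj v w')"
      by (rule span_norm_bound[OF D0 p])
    also have "\<dots> \<le> (4 * norm (proj v p) * (V * (norm u + 1) + V * (norm w + 1)) * ((norm u + 1) + (norm w + 1))) / (D / 2)"
      using pn n D D' V0 by (intro frac_le mult_mono add_mono mult_nonneg_nonneg add_nonneg_nonneg) auto
    also have "\<dots> = C * norm (proj v p)" unfolding C_def times_divide_eq_left by (simp only: mult_ac)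
    finally show ?thesis .
  qed
  obtain e1 where e1: "e1 > 0" "\<And>u' w'. norm (u' - u) \<le> e1 \<Longrightarrow> norm (w' - w) \<le> e1 \<Longrightarrow> nondeg u' w' \<and>
      (\<forall>i j. \<bar>grass u w i j\<bar> / 2 \<le> \<bar>grass u' w' i j\<bar> \<and> grass u w i j * grass u' w' i j \<ge> 0)"
    using nondeg_open[OF oriented_nondeg[OF ori]] by blast
  show ?thesis
  proof (rule that[of "min e1 1" C])
    show "min e1 1 > 0" using e1(1) by simp
    show "C \<ge> 0" by (rule C0)
    show "norm p \<le> C * norm (proj v p)" if "p \<in> span {u, w}" for p
      using bound[of u w p] that D by (simp add: D_def)
    fix u' w' assume n: "norm (u' - u) < min e1 1" "norm (w' - w) < min e1 1"
    then have "norm (u' - u) \<le> e1" "norm (w' - w) \<le> e1" by auto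
    note h = e1(2)[OF this]
    have G: "grass u w i j * det2 (v i) (v j) / 2 \<le> grass u' w' i j * det2 (v i) (v j)" for i j
    proof (cases "i = j")
      case False
      let ?c = "det2 (v i) (v j)"
      have p: "grass u w i j * ?c > 0" using ori False by (simp add: oriented_def)
      have a: "\<bar>grass u w i j\<bar> / 2 \<le> \<bar>grass u' w' i j\<bar>" "grass u w i j * grass u' w' i j \<ge> 0" using h by auto
      have "\<bar>grass u w i j\<bar> / 2 * \<bar>?c\<bar> \<le> \<bar>grass u' w' i j\<bar> * \<bar>?c\<bar>" using a(1) by (intro mult_right_mono) auto
      moreover have "grass u' w' i j * ?c \<ge> 0" using p a(2) by (auto simp: zero_less_mult_iff zero_le_mult_iff)
      ultimately show ?thesis using p by (simp add: abs_mult[symmetric] abs_of_nonneg)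
    qed simp
    have ori': "oriented v u' w'"
      unfolding oriented_def
    proof (intro allI impI)
      fix i j :: 4 assume "i \<noteq> j"
      then have "grass u w i j * det2 (v i) (v j) > 0" using ori by (simp add: oriented_def)
      then show "grass u' w' i j * det2 (v i) (v j) > 0" using G[of i j] by linarith
    qed
    have "(\<Sum>i\<in>UNIV. \<Sum>j\<in>UNIV. grass u w i j * det2 (v i) (v j) / 2) \<le> (\<Sum>i\<in>UNIV. \<Sum>j\<in>UNIV. grass u' w' i j * det2 (v i) (v j))"
      by (intro sum_mono G)
    then have "D / 2 \<le> det2 (proj v u') (proj v w')"
      using cauchy_binet[of v u w] cauchy_binet[of v u' w'] by (simp add: D_def sum_divide_distrib[symmetric])
    moreover have "norm u' \<le> norm u + 1" "norm w' \<le> norm w + 1"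
      using n norm_triangle_ineq2[of u' u] norm_triangle_ineq2[of w' w] by auto
    ultimately show "oriented v u' w' \<and> (\<forall>p\<in>span {u', w'}. norm p \<le> C * norm (proj v p))" using bound ori' by blast
  qed
qed

theorem theorem1:
  fixes v :: "4 \<Rightarrow> real^2" and E :: "(real^4) set"
  assumes "pairwise_noncolinear v"
    and "is_plane E" and "nondegenerate E"
    and E_is_a_slope: "\<exists>T t. planar_tiling v T E t"
    and "admits_weak_local_rules v E"
  shows "determined_by_subperiods E"
proof (rule ccontr)
  assume not_det: "\<not> determined_by_subperiods E"
  note nc = assms(1)
  obtain u1 w1 where E1: "direction E = span {u1, w1}" using plane_basis[OF assms(2)] .
  have nd1: "nondeg u1 w1" using nondegenerate_nondeg[OF assms(3) E1] .
  have "{direction F | F. is_plane F \<and> nondegenerate F \<and> (\<forall>k a. subperiod k E a \<longrightarrow> satisfies_equation F a)}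
     \<subseteq> {span {u', w'} | u' w'. nondeg u' w' \<and> inherits_subperiods u1 w1 u' w'}"
  proof
    fix D assume "D \<in> {direction F | F. is_plane F \<and> nondegenerate F \<and> (\<forall>k a. subperiod k E a \<longrightarrow> satisfies_equation F a)}"
    then obtain F where F: "D = direction F" "is_plane F" "nondegenerate F" "\<And>k a. subperiod k E a \<Longrightarrow> satisfies_equation F a" by blast
    obtain u' w' where F': "direction F = span {u', w'}" using plane_basis[OF F(2)] .
    have "nondeg u' w'" "inherits_subperiods u1 w1 u' w'"
      using nondegenerate_nondeg[OF F(3) F'] inherits_of_subperiods[OF E1 F' F(4)] by auto
    then show "D \<in> {span {u', w'} | u' w'. nondeg u' w' \<and> inherits_subperiods u1 w1 u' w'}" using F(1) F' by blast
  qed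
  then have "infinite {span {u', w'} | u' w'. nondeg u' w' \<and> inherits_subperiods u1 w1 u' w'}"
    using not_det finite_subset unfolding determined_by_subperiods_def by blast
  from approximation_exists[OF nd1 this] obtain u2 w2 k where 2: "span {u2, w2} = span {u1, w1}" "nondeg u2 w2" "int_normal u2 w2 k"
    "\<And>k'. int_normal u2 w2 k' \<Longrightarrow> \<exists>c. k' = c *\<^sub>R k" "approximable u2 w2 k" by metis
  obtain T t where T: "planar_tiling v T E t" using E_is_a_slope by blast
  then obtain f where f: "lift_near v T (span {u2, w2}) f t" using planar_lift_near[OF T] E1 2(1) by metis
  have oT: "octagonal_tiling v T" using T by (simp add: planar_tiling_def)
  \<comment> \<open>A tiling of slope E shows that the signs of the Grassmann coordinates match
    those of the tile determinants up to a global sign, which is corrected by exchanging the two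
    spanning vectors.\<close>
  obtain u w where uw: "span {u, w} = span {u1, w1}" "nondeg u w" "int_normal u w k"
    "\<And>k'. int_normal u w k' \<Longrightarrow> \<exists>c. k' = c *\<^sub>R k" "approximable u w k" and ori: "oriented v u w"
  proof -
    have "\<And>i j. i \<noteq> j \<Longrightarrow> grass u2 w2 i j \<noteq> 0" using 2(2) by (simp add: nondeg_def)
    from lift_near_orientation[OF nc oT f this] show ?thesis
    proof
      assume "\<forall>i j. i \<noteq> j \<longrightarrow> grass u2 w2 i j * det2 (v i) (v j) > 0"
      then show ?thesis using that[of u2 w2] 2 by (simp add: oriented_def)
    next
      assume n: "\<forall>i j. i \<noteq> j \<longrightarrow> grass u2 w2 i j * det2 (v i) (v j) < 0"
      have g: "grass w2 u2 i j = - grass u2 w2 i j" for i j by (simp add: grass_def)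
      have "oriented v w2 u2" using n by (simp add: oriented_def g)
      moreover have "int_normal w2 u2 = int_normal u2 w2" by (auto simp: int_normal_def fun_eq_iff)
      ultimately show ?thesis using that[of w2 u2] 2(2-) 2(1) approximable_swap[OF 2(5)] by (simp add: nondeg_def g insert_commute)
    qed
  qed
  have Eu: "direction E = span {u, w}" using E1 uw(1) by simp
  obtain a where a: "E = {a + e | e. e \<in> span {u, w}}" using plane_points[OF assms(2) Eu] .
  obtain r t where rt: "r \<ge> 0" "weak_local_rules v E r t" using assms(5) unfolding admits_weak_local_rules_def by blast
  obtain b where b: "\<And>l. typed l u w b \<noteq> 0" using typed_nonzero_point[OF uw(2)] by blast
  obtain e C where e: "e > 0" "C \<ge> 0" "\<And>p. p \<in> span {u, w} \<Longrightarrow> norm p \<le> C * norm (proj v p)"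
    "\<And>u' w'. norm (u' - u) < e \<Longrightarrow> norm (w' - w) < e \<Longrightarrow> oriented v u' w' \<and> (\<forall>p\<in>span {u', w'}. norm p \<le> C * norm (proj v p))"
    using oriented_open[OF nc ori] by metis
  \<comment> \<open>The radius required by \<open>r_map_transfer\<close>. It depends on the
    neighbourhood through \<open>C\<close> only, so the approximating plane may still depend on
    it.\<close>
  define R where "R = 5 + C * (r / 2 + 8 * (\<Sum>k\<in>UNIV. norm (v k)))"
  have R0: "R \<ge> 0" unfolding R_def using e(2) rt(1) by (simp add: sum_nonneg)
  from window[OF uw(2,3,4,5) b e(1) R0, of a] obtain u' w' a' where
    F: "norm (u' - u) < e" "norm (w' - w) < e" "span {u', w'} \<noteq> span {u, w}" "nondeg u' w'" "\<And>l. typed l u' w' b \<noteq> 0"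
    and win: "\<And>n0 f. lattice_point n0 \<Longrightarrow> f \<in> span {u', w'} \<Longrightarrow> (\<And>i. 0 \<le> (n0 - a' - f) $ i \<and> (n0 - a' - f) $ i \<le> 1) \<Longrightarrow>
       \<exists>n1. lattice_point n1 \<and> (\<forall>l m. lattice_point m \<longrightarrow> norm m \<le> R \<longrightarrow>
         sgn (lex_typed u w a b l (n1 + m)) = sgn (lex_typed u' w' a' b l (n0 + m)))" by blast
  have ori': "oriented v u' w'" and C': "\<And>p. p \<in> span {u', w'} \<Longrightarrow> norm p \<le> C * norm (proj v p)" using e(4)[OF F(1,2)] by auto
  have nb: "nondeg_shift u w b" "nondeg_shift u' w' b" using nondeg_shift_typed b F(5) by auto
  let ?T = "lex_tiling v u' w' a' b"
  have pE: "planar_tiling v (lex_tiling v u w a b) E 1" unfolding a by (rule lex_tiling_planar[OF nc ori nb(1)])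
  have pF: "planar_tiling v ?T {a' + e | e. e \<in> span {u', w'}} 1" by (rule lex_tiling_planar[OF nc ori' nb(2)])
  have oF: "octagonal_tiling v ?T" using pF by (simp add: planar_tiling_def)
  have "P \<in> r_maps r (lex_tiling v u w a b)" if "P \<in> r_maps r ?T" for P
    by (rule r_map_transfer[OF nc ori ori' nb(2) e(2,3) C' R_def rt(1) win that])
  \<comment> \<open>The local rules give some lift \<open>g\<close> near E, of which nothing else is
    known; comparison with the lift \<open>h\<close> near the other plane through common worms makes
    the directions equal.\<close>
  then have "planar_tiling v ?T E t" using rt(2) oF pE unfolding weak_local_rules_def by blast
  then obtain g where g: "lift_near v ?T (span {u, w}) g t" using planar_lift_near Eu by metis
  obtain h where h: "lift_near v ?T (span {u', w'}) h 1" using planar_lift_near[OF pF] direction_translate[OF subspace_span] by metis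
  have "span {u, w} = span {u', w'}"
    by (rule lift_near_unique_direction[OF nc oF g h]) (use uw(2) F(4) in \<open>auto simp: nondeg_def\<close>)
  then show False using F(3) by simp
qed

end
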